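(* There is an algorithm that, given a graph $G$ on $n$ vertices whose split-matching-width is less than $k$, finds in $n^{\mathcal{O}(1)}2^{\mathcal{O}(k)}$ time a branch decomposition of $G$ of split-matching-width less than $16k$.
   Context: All graphs are finite, simple and undirected. For $X\subseteq V(G)$, $N(X)$ denotes the set of vertices of $V(G)\setminus X$ having a neighbour in $X$, and $\overline{A}=V(G)\setminus A$. A branch decomposition of $G$ is a pair $(T,\delta)$ where $T$ is a tree of maximum degree at most three and $\delta$ is a bijection from the leaves of $T$ to $V(G)$. Removing an edge $e$ of $T$ splits the leaves into two sides, and thereby induces a bipartition $(A,\overline{A})$ of $V(G)$. For a symmetric function $f:2^{V(G)}\to\mathbb{N}$, the $f$-width of $(T,\delta)$ is the maximum of $f(A)$ over all bipartitions induced by edges of $T$. The $f$-width of $G$ is the minimum $f$-width over all branch decompositions of $G$. For $A\subseteq V(G)$, $\mathrm{mm}(A)$ is the size of a maximum matching in the bipartite graph $G[A,\overline{A}]$, whose vertex set is $V(G)$ and whose edges are the edges of $G$ with one endpoint in $A$ and one in $\overline{A}$. A split of a connected graph $G$ is a bipartition $(A,B)$ of $V(G)$ with $|A|,|B|\ge 2$ such that every vertex $a\in N(B)$ satisfies $N(a)\cap B=N(A)$. The function $\mathrm{sm}$ is defined by $\mathrm{sm}(A)=1$ if $(A,\overline{A})$ is a split of $G$, and $\mathrm{sm}(A)=\mathrm{mm}(A)$ otherwise. Split-matching-width is the $\mathrm{sm}$-width. *)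

theory Defs
  imports "Graph_Theory.Graph_Theory"
begin

section \<open>Undirected graphs\<close>

text \<open>
  A finite simple undirected graph is a \<^locale>\<open>pair_graph\<close>: an edge \<open>{u, v}\<close> is the pair of
  arcs \<open>(u, v)\<close>, \<open>(v, u)\<close>, so the degree of a vertex is its out-degree.
\<close>

definition edges :: "'a pair_pre_digraph \<Rightarrow> 'a set set" where
  "edges G = {{u, v} | u v. (u, v) \<in> parcs G}"

definition neighbourhood :: "'a pair_pre_digraph \<Rightarrow> 'a set \<Rightarrow> 'a set" where
  "neighbourhood G X = {v \<in> pverts G - X. \<exists>x \<in> X. (x, v) \<in> parcs G}"

definition delete_edge :: "'a pair_pre_digraph \<Rightarrow> 'a \<Rightarrow> 'a \<Rightarrow> 'a pair_pre_digraph" where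
  "delete_edge G u v = \<lparr>pverts = pverts G, parcs = parcs G - {(u, v), (v, u)}\<rparr>"

text \<open>
  The library's \<^const>\<open>tree\<close> and \<^const>\<open>forest\<close> are notions for directed graphs: the closed
  walk \<open>u, v, u\<close> counts as a cycle there, so a symmetric digraph with an arc is never a forest.
  The cycles of the undirected graph are those of length at least three.
\<close>

definition undirected_tree :: "'a pair_pre_digraph \<Rightarrow> bool" where
  "undirected_tree T \<longleftrightarrow> pair_graph T \<and> connected (with_proj T) \<and>
     \<not> (\<exists>p. pre_digraph.cycle (with_proj T) p \<and> length p \<ge> 3)"

text \<open>
  Leaves are vertices of degree one; in addition the vertex of a one-vertex tree is a leaf,
  so that one-vertex graphs have a branch decomposition.
\<close>

definition leaves :: "'a pair_pre_digraph \<Rightarrow> 'a set" where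
  "leaves T = {v \<in> pverts T. out_degree (with_proj T) v \<le> 1}"


section \<open>Branch decompositions and width\<close>

definition branch_decomposition ::
  "'a pair_pre_digraph \<Rightarrow> 'b pair_pre_digraph \<Rightarrow> ('b \<Rightarrow> 'a) \<Rightarrow> bool" where
  "branch_decomposition G T \<delta> \<longleftrightarrow>
     undirected_tree T \<and>
     (\<forall>v \<in> pverts T. out_degree (with_proj T) v \<le> 3) \<and>
     bij_betw \<delta> (leaves T) (pverts G)"

text \<open>
  The class, on the side of \<open>u\<close>, of the bipartition induced by the edge \<open>{u, v}\<close>. The class on
  the side of \<open>v\<close> is obtained by exchanging \<open>u\<close> and \<open>v\<close>.
\<close>

definition cut_side :: "'b pair_pre_digraph \<Rightarrow> ('b \<Rightarrow> 'a) \<Rightarrow> 'b \<Rightarrow> 'b \<Rightarrow> 'a set" where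
  "cut_side T \<delta> u v = \<delta> ` {l \<in> leaves T. u \<rightarrow>\<^sup>*\<^bsub>with_proj (delete_edge T u v)\<^esub> l}"

text \<open>The width of a decomposition whose tree has no edge is 0.\<close>

definition decomposition_width ::
  "('a set \<Rightarrow> nat) \<Rightarrow> 'b pair_pre_digraph \<Rightarrow> ('b \<Rightarrow> 'a) \<Rightarrow> nat" where
  "decomposition_width f T \<delta> = Max (insert 0 {f (cut_side T \<delta> u v) | u v. (u, v) \<in> parcs T})"

text \<open>
  Every finite tree is isomorphic to one whose vertices are natural numbers. For a nonempty
  finite graph the minimum is taken over a nonempty set; the empty graph has no branch
  decomposition, and its width is a junk value.
\<close>

definition graph_width :: "('a set \<Rightarrow> nat) \<Rightarrow> 'a pair_pre_digraph \<Rightarrow> nat" where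
  "graph_width f G = (LEAST w. \<exists>(T :: nat pair_pre_digraph) \<delta>.
     branch_decomposition G T \<delta> \<and> decomposition_width f T \<delta> = w)"


section \<open>Split-matching-width\<close>

definition cut_graph :: "'a pair_pre_digraph \<Rightarrow> 'a set \<Rightarrow> 'a pair_pre_digraph" where
  "cut_graph G A = \<lparr>pverts = pverts G, parcs = {(u, v) \<in> parcs G. (u \<in> A) \<noteq> (v \<in> A)}\<rparr>"

definition matching :: "'a pair_pre_digraph \<Rightarrow> 'a set set \<Rightarrow> bool" where
  "matching G M \<longleftrightarrow> M \<subseteq> edges G \<and> (\<forall>e \<in> M. \<forall>e' \<in> M. e \<noteq> e' \<longrightarrow> e \<inter> e' = {})"

definition mm :: "'a pair_pre_digraph \<Rightarrow> 'a set \<Rightarrow> nat" where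
  "mm G A = Max {card M | M. matching (cut_graph G A) M}"

definition split :: "'a pair_pre_digraph \<Rightarrow> 'a set \<Rightarrow> 'a set \<Rightarrow> bool" where
  "split G A B \<longleftrightarrow> connected (with_proj G) \<and>
     A \<union> B = pverts G \<and> A \<inter> B = {} \<and> card A \<ge> 2 \<and> card B \<ge> 2 \<and>
     (\<forall>a \<in> neighbourhood G B. neighbourhood G {a} \<inter> B = neighbourhood G A)"

definition sm :: "'a pair_pre_digraph \<Rightarrow> 'a set \<Rightarrow> nat" where
  "sm G A = (if split G A (pverts G - A) then 1 else mm G A)"

definition split_matching_width :: "'a pair_pre_digraph \<Rightarrow> nat" where
  "split_matching_width G = graph_width (sm G) G"


section \<open>Algorithms and running time\<close>

text \<open>
  Algorithms are structured programs for a random access machine over the natural numbers. The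
  memory consists of arrays, addressed by name, of natural numbers; a scalar variable is the cell
  0 of an array. A program mentions finitely many arrays, which can be interleaved in a single
  memory. The arithmetic instructions are addition and truncated subtraction, at unit cost.
  There is no multiplication: numbers grow by at most one bit per step, so
  that the unit-cost running time is polynomially related to Turing machine time.
\<close>

type_synonym state = "string \<Rightarrow> nat \<Rightarrow> nat"

datatype aexp = Num nat | Get string aexp | Add aexp aexp | Sub aexp aexp

datatype com =
    Skip
  | Put string aexp aexp  \<comment> \<open>\<open>Put x i e\<close> is \<open>x[i] := e\<close>\<close>
  | Seq com com
  | Cond aexp com com     \<comment> \<open>nonzero is true\<close>
  | While aexp com

primrec aval :: "aexp \<Rightarrow> state \<Rightarrow> nat" where
  "aval (Num n) s = n"
| "aval (Get x i) s = s x (aval i s)"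
| "aval (Add a b) s = aval a s + aval b s"
| "aval (Sub a b) s = aval a s - aval b s"

primrec cost :: "aexp \<Rightarrow> nat" where
  "cost (Num n) = 1"
| "cost (Get x i) = 1 + cost i"
| "cost (Add a b) = 1 + cost a + cost b"
| "cost (Sub a b) = 1 + cost a + cost b"

text \<open>\<open>exec c s t s'\<close>: started in \<open>s\<close>, the program \<open>c\<close> halts in \<open>s'\<close> after \<open>t\<close> steps.\<close>

inductive exec :: "com \<Rightarrow> state \<Rightarrow> nat \<Rightarrow> state \<Rightarrow> bool" where
  Skip: "exec Skip s 1 s"
| Put: "exec (Put x i e) s (1 + cost i + cost e) (s(x := (s x)(aval i s := aval e s)))"
| Seq: "exec c1 s t1 s' \<Longrightarrow> exec c2 s' t2 s'' \<Longrightarrow> exec (Seq c1 c2) s (t1 + t2) s''"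
| CondTrue: "aval b s \<noteq> 0 \<Longrightarrow> exec c1 s t s' \<Longrightarrow> exec (Cond b c1 c2) s (1 + cost b + t) s'"
| CondFalse: "aval b s = 0 \<Longrightarrow> exec c2 s t s' \<Longrightarrow> exec (Cond b c1 c2) s (1 + cost b + t) s'"
| WhileFalse: "aval b s = 0 \<Longrightarrow> exec (While b c) s (1 + cost b) s"
| WhileTrue: "aval b s \<noteq> 0 \<Longrightarrow> exec c s t1 s' \<Longrightarrow> exec (While b c) s' t2 s'' \<Longrightarrow>
    exec (While b c) s (1 + cost b + t1 + t2) s''"

inductive_cases exec_SkipE: "exec Skip s t s'"
inductive_cases exec_PutE: "exec (Put x i e) s t s'"
inductive_cases exec_SeqE: "exec (Seq c1 c2) s t s'"
inductive_cases exec_CondE: "exec (Cond b c1 c2) s t s'"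
inductive_cases exec_WhileE: "exec (While b c) s t s'"

lemma exec_deterministic:
  "exec c s t s' \<Longrightarrow> exec c s u s'' \<Longrightarrow> u = t \<and> s'' = s'"
proof (induction arbitrary: u s'' rule: exec.induct)
  case Skip
  from Skip.prems show ?case by (rule exec_SkipE) simp
next
  case Put
  from Put.prems show ?case by (rule exec_PutE) simp
next
  case (Seq c1 s t1 s1 c2 t2 s2)
  from Seq.prems obtain v1 v2 r where *: "exec c1 s v1 r" "exec c2 r v2 s''" "u = v1 + v2"
    by (rule exec_SeqE)
  from Seq.IH(1)[OF *(1)] *(2) have "exec c2 s1 v2 s''" by simp
  from Seq.IH(1)[OF *(1)] Seq.IH(2)[OF this] *(3) show ?case by simp
next
  case (CondTrue b s c1 t s1 c2)
  from CondTrue.prems CondTrue.hyps(1)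
  obtain v where *: "exec c1 s v s''" "u = 1 + cost b + v" by (auto elim!: exec_CondE)
  from CondTrue.IH[OF *(1)] *(2) show ?case by simp
next
  case (CondFalse b s c2 t s1 c1)
  from CondFalse.prems CondFalse.hyps(1)
  obtain v where *: "exec c2 s v s''" "u = 1 + cost b + v" by (auto elim!: exec_CondE)
  from CondFalse.IH[OF *(1)] *(2) show ?case by simp
next
  case WhileFalse
  from WhileFalse.prems show ?case by (rule exec_WhileE) (use WhileFalse.hyps in simp_all)
next
  case (WhileTrue b s c t1 s1 t2 s2)
  from WhileTrue.prems obtain v1 v2 r where *: "exec c s v1 r" "exec (While b c) r v2 s''" "u = 1 + cost b + v1 + v2"
  proof (rule exec_WhileE, goal_cases)
    case 1
    from 1(4) WhileTrue.hyps(1) show ?case by contradiction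
  next
    case (2 v1 r v2)
    from 2(2) have "u = 1 + cost b + v1 + v2" by simp
    with 2(4,5) show ?case by (rule 2(1))
  qed
  from WhileTrue.IH(1)[OF *(1)] *(2) have "exec (While b c) s1 v2 s''" by simp
  from WhileTrue.IH(1)[OF *(1)] WhileTrue.IH(2)[OF this] *(3) show ?case by simp
qed

text \<open>
  Graphs are represented by their adjacency matrices, stored row by row; the vertices of the input
  graph are \<open>0, \<dots>, n - 1\<close>. Cells that do not belong to the input are initially 0.
\<close>

definition input_state :: "nat pair_pre_digraph \<Rightarrow> nat \<Rightarrow> state" where
  "input_state G k = (\<lambda>x i.
     let n = card (pverts G) in
     if x = ''n'' \<and> i = 0 then n
     else if x = ''k'' \<and> i = 0 then k
     else if x = ''G'' \<and> i < n * n \<and> (i div n, i mod n) \<in> parcs G then 1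
     else 0)"

definition output_tree :: "state \<Rightarrow> nat pair_pre_digraph" where
  "output_tree s =
     (let m = s ''m'' 0 in
      \<lparr>pverts = {..<m}, parcs = {(i, j). i < m \<and> j < m \<and> s ''T'' (m * i + j) \<noteq> 0}\<rparr>)"

definition output_leaf_map :: "state \<Rightarrow> nat \<Rightarrow> nat" where
  "output_leaf_map s = s ''delta''"

end

theory Submission
 imports Defs
begin

text \<open>
 Call a vertex set good if its cut is complete between the two frontiers. By Koenig's theorem, small
 split-matching-width of a cut means that it has a small vertex cover, or that the graph is connected
 and the cut is good.

 A laminar family of good sets avoiding vertex 0 is computed first, such that contracting the earlier
 members inside a member leaves a prime quotient: the only good unions of the resulting blocks
 are single blocks and their complements. Take a decomposition of width less than \<open>k\<close>, which is needed only for
 the analysis, and round each of its cuts to a union of blocks. A cut with a cover of size less than \<open>k\<close> gets a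
 cover by blocks of weight less than \<open>K = 3 * k\<close>, and a good cut becomes trivial by primality.
 On blocks, the argument of Robertson and Seymour therefore applies. A node of the tree under construction is
 a union of blocks whose cut has a minimum cover \<open>S\<close> of weight less than \<open>4 * K\<close>, and some rounded cut \<open>W\<close>
 divides it such that \<open>S \<inter> W\<close> and \<open>S - W\<close> have weight at most \<open>3 * K\<close>. Trying all \<open>2 ^ (12 * k)\<close> subsets
 of \<open>S\<close> and separating each from its complement by a minimum cover, which an auction finds,
 gives two parts with covers of weight less than \<open>4 * K = 12 * k\<close>.
\<close>

section \<open>Expressions with bounded sums\<close>

text \<open>The obstacle is that a split costs 1 however large its matching is, so unions and
  intersections of cheap sets need not be cheap. In a prime quotient only single blocks and their
  complements can be cheap without a light cover; a single block is accepted as a part and opened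
  later, being a vertex or an earlier member of the family. Covers replace matchings because covers
  of two sets unite to a cover of their intersection. The factor 3 in \<open>K\<close> comes from
  rounding: a block is surely inside a rounded cut if more than two thirds of its frontier are,
  surely outside if less than one third is, so a vertex cover matters only for blocks of which it
  holds a third. Balanced halves of at most \<open>3 * K\<close> plus a separator below
  \<open>K\<close> return to the budget \<open>4 * K\<close>. A disconnected graph has no splits;
  there only the member \<open>{1..<n}\<close> is used, with single vertices as blocks. For the
  running time no steps are counted: the program text is fixed, so a common bound \<open>B\<close>
  on all loops yields a power of \<open>B\<close> with constant exponent.\<close>

text \<open>
 \<open>XSum i b e\<close> is the sum of \<open>e\<close> with the scalar \<open>i\<close> ranging below the scalar \<open>b\<close>; sums
 express counting, and hence bounded quantifiers. \<open>comp e d\<close> leaves the value of \<open>e\<close> in cell \<open>d\<close> of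
 the scratch array \<open>tmp\<close> and preserves the cells below \<open>d\<close>.
\<close>

datatype xexp =
  XN nat
 | XG string xexp
 | XA xexp xexp
 | XS xexp xexp
 | XSum string string xexp

abbreviation sc :: "state \<Rightarrow> string \<Rightarrow> nat \<Rightarrow> state" where
 "sc s x v \<equiv> s(x := (s x)(0 := v))"

primrec xval :: "xexp \<Rightarrow> state \<Rightarrow> nat" where
 "xval (XN c) s = c"
| "xval (XG x e) s = s x (xval e s)"
| "xval (XA a b) s = xval a s + xval b s"
| "xval (XS a b) s = xval a s - xval b s"
| "xval (XSum i b e) s = (\<Sum>j<s b 0. xval e (sc s i j))"

abbreviation tmp :: string where "tmp \<equiv> ''#''"

text \<open>Side condition of compilation. Inner bounds are checked in the given state although they
  are read after loop variables have changed; a loop variable that serves as an inner bound stays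
  below \<open>B\<close> by itself, which is \<open>ok_upd\<close>.\<close>

primrec ok :: "nat \<Rightarrow> state \<Rightarrow> xexp \<Rightarrow> bool" where
 "ok B s (XN c) = True"
| "ok B s (XG x e) = (x \<noteq> tmp \<and> ok B s e)"
| "ok B s (XA a b) = (ok B s a \<and> ok B s b)"
| "ok B s (XS a b) = (ok B s a \<and> ok B s b)"
| "ok B s (XSum i b e) = (i \<noteq> b \<and> i \<noteq> tmp \<and> b \<noteq> tmp \<and> s b 0 \<le> B \<and> ok B s e)"

primrec comp :: "xexp \<Rightarrow> nat \<Rightarrow> com" where
 "comp (XN c) d = Put tmp (Num d) (Num c)"
| "comp (XG x e) d = Seq (comp e d) (Put tmp (Num d) (Get x (Get tmp (Num d))))"
| "comp (XA a b) d = Seq (comp a d) (Seq (comp b (Suc d))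
   (Put tmp (Num d) (Add (Get tmp (Num d)) (Get tmp (Num (Suc d))))))"
| "comp (XS a b) d = Seq (comp a d) (Seq (comp b (Suc d))
   (Put tmp (Num d) (Sub (Get tmp (Num d)) (Get tmp (Num (Suc d))))))"
| "comp (XSum i b e) d =
   Seq (Put tmp (Num d) (Num 0)) (Seq (Put tmp (Num (Suc d)) (Get i (Num 0))) (Seq (Put i (Num 0) (Num 0))
   (Seq (While (Sub (Get b (Num 0)) (Get i (Num 0)))
    (Seq (comp e (Suc (Suc d)))
    (Seq (Put tmp (Num d) (Add (Get tmp (Num d)) (Get tmp (Num (Suc (Suc d))))))
      (Put i (Num 0) (Add (Get i (Num 0)) (Num 1))))))
   (Put i (Num 0) (Get tmp (Num (Suc d)))))))"

text \<open>A program in which no loop makes more than \<open>B\<close> iterations takes at most \<open>B ^ ce c\<close> steps.\<close>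

primrec ce :: "com \<Rightarrow> nat" where
 "ce Skip = 0"
| "ce (Put x i e) = 1 + cost i + cost e"
| "ce (Seq a b) = ce a + ce b + 1"
| "ce (Cond b c d) = cost b + ce c + ce d + 2"
| "ce (While b c) = cost b + ce c + 4"

section \<open>Running times as powers of the loop bound\<close>

lemma le_pow: "2 \<le> B \<Longrightarrow> m \<le> B ^ m" for B m :: nat
 by (metis less_exp less_imp_le_nat order_trans power_mono zero_le)

text \<open>The form in which costs compose: sequencing adds exponents, and the extra 1 absorbs a
  factor 2.\<close>

lemma pow_add_le: "2 \<le> B \<Longrightarrow> B ^ a + B ^ b \<le> B ^ (a + b + 1)" for B a b :: nat
proof -
 assume B: "2 \<le> B"
 have "B ^ a \<le> B ^ (a + b)" "B ^ b \<le> B ^ (a + b)" using B by (simp_all add: power_increasing)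
 then have "B ^ a + B ^ b \<le> 2 * B ^ (a + b)" by simp
 also have "\<dots> \<le> B * B ^ (a + b)" using B by simp
 finally show ?thesis by simp
qed

lemma ce_Seq_bound:
 fixes B :: nat
 assumes "2 \<le> B" "t1 \<le> B ^ ce a" "t2 \<le> B ^ ce b"
 shows "t1 + t2 \<le> B ^ ce (Seq a b)"
 using assms pow_add_le[OF assms(1), of "ce a" "ce b"] by simp

text \<open>The invariant relates the state to a ghost \<open>x\<close>, whose measure decreases. A
  ghost is needed because the state also carries scratch cells whose contents are known only up to
  existence.\<close>

lemma exec_while:
 assumes "\<And>x s. J x s \<Longrightarrow> aval b s \<noteq> 0 \<Longrightarrow>
   \<exists>t s' x'. exec c s t s' \<and> t \<le> T \<and> J x' s' \<and> (\<mu> x' :: nat) < \<mu> x"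
  and "J x s"
 shows "\<exists>t s' x'. exec (While b c) s t s' \<and> J x' s' \<and> aval b s' = 0 \<and>
   t \<le> (\<mu> x + 1) * (1 + cost b + T)"
 using assms(2)
proof (induction "\<mu> x" arbitrary: x s rule: less_induct)
 case less
 show ?case
 proof (cases "aval b s = 0")
  case True
  then show ?thesis using less.prems exec.WhileFalse[OF True] by fastforce
 next
  case False
  obtain t s' x' where 1: "exec c s t s'" "t \<le> T" "J x' s'" "\<mu> x' < \<mu> x"
   using assms(1)[OF less.prems False] by blast
  obtain t2 s2 x2 where 2: "exec (While b c) s' t2 s2" "J x2 s2" "aval b s2 = 0"
   "t2 \<le> (\<mu> x' + 1) * (1 + cost b + T)"
   using less.hyps[OF 1(4) 1(3)] by blast
  have "(\<mu> x' + 1) * (1 + cost b + T) \<le> \<mu> x * (1 + cost b + T)"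
   using 1(4) by (intro mult_right_mono) auto
  then have "1 + cost b + t + t2 \<le> (\<mu> x + 1) * (1 + cost b + T)"
   using 1(2) 2(4) by (simp add: algebra_simps)
  then show ?thesis using exec.WhileTrue[OF False 1(1) 2(1)] 2 by blast
 qed
qed

lemma ce_While_bound:
 assumes "2 \<le> B" "m \<le> B" "t \<le> (m + 1) * (1 + cost b + B ^ ce c)"
 shows "t \<le> B ^ ce (While b c)"
proof -
 have "1 + cost b \<le> B ^ (1 + cost b)" using le_pow[OF assms(1)] by blast
 then have "1 + cost b + B ^ ce c \<le> B ^ (1 + cost b + ce c + 1)"
  using pow_add_le[OF assms(1), of "1 + cost b" "ce c"] by linarith
 moreover have "m + 1 \<le> B ^ 2"
 proof -
  have "m + 1 \<le> B + B" using assms by linarith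
  also have "\<dots> \<le> B * B" using assms(1) mult_le_mono1[of 2 B B] by linarith
  finally show ?thesis by (simp add: power2_eq_square)
 qed
 ultimately have "t \<le> B ^ 2 * B ^ (1 + cost b + ce c + 1)"
  using assms(3) mult_le_mono order_trans by blast
 also have "\<dots> = B ^ ce (While b c)" by (simp flip: power_add) (simp add: eval_nat_numeral algebra_simps)
 finally show ?thesis .
qed

lemma ok_upd: "ok B s e \<Longrightarrow> j \<le> B \<Longrightarrow> ok B (sc s i j) e"
 by (induction e arbitrary: s) auto

lemma xval_tmp: "ok B s e \<Longrightarrow> xval e (s(tmp := h)) = xval e s"
proof (induction e arbitrary: s)
 case (XSum i b e)
 have "xval e (sc (s(tmp := h)) i j) = xval e (sc s i j)" if "j < s b 0" for j
 proof -
  have "sc (s(tmp := h)) i j = (sc s i j)(tmp := h)"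
   using XSum.prems by (auto simp: fun_eq_iff)
  moreover have "ok B (sc s i j) e" using XSum.prems that by (auto intro: ok_upd)
  ultimately show ?thesis using XSum.IH[of "sc s i j"] by metis
 qed
 moreover have "(s(tmp := h)) b 0 = s b 0" using XSum.prems by simp
 ultimately show ?case unfolding xval.simps by (metis (no_types, lifting) lessThan_iff sum.cong)
qed auto

lemma ok_tmp [simp]: "ok B (s(tmp := h)) e = ok B s e"
 by (induction e) auto

lemma exec_Seq_ex:
 assumes "2 \<le> B" "exec c1 s t1 s1" "t1 \<le> B ^ ce c1" "exec c2 s1 t2 s2" "t2 \<le> B ^ ce c2"
 shows "exec (Seq c1 c2) s (t1 + t2) s2 \<and> t1 + t2 \<le> B ^ ce (Seq c1 c2)"
 using ce_Seq_bound[OF assms(1,3,5)] exec.Seq[OF assms(2,4)] by blast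

lemma exec_Put_ex: "2 \<le> B \<Longrightarrow>
 exec (Put x i e) s (1 + cost i + cost e) (s(x := (s x)(aval i s := aval e s))) \<and>
 1 + cost i + cost e \<le> B ^ ce (Put x i e)"
 using le_pow[of B "1 + cost i + cost e"] exec.Put[of x i e s] by simp

definition tex :: "nat \<Rightarrow> com \<Rightarrow> state \<Rightarrow> state \<Rightarrow> bool" where
 "tex B c s s' \<longleftrightarrow> (\<exists>t. exec c s t s' \<and> t \<le> B ^ ce c)"

lemma tex_Seq: "\<lbrakk>2 \<le> B; tex B c1 s s1; tex B c2 s1 s2\<rbrakk> \<Longrightarrow> tex B (Seq c1 c2) s s2"
 unfolding tex_def using exec_Seq_ex by blast

lemma tex_Put: "2 \<le> B \<Longrightarrow> s' = s(x := (s x)(aval i s := aval e s)) \<Longrightarrow> tex B (Put x i e) s s'"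
 unfolding tex_def using exec_Put_ex by blast

lemma tex_While:
 assumes "2 \<le> B"
  and "\<And>x s. J x s \<Longrightarrow> aval b s \<noteq> 0 \<Longrightarrow> \<exists>s' x'. tex B c s s' \<and> J x' s' \<and> (\<mu> x' :: nat) < \<mu> x"
  and "J x s" "\<mu> x \<le> B"
 shows "\<exists>s' x'. tex B (While b c) s s' \<and> J x' s' \<and> aval b s' = 0"
proof -
 obtain t s' x' where "exec (While b c) s t s'" "J x' s'" "aval b s' = 0"
   "t \<le> (\<mu> x + 1) * (1 + cost b + B ^ ce c)"
  using exec_while[of J b c "B ^ ce c" \<mu> x s] assms(2,3) unfolding tex_def by meson
 then show ?thesis using ce_While_bound[OF assms(1,4)] unfolding tex_def by blast
qed

text \<open>A stack discipline in the scratch array: a second operand is compiled at depth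
  \<open>Suc d\<close>, and a sum keeps its accumulator in cell \<open>d\<close> and the old value
  of its loop variable in cell \<open>Suc d\<close>, from where it is restored. Hence evaluation
  changes nothing but scratch.\<close>

lemma comp_correct:
 assumes B: "2 \<le> B"
 shows "ok B s e \<Longrightarrow> \<exists>h. tex B (comp e d) s (s(tmp := h)) \<and> h d = xval e s \<and> (\<forall>c<d. h c = s tmp c)"
proof (induction e arbitrary: s d)
 case (XN c)
 have "tex B (comp (XN c) d) s (s(tmp := (s tmp)(d := c)))"
  unfolding comp.simps by (rule tex_Put[OF B]) simp
 then show ?case
  by (intro exI[of _ "(s tmp)(d := c)"] conjI, assumption) (simp_all)
next
 case (XG x e)
 from XG.prems have "ok B s e" by simp
 from XG.IH[OF this, of d] obtain h where h: "tex B (comp e d) s (s(tmp := h))" "h d = xval e s"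
  "\<forall>c<d. h c = s tmp c" by (elim exE conjE)
 have "tex B (comp (XG x e) d) s (s(tmp := h(d := s x (xval e s))))"
  unfolding comp.simps by (rule tex_Seq[OF B h(1) tex_Put[OF B]]) (use h XG.prems in simp)
 then show ?case
  by (intro exI[of _ "h(d := s x (xval e s))"] conjI, assumption) (use h in simp_all)
next
 case (XA a b)
 from XA.prems have okab: "ok B s a" "ok B s b" by simp_all
 from XA.IH(1)[OF okab(1), of d] obtain h where h: "tex B (comp a d) s (s(tmp := h))" "h d = xval a s"
  "\<forall>c<d. h c = s tmp c" by (elim exE conjE)
 from okab(2) have "ok B (s(tmp := h)) b" by simp
 note IH2 = XA.IH(2)[OF this, of "Suc d", unfolded fun_upd_upd xval_tmp[OF okab(2)] fun_upd_same]
 from IH2 obtain g where g: "tex B (comp b (Suc d)) (s(tmp := h)) (s(tmp := g))" "g (Suc d) = xval b s"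
   "\<forall>c<Suc d. g c = h c" by (elim exE conjE)
 have "tex B (comp (XA a b) d) s (s(tmp := g(d := xval a s + xval b s)))"
  unfolding comp.simps
  by (rule tex_Seq[OF B h(1) tex_Seq[OF B g(1) tex_Put[OF B]]]) (use h g in simp)
 then show ?case
  by (intro exI[of _ "g(d := xval a s + xval b s)"] conjI, assumption) (use h g in simp_all)
next
 case (XS a b)
 from XS.prems have okab: "ok B s a" "ok B s b" by simp_all
 from XS.IH(1)[OF okab(1), of d] obtain h where h: "tex B (comp a d) s (s(tmp := h))" "h d = xval a s"
  "\<forall>c<d. h c = s tmp c" by (elim exE conjE)
 from okab(2) have "ok B (s(tmp := h)) b" by simp
 note IH2 = XS.IH(2)[OF this, of "Suc d", unfolded fun_upd_upd xval_tmp[OF okab(2)] fun_upd_same]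
 from IH2 obtain g where g: "tex B (comp b (Suc d)) (s(tmp := h)) (s(tmp := g))" "g (Suc d) = xval b s"
   "\<forall>c<Suc d. g c = h c" by (elim exE conjE)
 have "tex B (comp (XS a b) d) s (s(tmp := g(d := xval a s - xval b s)))"
  unfolding comp.simps
  by (rule tex_Seq[OF B h(1) tex_Seq[OF B g(1) tex_Put[OF B]]]) (use h g in simp)
 then show ?case
  by (intro exI[of _ "g(d := xval a s - xval b s)"] conjI, assumption) (use h g in simp_all)
next
 case (XSum i b e)
 let ?c = "Seq (comp e (Suc (Suc d)))
    (Seq (Put tmp (Num d) (Add (Get tmp (Num d)) (Get tmp (Num (Suc (Suc d))))))
      (Put i (Num 0) (Add (Get i (Num 0)) (Num 1))))"
 let ?b = "Sub (Get b (Num 0)) (Get i (Num 0))"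
 \<comment> \<open>The ghost of this loop is the counter together with the scratch contents.\<close>
 let ?J = "\<lambda>(j, h) \<sigma>. j \<le> s b 0 \<and> \<sigma> = (sc s i j)(tmp := h) \<and> h d = (\<Sum>j<j. xval e (sc s i j)) \<and>
   h (Suc d) = s i 0 \<and> (\<forall>c<d. h c = s tmp c)"
 let ?h0 = "(s tmp)(d := 0, Suc d := s i 0)"
 let ?s0 = "(sc s i 0)(tmp := ?h0)"
 have ne: "i \<noteq> b" "i \<noteq> tmp" "b \<noteq> tmp" using XSum.prems by auto
 have "\<exists>\<sigma> x. tex B (While ?b ?c) ?s0 \<sigma> \<and> ?J x \<sigma> \<and> aval ?b \<sigma> = 0"
 proof (rule tex_While[OF B, where \<mu> = "\<lambda>(j, h). s b 0 - j" and x = "(0, ?h0)" and J = ?J])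
  fix x \<sigma> assume J: "?J x \<sigma>" and a: "aval ?b \<sigma> \<noteq> 0"
  obtain j h where x: "x = (j, h)" by (cases x)
  from J x have h: "\<sigma> = (sc s i j)(tmp := h)" "h d = (\<Sum>j<j. xval e (sc s i j))"
    "h (Suc d) = s i 0" "\<forall>c<d. h c = s tmp c" by simp_all
  have jl: "j < s b 0" using a h(1) ne by simp
  have okj: "ok B (sc s i j) e" using XSum.prems jl by (auto intro!: ok_upd)
  then have "ok B ((sc s i j)(tmp := h)) e" by simp
  note IH = XSum.IH[OF this, of "Suc (Suc d)", unfolded fun_upd_upd xval_tmp[OF okj] fun_upd_same]
  from IH obtain g where g: "tex B (comp e (Suc (Suc d))) ((sc s i j)(tmp := h)) ((sc s i j)(tmp := g))"
   "g (Suc (Suc d)) = xval e (sc s i j)" "\<forall>c<Suc (Suc d). g c = h c" by (elim exE conjE)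
  let ?g = "g(d := g d + g (Suc (Suc d)))"
  let ?\<sigma>' = "(sc s i (Suc j))(tmp := ?g)"
  have "tex B ?c \<sigma> ?\<sigma>'"
   unfolding h(1)
   by (rule tex_Seq[OF B g(1) tex_Seq[OF B tex_Put[OF B refl] tex_Put[OF B]]])
    (use ne in \<open>simp add: fun_eq_iff\<close>)
  moreover have "?J (Suc j, ?g) ?\<sigma>'"
   using jl g h by simp
  moreover have "(case (Suc j, ?g) of (j, h) \<Rightarrow> s b 0 - j) < (case x of (j, h) \<Rightarrow> s b 0 - j)"
   using jl x by simp
  ultimately show "\<exists>\<sigma>' x'. tex B ?c \<sigma> \<sigma>' \<and> ?J x' \<sigma>' \<and>
    (case x' of (j, h) \<Rightarrow> s b 0 - j) < (case x of (j, h) \<Rightarrow> s b 0 - j)"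
   by (intro exI conjI)
 next
  show "?J (0, ?h0) ?s0" by simp
 next
  show "(case (0, ?h0) of (j, h) \<Rightarrow> s b 0 - j) \<le> B" using XSum.prems by simp
 qed
 then obtain \<sigma> x where W: "tex B (While ?b ?c) ?s0 \<sigma>" "?J x \<sigma>" "aval ?b \<sigma> = 0" by (elim exE conjE)
 obtain j h where x: "x = (j, h)" by (cases x)
 from W(2) x have h: "j \<le> s b 0" "\<sigma> = (sc s i j)(tmp := h)" "h d = (\<Sum>j<j. xval e (sc s i j))"
    "h (Suc d) = s i 0" "\<forall>c<d. h c = s tmp c" by simp_all
 have j: "j = s b 0" using W(3) h(1,2) ne by simp
 have p4: "tex B (Put i (Num 0) (Get tmp (Num (Suc d)))) \<sigma> (s(tmp := h))"
  unfolding h(2) by (rule tex_Put[OF B]) (use ne h(4) in \<open>simp add: fun_eq_iff\<close>)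
 let ?s1 = "s(tmp := (s tmp)(d := 0))" and ?s2 = "s(tmp := ?h0)"
 have p1: "tex B (Put tmp (Num d) (Num 0)) s ?s1" by (rule tex_Put[OF B]) simp
 have p2: "tex B (Put tmp (Num (Suc d)) (Get i (Num 0))) ?s1 ?s2"
  by (rule tex_Put[OF B]) (use ne in simp)
 have p3: "tex B (Put i (Num 0) (Num 0)) ?s2 ?s0"
  by (rule tex_Put[OF B]) (use ne in \<open>simp add: fun_eq_iff\<close>)
 have "tex B (comp (XSum i b e) d) s (s(tmp := h))"
  unfolding comp.simps
  by (rule tex_Seq[OF B p1 tex_Seq[OF B p2 tex_Seq[OF B p3 tex_Seq[OF B W(1) p4]]]])
 moreover have "h d = xval (XSum i b e) s" using h(3) j by simp
 ultimately show ?case using h(5) by (intro exI conjI)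
qed

lemma tex_Cond:
 assumes "2 \<le> B" "aval b s \<noteq> 0 \<Longrightarrow> tex B c1 s s'" "aval b s = 0 \<Longrightarrow> tex B c2 s s'"
 shows "tex B (Cond b c1 c2) s s'"
proof -
 have bound: "1 + cost b + t \<le> B ^ ce (Cond b c1 c2)" if "t \<le> B ^ ce c1 \<or> t \<le> B ^ ce c2" for t
 proof -
  have "B ^ ce c1 \<le> B ^ (ce c1 + ce c2)" "B ^ ce c2 \<le> B ^ (ce c1 + ce c2)"
   using assms(1) by (simp_all add: power_increasing)
  then have "t \<le> B ^ (ce c1 + ce c2)" using that by linarith
  moreover have "1 + cost b \<le> B ^ (1 + cost b)" using le_pow[OF assms(1)] by blast
  ultimately have "1 + cost b + t \<le> B ^ (1 + cost b + (ce c1 + ce c2) + 1)"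
   using pow_add_le[OF assms(1), of "1 + cost b" "ce c1 + ce c2"] by linarith
  then show ?thesis by (simp add: algebra_simps)
 qed
 show ?thesis
 proof (cases "aval b s = 0")
  case True
  then show ?thesis using assms(3) exec.CondFalse bound unfolding tex_def by blast
 next
  case False
  then show ?thesis using assms(2) exec.CondTrue bound unfolding tex_def by blast
 qed
qed

primrec names :: "xexp \<Rightarrow> string set" where
 "names (XN c) = {}"
| "names (XG x e) = insert x (names e)"
| "names (XA a b) = names a \<union> names b"
| "names (XS a b) = names a \<union> names b"
| "names (XSum i b e) = {i, b} \<union> names e"

lemma xval_upd_other: "x \<notin> names e \<Longrightarrow> xval e (s(x := f)) = xval e s"
proof (induction e arbitrary: s)
 case (XSum i b e)
 have "xval e (sc (s(x := f)) i j) = xval e (sc s i j)" for j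
 proof -
  have "sc (s(x := f)) i j = (sc s i j)(x := f)"
   using XSum.prems by (auto simp: fun_eq_iff)
  then show ?thesis using XSum.IH[of "sc s i j"] XSum.prems by (metis UnCI names.simps(5))
 qed
 moreover have "(s(x := f)) b 0 = s b 0" using XSum.prems by auto
 ultimately show ?case unfolding xval.simps by presburger
qed auto

lemma ok_upd_other: "x \<notin> names e \<Longrightarrow> ok B (s(x := f)) e = ok B s e"
 by (induction e) auto

section \<open>Assignments, loops and arrays\<close>

definition SET :: "string \<Rightarrow> xexp \<Rightarrow> xexp \<Rightarrow> com" where
 "SET x i e = Seq (comp i 0) (Seq (comp e 1) (Put x (Get tmp (Num 0)) (Get tmp (Num 1))))"

definition IFF :: "xexp \<Rightarrow> com \<Rightarrow> com \<Rightarrow> com" where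
 "IFF e c1 c2 = Seq (comp e 0) (Cond (Get tmp (Num 0)) c1 c2)"

text \<open>\<open>While\<close> tests a plain \<open>aexp\<close>, so the compiled guard is run
  before the loop and again at the end of each round.\<close>

definition WHILE :: "xexp \<Rightarrow> com \<Rightarrow> com" where
 "WHILE e c = Seq (comp e 0) (While (Get tmp (Num 0)) (Seq c (comp e 0)))"

definition FOR :: "string \<Rightarrow> string \<Rightarrow> com \<Rightarrow> com" where
 "FOR i b c = Seq (SET i (XN 0) (XN 0))
   (WHILE (XS (XG b (XN 0)) (XG i (XN 0))) (Seq c (SET i (XN 0) (XA (XG i (XN 0)) (XN 1)))))"

text \<open>Fills the segment of \<open>x\<close> that starts at \<open>off\<close>. Scratch cells 0
  and 1 hold the offset and the saved loop variable, which is why \<open>e\<close> is compiled at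
  depth 2.\<close>

definition ARR :: "string \<Rightarrow> xexp \<Rightarrow> string \<Rightarrow> string \<Rightarrow> xexp \<Rightarrow> com" where
 "ARR x off i b e = Seq (comp off 0) (Seq (Put tmp (Num 1) (Get i (Num 0))) (Seq (Put i (Num 0) (Num 0))
   (Seq (While (Sub (Get b (Num 0)) (Get i (Num 0)))
    (Seq (comp e 2) (Seq (Put x (Add (Get tmp (Num 0)) (Get i (Num 0))) (Get tmp (Num 2)))
      (Put i (Num 0) (Add (Get i (Num 0)) (Num 1))))))
   (Put i (Num 0) (Get tmp (Num 1))))))"

text \<open>The scratch array is arbitrary at the start and hidden at the end, so assertions need not mention it.\<close>

definition wp :: "nat \<Rightarrow> com \<Rightarrow> state \<Rightarrow> (state \<Rightarrow> bool) \<Rightarrow> bool" where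
 "wp B c s Q \<longleftrightarrow> (\<forall>h. \<exists>s' h'. tex B c (s(tmp := h)) (s'(tmp := h')) \<and> Q s')"

lemma wpD: "wp B c s Q \<Longrightarrow> \<exists>s' h'. tex B c (s(tmp := h)) (s'(tmp := h')) \<and> Q s'"
 unfolding wp_def by (erule allE)

lemma wpI: "(\<And>h. \<exists>s' h'. tex B c (s(tmp := h)) (s'(tmp := h')) \<and> Q s') \<Longrightarrow> wp B c s Q"
 unfolding wp_def by (rule allI)

lemma wp_Skip:
 assumes "2 \<le> B" "Q s"
 shows "wp B Skip s Q"
proof (rule wpI)
 fix h
 have "tex B Skip (s(tmp := h)) (s(tmp := h))"
  unfolding tex_def by (intro exI[of _ 1] conjI exec.Skip) simp
 then show "\<exists>s' h'. tex B Skip (s(tmp := h)) (s'(tmp := h')) \<and> Q s'"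
  using assms(2) by (intro exI conjI)
qed

lemma wp_Seq:
 assumes "2 \<le> B" "wp B c1 s (\<lambda>s'. wp B c2 s' Q)"
 shows "wp B (Seq c1 c2) s Q"
proof (rule wpI)
 fix h
 from wpD[OF assms(2), of h] obtain s1 h1 where 1: "tex B c1 (s(tmp := h)) (s1(tmp := h1))" "wp B c2 s1 Q"
  by (elim exE conjE)
 from wpD[OF 1(2), of h1] obtain s2 h2 where 2: "tex B c2 (s1(tmp := h1)) (s2(tmp := h2))" "Q s2"
  by (elim exE conjE)
 show "\<exists>s' h'. tex B (Seq c1 c2) (s(tmp := h)) (s'(tmp := h')) \<and> Q s'"
  using tex_Seq[OF assms(1) 1(1) 2(1)] 2(2) by (intro exI conjI)
qed

lemma wp_mono: "wp B c s P \<Longrightarrow> (\<And>s'. P s' \<Longrightarrow> Q s') \<Longrightarrow> wp B c s Q"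
 unfolding wp_def by meson

lemma comp_run:
 assumes "2 \<le> B" "ok B s e"
 shows "\<exists>g. tex B (comp e d) (s(tmp := h)) (s(tmp := g)) \<and> g d = xval e s \<and> (\<forall>c<d. g c = h c)"
proof -
 from assms(2) have "ok B (s(tmp := h)) e" by simp
 from comp_correct[OF assms(1) this, of d, unfolded fun_upd_upd xval_tmp[OF assms(2)] fun_upd_same]
 show ?thesis .
qed

lemma wp_SET:
 assumes "2 \<le> B" "ok B s i" "ok B s e" "x \<noteq> tmp" "Q (s(x := (s x)(xval i s := xval e s)))"
 shows "wp B (SET x i e) s Q"
proof (rule wpI)
 fix h
 obtain g where g: "tex B (comp i 0) (s(tmp := h)) (s(tmp := g))" "g 0 = xval i s"
  using comp_run[OF assms(1,2), of 0 h] by (elim exE conjE)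
 obtain k where k: "tex B (comp e 1) (s(tmp := g)) (s(tmp := k))" "k 1 = xval e s" "\<forall>c<1. k c = g c"
  using comp_run[OF assms(1,3), of 1 g] by (elim exE conjE)
 have "tex B (Put x (Get tmp (Num 0)) (Get tmp (Num 1))) (s(tmp := k))
   ((s(x := (s x)(xval i s := xval e s)))(tmp := k))"
  by (rule tex_Put[OF assms(1)]) (use assms(4) g k in \<open>simp add: fun_eq_iff\<close>)
 from tex_Seq[OF assms(1) g(1) tex_Seq[OF assms(1) k(1) this]] assms(5)
 show "\<exists>s' h'. tex B (SET x i e) (s(tmp := h)) (s'(tmp := h')) \<and> Q s'"
  unfolding SET_def by (intro exI conjI)
qed

lemma wp_IFF:
 assumes "2 \<le> B" "ok B s e" "xval e s \<noteq> 0 \<Longrightarrow> wp B c1 s Q" "xval e s = 0 \<Longrightarrow> wp B c2 s Q"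
 shows "wp B (IFF e c1 c2) s Q"
proof (rule wpI)
 fix h
 let ?c = "if xval e s = 0 then c2 else c1"
 obtain g where g: "tex B (comp e 0) (s(tmp := h)) (s(tmp := g))" "g 0 = xval e s"
  using comp_run[OF assms(1,2), of 0 h] by (elim exE conjE)
 have "wp B ?c s Q" using assms(3,4) by simp
 from wpD[OF this, of g] obtain s' k where k: "tex B ?c (s(tmp := g)) (s'(tmp := k))" "Q s'"
  by (elim exE conjE)
 have "tex B (Cond (Get tmp (Num 0)) c1 c2) (s(tmp := g)) (s'(tmp := k))"
  by (rule tex_Cond[OF assms(1)]) (use g(2) k in \<open>simp_all split: if_splits\<close>)
 from tex_Seq[OF assms(1) g(1) this] k(2)
 show "\<exists>s' h'. tex B (IFF e c1 c2) (s(tmp := h)) (s'(tmp := h')) \<and> Q s'"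
  unfolding IFF_def by (intro exI conjI)
qed

text \<open>The measure serves twice: it decreases, and its initial value, being at most
  \<open>B\<close>, bounds the number of rounds.\<close>

lemma wp_WHILE:
 assumes B: "2 \<le> B" and I: "I s"
  and ok: "\<And>s. I s \<Longrightarrow> ok B s e"
  and step: "\<And>s. I s \<Longrightarrow> xval e s \<noteq> 0 \<Longrightarrow> wp B c s (\<lambda>s'. I s' \<and> (\<mu> s' :: nat) < \<mu> s)"
  and Q: "\<And>s. I s \<Longrightarrow> xval e s = 0 \<Longrightarrow> Q s"
  and \<mu>: "\<mu> s \<le> B"
 shows "wp B (WHILE e c) s Q"
proof (rule wpI)
 fix h
 let ?J = "\<lambda>x \<sigma>. I x \<and> (\<exists>h. \<sigma> = x(tmp := h) \<and> h 0 = xval e x)"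
 obtain g where g: "tex B (comp e 0) (s(tmp := h)) (s(tmp := g))" "g 0 = xval e s"
  using comp_run[OF B ok[OF I], of 0 h] by (elim exE conjE)
 have "\<exists>\<sigma> x. tex B (While (Get tmp (Num 0)) (Seq c (comp e 0))) (s(tmp := g)) \<sigma> \<and> ?J x \<sigma> \<and>
   aval (Get tmp (Num 0)) \<sigma> = 0"
 proof (rule tex_While[OF B, where \<mu> = \<mu> and x = s and J = ?J])
  fix x \<sigma> assume J: "?J x \<sigma>" and a: "aval (Get tmp (Num 0)) \<sigma> \<noteq> 0"
  then obtain k where k: "I x" "\<sigma> = x(tmp := k)" "k 0 = xval e x" by (elim exE conjE)
  from a k have "xval e x \<noteq> 0" by simp
  from wpD[OF step[OF k(1) this], of k] obtain y l
   where y: "tex B c \<sigma> (y(tmp := l))" "I y" "\<mu> y < \<mu> x" unfolding k(2) by (elim exE conjE)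
  obtain m where m: "tex B (comp e 0) (y(tmp := l)) (y(tmp := m))" "m 0 = xval e y"
   using comp_run[OF B ok[OF y(2)], of 0 l] by (elim exE conjE)
  have "?J y (y(tmp := m))" using y(2) m(2) by (intro conjI exI[of _ m] refl)
  then show "\<exists>\<sigma>' x'. tex B (Seq c (comp e 0)) \<sigma> \<sigma>' \<and> ?J x' \<sigma>' \<and> \<mu> x' < \<mu> x"
   by (intro exI[of _ "y(tmp := m)"] exI[of _ y], intro conjI[OF tex_Seq[OF B y(1) m(1)]] conjI[OF _ y(3)])
 next
  show "?J s (s(tmp := g))" using I g(2) by (intro conjI exI[of _ g] refl)
 qed (rule \<mu>)
 then obtain \<sigma> x k where *: "tex B (While (Get tmp (Num 0)) (Seq c (comp e 0))) (s(tmp := g)) \<sigma>"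
  "I x" "\<sigma> = x(tmp := k)" "k 0 = xval e x" "aval (Get tmp (Num 0)) \<sigma> = 0"
  by (elim exE conjE)
 have "xval e x = 0" using * by simp
 from Q[OF *(2) this] tex_Seq[OF B g(1) *(1)]
 show "\<exists>s' h'. tex B (WHILE e c) (s(tmp := h)) (s'(tmp := h')) \<and> Q s'"
  unfolding WHILE_def *(3) by (intro exI conjI)
qed

text \<open>\<open>I j\<close> describes the state with the counter at \<open>j\<close>. The body
  leaves the counter in place; the increment that follows it appears as the update in the
  postcondition of \<open>step\<close>.\<close>

lemma wp_FOR:
 assumes B: "2 \<le> B" and ne: "i \<noteq> b" "i \<noteq> tmp" "b \<noteq> tmp" and m: "s b 0 = m" "m \<le> B"
  and I: "I 0 (sc s i 0)"
  and step: "\<And>j s. \<lbrakk>j < m; I j s; s i 0 = j; s b 0 = m\<rbrakk> \<Longrightarrow>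
    wp B c s (\<lambda>s'. s' i 0 = j \<and> s' b 0 = m \<and> I (Suc j) (sc s' i (Suc j)))"
  and Q: "\<And>s. \<lbrakk>I m s; s i 0 = m; s b 0 = m\<rbrakk> \<Longrightarrow> Q s"
 shows "wp B (FOR i b c) s Q"
 unfolding FOR_def
proof (intro wp_Seq[OF B] wp_SET[OF B], goal_cases)
 case 4
 let ?I = "\<lambda>s. s i 0 \<le> m \<and> s b 0 = m \<and> I (s i 0) s"
 show ?case
 proof (rule wp_WHILE[OF B, where \<mu> = "\<lambda>s. m - s i 0" and I = ?I], goal_cases)
  case 1
  then show ?case using I m ne by simp
 next
  case (2 s)
  then show ?case using ne by simp
 next
  case (3 s)
  then have lt: "s i 0 < m" by simp
  show ?case
  proof (rule wp_Seq[OF B], rule wp_mono[OF step[of "s i 0" s]], goal_cases)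
   case (5 s')
   show ?case
    by (rule wp_SET[OF B]) (use 5 ne lt in simp_all)
  qed (use 3 lt in simp_all)
 next
  case (4 s)
  then have "s i 0 = m" by simp
  with 4 Q[of s] show ?case by simp
 next
  case 5
  show ?case using m by simp
 qed
qed (use ne in simp_all)

text \<open>As \<open>x\<close> does not occur in \<open>e\<close>, entries already written cannot
  influence later ones, and the loop acts as a simultaneous assignment evaluated in the initial
  state.\<close>

lemma wp_ARR:
 assumes B: "2 \<le> B" and side: "ok B s off \<and> ok B s e \<and> s b 0 \<le> B \<and> i \<noteq> b \<and> i \<noteq> tmp \<and> b \<noteq> tmp \<and>
   x \<noteq> tmp \<and> x \<noteq> i \<and> x \<noteq> b \<and> x \<notin> names e"
  and Q: "Q (s(x := \<lambda>p. if xval off s \<le> p \<and> p < xval off s + s b 0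
        then xval e (sc s i (p - xval off s)) else s x p))"
 shows "wp B (ARR x off i b e) s Q"
proof (rule wpI)
 have o: "ok B s off" and e: "ok B s e" and bB: "s b 0 \<le> B"
  and ne: "i \<noteq> b" "i \<noteq> tmp" "b \<noteq> tmp" "x \<noteq> tmp" "x \<noteq> i" "x \<noteq> b" "x \<notin> names e"
  using side by simp_all
 fix h
 define K where "K = xval off s"
 define X where "X = (\<lambda>j p. if K \<le> p \<and> p < K + j then xval e (sc s i (p - K)) else s x p)"
 obtain g where g: "tex B (comp off 0) (s(tmp := h)) (s(tmp := g))" "g 0 = K"
  using comp_run[OF B o, of 0 h] unfolding K_def by (elim exE conjE)
 let ?b = "Sub (Get b (Num 0)) (Get i (Num 0))"
 let ?c = "Seq (comp e 2) (Seq (Put x (Add (Get tmp (Num 0)) (Get i (Num 0))) (Get tmp (Num 2)))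
      (Put i (Num 0) (Add (Get i (Num 0)) (Num 1))))"
 let ?J = "\<lambda>(j, h) \<sigma>. j \<le> s b 0 \<and> \<sigma> = (sc (s(x := X j)) i j)(tmp := h) \<and> h 0 = K \<and> h 1 = s i 0"
 let ?g0 = "g(1 := s i 0)"
 let ?s0 = "(sc (s(x := X 0)) i 0)(tmp := ?g0)"
 have X0: "s(x := X 0) = s" by (simp add: X_def fun_eq_iff)
 have "\<exists>\<sigma> y. tex B (While ?b ?c) ?s0 \<sigma> \<and> ?J y \<sigma> \<and> aval ?b \<sigma> = 0"
 proof (rule tex_While[OF B, where \<mu> = "\<lambda>(j, h). s b 0 - j" and x = "(0, ?g0)" and J = ?J])
  fix y \<sigma> assume J: "?J y \<sigma>" and a: "aval ?b \<sigma> \<noteq> 0"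
  obtain j h where y: "y = (j, h)" by (cases y)
  from J y have h: "\<sigma> = (sc (s(x := X j)) i j)(tmp := h)" "h 0 = K" "h 1 = s i 0" by simp_all
  have jl: "j < s b 0" using a h(1) ne by simp
  have sw: "sc (s(x := X j)) i j = (sc s i j)(x := X j)" using ne by (simp add: fun_eq_iff)
  have okj: "ok B (sc (s(x := X j)) i j) e"
   unfolding sw using e jl bB ne by (simp add: ok_upd_other ok_upd)
  have v: "xval e (sc (s(x := X j)) i j) = xval e (sc s i j)"
   unfolding sw using ne by (simp add: xval_upd_other)
  obtain k where k: "tex B (comp e 2) ((sc (s(x := X j)) i j)(tmp := h)) ((sc (s(x := X j)) i j)(tmp := k))"
   "k 2 = xval e (sc s i j)" "\<forall>c<2. k c = h c"
   using comp_run[OF B okj, of 2 h] unfolding v by (elim exE conjE)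
  have X': "(X j)(K + j := xval e (sc s i j)) = X (Suc j)"
   unfolding X_def by (auto simp: fun_eq_iff)
  let ?\<sigma>' = "(sc (s(x := X (Suc j))) i (Suc j))(tmp := k)"
  have "tex B ?c \<sigma> ?\<sigma>'"
   unfolding h(1)
   by (rule tex_Seq[OF B k(1) tex_Seq[OF B tex_Put[OF B refl] tex_Put[OF B]]])
    (use ne k h in \<open>simp add: fun_eq_iff flip: X'\<close>)
  moreover have "?J (Suc j, k) ?\<sigma>'"
   using jl k h by simp
  moreover have "(case (Suc j, k) of (j, h) \<Rightarrow> s b 0 - j) < (case y of (j, h) \<Rightarrow> s b 0 - j)"
   using jl y by simp
  ultimately show "\<exists>\<sigma>' x'. tex B ?c \<sigma> \<sigma>' \<and> ?J x' \<sigma>' \<and>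
    (case x' of (j, h) \<Rightarrow> s b 0 - j) < (case y of (j, h) \<Rightarrow> s b 0 - j)"
   by (intro exI conjI)
 next
  show "?J (0, ?g0) ?s0" using g by simp
 next
  show "(case (0, ?g0) of (j, h) \<Rightarrow> s b 0 - j) \<le> B" using bB by simp
 qed
 then obtain \<sigma> y where W: "tex B (While ?b ?c) ?s0 \<sigma>" "?J y \<sigma>" "aval ?b \<sigma> = 0" by (elim exE conjE)
 obtain j k where y: "y = (j, k)" by (cases y)
 from W(2) y have h: "j \<le> s b 0" "\<sigma> = (sc (s(x := X j)) i j)(tmp := k)" "k 0 = K" "k 1 = s i 0"
  by simp_all
 have j: "j = s b 0" using W(3) h(1,2) ne by simp
 have p4: "tex B (Put i (Num 0) (Get tmp (Num 1))) \<sigma> ((s(x := X j))(tmp := k))"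
  unfolding h(2) by (rule tex_Put[OF B]) (use ne h(4) in \<open>simp add: fun_eq_iff\<close>)
 have p2: "tex B (Put tmp (Num 1) (Get i (Num 0))) (s(tmp := g)) (s(tmp := ?g0))"
  by (rule tex_Put[OF B]) (use ne in simp)
 have p3: "tex B (Put i (Num 0) (Num 0)) (s(tmp := ?g0)) ?s0"
  by (rule tex_Put[OF B]) (use ne in \<open>simp add: X0, simp add: fun_eq_iff\<close>)
 have "tex B (ARR x off i b e) (s(tmp := h)) ((s(x := X j))(tmp := k))"
  unfolding ARR_def
  by (rule tex_Seq[OF B g(1) tex_Seq[OF B p2 tex_Seq[OF B p3 tex_Seq[OF B W(1) p4]]]])
 moreover have "Q (s(x := X j))" using Q unfolding X_def K_def j by simp
 ultimately show "\<exists>s' h'. tex B (ARR x off i b e) (s(tmp := h)) (s'(tmp := h')) \<and> Q s'"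
  by (intro exI conjI)
qed

text \<open>Nonzero is true, and comparisons are truncated subtractions.\<close>

abbreviation V :: "string \<Rightarrow> xexp" where "V x \<equiv> XG x (XN 0)"
definition xnot where "xnot a = XS (XN 1) a"
definition xor where "xor a b = XA a b"
definition xand where "xand a b = xnot (XA (xnot a) (xnot b))"
definition ximp where "ximp a b = XA (xnot a) b"
definition xlt where "xlt a b = XS b a"
definition xle where "xle a b = xnot (XS a b)"
definition xeq where "xeq a b = xnot (XA (XS a b) (XS b a))"
definition xbool where "xbool a = xnot (xnot a)"
definition xex where "xex i b e = XSum i b e"
definition xall where "xall i b e = xnot (XSum i b (xnot e))"
definition xcnt where "xcnt i b e = XSum i b (xbool e)"
definition xmul where "xmul b a = XSum ''_'' b a"
text \<open>The minimum is computed as the number of indices below it.\<close>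

definition xleast where
 "xleast i n e = xcnt ''^'' n (xall i n (ximp (xle (V i) (V ''^'')) (xnot e)))"

definition tr :: "xexp \<Rightarrow> state \<Rightarrow> bool" where "tr e s \<longleftrightarrow> xval e s \<noteq> 0"

lemma tr_simps [simp]:
 "tr (XG x e) s \<longleftrightarrow> s x (xval e s) \<noteq> 0"
 "tr (xnot a) s \<longleftrightarrow> \<not> tr a s"
 "tr (xor a b) s \<longleftrightarrow> tr a s \<or> tr b s"
 "tr (xand a b) s \<longleftrightarrow> tr a s \<and> tr b s"
 "tr (ximp a b) s \<longleftrightarrow> (tr a s \<longrightarrow> tr b s)"
 "tr (xlt a b) s \<longleftrightarrow> xval a s < xval b s"
 "tr (xle a b) s \<longleftrightarrow> xval a s \<le> xval b s"
 "tr (xeq a b) s \<longleftrightarrow> xval a s = xval b s"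
 "tr (xbool a) s \<longleftrightarrow> tr a s"
 "tr (xex i n a) s \<longleftrightarrow> (\<exists>j<s n 0. tr a (sc s i j))"
 "tr (xall i n a) s \<longleftrightarrow> (\<forall>j<s n 0. tr a (sc s i j))"
proof -
 have z: "(1 - k \<noteq> 0) = (k = 0)" for k :: nat by auto
 show "tr (xall i n a) s \<longleftrightarrow> (\<forall>j<s n 0. tr a (sc s i j))"
  unfolding tr_def xall_def xnot_def xval.simps z by (auto simp: sum_eq_0_iff Suc_le_eq)
qed (auto simp: tr_def xnot_def xor_def xand_def ximp_def xlt_def xle_def xeq_def xbool_def xex_def sum_eq_0_iff)

lemma xval_xbool [simp]: "xval (xbool a) s = of_bool (tr a s)"
 unfolding tr_def xbool_def xnot_def by auto

lemma xval_xcnt [simp]: "xval (xcnt i n e) s = card {j. j < s n 0 \<and> tr e (sc s i j)}"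
proof -
 have "xval (xcnt i n e) s = (\<Sum>j<s n 0. if tr e (sc s i j) then 1 else 0)"
  unfolding xcnt_def by (simp add: of_bool_def)
 also have "\<dots> = card {j \<in> {..<s n 0}. tr e (sc s i j)}" by (simp flip: sum.inter_filter)
 finally show ?thesis by simp
qed

lemma xval_xmul: "''_'' \<notin> names a \<Longrightarrow> xval (xmul n a) s = s n 0 * xval a s"
 unfolding xmul_def by (simp add: xval_upd_other)

lemma card_le_least:
 fixes P :: "nat \<Rightarrow> bool"
 assumes "m < n" "P m"
 shows "card {j. j < n \<and> (\<forall>i<n. i \<le> j \<longrightarrow> \<not> P i)} = (LEAST i. P i)"
proof -
 have L: "P (LEAST i. P i)" "(LEAST i. P i) \<le> m"
  using LeastI[of P, OF assms(2)] Least_le[of P, OF assms(2)] by simp_all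
 have "{j. j < n \<and> (\<forall>i<n. i \<le> j \<longrightarrow> \<not> P i)} = {..<LEAST i. P i}"
 proof (intro set_eqI iffI)
  fix j assume j: "j \<in> {j. j < n \<and> (\<forall>i<n. i \<le> j \<longrightarrow> \<not> P i)}"
  show "j \<in> {..<LEAST i. P i}"
  proof (rule ccontr)
   assume "\<not> ?thesis"
   then have "(LEAST i. P i) \<le> j" by simp
   with j L(1) show False by simp
  qed
 next
  fix j assume "j \<in> {..<LEAST i. P i}"
  then have "j < (LEAST i. P i)" by simp
  moreover from this have "\<not> P i" if "i \<le> j" for i
   by (rule not_less_Least[OF le_less_trans[OF that]])
  ultimately show "j \<in> {j. j < n \<and> (\<forall>i<n. i \<le> j \<longrightarrow> \<not> P i)}"
   using L(2) assms(1) by simp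
 qed
 then show ?thesis by simp
qed

lemma xval_xleast:
 assumes "i \<noteq> ''^''" "i \<noteq> n" "n \<noteq> ''^''" "''^'' \<notin> names e" "m < s n 0" "tr e (sc s i m)"
 shows "xval (xleast i n e) s = (LEAST j. tr e (sc s i j))"
proof -
 have e: "tr e ((sc s ''^'' k)(i := (s i)(0 := j))) = tr e (sc s i j)" for j k
 proof -
  have "(sc s ''^'' k)(i := (s i)(0 := j)) = (sc s i j)(''^'' := (s ''^'')(0 := k))"
   using assms(1) by (simp add: fun_eq_iff)
  then show ?thesis unfolding tr_def using assms(4) by (metis xval_upd_other)
 qed
 have "xval (xleast i n e) s = card {k. k < s n 0 \<and> (\<forall>j<s n 0. j \<le> k \<longrightarrow> \<not> tr e (sc s i j))}"
  unfolding xleast_def xval_xcnt tr_simps xval.simps using assms(1-3) by (simp add: e)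
 also have "\<dots> = (LEAST j. tr e (sc s i j))"
  using card_le_least[of m "s n 0" "\<lambda>j. tr e (sc s i j)"] assms by simp
 finally show ?thesis .
qed

lemma ok_simps [simp]:
 "ok B s (xnot a) = ok B s a"
 "ok B s (xor a b) = (ok B s a \<and> ok B s b)"
 "ok B s (xand a b) = (ok B s a \<and> ok B s b)"
 "ok B s (ximp a b) = (ok B s a \<and> ok B s b)"
 "ok B s (xlt a b) = (ok B s b \<and> ok B s a)"
 "ok B s (xle a b) = (ok B s a \<and> ok B s b)"
 "ok B s (xeq a b) = (ok B s a \<and> ok B s b)"
 "ok B s (xbool a) = ok B s a"
 "ok B s (xex i n e) = (i \<noteq> n \<and> i \<noteq> tmp \<and> n \<noteq> tmp \<and> s n 0 \<le> B \<and> ok B s e)"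
 "ok B s (xall i n e) = (i \<noteq> n \<and> i \<noteq> tmp \<and> n \<noteq> tmp \<and> s n 0 \<le> B \<and> ok B s e)"
 "ok B s (xcnt i n e) = (i \<noteq> n \<and> i \<noteq> tmp \<and> n \<noteq> tmp \<and> s n 0 \<le> B \<and> ok B s e)"
 "ok B s (xmul n a) = (''_'' \<noteq> n \<and> n \<noteq> tmp \<and> s n 0 \<le> B \<and> ok B s a)"
 "ok B s (xleast i n e) = (''^'' \<noteq> n \<and> i \<noteq> n \<and> i \<noteq> tmp \<and> n \<noteq> tmp \<and> s n 0 \<le> B \<and> ok B s e)"
 unfolding xnot_def xor_def xand_def ximp_def xlt_def xle_def xeq_def xbool_def xex_def xall_def
  xcnt_def xmul_def xleast_def by auto

lemma names_simps [simp]: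
 "names (xnot a) = names a"
 "names (xor a b) = names a \<union> names b"
 "names (xand a b) = names a \<union> names b"
 "names (ximp a b) = names a \<union> names b"
 "names (xlt a b) = names a \<union> names b"
 "names (xle a b) = names a \<union> names b"
 "names (xeq a b) = names a \<union> names b"
 "names (xbool a) = names a"
 "names (xex i n e) = {i, n} \<union> names e"
 "names (xall i n e) = {i, n} \<union> names e"
 "names (xcnt i n e) = {i, n} \<union> names e"
 "names (xmul n e) = {''_'', n} \<union> names e"
 "names (xleast i n e) = {''^'', i, n} \<union> names e"
 unfolding xnot_def xor_def xand_def ximp_def xlt_def xle_def xeq_def xbool_def xex_def xall_def
  xcnt_def xmul_def xleast_def by auto

lemma wp_IFF':
 assumes "2 \<le> B" "ok B s e" "tr e s \<Longrightarrow> wp B c1 s Q" "\<not> tr e s \<Longrightarrow> wp B c2 s Q"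
 shows "wp B (IFF e c1 c2) s Q"
proof (rule wp_IFF[OF assms(1,2)])
 show "wp B c1 s Q" if "xval e s \<noteq> 0" by (rule assms(3)) (use that in \<open>simp add: tr_def\<close>)
 show "wp B c2 s Q" if "xval e s = 0" by (rule assms(4)) (use that in \<open>simp add: tr_def\<close>)
qed

lemma wp_WHILE':
 assumes "2 \<le> B" "I s"
  and "\<And>s. I s \<Longrightarrow> ok B s e"
  and "\<And>s. I s \<Longrightarrow> tr e s \<Longrightarrow> wp B c s (\<lambda>s'. I s' \<and> (\<mu> s' :: nat) < \<mu> s)"
  and "\<And>s. I s \<Longrightarrow> \<not> tr e s \<Longrightarrow> Q s"
  and "\<mu> s \<le> B"
 shows "wp B (WHILE e c) s Q"
proof (rule wp_WHILE[where I = I and \<mu> = \<mu> and Q = Q, OF assms(1,2) assms(3) _ _ assms(6)])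
 fix s assume I: "I s"
 {
  assume "xval e s \<noteq> 0"
  then have "tr e s" unfolding tr_def .
  from assms(4)[OF I this] show "wp B c s (\<lambda>s'. I s' \<and> \<mu> s' < \<mu> s)" .
 next
  assume "xval e s = 0"
  then have "\<not> tr e s" unfolding tr_def by (rule notI[OF notE[rotated]])
  from assms(5)[OF I this] show "Q s" .
 }
qed

section \<open>Bipartite vertex covers by an auction\<close>

text \<open>The right vertex \<open>q\<close> has price \<open>pr q\<close> and is assigned to the left vertex \<open>p\<close> if \<open>ow q = Suc p\<close>; 0 means unassigned.\<close>

definition auc_inv :: "nat \<Rightarrow> (nat \<Rightarrow> nat \<Rightarrow> bool) \<Rightarrow> (nat \<Rightarrow> nat) \<Rightarrow> (nat \<Rightarrow> nat) \<Rightarrow> bool" where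
 "auc_inv N E pr ow \<longleftrightarrow>
   (\<forall>q<N. \<forall>p. ow q = Suc p \<longrightarrow> E p q) \<and>
   (\<forall>q<N. \<forall>q'<N. ow q = ow q' \<longrightarrow> ow q \<noteq> 0 \<longrightarrow> q = q') \<and>
   (\<forall>q<N. ow q = 0 \<longrightarrow> pr q = 0) \<and>
   (\<forall>q<N. \<forall>p. ow q = Suc p \<longrightarrow> (\<forall>q'<N. E p q' \<longrightarrow> pr q \<le> Suc (pr q'))) \<and>
   (\<forall>q<N. pr q \<le> Suc N)"

definition auc_free :: "nat \<Rightarrow> (nat \<Rightarrow> nat) \<Rightarrow> nat \<Rightarrow> bool" where
 "auc_free N ow p \<longleftrightarrow> (\<forall>q<N. ow q \<noteq> Suc p)"

lemma auc_invD:
 assumes "auc_inv N E pr ow"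
 shows "q < N \<Longrightarrow> ow q = Suc p \<Longrightarrow> E p q"
  and "\<lbrakk>q < N; q' < N; ow q = ow q'; ow q \<noteq> 0\<rbrakk> \<Longrightarrow> q = q'"
  and "q < N \<Longrightarrow> ow q = 0 \<Longrightarrow> pr q = 0"
  and "\<lbrakk>q < N; ow q = Suc p; q' < N; E p q'\<rbrakk> \<Longrightarrow> pr q \<le> Suc (pr q')"
  and "q < N \<Longrightarrow> pr q \<le> Suc N"
 using assms unfolding auc_inv_def by simp_all

lemma auc_init: "auc_inv N E (\<lambda>_. 0) (\<lambda>_. 0)"
 unfolding auc_inv_def by simp

text \<open>A bid: the unassigned \<open>p\<close> takes a cheapest neighbour, possibly from another
  owner, and raises its price by one. That every owner pays at most one more than its cheapest
  alternative survives, since no price falls; an evicted owner is simply unassigned.\<close>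

lemma auc_step:
 assumes inv: "auc_inv N E pr ow" and p: "auc_free N ow p" and q: "q < N" "E p q" "pr q \<le> N"
  and min: "\<forall>q'<N. E p q' \<longrightarrow> pr q \<le> pr q'"
 shows "auc_inv N E (pr(q := Suc (pr q))) (ow(q := Suc p))"
proof -
 let ?pr = "pr(q := Suc (pr q))" and ?ow = "ow(q := Suc p)"
 have le: "pr x \<le> ?pr x" for x by simp
 note i = auc_invD[OF inv]
 have 1: "?pr q1 \<le> Suc (?pr q')" if "q1 < N" "?ow q1 = Suc p1" "q' < N" "E p1 q'" for q1 p1 q'
 proof (cases "q1 = q")
  case True
  then have "p1 = p" using that by simp
  then have "pr q \<le> pr q'" using min that by blast
  then show ?thesis using True le[of q'] by simp
 next
  case False
  then have "pr q1 \<le> Suc (pr q')" using i(4) that by simp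
  then show ?thesis using False le[of q'] by simp
 qed
 have 2: "q1 = q2" if h: "q1 < N" "q2 < N" "?ow q1 = ?ow q2" "?ow q1 \<noteq> 0" for q1 q2
 using p h auc_free_def fun_upd_apply i(2) by metis
 have 3: "E p1 q1" if "q1 < N" "?ow q1 = Suc p1" for q1 p1
  using that i(1) q(2) by (cases "q1 = q") simp_all
 have 4: "?pr q1 = 0" if "q1 < N" "?ow q1 = 0" for q1
  using that i(3) by (cases "q1 = q") simp_all
 have 5: "?pr q1 \<le> Suc N" if "q1 < N" for q1
  using that i(5) q(3) by (cases "q1 = q") simp_all
 show ?thesis unfolding auc_inv_def using 1 2 3 4 5 by (intro conjI allI impI)
qed

text \<open>The potential of the auction: a bid raises a price that is at most \<open>N\<close>, so
  it drops.\<close>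

definition auc_meas :: "nat \<Rightarrow> (nat \<Rightarrow> nat) \<Rightarrow> nat" where
 "auc_meas N pr = (\<Sum>q<N. Suc N - pr q)"

lemma auc_meas_step:
 assumes "q < N" "pr q \<le> N"
 shows "auc_meas N (pr(q := Suc (pr q))) < auc_meas N pr"
 unfolding auc_meas_def
proof (rule sum_strict_mono_ex1)
 show "\<forall>x\<in>{..<N}. Suc N - (pr(q := Suc (pr q))) x \<le> Suc N - pr x" by auto
 show "\<exists>a\<in>{..<N}. Suc N - (pr(q := Suc (pr q))) a < Suc N - pr a"
  using assms by (intro bexI[of _ q]) auto
qed simp

lemma auc_meas_le: "auc_meas N pr \<le> N * Suc N"
proof -
 have "auc_meas N pr \<le> (\<Sum>q<N. Suc N)" unfolding auc_meas_def by (rule sum_mono) simp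
 then show ?thesis by simp
qed

definition bcover :: "(nat \<Rightarrow> nat \<Rightarrow> bool) \<Rightarrow> nat set \<Rightarrow> nat set \<Rightarrow> bool" where
 "bcover E C D \<longleftrightarrow> (\<forall>p q. E p q \<longrightarrow> p \<in> C \<or> q \<in> D)"

lemma gap_exists: "\<exists>l\<in>{1..Suc N}. \<forall>q<N. pr q \<noteq> l" for pr :: "nat \<Rightarrow> nat"
proof (rule ccontr)
 assume "\<not> ?thesis"
 then have "{1..Suc N} \<subseteq> pr ` {..<N}" by force
 then have "card {1..Suc N} \<le> card (pr ` {..<N})" by (intro card_mono) auto
 also have "\<dots> \<le> N" using card_image_le[of "{..<N}" pr] by simp
 finally show False by simp
qed

text \<open>At a price level that no right vertex has, the prices separate a minimum vertex cover from the rest.\<close>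

lemma auc_cover:
 assumes inv: "auc_inv N E pr ow"
  and E: "\<And>p q. E p q \<Longrightarrow> p < N \<and> q < N"
  and stop: "\<And>p q. auc_free N ow p \<Longrightarrow> E p q \<Longrightarrow> pr q > N"
  and l: "1 \<le> l" "l \<le> Suc N" "\<And>q. q < N \<Longrightarrow> pr q \<noteq> l"
  and CL: "CL = {p. \<exists>q. E p q \<and> pr q < l}" and CR: "CR = {q. q < N \<and> pr q > l}"
 shows "bcover E CL CR" and "finite CL" and "card CL + card CR \<le> card {q. q < N \<and> ow q \<noteq> 0}"
proof -
 note i = auc_invD[OF inv]
 show "bcover E CL CR" 
 proof -
  have "p \<in> CL \<or> q \<in> CR" if "E p q" for p q
  proof (cases "pr q < l")
   case False
   then have "pr q > l" using l(3)[of q] E[OF that] by linarith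
   then show ?thesis using E[OF that] CR by simp
  qed (use that CL in blast)
  then show ?thesis unfolding bcover_def by blast
 qed
 show fin: "finite CL" by (rule finite_subset[of _ "{..<N}"]) (use E CL in auto)
 \<comment> \<open>A left vertex with a neighbour priced below \<open>l \<le> Suc N\<close> is not
   free, as free vertices see only prices above \<open>N\<close>.\<close>
 have "\<exists>q<N. ow q = Suc p" if pc: "p \<in> CL" for p
 using auc_free_def pc CL stop l(2) by fastforce
 then have "\<forall>p\<in>CL. \<exists>q. q < N \<and> ow q = Suc p" by blast
 from bchoice[OF this] obtain m where "\<forall>p\<in>CL. m p < N \<and> ow (m p) = Suc p" by (elim exE)
 then have m: "m p < N \<and> ow (m p) = Suc p" if "p \<in> CL" for p using that by simp
 have "inj_on m CL"
 proof (rule inj_onI)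
  fix x y assume h: "x \<in> CL" "y \<in> CL" "m x = m y"
  have "Suc x = ow (m x)" using m[OF h(1)] by simp
  also have "\<dots> = Suc y" using m[OF h(2)] unfolding h(3) by simp
  finally show "x = y" by simp
 qed
 then have "card CL = card (m ` CL)" by (simp add: card_image)
 \<comment> \<open>The partner of \<open>p\<close> costs at most one more than the neighbour priced
   below \<open>l\<close>, hence at most \<open>l\<close>. This is where the unit slack of the
   auction is used.\<close>
 moreover have "m ` CL \<inter> CR = {}"
 proof (rule ccontr)
  assume "m ` CL \<inter> CR \<noteq> {}"
  then obtain p where p: "p \<in> CL" "m p \<in> CR" by auto
  then obtain q where q: "E p q" "pr q < l" using CL by auto
  have "pr (m p) \<le> Suc (pr q)" using i(4)[of "m p" p q] m[OF p(1)] q(1) E by blast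
  then show False using p(2) q(2) CR by simp
 qed
 moreover have "m ` CL \<union> CR \<subseteq> {q. q < N \<and> ow q \<noteq> 0}"
 proof
  fix x assume "x \<in> m ` CL \<union> CR"
  then show "x \<in> {q. q < N \<and> ow q \<noteq> 0}"
  proof
   assume "x \<in> m ` CL"
   then obtain p where "p \<in> CL" "x = m p" by blast
   with m[of p] show ?thesis by simp
  next
   assume "x \<in> CR"
   with i(3)[of x] CR show ?thesis by (cases "ow x = 0") simp_all
  qed
 qed
 then have "card (m ` CL \<union> CR) \<le> card {q. q < N \<and> ow q \<noteq> 0}" by (intro card_mono) simp_all
 moreover have "finite CR" using CR by simp
 ultimately show "card CL + card CR \<le> card {q. q < N \<and> ow q \<noteq> 0}"
  using card_Un_disjoint[of "m ` CL" CR] fin by simp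
qed

text \<open>Every assigned pair is an edge and needs its own cover vertex: the pairs are divided by
  whether their right end lies in \<open>D\<close>.\<close>

lemma auc_weak_duality:
 assumes inv: "auc_inv N E pr ow" and C: "bcover E C D" "finite C" "finite D"
 shows "card {q. q < N \<and> ow q \<noteq> 0} \<le> card C + card D"
proof -
 note i = auc_invD[OF inv]
 let ?M = "{q. q < N \<and> ow q \<noteq> 0}"
 have fin: "finite ?M" by simp
 let ?A = "{q \<in> ?M. q \<in> D}" and ?B = "{q \<in> ?M. q \<notin> D}"
 have "card ?A \<le> card D" using C(3) by (intro card_mono) auto
 moreover have "card ?B \<le> card C"
 proof (rule card_inj_on_le[of "\<lambda>q. ow q - 1"])
  show "inj_on (\<lambda>q. ow q - 1) ?B"
  proof (rule inj_onI)
   fix x y assume h: "x \<in> ?B" "y \<in> ?B" "ow x - 1 = ow y - 1"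
   then have "ow x = ow y" by simp linarith
   with h i(2)[of x y] show "x = y" by simp
  qed
  show "(\<lambda>q. ow q - 1) ` ?B \<subseteq> C"
  proof
   fix p assume "p \<in> (\<lambda>q. ow q - 1) ` ?B"
   then obtain q where q: "q < N" "ow q \<noteq> 0" "q \<notin> D" "p = ow q - 1" by auto
   then have "ow q = Suc p" by simp
   then have "E p q" using i(1) q(1) by blast
   then show "p \<in> C" using C(1) q(3) unfolding bcover_def by blast
  qed
 qed (rule C)
 moreover have "card ?M = card ?A + card ?B"
  by (subst card_Un_disjoint[symmetric]) (auto intro: arg_cong[where f = card])
 ultimately show ?thesis by simp
qed

text \<open>Here only existence is at stake, so the bidder is arbitrary; the program performs the
  same loop with the least possible bidder.\<close>

lemma auc_terminates:
 assumes "auc_inv N E pr ow" "\<And>p q. E p q \<Longrightarrow> p < N \<and> q < N"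
 shows "\<exists>pr ow. auc_inv N E pr ow \<and> (\<forall>p q. auc_free N ow p \<longrightarrow> E p q \<longrightarrow> pr q > N)"
 using assms(1)
proof (induction "auc_meas N pr" arbitrary: pr ow rule: less_induct)
 case less
 show ?case
 proof (cases "\<forall>p q. auc_free N ow p \<longrightarrow> E p q \<longrightarrow> pr q > N")
  case True
  then show ?thesis using less.prems by blast
 next
  case False
  then obtain p q0 where p: "auc_free N ow p" "E p q0" "pr q0 \<le> N" by force
  let ?q = "arg_min pr (E p)"
  have q: "E p ?q" "\<And>q'. E p q' \<Longrightarrow> pr ?q \<le> pr q'"
   using arg_min_natI[of "E p" q0 pr] arg_min_nat_le[of "E p" _ pr] p(2) by auto
  have qN: "?q < N" "pr ?q \<le> N" using q assms(2) p by (blast, meson le_trans)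
  have "auc_inv N E (pr(?q := Suc (pr ?q))) (ow(?q := Suc p))"
   using auc_step[OF less.prems p(1) qN(1) q(1) qN(2)] q(2) by blast
  then show ?thesis using less.hyps[OF auc_meas_step[of ?q N pr, OF qN]] by blast
 qed
qed

text \<open>Koenig's theorem; \<open>ow\<close> encodes the matching.\<close>

lemma koenig:
 assumes E: "\<And>p q. E p q \<Longrightarrow> p < N \<and> q < (N :: nat)"
 shows "\<exists>ow C D. (\<forall>q<N. \<forall>p. ow q = Suc p \<longrightarrow> E p q) \<and> (\<forall>q<N. \<forall>q'<N. ow q = ow q' \<longrightarrow> ow q \<noteq> 0 \<longrightarrow> q = q') \<and>
   bcover E C D \<and> finite C \<and> finite D \<and> card C + card D \<le> card {q. q < N \<and> ow q \<noteq> 0}"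
proof -
 obtain pr ow where 1: "auc_inv N E pr ow" "\<And>p q. auc_free N ow p \<Longrightarrow> E p q \<Longrightarrow> pr q > N"
  using auc_terminates[OF auc_init E] by blast
 obtain l where l: "1 \<le> l" "l \<le> Suc N" "\<And>q. q < N \<Longrightarrow> pr q \<noteq> l"
  using gap_exists[of N pr] by auto
 have "finite {q. q < N \<and> l < pr q}" by simp
 note c = auc_cover[OF 1(1) E 1(2) l refl refl]
 have a: "\<forall>q<N. \<forall>p. ow q = Suc p \<longrightarrow> E p q" "\<forall>q<N. \<forall>q'<N. ow q = ow q' \<longrightarrow> ow q \<noteq> 0 \<longrightarrow> q = q'"
  using 1(1) unfolding auc_inv_def by simp_all
 show ?thesis
  by (rule exI[of _ ow], rule exI[of _ "{p. \<exists>q. E p q \<and> pr q < l}"],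
    rule exI[of _ "{q. q < N \<and> l < pr q}"])
   (use a c in simp)
qed

section \<open>Minimum separations\<close>

text \<open>
 A class \<open>W\<close> of points containing \<open>S1\<close> and avoiding \<open>S2\<close>, with a cover of its cut, corresponds to a
 bipartite vertex cover: points outside \<open>S2\<close> occur on the left, points outside \<open>S1\<close> on the right,
 and the two copies of a point are adjacent.
\<close>

locale separation =
 fixes P :: "nat set" and cls :: "nat \<Rightarrow> nat" and badj :: "nat \<Rightarrow> nat \<Rightarrow> bool" and S1 S2 :: "nat set"
 assumes finP: "finite P" and S1: "S1 \<subseteq> P" and S2: "S2 \<subseteq> P" and disj: "S1 \<inter> S2 = {}"
  and S1_cls: "\<And>p q. \<lbrakk>p \<in> S1; q \<in> P; cls p = cls q\<rbrakk> \<Longrightarrow> q \<in> S1"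
  and S2_cls: "\<And>p q. \<lbrakk>p \<in> S2; q \<in> P; cls p = cls q\<rbrakk> \<Longrightarrow> q \<in> S2"
  and sym: "\<And>b c. badj b c \<Longrightarrow> badj c b"
begin

definition E :: "nat \<Rightarrow> nat \<Rightarrow> bool" where
 "E p q \<longleftrightarrow> p \<in> P - S2 \<and> q \<in> P - S1 \<and> (p = q \<or> badj (cls p) (cls q))"

definition pcover :: "nat set \<Rightarrow> (nat \<Rightarrow> bool) \<Rightarrow> bool" where
 "pcover Z W \<longleftrightarrow> (\<forall>p\<in>P. \<forall>q\<in>P. W (cls p) \<longrightarrow> \<not> W (cls q) \<longrightarrow> badj (cls p) (cls q) \<longrightarrow> p \<in> Z \<or> q \<in> Z)"

text \<open>The cover takes the left copies outside \<open>W\<close>, the right copies inside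
  \<open>W\<close>, and both copies of points of \<open>Z\<close>. A nonterminal thus pays once and
  a terminal, having only one copy, not at all, except that points of \<open>Z\<close> pay once
  more.\<close>

lemma cover_of_separation:
 assumes W: "\<And>p. p \<in> S1 \<Longrightarrow> W (cls p)" "\<And>p. p \<in> S2 \<Longrightarrow> \<not> W (cls p)"
  and Z: "pcover Z W" "Z \<subseteq> P"
 defines "C \<equiv> {p \<in> P - S2. \<not> W (cls p) \<or> p \<in> Z}" and "D \<equiv> {q \<in> P - S1. W (cls q) \<or> q \<in> Z}"
 shows "bcover E C D" "finite C" "finite D"
  "card C + card D + card S1 + card S2 = card P + card Z"
proof -
 show "bcover E C D"
  unfolding bcover_def
 proof (intro allI impI)
  fix p q assume "E p q"
  then show "p \<in> C \<or> q \<in> D"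
   using Z(1) unfolding E_def C_def D_def pcover_def by blast
 qed
 show fin: "finite C" "finite D" unfolding C_def D_def using finP by auto
 have finS: "finite S1" "finite S2" "finite Z" using S1 S2 Z(2) finP finite_subset by blast+
 have c: "card X = (\<Sum>p\<in>P. of_bool (p \<in> X))" if "X \<subseteq> P" for X
 proof -
  have "(\<Sum>p\<in>P. of_bool (p \<in> X)) = card (P \<inter> X)"
   using finP by simp
  then show ?thesis using that by (simp add: Int_absorb1)
 qed
 have sub: "C \<subseteq> P" "D \<subseteq> P" unfolding C_def D_def by auto
 have "card C + card D + card S1 + card S2 =
   (\<Sum>p\<in>P. of_bool (p \<in> C) + of_bool (p \<in> D) + of_bool (p \<in> S1) + of_bool (p \<in> S2))"
  unfolding c[OF sub(1)] c[OF sub(2)] c[OF S1] c[OF S2] by (simp add: sum.distrib)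
 also have "\<dots> = (\<Sum>p\<in>P. 1 + of_bool (p \<in> Z))"
 proof (rule sum.cong[OF refl])
  fix p assume p: "p \<in> P"
  have "\<not> (p \<in> S1 \<and> p \<in> S2)" "p \<in> S1 \<Longrightarrow> W (cls p)" "p \<in> S2 \<Longrightarrow> \<not> W (cls p)"
   using disj W by auto
  then show "of_bool (p \<in> C) + of_bool (p \<in> D) + of_bool (p \<in> S1) + of_bool (p \<in> S2) = 1 + (of_bool (p \<in> Z) :: nat)"
   using p unfolding C_def D_def
   by (cases "p \<in> S1"; cases "p \<in> S2"; cases "W (cls p)"; cases "p \<in> Z") simp_all
 qed
 also have "\<dots> = card P + card Z" unfolding c[OF Z(2)] sum.distrib by simp
 finally show "card C + card D + card S1 + card S2 = card P + card Z" .
qed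

text \<open>Read off a separation from a minimum cover: the uncovered left points, closed under twins.\<close>

definition Xb :: "nat set \<Rightarrow> nat \<Rightarrow> bool" where
 "Xb C b \<longleftrightarrow> (\<exists>p\<in>P - S2. p \<notin> C \<and> cls p = b)"

definition Zc :: "nat set \<Rightarrow> nat set" where
 "Zc C = {q \<in> P. \<not> Xb C (cls q) \<and> (q \<in> S1 \<or> (\<exists>b. Xb C b \<and> badj b (cls q)))}"

definition Yb :: "nat set \<Rightarrow> nat \<Rightarrow> bool" where
 "Yb C b \<longleftrightarrow> Xb C b \<or> (\<exists>p\<in>S1. cls p = b)"

text \<open>An edge leaving a class of \<open>Xb C\<close> ends in a point adjacent to
  \<open>Xb C\<close>, and an edge leaving another class of \<open>S1\<close> starts in a point of
  \<open>Zc C\<close>. All sets involved are unions of classes, so twins are treated alike.\<close>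

lemma Yb_props:
 shows "p \<in> S1 \<Longrightarrow> Yb C (cls p)" "p \<in> S2 \<Longrightarrow> \<not> Yb C (cls p)" "pcover (Zc C) (Yb C)"
  "Zc C \<subseteq> P" "\<lbrakk>p \<in> Zc C; q \<in> P; cls p = cls q\<rbrakk> \<Longrightarrow> q \<in> Zc C"
proof -
 show "p \<in> S1 \<Longrightarrow> Yb C (cls p)" unfolding Yb_def by blast
 show "\<not> Yb C (cls p)" if p: "p \<in> S2"
 proof
  assume "Yb C (cls p)"
  then obtain q where "q \<in> P" "q \<notin> S2" "cls q = cls p"
   unfolding Yb_def Xb_def using S1 disj by blast
  with S2_cls[OF p] show False by simp
 qed
 show "Zc C \<subseteq> P" unfolding Zc_def by blast
 show "\<lbrakk>p \<in> Zc C; q \<in> P; cls p = cls q\<rbrakk> \<Longrightarrow> q \<in> Zc C"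
  unfolding Zc_def using S1_cls by auto
 show "pcover (Zc C) (Yb C)"
  unfolding pcover_def
 proof (intro ballI impI)
  fix p q assume h: "p \<in> P" "q \<in> P" "Yb C (cls p)" "\<not> Yb C (cls q)" "badj (cls p) (cls q)"
  show "p \<in> Zc C \<or> q \<in> Zc C"
  proof (cases "Xb C (cls p)")
   case True
   then show ?thesis using h unfolding Zc_def Yb_def by blast
  next
   case False
   then obtain r where "r \<in> S1" "cls r = cls p" using h(3) unfolding Yb_def by blast
   then have "p \<in> S1" using S1_cls h(1) by blast
   then show ?thesis using False h(1) unfolding Zc_def by blast
  qed
 qed
qed

text \<open>The count of \<open>cover_of_separation\<close> in reverse: all existing copies of a
  point of \<open>Zc C\<close> are covered, the left one because the class is not in
  \<open>Xb C\<close>, the right one because it is adjacent to an uncovered left point.\<close>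

lemma Zc_card:
 assumes C: "bcover E C D" "finite C" "finite D"
 shows "card P + card (Zc C) \<le> card C + card D + card S1 + card S2"
proof -
 have finS: "finite S1" "finite S2" using S1 S2 finP finite_subset by blast+
 have c: "(\<Sum>p\<in>P. of_bool (p \<in> X)) \<le> card X" if "finite X" for X
 proof -
  have "(\<Sum>p\<in>P. of_bool (p \<in> X)) = card (P \<inter> X)"
   using finP by simp
  also have "\<dots> \<le> card X" using that by (intro card_mono) auto
  finally show ?thesis .
 qed
 have c': "card (Zc C) = (\<Sum>p\<in>P. of_bool (p \<in> Zc C))"
 proof -
  have "(\<Sum>p\<in>P. of_bool (p \<in> Zc C)) = card (P \<inter> Zc C)"
   using finP by simp
  also have "P \<inter> Zc C = Zc C" using Yb_props(4) by blast
  finally show ?thesis by simp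
 qed
 have "card P + card (Zc C) = (\<Sum>p\<in>P. 1 + of_bool (p \<in> Zc C))"
  unfolding c' sum.distrib by simp
 also have "\<dots> \<le> (\<Sum>p\<in>P. of_bool (p \<in> C) + of_bool (p \<in> D) + of_bool (p \<in> S1) + of_bool (p \<in> S2))"
 proof (rule sum_mono)
  fix p assume p: "p \<in> P"
  have d: "\<not> (p \<in> S1 \<and> p \<in> S2)" using disj by blast
  have a: "p \<in> C \<or> p \<in> D" if "p \<notin> S1" "p \<notin> S2"
   using C(1) p that unfolding bcover_def E_def by blast
  have z: "p \<notin> S2 \<Longrightarrow> p \<in> C" "p \<notin> S1 \<Longrightarrow> p \<in> D" if "p \<in> Zc C"
  proof -
   have nX: "\<not> Xb C (cls p)" and or: "p \<in> S1 \<or> (\<exists>b. Xb C b \<and> badj b (cls p))"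
    using that unfolding Zc_def by auto
   show "p \<in> C" if "p \<notin> S2" using nX p that unfolding Xb_def by blast
   show "p \<in> D" if pS1: "p \<notin> S1"
   using or pS1 Xb_def E_def p C bcover_def by auto
  qed
  show "1 + of_bool (p \<in> Zc C) \<le>
    of_bool (p \<in> C) + of_bool (p \<in> D) + of_bool (p \<in> S1) + (of_bool (p \<in> S2) :: nat)"
   using d a z by (cases "p \<in> S1"; cases "p \<in> S2"; cases "p \<in> Zc C") auto
 qed
 also have "\<dots> \<le> card C + card D + card S1 + card S2"
  using c[OF C(2)] c[OF C(3)] c[OF finS(1)] c[OF finS(2)] by (simp add: sum.distrib)
 finally show ?thesis .
qed

lemma Zc_minimal:
 assumes C: "bcover E C D" "finite C" "finite D"
  and min: "\<And>C' D'. \<lbrakk>bcover E C' D'; finite C'; finite D'\<rbrakk> \<Longrightarrow> card C + card D \<le> card C' + card D'"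
  and W: "\<And>p. p \<in> S1 \<Longrightarrow> W (cls p)" "\<And>p. p \<in> S2 \<Longrightarrow> \<not> W (cls p)"
  and Z: "pcover Z W" "Z \<subseteq> P"
 shows "card (Zc C) \<le> card Z"
proof -
 note c = cover_of_separation[OF W Z]
 from min[OF c(1-3)] c(4) Zc_card[OF C] show ?thesis by linarith
qed

end

section \<open>Rounding a tree to blocks\<close>

text \<open>Rooted binary form of a branch decomposition. A cut is represented by the leaf set of
  the subtree below it, and \<open>subs\<close> collects these.\<close>

datatype 'a bt = Lf 'a | Nd "'a bt" "'a bt"

primrec lv :: "'a bt \<Rightarrow> 'a set" where
 "lv (Lf a) = {a}"
| "lv (Nd l r) = lv l \<union> lv r"

primrec subs :: "'a bt \<Rightarrow> 'a set set" where
 "subs (Lf a) = {{a}}"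
| "subs (Nd l r) = insert (lv l \<union> lv r) (subs l \<union> subs r)"

primrec dis :: "'a bt \<Rightarrow> bool" where
 "dis (Lf a) = True"
| "dis (Nd l r) = (dis l \<and> dis r \<and> lv l \<inter> lv r = {})"

lemma lv_in_subs: "lv t \<in> subs t"
 by (cases t) auto

lemma lv_nonempty: "lv t \<noteq> {}"
 by (induction t) auto

lemma subs_props: "W \<in> subs t \<Longrightarrow> W \<noteq> {} \<and> W \<subseteq> lv t"
 using lv_nonempty by (induction t) auto

text \<open>Descend from the root as long as some child satisfies \<open>P\<close>.\<close>

lemma subs_minimal:
 assumes "dis t" "P (lv t)"
 obtains (leaf) a where "{a} \<in> subs t" "P {a}"
 | (node) W1 W2 where "W1 \<in> subs t" "W2 \<in> subs t" "W1 \<union> W2 \<in> subs t" "W1 \<inter> W2 = {}"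
   "P (W1 \<union> W2)" "\<not> P W1" "\<not> P W2"
 using assms
proof (induction t arbitrary: thesis)
 case (Lf a)
 show ?case by (rule Lf.prems(1)[of a]) (use Lf.prems in simp_all)
next
 case (Nd l r)
 have d: "dis l" "dis r" using Nd.prems by simp_all
 show ?case
 proof (cases "P (lv l)")
  case True
  show ?thesis
  proof (rule Nd.IH(1)[OF _ _ d(1) True])
   show thesis if "{a} \<in> subs l" "P {a}" for a
    by (rule Nd.prems(1)[of a]) (use that in simp_all)
   show thesis if "W1 \<in> subs l" "W2 \<in> subs l" "W1 \<union> W2 \<in> subs l" "W1 \<inter> W2 = {}"
    "P (W1 \<union> W2)" "\<not> P W1" "\<not> P W2" for W1 W2
    by (rule Nd.prems(2)[of W1 W2]) (use that in simp_all)
  qed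
 next
  case l: False
  show ?thesis
  proof (cases "P (lv r)")
   case True
   show ?thesis
   proof (rule Nd.IH(2)[OF _ _ d(2) True])
   show thesis if "{a} \<in> subs r" "P {a}" for a
    by (rule Nd.prems(1)[of a]) (use that in simp_all)
   show thesis if "W1 \<in> subs r" "W2 \<in> subs r" "W1 \<union> W2 \<in> subs r" "W1 \<inter> W2 = {}"
    "P (W1 \<union> W2)" "\<not> P W1" "\<not> P W2" for W1 W2
    by (rule Nd.prems(2)[of W1 W2]) (use that in simp_all)
  qed
  next
   case False
   show ?thesis
    by (rule Nd.prems(2)[of "lv l" "lv r"]) (use Nd.prems l False lv_in_subs[of l] lv_in_subs[of r] in simp_all)
  qed
 qed
qed

text \<open>Walk from the root of \<open>t\<close> towards \<open>r\<close>; \<open>c\<close>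
  accumulates everything passed on the way. A subtree of the result is an old one or, where an edge
  has been reversed, the complement of an old one.\<close>

lemma reroot_aux:
 assumes "dis t" "r \<in> lv t" "dis c" "lv t \<inter> lv c = {}"
 shows "\<exists>t'. dis t' \<and> lv t' = (lv t \<union> lv c) - {r} \<and>
   (\<forall>W\<in>subs t'. W \<in> subs c \<or> W \<in> subs t \<or> (lv t \<union> lv c) - W \<in> subs t)"
 using assms
proof (induction t arbitrary: c)
 case (Lf a)
 then show ?case by (intro exI[of _ c]) auto
next
 case (Nd a b)
 have step: "\<exists>t'. dis t' \<and> lv t' = (lv x \<union> lv y \<union> lv c) - {r} \<and>
   (\<forall>W\<in>subs t'. W \<in> subs c \<or> W \<in> subs (Nd x y) \<or> (lv x \<union> lv y \<union> lv c) - W \<in> subs (Nd x y))"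
  if x: "r \<in> lv x" and d: "dis (Nd x y)" "lv (Nd x y) \<inter> lv c = {}"
   and IH: "\<And>c. \<lbrakk>dis x; r \<in> lv x; dis c; lv x \<inter> lv c = {}\<rbrakk> \<Longrightarrow>
    \<exists>t'. dis t' \<and> lv t' = (lv x \<union> lv c) - {r} \<and>
     (\<forall>W\<in>subs t'. W \<in> subs c \<or> W \<in> subs x \<or> (lv x \<union> lv c) - W \<in> subs x)" for x y
 proof -
  have "dis (Nd y c)" "lv x \<inter> lv (Nd y c) = {}" "dis x" using d Nd.prems(3) by auto
  from IH[OF this(3) x this(1,2)] obtain t' where t': "dis t'" "lv t' = (lv x \<union> lv (Nd y c)) - {r}"
   "\<forall>W\<in>subs t'. W \<in> subs (Nd y c) \<or> W \<in> subs x \<or> (lv x \<union> lv (Nd y c)) - W \<in> subs x"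
   by (elim exE conjE)
  have "(lv x \<union> lv y \<union> lv c) - (lv y \<union> lv c) = lv x" using d by auto
  then have top: "(lv x \<union> lv y \<union> lv c) - lv (Nd y c) \<in> subs (Nd x y)" using lv_in_subs[of x] by simp
  have "W \<in> subs c \<or> W \<in> subs (Nd x y) \<or> (lv x \<union> lv y \<union> lv c) - W \<in> subs (Nd x y)"
   if Wt: "W \<in> subs t'" for W
  proof -
   consider "W = lv (Nd y c)" | "W \<in> subs y" | "W \<in> subs c" | "W \<in> subs x"
    | "(lv x \<union> lv y \<union> lv c) - W \<in> subs x"
    using bspec[OF t'(3) Wt] by (simp add: Un_assoc) blast
   then show ?thesis using top by cases simp_all
  qed
  moreover have "lv t' = (lv x \<union> lv y \<union> lv c) - {r}" using t'(2) by (simp add: Un_assoc)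
  ultimately show ?thesis using t'(1) by blast
 qed
 show ?case
 proof (cases "r \<in> lv a")
  case True
  show ?thesis unfolding lv.simps by (rule step[OF True Nd.prems(1,4)]) (rule Nd.IH(1))
 next
  case False
  then have b: "r \<in> lv b" using Nd.prems by simp
  have "dis (Nd b a)" "lv (Nd b a) \<inter> lv c = {}" using Nd.prems by auto
  then have st: "\<exists>t'. dis t' \<and> lv t' = (lv b \<union> lv a \<union> lv c) - {r} \<and>
   (\<forall>W\<in>subs t'. W \<in> subs c \<or> W \<in> subs (Nd b a) \<or> (lv b \<union> lv a \<union> lv c) - W \<in> subs (Nd b a))"
   by (rule step[OF b]) (rule Nd.IH(2))
  have "subs (Nd b a) = subs (Nd a b)" "lv b \<union> lv a = lv a \<union> lv b" by auto
  then show ?thesis using st unfolding lv.simps by metis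
 qed
qed

lemma reroot:
 assumes "dis t" "r \<in> lv t" "lv t \<noteq> {r}"
 shows "\<exists>t'. dis t' \<and> lv t' = lv t - {r} \<and> (\<forall>W\<in>subs t'. W \<in> subs t \<or> lv t - W \<in> subs t)"
proof (cases t)
 case (Lf a)
 then show ?thesis using assms by simp
next
 case (Nd a b)
 show ?thesis
 proof (cases "r \<in> lv a")
  case True
  have "dis a" "dis b" "lv a \<inter> lv b = {}" using assms Nd by auto
  from reroot_aux[OF this(1) True this(2,3)] obtain t' where t': "dis t'" "lv t' = (lv a \<union> lv b) - {r}"
   "\<forall>W\<in>subs t'. W \<in> subs b \<or> W \<in> subs a \<or> (lv a \<union> lv b) - W \<in> subs a" by (elim exE conjE)
  show ?thesis unfolding Nd by (intro exI[of _ t'] conjI ballI) (use t' in auto)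
 next
  case False
  then have r: "r \<in> lv b" using assms Nd by simp
  have "dis b" "dis a" "lv b \<inter> lv a = {}" using assms Nd by auto
  from reroot_aux[OF this(1) r this(2,3)] obtain t' where t': "dis t'" "lv t' = (lv b \<union> lv a) - {r}"
   "\<forall>W\<in>subs t'. W \<in> subs a \<or> W \<in> subs b \<or> (lv b \<union> lv a) - W \<in> subs b" by (elim exE conjE)
  have c: "lv b \<union> lv a = lv a \<union> lv b" by blast
  show ?thesis unfolding Nd by (intro exI[of _ t'] conjI ballI) (use t'[unfolded c] in auto)
 qed
qed

text \<open>The elements of \<open>D\<close> are attached above the tree for \<open>C\<close> one at
  a time, so each new subtree is a singleton or has a leaf set between \<open>C\<close> and
  \<open>C \<union> D\<close>.\<close>

lemma extend_tree:
 assumes "finite D" "D \<inter> C = {}" "C = {} \<or> (\<exists>t. dis t \<and> lv t = C \<and> (\<forall>W\<in>subs t. G W))"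
  and "\<And>W. C \<subseteq> W \<Longrightarrow> W \<subseteq> C \<union> D \<Longrightarrow> G W" "\<And>b. G {b}"
 shows "C \<union> D = {} \<or> (\<exists>t. dis t \<and> lv t = C \<union> D \<and> (\<forall>W\<in>subs t. G W))"
 using assms
proof (induction D rule: finite_induct)
 case empty
 then show ?case by simp
next
 case (insert b D)
 have "C \<union> D = {} \<or> (\<exists>t. dis t \<and> lv t = C \<union> D \<and> (\<forall>W\<in>subs t. G W))"
  by (rule insert.IH) (use insert.prems in \<open>auto simp: subset_insertI2\<close>)
 then show ?case
 proof
  assume "C \<union> D = {}"
  then show ?thesis using insert.prems(4) by (intro disjI2 exI[of _ "Lf b"]) auto
 next
  assume "\<exists>t. dis t \<and> lv t = C \<union> D \<and> (\<forall>W\<in>subs t. G W)"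
  then obtain t where t: "dis t" "lv t = C \<union> D" "\<forall>W\<in>subs t. G W" by (elim exE conjE)
  have "G (insert b (C \<union> D))" using insert.prems(3)[of "insert b (C \<union> D)"] by auto
  moreover have "b \<notin> C \<union> D" using insert by auto
  ultimately show ?thesis using t insert.prems(4)
   by (intro disjI2 exI[of _ "Nd (Lf b) t"]) auto
 qed
qed

text \<open>
 Every block \<open>b\<close> is spread over the leaves \<open>F b\<close> of a tree. A cut \<open>Y\<close> of the tree determines the
 blocks that are mostly inside \<open>Y\<close> and those that are substantially inside.
\<close>

locale rounding =
 fixes BL :: "'b set" and F :: "'b \<Rightarrow> 'v set"
 assumes finBL: "finite BL" and finF: "b \<in> BL \<Longrightarrow> finite (F b)" and F_ne: "b \<in> BL \<Longrightarrow> F b \<noteq> {}"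
  and F_disj: "\<lbrakk>b \<in> BL; c \<in> BL; b \<noteq> c\<rbrakk> \<Longrightarrow> F b \<inter> F c = {}"
begin

definition lo :: "'v set \<Rightarrow> 'b set" where
 "lo Y = {b \<in> BL. 3 * card (F b \<inter> Y) > 2 * card (F b)}"

definition hi :: "'v set \<Rightarrow> 'b set" where
 "hi Y = {b \<in> BL. card (F b) \<le> 3 * card (F b \<inter> Y)}"

lemma lo_hi: "lo Y \<subseteq> hi Y"
 unfolding lo_def hi_def by auto

definition rnd :: "'v set set \<Rightarrow> 'b set \<Rightarrow> bool" where
 "rnd \<Y> W \<longleftrightarrow> (\<exists>b. W = {b}) \<or> (\<exists>Y\<in>\<Y>. lo Y \<subseteq> W \<and> W \<subseteq> hi Y)"

lemma card_split:
 assumes "b \<in> BL" "Y1 \<inter> Y2 = {}"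
 shows "card (F b \<inter> (Y1 \<union> Y2)) = card (F b \<inter> Y1) + card (F b \<inter> Y2)"
 using finF[OF assms(1)] assms(2) by (subst card_Un_disjoint[symmetric]) (auto simp: Int_Un_distrib)

text \<open>A block with more than two thirds of \<open>F b\<close> in \<open>Y\<close> has at least
  one third in one of the two children, and is sent to the child holding more. If a child holds more
  than two thirds, the block goes there. So the blocks sent to \<open>y1\<close> lie between
  \<open>lo (lv y1)\<close> and \<open>hi (lv y1)\<close>, likewise for \<open>y2\<close>, and
  \<open>extend_tree\<close> adds those missing from the recursively built tree.\<close>

lemma rounded_tree:
 "dis y \<Longrightarrow> lo (lv y) = {} \<or> (\<exists>t. dis t \<and> lv t = lo (lv y) \<and> (\<forall>W\<in>subs t. rnd (subs y) W))"
proof (induction y)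
 case (Lf v)
 have "\<exists>b. lo {v} \<subseteq> {b}"
 proof (cases "lo {v} = {}")
  case False
  then obtain b where b: "b \<in> lo {v}" by blast
  have mem: "v \<in> F c" if "c \<in> lo {v}" for c
  proof (rule ccontr)
   assume "v \<notin> F c"
   then have "F c \<inter> {v} = {}" by blast
   then show False using that unfolding lo_def by simp
  qed
  have "c = b" if "c \<in> lo {v}" for c
   using mem[OF that] mem[OF b] F_disj[of b c] b that unfolding lo_def by blast
  then show ?thesis by blast
 qed simp
 then obtain b where "lo {v} \<subseteq> {b}" by blast
 then have "lo {v} = {} \<or> lo {v} = {b}" by blast
 then show ?case
 proof
  assume "lo {v} = {b}"
  then show ?thesis by (intro disjI2 exI[of _ "Lf b"]) (simp add: rnd_def)
 qed simp
next
 case (Nd y1 y2)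
 have disj: "lv y1 \<inter> lv y2 = {}" using Nd.prems by simp
 let ?Y = "lv (Nd y1 y2)"
 have sp: "card (F b \<inter> ?Y) = card (F b \<inter> lv y1) + card (F b \<inter> lv y2)" if "b \<in> BL" for b
  using card_split[OF that disj] by simp
 have side: "U = {} \<or> (\<exists>t. dis t \<and> lv t = U \<and> (\<forall>W\<in>subs t. rnd (subs (Nd y1 y2)) W))"
  if IH: "lo (lv y) = {} \<or> (\<exists>t. dis t \<and> lv t = lo (lv y) \<and> (\<forall>W\<in>subs t. rnd (subs y) W))"
   and sub: "subs y \<subseteq> subs (Nd y1 y2)" and U: "lo (lv y) \<subseteq> U" "U \<subseteq> hi (lv y)" for U y
 proof -
  let ?G = "rnd (subs (Nd y1 y2))"
  have mono: "?G W" if "rnd (subs y) W" for W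
   using that sub unfolding rnd_def by blast
  have "finite (U - lo (lv y))" using U(2) finBL unfolding hi_def by (auto intro: finite_subset)
  moreover have "lo (lv y) = {} \<or> (\<exists>t. dis t \<and> lv t = lo (lv y) \<and> (\<forall>W\<in>subs t. ?G W))"
   using IH mono by blast
  moreover have "?G W" if "lo (lv y) \<subseteq> W" "W \<subseteq> lo (lv y) \<union> (U - lo (lv y))" for W
   using that U sub lv_in_subs[of y] unfolding rnd_def by blast
  moreover have "?G {b}" for b unfolding rnd_def by blast
  ultimately have "lo (lv y) \<union> (U - lo (lv y)) = {} \<or>
    (\<exists>t. dis t \<and> lv t = lo (lv y) \<union> (U - lo (lv y)) \<and> (\<forall>W\<in>subs t. ?G W))"
   by (intro extend_tree) auto
  moreover have "lo (lv y) \<union> (U - lo (lv y)) = U" using U by blast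
  ultimately show ?thesis by metis
 qed
 define U1 where "U1 = {b \<in> lo ?Y. card (F b \<inter> lv y1) \<ge> card (F b \<inter> lv y2)}"
 define U2 where "U2 = lo ?Y - U1"
 have U1: "lo (lv y1) \<subseteq> U1" "U1 \<subseteq> hi (lv y1)"
 proof -
  show "lo (lv y1) \<subseteq> U1"
  proof
   fix b assume b: "b \<in> lo (lv y1)"
   then have bB: "b \<in> BL" unfolding lo_def by simp
   have "card (F b \<inter> lv y1) + card (F b \<inter> lv y2) \<le> card (F b)"
    unfolding sp[OF bB, symmetric] by (rule card_mono[OF finF[OF bB]]) blast
   then show "b \<in> U1" using b sp[OF bB] unfolding U1_def lo_def by simp
  qed
  show "U1 \<subseteq> hi (lv y1)"
  proof
   fix b assume b: "b \<in> U1"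
   then have "b \<in> BL" unfolding U1_def lo_def by simp
   from sp[OF this] b show "b \<in> hi (lv y1)" unfolding U1_def lo_def hi_def by simp
  qed
 qed
 have U2: "lo (lv y2) \<subseteq> U2" "U2 \<subseteq> hi (lv y2)"
 proof -
  show "lo (lv y2) \<subseteq> U2"
  proof
   fix b assume b: "b \<in> lo (lv y2)"
   then have bB: "b \<in> BL" unfolding lo_def by simp
   have "card (F b \<inter> lv y1) + card (F b \<inter> lv y2) \<le> card (F b)"
    unfolding sp[OF bB, symmetric] by (rule card_mono[OF finF[OF bB]]) blast
   then show "b \<in> U2" using b sp[OF bB] unfolding U2_def U1_def lo_def by simp
  qed
  show "U2 \<subseteq> hi (lv y2)"
  proof
   fix b assume b: "b \<in> U2"
   then have "b \<in> BL" unfolding U2_def lo_def by simp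
   from sp[OF this] b show "b \<in> hi (lv y2)" unfolding U2_def U1_def lo_def hi_def by auto
  qed
 qed
 have un: "U1 \<union> U2 = lo ?Y" "U1 \<inter> U2 = {}" unfolding U1_def U2_def by auto
 have "dis y1" "dis y2" using Nd.prems by simp_all
 then have 1: "U1 = {} \<or> (\<exists>t. dis t \<and> lv t = U1 \<and> (\<forall>W\<in>subs t. rnd (subs (Nd y1 y2)) W))"
  and 2: "U2 = {} \<or> (\<exists>t. dis t \<and> lv t = U2 \<and> (\<forall>W\<in>subs t. rnd (subs (Nd y1 y2)) W))"
  using Nd.IH side[of y1 U1] side[of y2 U2] U1 U2 by auto
 show ?case
 proof (cases "U1 = {} \<or> U2 = {}")
  case True
  then show ?thesis using 1 2 un by auto
 next
  case False
  with 1 2 obtain t1 t2 where t: "dis t1" "lv t1 = U1" "\<forall>W\<in>subs t1. rnd (subs (Nd y1 y2)) W"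
   "dis t2" "lv t2 = U2" "\<forall>W\<in>subs t2. rnd (subs (Nd y1 y2)) W" by (elim disjE exE conjE) simp_all
  have "rnd (subs (Nd y1 y2)) (lo ?Y)"
   unfolding rnd_def using lo_hi lv_in_subs[of "Nd y1 y2"] by blast
  then show ?thesis using t un by (intro disjI2 exI[of _ "Nd t1 t2"]) auto
 qed
qed

lemma rounded_tree_all:
 assumes "dis T" "\<And>b. b \<in> BL \<Longrightarrow> F b \<subseteq> lv T" "BL \<noteq> {}"
 shows "\<exists>t. dis t \<and> lv t = BL \<and> (\<forall>W\<in>subs t. rnd (subs T) W)"
proof -
 have "lo (lv T) = BL"
 proof -
  have "b \<in> lo (lv T)" if b: "b \<in> BL" for b
  proof -
   have "F b \<inter> lv T = F b" using assms(2)[OF b] by blast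
   moreover have "card (F b) > 0" using finF[OF b] F_ne[OF b] by (simp add: card_gt_0_iff)
   ultimately show ?thesis using b unfolding lo_def by simp
  qed
  then show ?thesis unfolding lo_def by blast
 qed
 then show ?thesis using rounded_tree[OF assms(1)] assms(3) by simp
qed

end

section \<open>Balanced cuts in a weighted block graph\<close>

locale wgraph =
 fixes BL :: "'b set" and w :: "'b \<Rightarrow> nat" and badj :: "'b \<Rightarrow> 'b \<Rightarrow> bool" and K :: nat
 assumes finBL: "finite BL" and symb: "badj b c \<Longrightarrow> badj c b"
  and w: "b \<in> BL \<Longrightarrow> w b < K \<or> w b \<ge> 4 * K"
begin

definition cov :: "'b set \<Rightarrow> 'b set \<Rightarrow> bool" where
 "cov Z W \<longleftrightarrow> Z \<subseteq> BL \<and> (\<forall>b\<in>BL. \<forall>c\<in>BL. b \<in> W \<longrightarrow> c \<notin> W \<longrightarrow> badj b c \<longrightarrow> b \<in> Z \<or> c \<in> Z)"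

abbreviation wt :: "'b set \<Rightarrow> nat" where "wt Z \<equiv> sum w Z"

lemma cov_compl: "cov Z (BL - W) \<Longrightarrow> cov Z W"
 unfolding cov_def using symb by blast

lemma fin_sub: "Z \<subseteq> BL \<Longrightarrow> finite Z"
 using finBL by (rule finite_subset[rotated])

lemma wt_split: "S \<subseteq> BL \<Longrightarrow> wt S = wt (S \<inter> W) + wt (S - W)"
 by (rule sum.Int_Diff[OF fin_sub])

lemma wt_Un: "S \<subseteq> BL \<Longrightarrow> S' \<subseteq> BL \<Longrightarrow> wt (S \<union> S') \<le> wt S + wt S'"
 using sum_Un_nat[OF fin_sub fin_sub, of S S' w] by simp

text \<open>The cuts that rounding and primality leave: the root cut, single blocks, and cuts with a
  light cover.\<close>

definition fine :: "'b set \<Rightarrow> 'b set \<Rightarrow> bool" where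
 "fine U W \<longleftrightarrow> W = U \<or> (\<exists>b. W = {b}) \<or> (\<exists>Z. cov Z W \<and> wt Z < K)"

text \<open>Balancing along a tree. If \<open>S\<close> weighs at most \<open>3 * K\<close>, every
  cut is balanced, and the children of the lowest subtree containing \<open>A\<close> divide
  \<open>A\<close>. Otherwise the lowest subtree holding at least \<open>K\<close> of the weight of
  \<open>S\<close> holds less than \<open>2 * K\<close>; it divides \<open>A\<close>, because
  otherwise one side of \<open>S\<close> could be exchanged for the lighter \<open>Z\<close>,
  against minimality.\<close>

lemma balanced_cut:
 assumes t: "dis t" "lv t = U" "\<And>W. W \<in> subs t \<Longrightarrow> fine U W" and U: "U = BL - {r}"
  and A: "A \<subseteq> U" "card A \<ge> 3"
  and S: "cov S A" "wt S < 4 * K" "\<And>S'. cov S' A \<Longrightarrow> wt S \<le> wt S'"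
 shows "\<exists>W Z. W \<subseteq> BL \<and> cov Z W \<and> wt Z < K \<and> A \<inter> W \<noteq> {} \<and> A - W \<noteq> {} \<and>
   wt (S \<inter> W) \<le> 3 * K \<and> wt (S - W) \<le> 3 * K"
proof -
 have SB: "S \<subseteq> BL" using S(1) unfolding cov_def by blast
 have finS: "finite S" using SB finBL finite_subset by blast
 \<comment> \<open>The gap in the weights: a block of weight at least \<open>4 * K\<close> does not
   fit into \<open>S\<close>.\<close>
 have light: "w b < K" if "b \<in> S" for b
 proof -
  have "w b \<le> wt S" using finS that by (simp add: member_le_sum)
  then show ?thesis using w[of b] that SB S(2) by fastforce
 qed
 have WB: "W \<subseteq> BL" if "W \<in> subs t" for W using subs_props[OF that] t(2) U by blast
 show ?thesis
 proof (cases "wt S \<le> 3 * K")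
  case True
  have le: "wt (S \<inter> W) \<le> 3 * K" "wt (S - W) \<le> 3 * K" for W
   using wt_split[OF SB, of W] True by linarith+
  have nl: "\<not> A \<subseteq> {a}" for a
   using A(2) card_mono[of "{a}" A] by auto
  have "A \<subseteq> lv t" using A(1) t(2) by simp
  then obtain W1 W2 where W: "W1 \<in> subs t" "W2 \<in> subs t" "W1 \<union> W2 \<in> subs t" "W1 \<inter> W2 = {}"
    "A \<subseteq> W1 \<union> W2" "\<not> A \<subseteq> W1" "\<not> A \<subseteq> W2"
   by (rule subs_minimal[OF t(1), of "\<lambda>W. A \<subseteq> W"]) (use nl in blast)
  have neU: "W1 \<noteq> U" "W2 \<noteq> U"
   using W(1-4) subs_props[of _ t] t(2) by blast+
  have ne: "A \<inter> W1 \<noteq> {}" "A - W1 \<noteq> {}" "A \<inter> W2 \<noteq> {}" "A - W2 \<noteq> {}" using W by blast+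
  consider Z where "cov Z W1" "wt Z < K" | Z where "cov Z W2" "wt Z < K" | b c where "W1 = {b}" "W2 = {c}"
   using t(3)[OF W(1)] t(3)[OF W(2)] neU unfolding fine_def by blast
  then show ?thesis
  proof cases
   case 1
   then show ?thesis using WB[OF W(1)] le ne by blast
  next
   case 2
   then show ?thesis using WB[OF W(2)] le ne by blast
  next
   case 3
   then have "A \<subseteq> {b, c}" using W(5) by blast
   then have "card A \<le> card {b, c}" by (intro card_mono) auto
   also have "\<dots> \<le> 2" by (simp add: card_insert_if)
   finally show ?thesis using A(2) by simp
  qed
 next
  case False
  \<comment> \<open>Outside \<open>U\<close> there is only the root block \<open>r\<close>, which is
    light if it belongs to \<open>S\<close>.\<close>
  have SU: "wt (S \<inter> U) > 2 * K"
  proof -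
   have "S - U \<subseteq> {r}" "S - U \<subseteq> S" using SB U by blast+
   then have "wt (S - U) < K \<or> S - U = {}" using light by (cases "S - U = {}") (auto simp: subset_singleton_iff)
   then have "wt (S - U) \<le> K" by (metis less_imp_le_nat sum.empty zero_le)
   then show ?thesis using False wt_split[OF SB, of U] by linarith
  qed
  have K: "K > 0" using S(2) by simp
  have nl: "\<not> K \<le> wt (S \<inter> {a})" for a
   using light[of a] K by (cases "a \<in> S") auto
  have "K \<le> wt (S \<inter> lv t)" using t(2) SU by simp
  then obtain W1 W2 where W: "W1 \<in> subs t" "W2 \<in> subs t" "W1 \<union> W2 \<in> subs t" "W1 \<inter> W2 = {}"
    "K \<le> wt (S \<inter> (W1 \<union> W2))" "\<not> K \<le> wt (S \<inter> W1)" "\<not> K \<le> wt (S \<inter> W2)"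
   by (rule subs_minimal[OF t(1), of "\<lambda>W. K \<le> wt (S \<inter> W)"]) (use nl in blast)
  then have W67: "wt (S \<inter> W1) < K" "wt (S \<inter> W2) < K" by simp_all
  let ?W = "W1 \<union> W2"
  have lt2: "wt (S \<inter> ?W) < 2 * K"
  proof -
   have "wt (S \<inter> W1 \<union> S \<inter> W2) \<le> wt (S \<inter> W1) + wt (S \<inter> W2)" by (rule wt_Un) (use SB in blast)+
   then show ?thesis using W67 by (simp add: Int_Un_distrib)
  qed
  have neU: "?W \<noteq> U" using lt2 SU by auto
  have ns: "?W \<noteq> {b}" for b
  proof
   assume e: "?W = {b}"
   have "W1 \<noteq> {}" "W2 \<noteq> {}" using W(1,2) subs_props by blast+
   with e W(4) show False by (auto simp: Un_singleton_iff)
  qed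
  obtain Z where Z: "cov Z ?W" "wt Z < K" using t(3)[OF W(3)] neU ns unfolding fine_def by blast
  have ZB: "Z \<subseteq> BL" using Z(1) unfolding cov_def by blast
  have out: "wt (S - ?W) > K" using wt_split[OF SB, of ?W] lt2 False by linarith
  have "A \<inter> ?W \<noteq> {}"
  proof
   assume e: "A \<inter> ?W = {}"
   \<comment> \<open>An edge leaving \<open>A\<close> that only \<open>S \<inter> ?W\<close> covers
     ends in \<open>?W\<close>, while \<open>A\<close> avoids \<open>?W\<close>; so it crosses
     \<open>?W\<close> and \<open>Z\<close> covers it.\<close>
   have "cov ((S - ?W) \<union> Z) A"
    using S(1) Z(1) e symb unfolding cov_def by blast
   from S(3)[OF this] have "wt S \<le> wt (S - ?W) + wt Z" by (rule order_trans[OF _ wt_Un]) (use SB ZB in auto)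
   then show False using wt_split[OF SB, of ?W] Z(2) W(5) by linarith
  qed
  moreover have "A - ?W \<noteq> {}"
  proof
   assume e: "A - ?W = {}"
   have "cov ((S \<inter> ?W) \<union> Z) A"
    using S(1) Z(1) e unfolding cov_def by blast
   from S(3)[OF this] have "wt S \<le> wt (S \<inter> ?W) + wt Z" by (rule order_trans[OF _ wt_Un]) (use SB ZB in auto)
   then show False using wt_split[OF SB, of ?W] Z(2) out by linarith
  qed
  moreover have "wt (S - ?W) \<le> 3 * K" using wt_split[OF SB, of ?W] W(5) S(2) by linarith
  moreover have "wt (S \<inter> ?W) \<le> 3 * K" using lt2 by simp
  ultimately show ?thesis using Z WB[OF W(3)] by blast
 qed
qed

text \<open>At the root of the tree the covers of the two children would unite to a cheap cover of
  \<open>U\<close>. So one child is a single block, and the other is the rest.\<close>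

lemma first_cut:
 assumes t: "dis t" "lv t = U" "\<And>W. W \<in> subs t \<Longrightarrow> fine U W"
  and U: "card U \<ge> 2" and no: "\<And>Z. cov Z U \<Longrightarrow> wt Z \<ge> 4 * K" and K: "K > 0"
 shows "\<exists>b\<in>U. (\<exists>c. U - {b} = {c}) \<or> (\<exists>Z. cov Z (U - {b}) \<and> wt Z < K)"
proof (cases t)
 case (Lf a)
 then show ?thesis using t(2) U by auto
next
 case (Nd l r)
 have l: "lv l \<in> subs t" and r: "lv r \<in> subs t" using Nd lv_in_subs by auto
 have d: "lv l \<inter> lv r = {}" "lv l \<union> lv r = U" using t Nd by auto
 have ne: "lv l \<noteq> U" "lv r \<noteq> U" using d lv_nonempty[of l] lv_nonempty[of r] by auto
 have single: "\<exists>b\<in>U. (\<exists>c. U - {b} = {c}) \<or> (\<exists>Z. cov Z (U - {b}) \<and> wt Z < K)"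
  if "X = {b}" "X \<inter> Y = {}" "X \<union> Y = U" "fine U Y" "Y \<noteq> U" for X Y b
 proof -
  have "U - {b} = Y" "b \<in> U" using that(1-3) by auto
  then show ?thesis using that(4,5) unfolding fine_def by auto
 qed
 consider b where "lv l = {b}" | b where "lv r = {b}"
  | Z1 Z2 where "cov Z1 (lv l)" "wt Z1 < K" "cov Z2 (lv r)" "wt Z2 < K"
  using t(3)[OF l] t(3)[OF r] ne unfolding fine_def by blast
 then show ?thesis
 proof cases
  case 1
  from single[OF 1 d t(3)[OF r] ne(2)] show ?thesis .
 next
  case 2
  have "lv r \<inter> lv l = {}" "lv r \<union> lv l = U" using d by auto
  from single[OF 2 this t(3)[OF l] ne(1)] show ?thesis .
 next
  case 3
  have "cov (Z1 \<union> Z2) U" using 3 d unfolding cov_def by blast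
  moreover have "wt (Z1 \<union> Z2) < 4 * K"
   using wt_Un[of Z1 Z2] 3 unfolding cov_def by auto
  ultimately show ?thesis using no by (meson not_le)
 qed
qed

end

section \<open>Prime quotients\<close>

locale ugraph =
 fixes n :: nat and adj :: "nat \<Rightarrow> nat \<Rightarrow> bool"
 assumes n: "n \<ge> 1" and adj_sym: "adj u v \<Longrightarrow> adj v u" and adj_irr: "\<not> adj u u"
  and adj_n: "adj u v \<Longrightarrow> u < n \<and> v < n"
begin

text \<open>In a connected graph, with at least two vertices on each side, these are the splits.
  Speaking of pairs of crossing edges avoids naming the frontiers.\<close>

definition good :: "nat set \<Rightarrow> bool" where
 "good X \<longleftrightarrow> (\<forall>x\<in>X. \<forall>x'\<in>X. \<forall>y y'. y \<notin> X \<longrightarrow> y' \<notin> X \<longrightarrow> adj x y \<longrightarrow> adj x' y' \<longrightarrow> adj x y')"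

text \<open>Connectedness by cuts, the form that supplies an edge leaving a given set.\<close>

definition conn :: bool where
 "conn \<longleftrightarrow> (\<forall>X. X \<noteq> {} \<longrightarrow> X \<subset> {..<n} \<longrightarrow> (\<exists>u\<in>X. \<exists>v. v \<notin> X \<and> adj u v))"

definition vcov :: "nat set \<Rightarrow> nat set \<Rightarrow> bool" where
 "vcov Z Y \<longleftrightarrow> finite Z \<and> (\<forall>x y. x \<in> Y \<longrightarrow> y \<notin> Y \<longrightarrow> adj x y \<longrightarrow> x \<in> Z \<or> y \<in> Z)"

lemma goodD: "\<lbrakk>good X; x \<in> X; x' \<in> X; y \<notin> X; y' \<notin> X; adj x y; adj x' y'\<rbrakk> \<Longrightarrow> adj x y'"
 unfolding good_def by blast

lemma connD:
 assumes "conn" "X \<noteq> {}" "X \<subset> {..<n}"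
 obtains u v where "u \<in> X" "v \<notin> X" "adj u v"
 using assms unfolding conn_def by blast

lemma good_compl: "good X \<Longrightarrow> good ({..<n} - X)" for X
proof -
 assume g: "good X"
 show "good ({..<n} - X)"
  unfolding good_def
 proof (intro ballI allI impI)
  fix x x' y y' assume h: "x \<in> {..<n} - X" "x' \<in> {..<n} - X" "y \<notin> {..<n} - X" "y' \<notin> {..<n} - X"
   "adj x y" "adj x' y'"
  have "y \<in> X" "y' \<in> X" using adj_n[OF h(5)] adj_n[OF h(6)] h(3,4) by auto
  with goodD[OF g, of y' y x' x] h(1,2) adj_sym[OF h(5)] adj_sym[OF h(6)] have "adj y' x" by simp
  then show "adj x y'" by (rule adj_sym)
 qed
qed

lemma good_single: "good {v}"
 unfolding good_def by simp

lemma good_Vn_minus: "good ({..<n} - {v})"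
 by (rule good_compl[OF good_single])

end

section \<open>Quotients by blocks and cuts rounded to them\<close>

locale blocks = ugraph +
 fixes blk :: "nat \<Rightarrow> nat" and K :: nat and w :: "nat \<Rightarrow> nat"
begin

text \<open>The second disjunct makes a single-vertex block its own frontier, so that isolated
  vertices do not create blocks with empty frontier.\<close>

definition Fr :: "nat \<Rightarrow> bool" where
 "Fr v \<longleftrightarrow> v < n \<and> ((\<exists>y<n. adj v y \<and> blk y \<noteq> blk v) \<or> (\<forall>y<n. blk y = blk v \<longrightarrow> y = v))"

definition F :: "nat \<Rightarrow> nat set" where "F b = {v. Fr v \<and> blk v = b}"

definition BL :: "nat set" where "BL = blk ` {..<n}"

definition badj :: "nat \<Rightarrow> nat \<Rightarrow> bool" where
 "badj b c \<longleftrightarrow> b \<noteq> c \<and> (\<exists>x\<in>F b. \<exists>y\<in>F c. adj x y)"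

definition ext :: "nat set \<Rightarrow> nat set" where "ext W = {v. v < n \<and> blk v \<in> W}"

end

locale prime_blocks = blocks +
 assumes blk_good: "b \<in> BL \<Longrightarrow> good {v. v < n \<and> blk v = b}"
  and two: "card BL \<ge> 2"
  and sing: "\<lbrakk>\<not> conn; u < n; v < n; blk u = blk v\<rbrakk> \<Longrightarrow> u = v"
  and prime: "\<lbrakk>conn; W \<subseteq> BL; W \<noteq> {}; W \<noteq> BL; good (ext W)\<rbrakk> \<Longrightarrow>
    (\<exists>b. W = {b}) \<or> (\<exists>b. BL - W = {b})"
  and w_light: "b \<in> BL \<Longrightarrow> card (F b) < K \<Longrightarrow> w b = card (F b)"
  and w_heavy: "b \<in> BL \<Longrightarrow> card (F b) \<ge> K \<Longrightarrow> w b \<ge> 4 * K"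
begin

lemma finBL: "finite BL" unfolding BL_def by simp

lemma F_sub: "F b \<subseteq> {..<n}" unfolding F_def Fr_def by auto

lemma finF: "finite (F b)" using F_sub finite_subset by blast

text \<open>Goodness of the two blocks in turn: one edge between \<open>F b\<close> and
  \<open>F c\<close> first joins its end \<open>y0\<close> to all of \<open>F b\<close>, and then
  each vertex of \<open>F b\<close> to all of \<open>F c\<close>.\<close>

lemma full:
 assumes "badj b c" "x \<in> F b" "y \<in> F c"
 shows "adj x y"
proof -
 obtain x0 y0 where 0: "b \<noteq> c" "x0 \<in> F b" "y0 \<in> F c" "adj x0 y0" using assms(1) unfolding badj_def by blast
 have tr: "adj x y" if h: "b \<noteq> c" "x0 \<in> F b" "x \<in> F b" "y \<in> F c" "adj x0 y" for b c x0 x y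
 proof -
  have x: "x < n" "blk x = b" and x0: "x0 < n" "blk x0 = b" and y: "y < n" "blk y = c"
   using h unfolding F_def Fr_def by auto
  have "Fr x" using h unfolding F_def by simp
  then consider z where "z < n" "adj x z" "blk z \<noteq> blk x" | "\<forall>y<n. blk y = blk x \<longrightarrow> y = x"
   unfolding Fr_def by blast
  then show ?thesis
  proof cases
   case 1
   have "b \<in> BL" using x unfolding BL_def by blast
   from goodD[OF blk_good[OF this], of x x0 z y] show ?thesis
    using 1 x x0 y h by simp
  next
   case 2
   then show ?thesis using x x0 h(5) by auto
  qed
 qed
 from tr[OF 0(1,2) assms(2) 0(3,4)] have "adj y0 x" by (rule adj_sym)
 from tr[OF _ 0(3) assms(3) assms(2) this] 0(1) have "adj y x" by blast
 then show ?thesis by (rule adj_sym)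
qed

lemma badj_sym: "badj b c \<Longrightarrow> badj c b"
 unfolding badj_def using adj_sym by blast

lemma cross_in_F:
 assumes "adj x y" "blk x \<noteq> blk y"
 shows "x \<in> F (blk x)" "y \<in> F (blk y)" "badj (blk x) (blk y)"
proof -
 show x: "x \<in> F (blk x)" unfolding F_def Fr_def using adj_n[OF assms(1)] assms by auto
 show y: "y \<in> F (blk y)" unfolding F_def Fr_def using adj_n[OF assms(1)] adj_sym[OF assms(1)] assms by auto
 show "badj (blk x) (blk y)" unfolding badj_def using x y assms by blast
qed

text \<open>A connected graph has an edge leaving the block; in a disconnected one the block is a
  single vertex.\<close>

lemma F_ne:
 assumes "b \<in> BL"
 shows "F b \<noteq> {}"
proof (cases conn)
 case True
 let ?X = "{v. v < n \<and> blk v = b}"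
 obtain v where v: "v < n" "blk v = b" using assms unfolding BL_def by blast
 have "\<exists>c\<in>BL. c \<noteq> b"
 proof (rule ccontr)
  assume "\<not> ?thesis"
  then have "BL \<subseteq> {b}" by blast
  then have "card BL \<le> card {b}" by (intro card_mono) auto
  then show False using two by simp
 qed
 then obtain u where "u < n" "blk u \<noteq> b" unfolding BL_def by blast
 then have "?X \<noteq> {}" "?X \<subset> {..<n}" using v by auto
 from connD[OF True this] obtain x y where "x \<in> ?X" "y \<notin> ?X" "adj x y" .
 then have "x \<in> F b" using cross_in_F(1)[of x y] adj_n[of x y] by auto
 then show ?thesis by auto
next
 case False
 obtain v where v: "v < n" "blk v = b" using assms unfolding BL_def by blast
 then have "v \<in> F b" using sing[OF False] unfolding F_def Fr_def by auto
 then show ?thesis by blast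
qed

sublocale rounding BL F
proof
 show "F b \<inter> F c = {}" if "b \<noteq> c" for b c using that unfolding F_def by auto
qed (use finBL finF F_ne in auto)

sublocale wgraph BL w badj K
proof
 show "w b < K \<or> 4 * K \<le> w b" if "b \<in> BL" for b
  using w_light[OF that] w_heavy[OF that] by (cases "card (F b) < K") auto
qed (use finBL badj_sym in auto)

text \<open>The new cover consists of the blocks of whose frontier \<open>Z\<close> holds at least a
  third, so it weighs at most \<open>3 * card Z\<close>. For an uncovered crossing pair, at least a
  third of \<open>F b\<close> is inside \<open>Y\<close> and at least a third of \<open>F c\<close>
  outside, so both contain a vertex there that avoids \<open>Z\<close>; by \<open>full\<close> these
  are adjacent, although \<open>Z\<close> covers the cut of \<open>Y\<close>.\<close>

lemma round_cover:
 assumes Z: "vcov Z Y" "3 * card Z < K" and W: "lo Y \<subseteq> W" "W \<subseteq> hi Y"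
 shows "\<exists>Z'. cov Z' W \<and> wt Z' < K"
proof (intro exI conjI)
 let ?Z = "{b \<in> BL. card (F b) \<le> 3 * card (Z \<inter> F b)}"
 have finZ: "finite Z" using Z(1) unfolding vcov_def by blast
 have le: "card (Z \<inter> F b) \<le> card Z" for b using finZ by (intro card_mono) auto
 have "wt ?Z \<le> (\<Sum>b\<in>?Z. 3 * card (Z \<inter> F b))"
 proof (rule sum_mono)
  fix b assume b: "b \<in> ?Z"
  have "card (F b) < K" using b le[of b] Z(2) by simp
  then show "w b \<le> 3 * card (Z \<inter> F b)" using w_light[of b] b by simp
 qed
 also have "\<dots> = 3 * (\<Sum>b\<in>?Z. card (Z \<inter> F b))" by (simp add: sum_distrib_left)
 also have "(\<Sum>b\<in>?Z. card (Z \<inter> F b)) = card (\<Union>b\<in>?Z. Z \<inter> F b)"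
  using finBL finZ F_disj by (subst card_UN_disjoint) auto
 also have "\<dots> \<le> card Z" using finZ by (intro card_mono) auto
 finally show "wt ?Z < K" using Z(2) by simp
 show "cov ?Z W"
  unfolding cov_def
 proof (intro conjI ballI impI)
  fix b c assume h: "b \<in> BL" "c \<in> BL" "b \<in> W" "c \<notin> W" "badj b c"
  show "b \<in> ?Z \<or> c \<in> ?Z"
  proof (rule ccontr)
   assume no: "\<not> ?thesis"
   have "card (F b) \<le> 3 * card (F b \<inter> Y)" using h(3) W(2) unfolding hi_def by blast
   moreover have "card (F b) > 3 * card (Z \<inter> F b)" using no h by auto
   ultimately have "\<not> F b \<inter> Y \<subseteq> Z \<inter> F b"
    using card_mono[of "Z \<inter> F b" "F b \<inter> Y"] finZ by fastforce
   then obtain x where x: "x \<in> F b" "x \<in> Y" "x \<notin> Z" by blast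
   have "c \<notin> lo Y" using h(4) W(1) by blast
   then have "3 * card (F c \<inter> Y) \<le> 2 * card (F c)" using h unfolding lo_def by auto
   moreover have "card (F c) = card (F c \<inter> Y) + card (F c - Y)" by (rule card_Int_Diff[OF finF[OF h(2)]])
   ultimately have "card (F c) \<le> 3 * card (F c - Y)" by linarith
   moreover have "card (F c) > 3 * card (Z \<inter> F c)" using no h by auto
   ultimately have "\<not> F c - Y \<subseteq> Z \<inter> F c"
    using card_mono[of "Z \<inter> F c" "F c - Y"] finZ by fastforce
   then obtain y where y: "y \<in> F c" "y \<notin> Y" "y \<notin> Z" by blast
   have "adj x y" using full[OF h(5) x(1) y(1)] .
   then show False using Z(1) x y unfolding vcov_def by blast
  qed
 qed blast
qed

text \<open>A block in \<open>W\<close> has a frontier vertex in \<open>Y\<close>, any other block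
  one outside. Crossing edges pass to these representatives and back, because adjacent frontiers are
  completely joined.\<close>

lemma round_good:
 assumes Y: "good Y" and W: "lo Y \<subseteq> W" "W \<subseteq> hi Y"
 shows "good (ext W)"
proof -
 have "\<exists>x\<in>F b. x \<in> Y" if b: "b \<in> W" for b
 proof (rule ccontr)
  assume "\<not> ?thesis"
  then have "F b \<inter> Y = {}" by blast
  moreover have "b \<in> BL" "card (F b) \<le> 3 * card (F b \<inter> Y)" using b W unfolding hi_def by blast+
  ultimately have "card (F b) = 0" by simp
  then show False using F_ne[OF \<open>b \<in> BL\<close>] finF[OF \<open>b \<in> BL\<close>] by simp
 qed
 then obtain f where f: "\<And>b. b \<in> W \<Longrightarrow> f b \<in> F b \<and> f b \<in> Y" by metis
 have "\<exists>x\<in>F c. x \<notin> Y" if c: "c \<in> BL" "c \<notin> W" for c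
 proof (rule ccontr)
  assume "\<not> ?thesis"
  then have "F c \<inter> Y = F c" by blast
  moreover have "3 * card (F c \<inter> Y) \<le> 2 * card (F c)" using c W unfolding lo_def by auto
  ultimately have "card (F c) = 0" by simp
  then show False using F_ne[OF c(1)] finF[OF c(1)] by simp
 qed
 then obtain g where g: "\<And>c. c \<in> BL \<Longrightarrow> c \<notin> W \<Longrightarrow> g c \<in> F c \<and> g c \<notin> Y" by metis
 show ?thesis
  unfolding good_def
 proof (intro ballI allI impI)
  fix x x' y y' assume h: "x \<in> ext W" "x' \<in> ext W" "y \<notin> ext W" "y' \<notin> ext W" "adj x y" "adj x' y'"
  have m: "blk x \<in> W" "blk x' \<in> W" "blk y \<notin> W" "blk y' \<notin> W" "blk y \<in> BL" "blk y' \<in> BL"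
   using h adj_n[OF h(5)] adj_n[OF h(6)] unfolding ext_def BL_def by auto
  have ne: "blk x \<noteq> blk y" "blk x' \<noteq> blk y'" using m(1-4) by metis+
  have b1: "badj (blk x) (blk y)" "x \<in> F (blk x)" using cross_in_F[OF h(5) ne(1)] by simp_all
  have b2: "badj (blk x') (blk y')" "y' \<in> F (blk y')" using cross_in_F[OF h(6) ne(2)] by simp_all
  have a1: "adj (f (blk x)) (g (blk y))" using full[OF b1(1)] f[OF m(1)] g[OF m(5,3)] by blast
  have a2: "adj (f (blk x')) (g (blk y'))" using full[OF b2(1)] f[OF m(2)] g[OF m(6,4)] by blast
  have "adj (f (blk x)) (g (blk y'))"
   using goodD[OF Y _ _ _ _ a1 a2] f[OF m(1)] f[OF m(2)] g[OF m(5,3)] g[OF m(6,4)] by blast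
  moreover have "blk x \<noteq> blk y'" using m(1,4) by metis
  ultimately have "badj (blk x) (blk y')"
   unfolding badj_def
   by (intro conjI bexI[OF bexI[OF _ g[OF m(6,4), THEN conjunct1]] f[OF m(1), THEN conjunct1]])
  from full[OF this b1(2) b2(2)] show "adj x y'" .
 qed
qed

definition small :: "nat set \<Rightarrow> bool" where
 "small Y \<longleftrightarrow> (\<exists>Z. vcov Z Y \<and> 3 * card Z < K) \<or> (conn \<and> good Y)"

lemma block_tree:
 assumes T: "dis T" "lv T = {..<n}" "\<And>Y. Y \<in> subs T \<Longrightarrow> Y \<noteq> {..<n} \<Longrightarrow> small Y" and r: "r \<in> BL"
 shows "\<exists>t. dis t \<and> lv t = BL - {r} \<and> (\<forall>W\<in>subs t. fine (BL - {r}) W)"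
proof -
 have FT: "F b \<subseteq> lv T" for b using F_sub T(2) by simp
 have "BL \<noteq> {}" using r by blast
 from rounded_tree_all[OF T(1) FT this] obtain t where
  t: "dis t" "lv t = BL" "\<forall>W\<in>subs t. rnd (subs T) W" by (elim exE conjE)
 have ne: "lv t \<noteq> {r}" using two t(2) by auto
 have rt: "r \<in> lv t" using r t(2) by simp
 from reroot[OF t(1) rt ne] obtain t' where t': "dis t'" "lv t' = lv t - {r}"
  "\<forall>W\<in>subs t'. W \<in> subs t \<or> lv t - W \<in> subs t" by (elim exE conjE)
 have cl: "(\<exists>b. W = {b}) \<or> (\<exists>b. BL - W = {b}) \<or> (\<exists>Z. cov Z W \<and> wt Z < K)"
  if W: "W \<in> subs t" "W \<noteq> BL" for W
 proof -
  have Wp: "W \<noteq> {}" "W \<subseteq> BL" using subs_props[OF W(1)] t(2) by auto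
  consider b where "W = {b}" | Y where "Y \<in> subs T" "lo Y \<subseteq> W" "W \<subseteq> hi Y"
   using bspec[OF t(3) W(1)] unfolding rnd_def by blast
  then show ?thesis
  proof cases
   case 1
   then show ?thesis by blast
  next
   case 2
   have "Y \<noteq> {..<n}"
   proof
    assume Y: "Y = {..<n}"
    have "b \<in> lo Y" if b: "b \<in> BL" for b
    proof -
     have "F b \<inter> Y = F b" using F_sub Y by blast
     moreover have "card (F b) > 0" using finF[OF b] F_ne[OF b] by (simp add: card_gt_0_iff)
     ultimately show ?thesis using b unfolding lo_def by simp
    qed
    then show False using 2 W(2) Wp by blast
   qed
   from T(3)[OF 2(1) this] show ?thesis
    unfolding small_def
   proof
    assume "\<exists>Z. vcov Z Y \<and> 3 * card Z < K"
    then show ?thesis using round_cover 2 by blast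
   next
    assume "conn \<and> good Y"
    then show ?thesis using prime[OF _ Wp(2,1) W(2) round_good[OF _ 2(2,3)]] by blast
   qed
  qed
 qed
 have "fine (BL - {r}) W" if W: "W \<in> subs t'" for W
 proof -
  have Wp: "W \<noteq> {}" "W \<subseteq> BL - {r}" using subs_props[OF W] t'(2) t(2) by auto
  from bspec[OF t'(3) W] show ?thesis
  proof
   assume m: "W \<in> subs t"
   have "W \<noteq> BL" using Wp r by auto
   from cl[OF m this] show ?thesis
   proof (elim disjE exE)
    fix b assume e: "BL - W = {b}"
    have "r \<in> BL - W" using Wp r by auto
    then have "BL - W = {r}" using e by simp
    moreover have "BL - (BL - W) = W" using Wp by (intro double_diff) auto
    ultimately have "W = BL - {r}" by simp
    then show ?thesis unfolding fine_def by simp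
   qed (auto simp: fine_def)
  next
   assume m: "lv t - W \<in> subs t"
   then have m: "BL - W \<in> subs t" using t(2) by simp
   have "BL - W \<noteq> BL" using Wp by auto
   from cl[OF m this] show ?thesis
   proof (elim disjE exE)
    fix b assume e: "BL - W = {b}"
    have "r \<in> BL - W" using Wp r by auto
    then have "BL - W = {r}" using e by simp
    moreover have "BL - (BL - W) = W" using Wp by (intro double_diff) auto
    ultimately have "W = BL - {r}" by simp
    then show ?thesis unfolding fine_def by simp
   next
    fix b assume "BL - (BL - W) = {b}"
    moreover have "BL - (BL - W) = W" using Wp by (intro double_diff) auto
    ultimately show ?thesis unfolding fine_def by simp
   next
    fix Z assume "cov Z (BL - W) \<and> wt Z < K"
    then show ?thesis using cov_compl unfolding fine_def by blast
   qed
  qed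
 qed
 then show ?thesis using t'(1,2) t(2) by (intro exI[of _ t']) auto
qed

end

section \<open>Choosing a cut at a node and uncrossing it\<close>

context wgraph
begin

text \<open>The requirement on a part: a single block is refined in a quotient of its own, anything
  else must keep a cover within the budget.\<close>

definition okc :: "'b set \<Rightarrow> bool" where
 "okc X \<longleftrightarrow> (\<exists>c. X = {c}) \<or> (\<exists>Z. cov Z X \<and> wt Z < 4 * K)"

text \<open>Of two blocks either can be split off. With three or more, a cheap cover permits
  balancing; a node without one is all of \<open>U\<close>, and \<open>first_cut\<close> splits off
  a block.\<close>

lemma cut_exists:
 assumes t: "dis t" "lv t = U" "\<And>W. W \<in> subs t \<Longrightarrow> fine U W" and U: "U = BL - {r}"
  and A: "A \<subseteq> U" "card A \<ge> 2" "A = U \<or> (\<exists>S. cov S A \<and> wt S < 4 * K)" and K: "K > 0"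
  and S: "cov S A" "\<And>S'. cov S' A \<Longrightarrow> wt S \<le> wt S'"
 shows "(\<exists>b\<in>A. A - {b} \<noteq> {} \<and> okc (A - {b})) \<or>
  (\<exists>W Z. wt S < 4 * K \<and> W \<subseteq> BL \<and> cov Z W \<and> wt Z < K \<and> A \<inter> W \<noteq> {} \<and> A - W \<noteq> {} \<and>
   wt (S \<inter> W) \<le> 3 * K \<and> wt (S - W) \<le> 3 * K)"
proof (cases "card A \<ge> 3")
 case False
 then have "card A = 2" using A(2) by simp
 then obtain b c where bc: "A = {b, c}" "b \<noteq> c" by (meson card_2_iff)
 then have "A - {b} = {c}" by auto
 then have "b \<in> A \<and> A - {b} \<noteq> {} \<and> okc (A - {b})" using bc unfolding okc_def by auto
 then show ?thesis by blast
next
 case 3: True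
 show ?thesis
 proof (cases "\<exists>S. cov S A \<and> wt S < 4 * K")
  case True
  then have "wt S < 4 * K" using S(2) by (meson le_less_trans)
  with balanced_cut[OF t U A(1) 3 S(1) this S(2)] show ?thesis by simp
 next
  case False
  then have AU: "A = U" and no: "\<And>Z. cov Z U \<Longrightarrow> 4 * K \<le> wt Z" using A(3) by (auto simp: not_less)
  have "card U \<ge> 2" using A(2) AU by simp
  from first_cut[OF t this no K] obtain b where
   b: "b \<in> U" "(\<exists>c. U - {b} = {c}) \<or> (\<exists>Z. cov Z (U - {b}) \<and> wt Z < K)" by blast
  have "wt Z < 4 * K" if "wt Z < K" for Z using that by simp
  then have "okc (A - {b})" using b(2) unfolding okc_def AU by blast
  moreover have "A - {b} \<noteq> {}"
  proof
   assume "A - {b} = {}"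
   then have "A \<subseteq> {b}" by simp
   then have "card A \<le> card {b}" by (rule card_mono[rotated]) simp
   then show False using A(2) by simp
  qed
  ultimately show ?thesis using b(1) AU by blast
 qed
qed

text \<open>\<open>Y\<close> has to agree with \<open>W\<close> on \<open>S\<close> only, which is
  why guessing a subset of \<open>S\<close> suffices. An edge leaving \<open>A \<inter> Y\<close>
  either crosses \<open>Y\<close>, where \<open>Z\<close> covers it, or stays inside
  \<open>Y\<close>, where the block of \<open>S\<close> covering it lies in \<open>W\<close>. The
  weights add up to less than \<open>3 * K + K\<close>; the other part is symmetric.\<close>

lemma cut_parts:
 assumes S: "cov S A" and Z: "cov Z Y" "wt Z < K"
  and SW: "wt (S \<inter> W) \<le> 3 * K" "wt (S - W) \<le> 3 * K"
  and Y: "S \<inter> W \<subseteq> Y" "(S - W) \<inter> Y = {}"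
 shows "okc (A \<inter> Y)" "okc (A - Y)"
proof -
 have SB: "S \<subseteq> BL" and ZB: "Z \<subseteq> BL" using S Z unfolding cov_def by blast+
 have "cov ((S \<inter> W) \<union> Z) (A \<inter> Y)"
  unfolding cov_def
 proof (intro conjI ballI impI)
  fix b c assume h: "b \<in> BL" "c \<in> BL" "b \<in> A \<inter> Y" "c \<notin> A \<inter> Y" "badj b c"
  show "b \<in> (S \<inter> W) \<union> Z \<or> c \<in> (S \<inter> W) \<union> Z"
  proof (cases "c \<in> Y")
   case True
   then have "b \<in> S \<or> c \<in> S" using S h unfolding cov_def by blast
   then show ?thesis using Y(2) True h(3) by blast
  next
   case False
   then show ?thesis using Z(1) h unfolding cov_def by blast
  qed
 qed (use SB ZB in blast)
 moreover have "wt ((S \<inter> W) \<union> Z) < 4 * K"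
 proof -
  have "wt ((S \<inter> W) \<union> Z) \<le> wt (S \<inter> W) + wt Z" by (rule wt_Un) (use SB ZB in auto)
  then show ?thesis using SW Z(2) by linarith
 qed
 ultimately show "okc (A \<inter> Y)" unfolding okc_def by blast
 have "cov ((S - W) \<union> Z) (A - Y)"
  unfolding cov_def
 proof (intro conjI ballI impI)
  fix b c assume h: "b \<in> BL" "c \<in> BL" "b \<in> A - Y" "c \<notin> A - Y" "badj b c"
  show "b \<in> (S - W) \<union> Z \<or> c \<in> (S - W) \<union> Z"
  proof (cases "c \<in> Y")
   case False
   then have "b \<in> S \<or> c \<in> S" using S h unfolding cov_def by blast
   then show ?thesis using Y(1) False h(3) by blast
  next
   case True
   then show ?thesis using Z(1) h symb[of b c] unfolding cov_def by blast
  qed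
 qed (use SB ZB in blast)
 moreover have "wt ((S - W) \<union> Z) < 4 * K"
 proof -
  have "wt ((S - W) \<union> Z) \<le> wt (S - W) + wt Z" by (rule wt_Un) (use SB ZB in auto)
  then show ?thesis using SW Z(2) by linarith
 qed
 ultimately show "okc (A - Y)" unfolding okc_def by blast
qed

end

context prime_blocks
begin

text \<open>A cover within the budget contains light blocks only, and edges between different blocks
  join frontier vertices, so the frontiers of the covering blocks cover the cut of the
  graph.\<close>

lemma cov_vcov:
 assumes "cov Z W" "wt Z < 4 * K"
 shows "\<exists>X. vcov X (ext W) \<and> card X < 4 * K"
proof (intro exI conjI)
 let ?X = "\<Union>b\<in>Z. F b"
 have ZB: "Z \<subseteq> BL" using assms(1) unfolding cov_def by blast
 have finZ: "finite Z" using ZB finBL finite_subset by blast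
 have "card ?X \<le> (\<Sum>b\<in>Z. card (F b))" by (rule card_UN_le[OF finZ])
 also have "\<dots> \<le> wt Z"
 proof (rule sum_mono)
  fix b assume b: "b \<in> Z"
  then have "w b \<le> wt Z" using finZ by (simp add: member_le_sum)
  then have "card (F b) < K" using w_heavy[of b] b ZB assms(2) by fastforce
  then show "card (F b) \<le> w b" using w_light[of b] b ZB by auto
 qed
 finally show "card ?X < 4 * K" using assms(2) by simp
 show "vcov ?X (ext W)"
  unfolding vcov_def
 proof (intro conjI allI impI)
  show "finite ?X" using finZ finF ZB by blast
  fix x y assume h: "x \<in> ext W" "y \<notin> ext W" "adj x y"
  have m: "blk x \<in> W" "blk y \<notin> W" "blk x \<in> BL" "blk y \<in> BL"
   using h adj_n[OF h(3)] unfolding ext_def BL_def by auto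
  then have "blk x \<noteq> blk y" by metis
  from cross_in_F[OF h(3) this] m assms(1) show "x \<in> ?X \<or> y \<in> ?X"
   unfolding cov_def by blast
 qed
qed

end

text \<open>
 Blocks are weighted by points: a light block has one point for each frontier vertex, a heavy one
 has so many that no cover of interest can afford them.
\<close>

locale point_blocks = blocks +
 fixes \<Theta> :: nat
 assumes w_def: "\<And>b. w b = card {p. p < n * \<Theta> \<and> Fr (p div \<Theta>) \<and>
   (p mod \<Theta> = 0 \<or> card (F (blk (p div \<Theta>))) \<ge> K) \<and> blk (p div \<Theta>) = b}"
  and \<Theta>: "\<Theta> = 4 * K" and K0: "K > 0"
begin

text \<open>Point \<open>p\<close> is copy \<open>p mod \<Theta>\<close> of vertex
  \<open>p div \<Theta>\<close>. Vertices off the frontier have no point, and copies other than 0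
  exist in heavy blocks only.\<close>

definition P :: "nat set" where
 "P = {p. p < n * \<Theta> \<and> Fr (p div \<Theta>) \<and> (p mod \<Theta> = 0 \<or> card (F (blk (p div \<Theta>))) \<ge> K)}"

definition cls :: "nat \<Rightarrow> nat" where "cls p = blk (p div \<Theta>)"

lemma w_card: "w b = card {p \<in> P. cls p = b}"
 unfolding w_def P_def cls_def by (rule arg_cong[where f = card]) auto

lemma finP: "finite P" unfolding P_def by simp

lemma \<Theta>0: "\<Theta> > 0" using \<Theta> K0 by simp

lemma first_point: "v \<in> F b \<Longrightarrow> v * \<Theta> \<in> P \<and> cls (v * \<Theta>) = b"
 unfolding P_def cls_def F_def Fr_def using \<Theta>0 by auto

lemma light_weight:
 assumes "card (F b) < K"
 shows "w b = card (F b)"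
proof -
 have "{p \<in> P. cls p = b} = (\<lambda>v. v * \<Theta>) ` F b"
 proof (intro set_eqI iffI)
  fix p assume "p \<in> {p \<in> P. cls p = b}"
  then have p: "p < n * \<Theta>" "Fr (p div \<Theta>)" "blk (p div \<Theta>) = b" "p mod \<Theta> = 0"
   using assms unfolding P_def cls_def by auto
  then have "p = (p div \<Theta>) * \<Theta>" by auto
  moreover have "p div \<Theta> \<in> F b" using p unfolding F_def by simp
  ultimately show "p \<in> (\<lambda>v. v * \<Theta>) ` F b" by blast
 qed (use first_point in auto)
 moreover have "inj_on (\<lambda>v. v * \<Theta>) (F b)" using \<Theta>0 by (auto intro: inj_onI)
 ultimately show ?thesis unfolding w_card by (simp add: card_image)
qed

lemma heavy_weight:
 assumes "card (F b) \<ge> K"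
 shows "w b \<ge> 4 * K"
proof -
 obtain v where v: "v \<in> F b" using assms K0 by fastforce
 have "(\<lambda>c. v * \<Theta> + c) ` {..<\<Theta>} \<subseteq> {p \<in> P. cls p = b}"
 proof
  fix p assume "p \<in> (\<lambda>c. v * \<Theta> + c) ` {..<\<Theta>}"
  then obtain c where c: "p = v * \<Theta> + c" "c < \<Theta>" by auto
  have vn: "Fr v" "blk v = b" "v < n" using v unfolding F_def Fr_def by auto
  have d: "p div \<Theta> = v" using c by simp
  have "v * \<Theta> + c < (v + 1) * \<Theta>" using c by simp
  also have "\<dots> \<le> n * \<Theta>" using vn(3) by (intro mult_le_mono1) simp
  finally have "p < n * \<Theta>" using c by simp
  then show "p \<in> {p \<in> P. cls p = b}" using d vn assms unfolding P_def cls_def by simp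
 qed
 then have "card ((\<lambda>c. v * \<Theta> + c) ` {..<\<Theta>}) \<le> w b"
  unfolding w_card using finP by (intro card_mono) auto
 moreover have "card ((\<lambda>c. v * \<Theta> + c) ` {..<\<Theta>}) = \<Theta>"
  by (subst card_image) (auto intro: inj_onI)
 ultimately show ?thesis using \<Theta> by simp
qed

end

locale prime_points = point_blocks + prime_blocks
begin

lemma cls_BL: "p \<in> P \<Longrightarrow> cls p \<in> BL"
 unfolding P_def cls_def BL_def Fr_def by auto

lemma point_of: "b \<in> BL \<Longrightarrow> \<exists>p\<in>P. cls p = b"
 using F_ne[of b] first_point[of _ b] by blast

definition pcov :: "nat set \<Rightarrow> nat set \<Rightarrow> bool" where
 "pcov Z W \<longleftrightarrow> (\<forall>p\<in>P. \<forall>q\<in>P. cls p \<in> W \<longrightarrow> cls q \<notin> W \<longrightarrow> badj (cls p) (cls q) \<longrightarrow> p \<in> Z \<or> q \<in> Z)"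

definition clsd :: "nat set \<Rightarrow> bool" where
 "clsd Z \<longleftrightarrow> Z \<subseteq> P \<and> (\<forall>p\<in>Z. \<forall>q\<in>P. cls p = cls q \<longrightarrow> q \<in> Z)"

lemma cov_pcov:
 assumes "cov Z W"
 shows "pcov {p \<in> P. cls p \<in> Z} W" "card {p \<in> P. cls p \<in> Z} = wt Z" "{p \<in> P. cls p \<in> Z} \<subseteq> P"
proof -
 show "pcov {p \<in> P. cls p \<in> Z} W"
  using assms cls_BL unfolding cov_def pcov_def by blast
 have ZB: "Z \<subseteq> BL" using assms unfolding cov_def by blast
 then have finZ: "finite Z" using finBL finite_subset by blast
 have "{p \<in> P. cls p \<in> Z} = (\<Union>b\<in>Z. {p \<in> P. cls p = b})" by auto
 then have "card {p \<in> P. cls p \<in> Z} = card (\<Union>b\<in>Z. {p \<in> P. cls p = b})" by simp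
 also have "\<dots> = (\<Sum>b\<in>Z. card {p \<in> P. cls p = b})"
  by (rule card_UN_disjoint) (use finZ finP in auto)
 finally show "card {p \<in> P. cls p \<in> Z} = wt Z" unfolding w_card .
qed auto

text \<open>A point cover corresponds to a set of blocks if it is closed under classes; minimum
  separations are read off in closed form, so this costs nothing.\<close>

lemma pcov_cov:
 assumes "pcov Z W" "clsd Z"
 shows "cov (cls ` Z) W" "wt (cls ` Z) = card Z"
proof -
 have ZP: "Z \<subseteq> P" using assms(2) unfolding clsd_def by blast
 show c: "cov (cls ` Z) W"
  unfolding cov_def
 proof (intro conjI ballI impI)
  show "cls ` Z \<subseteq> BL" using ZP cls_BL by blast
  fix b c assume h: "b \<in> BL" "c \<in> BL" "b \<in> W" "c \<notin> W" "badj b c"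
  obtain p q where "p \<in> P" "cls p = b" "q \<in> P" "cls q = c" using point_of h(1,2) by blast
  then show "b \<in> cls ` Z \<or> c \<in> cls ` Z" using assms(1) h unfolding pcov_def by blast
 qed
 have "{p \<in> P. cls p \<in> cls ` Z} = Z"
  using assms(2) unfolding clsd_def by auto
 then show "wt (cls ` Z) = card Z" using cov_pcov(2)[OF c] by simp
qed

end

section \<open>The laminar family\<close>

context ugraph
begin

definition same :: "nat \<Rightarrow> (nat \<Rightarrow> nat set) \<Rightarrow> nat \<Rightarrow> nat \<Rightarrow> bool" where
 "same g fam u v \<longleftrightarrow> u = v \<or> (\<exists>t<g. u \<in> fam t \<and> v \<in> fam t)"

text \<open>If the edge \<open>u w\<close> leaves a good set, a pair \<open>x\<close>,
  \<open>v\<close> across its cut is adjacent exactly if \<open>v\<close> is adjacent to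
  \<open>u\<close> and \<open>x\<close> to \<open>w\<close>. A pair violating this cannot be
  separated, so \<open>x\<close> forces \<open>v\<close>; so do the classes of \<open>E\<close>,
  which must stay together.\<close>

definition crel :: "(nat \<Rightarrow> nat \<Rightarrow> bool) \<Rightarrow> nat \<Rightarrow> nat \<Rightarrow> (nat \<times> nat) set" where
 "crel E u w = {(x, v). x < n \<and> v < n \<and> (E x v \<or> adj x v \<noteq> (adj v u \<and> adj x w))}"

definition clos :: "(nat \<Rightarrow> nat \<Rightarrow> bool) \<Rightarrow> nat \<Rightarrow> nat \<Rightarrow> nat \<Rightarrow> nat set" where
 "clos E u y w = (crel E u w)\<^sup>* `` {u, y}"

lemma clos_closed: "x \<in> clos E u y w \<Longrightarrow> (x, v) \<in> crel E u w \<Longrightarrow> v \<in> clos E u y w"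
 unfolding clos_def by (auto intro: rtrancl_into_rtrancl)

lemma clos_sub:
 assumes "u < n" "y < n"
 shows "clos E u y w \<subseteq> {..<n}"
proof
 fix v assume "v \<in> clos E u y w"
 then obtain x where x: "(x, v) \<in> (crel E u w)\<^sup>*" "x = u \<or> x = y" unfolding clos_def by blast
 from x(1) show "v \<in> {..<n}"
  by cases (use x(2) assms in \<open>auto simp: crel_def\<close>)
qed

text \<open>No forcing pair leaves the closure. So an edge leaving it starts at a neighbour of
  \<open>w\<close> and ends at a neighbour of \<open>u\<close>, and all such pairs across the cut
  are edges.\<close>

lemma clos_good: "good (clos E u y w)"
 unfolding good_def
proof (intro ballI allI impI)
 let ?C = "clos E u y w"
 fix x x' v v' assume h: "x \<in> ?C" "x' \<in> ?C" "v \<notin> ?C" "v' \<notin> ?C" "adj x v" "adj x' v'"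
 have f: "adj a b = (adj b u \<and> adj a w)" if "a \<in> ?C" "b \<notin> ?C" "a < n" "b < n" for a b
 proof -
  have "(a, b) \<notin> crel E u w" using clos_closed that by blast
  then show ?thesis using that unfolding crel_def by blast
 qed
 have "adj x w" using f[OF h(1,3)] h(5) adj_n by blast
 moreover have "adj v' u" using f[OF h(2,4)] h(6) adj_n by blast
 ultimately show "adj x v'" using f[OF h(1,4)] adj_n by blast
qed

lemma clos_E:
 assumes "x \<in> clos E u y w" "E x v" "x < n" "v < n"
 shows "v \<in> clos E u y w"
 using clos_closed[OF assms(1), of v] assms unfolding crel_def by blast

text \<open>With the leaving edge \<open>u w\<close>, goodness of \<open>W\<close> is the very
  equivalence whose failures generate the closure, so no step of the generation leaves
  \<open>W\<close>.\<close>

lemma clos_min: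
 assumes W: "good W" "\<And>x v. \<lbrakk>x \<in> W; v < n; E x v\<rbrakk> \<Longrightarrow> v \<in> W" "u \<in> W" "y \<in> W" "w \<notin> W" "adj u w"
 shows "clos E u y w \<subseteq> W"
proof
 fix v assume "v \<in> clos E u y w"
 then obtain x where x: "(x, v) \<in> (crel E u w)\<^sup>*" "x = u \<or> x = y" unfolding clos_def by blast
 from x(1) show "v \<in> W"
 proof (induction rule: rtrancl_induct)
  case base
  then show ?case using x(2) W by blast
 next
  case (step a b)
  show ?case
  proof (rule ccontr)
   assume b: "b \<notin> W"
   have ab: "a < n" "b < n" "E a b \<or> adj a b \<noteq> (adj b u \<and> adj a w)"
    using step(2) unfolding crel_def by auto
   have "\<not> E a b" using W(2)[OF step(3) ab(2)] b by blast
   moreover have "adj a b = (adj b u \<and> adj a w)"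
   using goodD W(1) W(3) step(3) W(5) b W(6) adj_sym by blast
   ultimately show False using ab(3) by blast
  qed
 qed
qed

definition Eclosed :: "(nat \<Rightarrow> nat \<Rightarrow> bool) \<Rightarrow> nat set \<Rightarrow> bool" where
 "Eclosed E W \<longleftrightarrow> (\<forall>x\<in>W. \<forall>v<n. E x v \<longrightarrow> v \<in> W)"

text \<open>\<open>B\<close> is a good union of \<open>E\<close>-classes that avoids the root 0 and is minimal among those containing several classes.\<close>

definition rok :: "(nat \<Rightarrow> nat \<Rightarrow> bool) \<Rightarrow> nat set \<Rightarrow> bool" where
 "rok E B \<longleftrightarrow> B \<subseteq> {1..<n} \<and> good B \<and> Eclosed E B \<and>
   (B = {1..<n} \<or> (\<exists>u\<in>B. \<exists>y\<in>B. \<not> E u y)) \<and>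
   (conn \<longrightarrow> (\<forall>W. W \<subset> B \<longrightarrow> good W \<longrightarrow> Eclosed E W \<longrightarrow> (\<forall>x\<in>W. \<forall>y\<in>W. E x y))) \<and>
   (\<not> conn \<longrightarrow> B = {1..<n})"

definition triple :: "(nat \<Rightarrow> nat \<Rightarrow> bool) \<Rightarrow> nat \<Rightarrow> nat \<Rightarrow> nat \<Rightarrow> bool" where
 "triple E u y w \<longleftrightarrow> u < n \<and> y < n \<and> w < n \<and> adj u w \<and> \<not> E u y \<and> 0 \<notin> clos E u y w"

lemma compl0: "{..<n} - {0} = {1..<n}" by auto

lemma good_V0: "good {1..<n}"
 using good_Vn_minus[of 0] unfolding compl0 .

lemma rok_clos:
 assumes "triple E u y w"
 shows "clos E u y w \<subseteq> {1..<n}" "good (clos E u y w)" "Eclosed E (clos E u y w)"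
  "u \<in> clos E u y w" "y \<in> clos E u y w"
proof -
 have uy: "u < n" "y < n" using assms unfolding triple_def by simp_all
 show "clos E u y w \<subseteq> {1..<n}"
 proof
  fix x assume x: "x \<in> clos E u y w"
  then have "x \<noteq> 0" "x < n" using clos_sub[OF uy] assms unfolding triple_def by (metis, blast)
  then show "x \<in> {1..<n}" by simp
 qed
 show "Eclosed E (clos E u y w)"
  unfolding Eclosed_def using clos_E clos_sub[OF uy] by blast
 show "u \<in> clos E u y w" "y \<in> clos E u y w" unfolding clos_def by auto
qed (rule clos_good)

text \<open>Minimality is tested against closures only, yet holds against all good sets: one
  strictly inside \<open>B\<close> that contains several classes has, by connectedness, a leaving
  edge \<open>u w\<close>, and some \<open>z\<close> not equivalent to \<open>u\<close>; the closure
  for \<open>u\<close>, \<open>z\<close>, \<open>w\<close> stays inside it.\<close>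

lemma rokI:
 assumes E: "\<And>x. E x x" "\<And>x y. E x y \<Longrightarrow> E y x" "\<And>x y z. E x y \<Longrightarrow> E y z \<Longrightarrow> E x z"
  and E0: "\<And>y. E 0 y \<Longrightarrow> y = 0"
  and B: "B = {1..<n} \<or> (\<exists>u y w. triple E u y w \<and> B = clos E u y w)"
  and min: "\<And>u y w. conn \<Longrightarrow> triple E u y w \<Longrightarrow> \<not> clos E u y w \<subset> B"
  and disc: "\<not> conn \<Longrightarrow> B = {1..<n}"
 shows "rok E B"
proof -
 have V0: "Eclosed E {1..<n}"
  unfolding Eclosed_def
 proof (intro ballI allI impI)
  fix x v assume h: "x \<in> {1..<n}" "v < n" "E x v"
  have "v \<noteq> 0"
  proof
   assume "v = 0"
   then have "x = 0" using E0 E(2)[OF h(3)] by blast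
   then show False using h(1) by simp
  qed
  then show "v \<in> {1..<n}" using h(2) by simp
 qed
 have 1: "B \<subseteq> {1..<n} \<and> good B \<and> Eclosed E B \<and> (B = {1..<n} \<or> (\<exists>u\<in>B. \<exists>y\<in>B. \<not> E u y))"
  using B
 proof
  assume "B = {1..<n}"
  then show ?thesis using V0 good_V0 by simp
 next
  assume "\<exists>u y w. triple E u y w \<and> B = clos E u y w"
  then obtain u y w where t: "triple E u y w" "B = clos E u y w" by (elim exE conjE)
  have "\<not> E u y" using t(1) unfolding triple_def by simp
  then show ?thesis using rok_clos[OF t(1)] unfolding t(2) by blast
 qed
 have 2: "E x y" if c: "conn" and W: "W \<subset> B" "good W" "Eclosed E W" and xy: "x \<in> W" "y \<in> W" for W x y
 proof (rule ccontr)
  assume ne: "\<not> E x y"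
  have WB: "W \<subseteq> {1..<n}" using W(1) 1 by blast
  have "W \<subset> {..<n}"
  proof
   show "W \<subseteq> {..<n}" using WB by auto
   have "0 \<notin> W" using WB by auto
   then show "W \<noteq> {..<n}" using n by auto
  qed
  moreover have "W \<noteq> {}" using xy by blast
  ultimately obtain u w where uw: "u \<in> W" "w \<notin> W" "adj u w" using connD[OF c] by metis
  have "\<not> E u x \<or> \<not> E u y" using E(2,3) ne by blast
  then obtain z where z: "z \<in> W" "\<not> E u z" using xy by blast
  have sub: "clos E u z w \<subseteq> W"
   by (rule clos_min[OF W(2) _ uw(1) z(1) uw(2,3)]) (use W(3) in \<open>auto simp: Eclosed_def\<close>)
  have "0 \<notin> clos E u z w" using sub WB by auto
  moreover have "z < n" using WB z(1) by auto
  ultimately have "triple E u z w" unfolding triple_def using uw(3) z(2) adj_n by blast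
  from min[OF c this] sub W(1) show False by blast
 qed
 show ?thesis unfolding rok_def using 1 2 disc by blast
qed

definition famok :: "nat \<Rightarrow> (nat \<Rightarrow> nat set) \<Rightarrow> bool" where
 "famok g fam \<longleftrightarrow> (\<forall>t<g. rok (same t fam) (fam t))"

lemma famokD:
 assumes "famok g fam" "t < g"
 shows "fam t \<subseteq> {1..<n}" "good (fam t)" "Eclosed (same t fam) (fam t)"
  "fam t = {1..<n} \<or> (\<exists>u\<in>fam t. \<exists>y\<in>fam t. \<not> same t fam u y)"
  "\<lbrakk>conn; W \<subset> fam t; good W; Eclosed (same t fam) W; x \<in> W; y \<in> W\<rbrakk> \<Longrightarrow> same t fam x y"
  "\<not> conn \<Longrightarrow> fam t = {1..<n}"
 using assms unfolding famok_def rok_def by blast+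

text \<open>A member is closed under sharing an earlier member, so it contains every earlier member
  that it meets.\<close>

lemma laminar:
 assumes f: "famok g fam" and t: "t < t'" "t' < g" and ne: "x \<in> fam t" "x \<in> fam t'"
 shows "fam t \<subseteq> fam t'"
proof
 fix y assume y: "y \<in> fam t"
 have "t < g" using t by simp
 then have "y < n" using famokD(1)[OF f] y by fastforce
 moreover have "same t' fam x y" unfolding same_def using t(1) ne(1) y by blast
 ultimately show "y \<in> fam t'" using famokD(3)[OF f t(2)] ne(2) unfolding Eclosed_def by blast
qed

lemma same_equiv:
 assumes f: "famok g fam" and s: "s \<le> g"
 shows "same s fam x x" "same s fam x y \<Longrightarrow> same s fam y x"
  "same s fam x y \<Longrightarrow> same s fam y z \<Longrightarrow> same s fam x z" "same s fam 0 y \<Longrightarrow> y = 0"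
proof -
 show "same s fam x x" unfolding same_def by simp
 show "same s fam x y \<Longrightarrow> same s fam y x" unfolding same_def by blast
 have no0: "0 \<notin> fam t" if "t < s" for t
 proof -
  have "fam t \<subseteq> {1..<n}" by (rule famokD(1)[OF f]) (use that s in simp)
  then show ?thesis by auto
 qed
 show "same s fam 0 y \<Longrightarrow> y = 0"
  unfolding same_def using no0 by auto
 assume h: "same s fam x y" "same s fam y z"
 show "same s fam x z"
 proof (cases "x = y \<or> y = z")
  case False
  then obtain t t' where t: "t < s" "x \<in> fam t" "y \<in> fam t" "t' < s" "y \<in> fam t'" "z \<in> fam t'"
   using h unfolding same_def by blast
  consider "t < t'" | "t = t'" | "t' < t" by linarith
  then show ?thesis
  proof cases
   case 1
   have "fam t \<subseteq> fam t'" by (rule laminar[OF f 1 _ t(3,5)]) (use t s in simp)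
   then show ?thesis unfolding same_def using t by blast
  next
   case 2
   then show ?thesis unfolding same_def using t by blast
  next
   case 3
   have "fam t' \<subseteq> fam t" by (rule laminar[OF f 3 _ t(5,3)]) (use t s in simp)
   then show ?thesis unfolding same_def using t by blast
  qed
 qed (use h in auto)
qed

text \<open>Each round that does not yet produce everything identifies a new pair of vertices.\<close>

lemma fam_full:
 assumes f: "famok g fam" and g: "g > n * n"
 shows "\<exists>t<g. fam t = {1..<n}"
proof (rule ccontr)
 assume no: "\<not> ?thesis"
 define Q where "Q = (\<lambda>s. {p \<in> {..<n} \<times> {..<n}. same s fam (fst p) (snd p)})"
 have fin: "finite (Q s)" for s unfolding Q_def by simp
 have "s \<le> card (Q s)" if "s \<le> g" for s
  using that
 proof (induction s)
  case (Suc s)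
  have "s < g" using Suc.prems by simp
  then obtain u y where uy: "u \<in> fam s" "y \<in> fam s" "\<not> same s fam u y"
   using famokD(4)[OF f] no by blast
  have "fam s \<subseteq> {1..<n}" by (rule famokD(1)[OF f \<open>s < g\<close>])
  then have "(u, y) \<in> Q (Suc s)" "(u, y) \<notin> Q s" using uy unfolding Q_def same_def by auto
  moreover have "Q s \<subseteq> Q (Suc s)" unfolding Q_def same_def by (auto simp: less_Suc_eq)
  ultimately have "Q s \<subset> Q (Suc s)" by blast
  then have "card (Q s) < card (Q (Suc s))" by (rule psubset_card_mono[OF fin])
  then show ?case using Suc by simp
 qed simp
 then have "g \<le> card (Q g)" by simp
 also have "\<dots> \<le> card ({..<n} \<times> {..<n})" unfolding Q_def by (intro card_mono) auto
 finally show False using g by (simp add: card_cartesian_product)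
qed

end

text \<open>\<open>fam (ix A)\<close> is the smallest member around \<open>A\<close>; earlier members divide it into blocks, named by their
 least vertices, and 0 names the block of everything outside.\<close>

locale famctx = ugraph +
 fixes g :: nat and fam :: "nat \<Rightarrow> nat set"
 assumes famok: "famok g fam" and full: "\<exists>t<g. fam t = {1..<n}"
begin

definition ix :: "nat set \<Rightarrow> nat" where "ix A = (LEAST t. t < g \<and> A \<subseteq> fam t)"

definition blkt :: "nat \<Rightarrow> nat \<Rightarrow> nat" where
 "blkt t v = (if v \<in> fam t then LEAST y. y \<in> fam t \<and> same t fam v y else 0)"

lemma ix_props:
 assumes "A \<subseteq> {1..<n}"
 shows "ix A < g" "A \<subseteq> fam (ix A)" "\<And>t. t < g \<Longrightarrow> A \<subseteq> fam t \<Longrightarrow> ix A \<le> t"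
proof -
 obtain t where "t < g" "fam t = {1..<n}" using full by blast
 then have "t < g \<and> A \<subseteq> fam t" using assms by simp
 from LeastI[of "\<lambda>t. t < g \<and> A \<subseteq> fam t", OF this]
 show "ix A < g" "A \<subseteq> fam (ix A)" unfolding ix_def by simp_all
 show "\<And>t. t < g \<Longrightarrow> A \<subseteq> fam t \<Longrightarrow> ix A \<le> t" unfolding ix_def by (rule Least_le) simp
qed

lemma ix_Inter:
 assumes "A \<subseteq> {1..<n}" "A \<noteq> {}" "t < g" "A \<subseteq> fam t"
 shows "fam (ix A) \<subseteq> fam t"
proof (cases "ix A = t")
 case False
 then have "ix A < t" using ix_props(3)[OF assms(1,3,4)] by simp
 moreover obtain x where "x \<in> A" using assms(2) by blast
 ultimately show ?thesis
  using laminar[OF famok _ assms(3), of "ix A" x] ix_props(2)[OF assms(1)] assms(4) by blast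
qed simp

context
 fixes t assumes t: "t < g"
begin

lemma tsame: "same t fam x x" "same t fam x y \<Longrightarrow> same t fam y x"
  "same t fam x y \<Longrightarrow> same t fam y z \<Longrightarrow> same t fam x z"
proof -
 note e = same_equiv[OF famok less_imp_le[OF t]]
 show "same t fam x x" by (rule e(1))
 show "same t fam x y \<Longrightarrow> same t fam y x" by (rule e(2))
 show "same t fam x y \<Longrightarrow> same t fam y z \<Longrightarrow> same t fam x z" by (rule e(3))
qed

lemma fam_sub: "fam t \<subseteq> {1..<n}" by (rule famokD(1)[OF famok t])

lemma blkt_rep:
 assumes "v \<in> fam t"
 shows "blkt t v \<in> fam t" "same t fam v (blkt t v)" "blkt t v \<noteq> 0"
proof -
 have "v \<in> fam t \<and> same t fam v v" using assms tsame(1) by simp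
 from LeastI[of "\<lambda>y. y \<in> fam t \<and> same t fam v y", OF this]
 show 1: "blkt t v \<in> fam t" "same t fam v (blkt t v)" unfolding blkt_def using assms by simp_all
 from 1(1) fam_sub show "blkt t v \<noteq> 0" by auto
qed

lemma blkt_eq:
 assumes "u \<in> fam t" "v \<in> fam t"
 shows "blkt t u = blkt t v \<longleftrightarrow> same t fam u v"
proof
 assume e: "blkt t u = blkt t v"
 have "same t fam u (blkt t v)" using blkt_rep(2)[OF assms(1)] e by simp
 moreover have "same t fam (blkt t v) v" using blkt_rep(2)[OF assms(2)] tsame(2) by blast
 ultimately show "same t fam u v" using tsame(3) by blast
next
 assume "same t fam u v"
 then have "same t fam u y = same t fam v y" for y using tsame(2,3) by blast
 then show "blkt t u = blkt t v" unfolding blkt_def using assms by simp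
qed

lemma blkt_0: "v \<notin> fam t \<longleftrightarrow> blkt t v = 0"
 using blkt_rep(3) unfolding blkt_def by auto

lemma blkt_eq_all: "blkt t u = blkt t v \<longleftrightarrow>
  (u \<notin> fam t \<and> v \<notin> fam t) \<or> (u \<in> fam t \<and> v \<in> fam t \<and> same t fam u v)"
 using blkt_eq blkt_0 by metis

text \<open>By laminarity the latest earlier member containing \<open>v\<close> contains all the
  others that contain \<open>v\<close>. So a block inside \<open>fam t\<close> is a vertex or itself
  a member, which lets the recursion continue inside it.\<close>

lemma class_cases:
 assumes "v \<in> fam t"
 shows "{u. u < n \<and> blkt t u = blkt t v} = {v} \<or>
   (\<exists>s<t. {u. u < n \<and> blkt t u = blkt t v} = fam s)"
proof -
 let ?C = "{u. u < n \<and> blkt t u = blkt t v}"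
 have C: "?C = {u. u \<in> fam t \<and> same t fam u v}"
  using blkt_eq_all assms fam_sub by fastforce
 show ?thesis
 proof (cases "\<exists>s<t. v \<in> fam s")
  case False
  then have "?C = {v}" unfolding C same_def using assms by auto
  then show ?thesis by blast
 next
  case True
  define s where "s = (GREATEST s. s < t \<and> v \<in> fam s)"
  have s: "s < t \<and> v \<in> fam s" unfolding s_def
   using True GreatestI_nat[of "\<lambda>s. s < t \<and> v \<in> fam s" _ t] by auto
  have mx: "s' \<le> s" if "s' < t" "v \<in> fam s'" for s'
   unfolding s_def using that Greatest_le_nat[of "\<lambda>s. s < t \<and> v \<in> fam s" s' t] by auto
  have "?C = fam s"
  proof (intro set_eqI iffI)
   fix u assume "u \<in> ?C"
   then have "same t fam u v" unfolding C by simp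
   then show "u \<in> fam s" unfolding same_def
   proof (elim disjE exE conjE)
    fix s' assume s': "s' < t" "u \<in> fam s'" "v \<in> fam s'"
    show "u \<in> fam s"
    proof (cases "s' = s")
     case False
     then have "s' < s" using mx[OF s'(1,3)] by simp
     moreover have "s < g" using s t by simp
     ultimately show ?thesis using laminar[OF famok _ _ s'(3)] s s'(2) by blast
    qed (use s' in simp)
   qed (use s in simp)
  next
   fix u assume u: "u \<in> fam s"
   have "fam s \<subseteq> fam t" using laminar[OF famok _ t, of s v] s assms by blast
   then show "u \<in> ?C" unfolding C same_def using u s by blast
  qed
  then show ?thesis using s by blast
 qed
qed

lemma blkt_good:
 assumes "b \<in> blkt t ` {..<n}"
 shows "good {v. v < n \<and> blkt t v = b}"
proof -
 obtain v where v: "v < n" "b = blkt t v" using assms by blast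
 show ?thesis
 proof (cases "v \<in> fam t")
  case True
  from class_cases[OF this] show ?thesis
  proof
   assume "\<exists>s<t. {u. u < n \<and> blkt t u = blkt t v} = fam s"
   then obtain s where "s < t" "{u. u < n \<and> blkt t u = blkt t v} = fam s" by blast
   then show ?thesis using famokD(2)[OF famok, of s] t v by simp
  qed (use good_single v in simp)
 next
  case False
  then have "b = 0" using v blkt_0 by simp
  then have "{v. v < n \<and> blkt t v = b} = {..<n} - fam t" using blkt_0 by auto
  then show ?thesis using good_compl[OF famokD(2)[OF famok t]] by simp
 qed
qed

end

end

section \<open>Nodes of the decomposition\<close>

locale nodes = famctx +
 fixes K :: nat
 assumes K0: "K > 0"
begin

definition wgt :: "nat \<Rightarrow> nat \<Rightarrow> nat" where
 "wgt t b = card {p. p < n * (4 * K) \<and> blocks.Fr n adj (blkt t) (p div (4 * K)) \<and>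
   (p mod (4 * K) = 0 \<or> card (blocks.F n adj (blkt t) (blkt t (p div (4 * K)))) \<ge> K) \<and>
   blkt t (p div (4 * K)) = b}"

text \<open>Primality of the quotient: a good union of blocks inside \<open>fam t\<close> is a good
  closed set, so by minimality of the member it is all of \<open>fam t\<close> or a single class. In
  a disconnected graph \<open>t = 0\<close>, with no earlier members, makes all blocks single
  vertices.\<close>

lemma ctx:
 assumes t: "t < g" and ne: "fam t \<noteq> {}" and disc: "\<not> conn \<Longrightarrow> t = 0"
 shows "prime_points n adj (blkt t) K (wgt t) (4 * K)"
proof -
 interpret B: point_blocks n adj "blkt t" K "wgt t" "4 * K"
  by unfold_locales (use K0 in \<open>simp_all add: wgt_def\<close>)
 have f1: "fam t \<subseteq> {1..<n}" by (rule fam_sub[OF t])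
 then have f0: "fam t \<subseteq> {..<n}" "0 \<notin> fam t" by auto
 have "prime_blocks n adj (blkt t) K (wgt t)"
 proof
  show "good {v. v < n \<and> blkt t v = b}" if "b \<in> B.BL" for b
   using blkt_good[OF t] that unfolding B.BL_def .
  show "2 \<le> card B.BL"
  proof -
   obtain v where v: "v \<in> fam t" using ne by blast
   have "blkt t v \<in> B.BL" using v f0 unfolding B.BL_def by auto
   moreover have "blkt t 0 \<in> B.BL" using n unfolding B.BL_def by auto
   moreover have "blkt t 0 = 0" using f0(2) blkt_0[OF t] by simp
   moreover have "blkt t v \<noteq> 0" by (rule blkt_rep(3)[OF t v])
   ultimately have "{0, blkt t v} \<subseteq> B.BL" "card {0, blkt t v} = 2" by auto
   then show ?thesis using card_mono[of B.BL "{0, blkt t v}"] unfolding B.BL_def by simp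
  qed
  show "u = v" if h: "\<not> conn" "u < n" "v < n" "blkt t u = blkt t v" for u v
  using famokD(6) famok h(1) h(4) blkt_eq_all t disc h(2,3) same_def by fastforce
  show "(\<exists>b. W = {b}) \<or> (\<exists>b. B.BL - W = {b})"
   if h: "conn" "W \<subseteq> B.BL" "W \<noteq> {}" "W \<noteq> B.BL" "good (B.ext W)" for W
  proof -
   \<comment> \<open>Sets avoiding the outer block 0 suffice, since goodness passes to
     complements.\<close>
   have main: "(\<exists>b. X = {b}) \<or> X = B.BL - {0}" if X: "X \<subseteq> B.BL" "X \<noteq> {}" "0 \<notin> X" "good (B.ext X)" for X
   proof -
    have sub: "B.ext X \<subseteq> fam t"
    proof (rule subsetI, rule ccontr)
     fix x assume x: "x \<in> B.ext X" "x \<notin> fam t"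
     then have "blkt t x = 0" using blkt_0[OF t, of x] by blast
     then show False using x(1) X(3) unfolding B.ext_def by simp
    qed
    show ?thesis
    proof (cases "B.ext X = fam t")
     case True
     have "b \<in> X" if b: "b \<in> B.BL - {0}" for b
     proof -
      obtain v where v: "v < n" "b = blkt t v" using b unfolding B.BL_def by blast
      have "v \<in> fam t"
      using blkt_0 t v b by blast
      then have "v \<in> B.ext X" using True by simp
      then show ?thesis using v unfolding B.ext_def by simp
     qed
     then show ?thesis using X by blast
    next
     case False
     then have ps: "B.ext X \<subset> fam t" using sub by blast
     have cl: "Eclosed (same t fam) (B.ext X)"
      unfolding Eclosed_def
     proof (intro ballI allI impI)
      fix x v assume x: "x \<in> B.ext X" "v < n" "same t fam x v"
      have xf: "x \<in> fam t" using x(1) sub by blast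
      have "v \<in> fam t" using famokD(3)[OF famok t] xf x(2,3) unfolding Eclosed_def by blast
      then have "blkt t x = blkt t v" using blkt_eq[OF t xf] x(3) by blast
      then show "v \<in> B.ext X" using x(1,2) unfolding B.ext_def by simp
     qed
     have all: "same t fam x y" if "x \<in> B.ext X" "y \<in> B.ext X" for x y
      by (rule famokD(5)[OF famok t h(1) ps X(4) cl that])
     have "b = c" if bc: "b \<in> X" "c \<in> X" for b c
     proof -
      obtain u v where "u < n" "b = blkt t u" "v < n" "c = blkt t v"
       using bc X(1) unfolding B.BL_def by blast
      moreover from this have "u \<in> B.ext X" "v \<in> B.ext X" using bc unfolding B.ext_def by auto
      ultimately show ?thesis using all[of u v] blkt_eq[OF t, of u v] sub by auto
     qed
     then show ?thesis using X(2) by blast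
    qed
   qed
   have 0: "0 \<in> B.BL"
   proof -
    have "blkt t 0 = 0" using f0(2) blkt_0[OF t] by simp
    then show ?thesis using n unfolding B.BL_def by (metis imageI lessThan_iff less_eq_Suc_le One_nat_def)
   qed
   show ?thesis
   proof (cases "0 \<in> W")
    case False
    from main[OF h(2,3) False h(5)] show ?thesis
    proof
     assume "W = B.BL - {0}"
     then have "B.BL - W = {0}" using 0 by auto
     then show ?thesis by blast
    qed blast
   next
    case True
    have "B.ext (B.BL - W) = {..<n} - B.ext W" unfolding B.ext_def B.BL_def by auto
    then have "good (B.ext (B.BL - W))" using good_compl[OF h(5)] by simp
    moreover have "B.BL - W \<noteq> {}" using h(2,4) by auto
    ultimately have "(\<exists>b. B.BL - W = {b}) \<or> B.BL - W = B.BL - {0}"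
     using True main[of "B.BL - W"] by auto
    then show ?thesis
    proof
     assume e: "B.BL - W = B.BL - {0}"
     have "B.BL - (B.BL - W) = W" "B.BL - (B.BL - {0}) = {0}" using h(2) 0 by (auto intro: double_diff)
     then have "W = {0}" unfolding e by (rule trans[OF sym])
     then show ?thesis by blast
    qed blast
   qed
  qed
  show "wgt t b = card (B.F b)" if "card (B.F b) < K" for b by (rule B.light_weight[OF that])
  show "4 * K \<le> wgt t b" if "K \<le> card (B.F b)" for b by (rule B.heavy_weight[OF that])
 qed
 then show ?thesis unfolding prime_points_def using B.point_blocks_axioms by blast
qed

definition covered :: "nat \<Rightarrow> nat set \<Rightarrow> bool" where
 "covered t X \<longleftrightarrow> (\<exists>Z. wgraph.cov (blocks.BL n (blkt t)) (blocks.badj n adj (blkt t)) Z (blkt t ` X) \<and>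
   sum (wgt t) Z < 4 * K)"

definition bclosed :: "nat \<Rightarrow> nat set \<Rightarrow> bool" where
 "bclosed t X \<longleftrightarrow> (\<forall>x\<in>X. \<forall>y<n. blkt t x = blkt t y \<longrightarrow> y \<in> X)"

text \<open>The invariant of the recursion. A full member of the family is exempt from the cover
  condition because its cut is cheap anyway; see \<open>ninv_cut\<close>.\<close>

definition ninv :: "nat set \<Rightarrow> bool" where
 "ninv A \<longleftrightarrow> A = {..<n} \<or> (\<exists>v<n. A = {v}) \<or>
   (A \<noteq> {} \<and> A \<subseteq> {1..<n} \<and> bclosed (ix A) A \<and> (A = fam (ix A) \<or> covered (ix A) A))"

lemma disc_ix: "A \<subseteq> {1..<n} \<Longrightarrow> \<not> conn \<Longrightarrow> ix A = 0"
proof -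
 assume A: "A \<subseteq> {1..<n}" and c: "\<not> conn"
 have "0 < g" using full by (metis less_nat_zero_code not_gr_zero)
 moreover from famokD(6)[OF famok this c] A have "A \<subseteq> fam 0" by simp
 ultimately show "ix A = 0" using ix_props(3)[OF A, of 0] by simp
qed

lemma ix_ctx:
 assumes "A \<subseteq> {1..<n}" "A \<noteq> {}"
 shows "prime_points n adj (blkt (ix A)) K (wgt (ix A)) (4 * K)"
using ctx ix_props(1) assms(1) ix_props(2) assms(2) disc_ix by blast

lemma fam_bclosed:
 assumes "t < g"
 shows "bclosed t (fam t)"
 unfolding bclosed_def using blkt_eq_all[OF assms] by blast

lemma fam_ix:
 assumes "s < g" "fam s \<noteq> {}"
 shows "fam (ix (fam s)) = fam s"
proof -
 have "fam s \<subseteq> {1..<n}" by (rule fam_sub[OF assms(1)])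
 from ix_Inter[OF this assms(2,1)] ix_props(2)[OF this] show ?thesis by auto
qed

lemma ninv_fam:
 assumes "s < g" "fam s \<noteq> {}"
 shows "ninv (fam s)"
using fam_sub fam_bclosed ix_props(1) fam_ix assms ninv_def by metis

lemma ninv_children_top:
 assumes "n \<ge> 2"
 shows "ninv {0}" "ninv {1..<n}"
proof -
 show "ninv {0}" unfolding ninv_def using n by auto
 obtain s where "s < g" "fam s = {1..<n}" using full by blast
 then show "ninv {1..<n}" using ninv_fam[of s] assms by auto
qed

text \<open>A part inside one block is that block, hence a vertex or an earlier member, which starts
  a quotient of its own. A part meeting two blocks keeps the quotient of \<open>A\<close>: an
  earlier member around it would have merged these blocks.\<close>

lemma ninv_child:
 assumes A: "A \<subseteq> {1..<n}" and X: "X \<subseteq> A" "X \<noteq> {}" "bclosed (ix A) X"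
  and c: "(\<forall>x\<in>X. \<forall>y\<in>X. blkt (ix A) x = blkt (ix A) y) \<or> covered (ix A) X"
 shows "ninv X"
proof (cases "\<forall>x\<in>X. \<forall>y\<in>X. blkt (ix A) x = blkt (ix A) y")
 case True
 obtain v where v: "v \<in> X" using X(2) by blast
 have t: "ix A < g" by (rule ix_props(1)[OF A])
 have vf: "v \<in> fam (ix A)" "v < n" using v X(1) A ix_props(2)[OF A] by auto
 have "X = {u. u < n \<and> blkt (ix A) u = blkt (ix A) v}"
 proof (intro set_eqI iffI)
  fix u assume u: "u \<in> X"
  then have "u < n" using X(1) A by auto
  moreover have "blkt (ix A) u = blkt (ix A) v" using True[rule_format, OF u v] .
  ultimately show "u \<in> {u. u < n \<and> blkt (ix A) u = blkt (ix A) v}" by blast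
 next
  fix u assume "u \<in> {u. u < n \<and> blkt (ix A) u = blkt (ix A) v}"
  then have "u < n" "blkt (ix A) v = blkt (ix A) u" by simp_all
  then show "u \<in> X" using X(3) v unfolding bclosed_def by blast
 qed
 with class_cases[OF t vf(1)] have "X = {v} \<or> (\<exists>s<ix A. X = fam s)" by metis
 then show ?thesis
 proof
  assume "X = {v}"
  then show ?thesis unfolding ninv_def using vf(2) by blast
 next
  assume "\<exists>s<ix A. X = fam s"
  then obtain s where "s < ix A" "X = fam s" by blast
  then show ?thesis using ninv_fam[of s] t X(2) by simp
 qed
next
 case False
 then obtain x y where xy: "x \<in> X" "y \<in> X" "blkt (ix A) x \<noteq> blkt (ix A) y" by blast
 have X1: "X \<subseteq> {1..<n}" using X(1) A by blast
 have t: "ix A < g" by (rule ix_props(1)[OF A])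
 have XA: "X \<subseteq> fam (ix A)" using X(1) ix_props(2)[OF A] by blast
 have "ix X \<le> ix A" by (rule ix_props(3)[OF X1 t XA])
 moreover have "\<not> ix X < ix A"
 proof
  assume "ix X < ix A"
  then have "same (ix A) fam x y" unfolding same_def using ix_props(2)[OF X1] xy(1,2) by blast
  then show False using blkt_eq[OF t, of x y] xy XA by blast
 qed
 ultimately have "ix X = ix A" by simp
 then show ?thesis unfolding ninv_def using c False X X1 by simp
qed

text \<open>In a connected graph a full member has a good cut; in a disconnected one it is
  everything but vertex 0, and \<open>{0}\<close> covers its cut.\<close>

lemma ninv_cut:
 assumes "ninv A" "A \<noteq> {..<n}"
 shows "(\<exists>Z. vcov Z A \<and> card Z < 4 * K) \<or> (conn \<and> good A)"
proof -
 have single: "vcov {v} A" if "A = {v} \<or> A = {..<n} - {v}" for v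
  unfolding vcov_def using that adj_n by auto
 from assms consider v where "v < n" "A = {v}"
  | "A \<noteq> {}" "A \<subseteq> {1..<n}" "bclosed (ix A) A" "A = fam (ix A) \<or> covered (ix A) A"
  unfolding ninv_def by blast
 then show ?thesis
 proof cases
  case 1
  then show ?thesis using single[of v] K0 by (intro disjI1 exI[of _ "{v}"]) auto
 next
  case 2
  interpret C: prime_points n adj "blkt (ix A)" K "wgt (ix A)" "4 * K" by (rule ix_ctx[OF 2(2,1)])
  have t: "ix A < g" by (rule ix_props(1)[OF 2(2)])
  from 2(4) show ?thesis
  proof
   assume e: "A = fam (ix A)"
   show ?thesis
   using famokD(2) famok t e famokD(6) single compl0 K0 disjI1 exI by fastforce
  next
   assume "covered (ix A) A"
   then obtain Z where Z: "C.cov Z (blkt (ix A) ` A)" "C.wt Z < 4 * K" unfolding covered_def by blast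
   have "C.ext (blkt (ix A) ` A) = A"
    using 2(2,3) unfolding C.ext_def bclosed_def by (auto; metis)
   with C.cov_vcov[OF Z] show ?thesis by simp
  qed
 qed
qed

text \<open>A node inside one block would be a vertex or lie in an earlier member, against the
  choice of \<open>ix A\<close>.\<close>

lemma two_blocks:
 assumes A: "ninv A" "A \<subseteq> {1..<n}" "card A \<ge> 2"
 shows "card (blkt (ix A) ` A) \<ge> 2" "bclosed (ix A) A" "A = fam (ix A) \<or> covered (ix A) A"
proof -
 have ns: "A \<noteq> {v}" for v using A(3) by auto
 have "0 \<notin> A" using A(2) by auto
 moreover have "0 \<in> {..<n}" using n by simp
 ultimately have "A \<noteq> {..<n}" by metis
 then have i: "A \<noteq> {}" "bclosed (ix A) A" "A = fam (ix A) \<or> covered (ix A) A"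
  using A(1) ns unfolding ninv_def by auto
 then show "bclosed (ix A) A" "A = fam (ix A) \<or> covered (ix A) A" by auto
 show "card (blkt (ix A) ` A) \<ge> 2"
 proof (rule ccontr)
  assume "\<not> ?thesis"
  moreover have fin: "finite (blkt (ix A) ` A)" using A(2) finite_subset by blast
  moreover have "card (blkt (ix A) ` A) \<noteq> 0" using fin i(1) by simp
  ultimately have "card (blkt (ix A) ` A) = 1" by linarith
  then obtain b where b: "blkt (ix A) ` A = {b}" by (rule card_1_singletonE)
  obtain v where v: "v \<in> A" using i(1) by blast
  have t: "ix A < g" by (rule ix_props(1)[OF A(2)])
  have vf: "v \<in> fam (ix A)" using v ix_props(2)[OF A(2)] by auto
  have eq: "blkt (ix A) u = blkt (ix A) v" if "u \<in> A" for u using b that v by (metis imageI singletonD)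
  have sub: "A \<subseteq> {u. u < n \<and> blkt (ix A) u = blkt (ix A) v}"
   using eq A(2) by auto
  from class_cases[OF t vf] show False
  proof
   assume "{u. u < n \<and> blkt (ix A) u = blkt (ix A) v} = {v}"
   then have "A = {v}" using sub v by auto
   then show False using ns by simp
  next
   assume "\<exists>s<ix A. {u. u < n \<and> blkt (ix A) u = blkt (ix A) v} = fam s"
   then obtain s where "s < ix A" "A \<subseteq> fam s" using sub by auto
   then show False using ix_props(3)[OF A(2), of s] t by simp
  qed
 qed
qed

definition small_tree :: "nat bt \<Rightarrow> bool" where
 "small_tree T \<longleftrightarrow> dis T \<and> lv T = {..<n} \<and>
   (\<forall>Y\<in>subs T. Y = {..<n} \<or> (\<exists>Z. vcov Z Y \<and> 3 * card Z < K) \<or> (conn \<and> good Y))"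

text \<open>The outer block 0 serves as the root block, because the remaining blocks are exactly
  those of \<open>fam t\<close>.\<close>

lemma node_cut:
 fixes A defines "t \<equiv> ix A"
 assumes T: "small_tree T" and A: "ninv A" "A \<subseteq> {1..<n}" "card A \<ge> 2"
  and cov_eq: "cv = wgraph.cov (blocks.BL n (blkt t)) (blocks.badj n adj (blkt t))"
  and S: "cv S (blkt t ` A)" "\<And>S'. cv S' (blkt t ` A) \<Longrightarrow> sum (wgt t) S \<le> sum (wgt t) S'"
 shows "(\<exists>b\<in>blkt t ` A. blkt t ` A - {b} \<noteq> {} \<and>
    wgraph.okc (blocks.BL n (blkt t)) (wgt t) (blocks.badj n adj (blkt t)) K (blkt t ` A - {b})) \<or>
  (\<exists>W Z. sum (wgt t) S < 4 * K \<and> W \<subseteq> blocks.BL n (blkt t) \<and> cv Z W \<and> sum (wgt t) Z < K \<and>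
   blkt t ` A \<inter> W \<noteq> {} \<and> blkt t ` A - W \<noteq> {} \<and>
   sum (wgt t) (S \<inter> W) \<le> 3 * K \<and> sum (wgt t) (S - W) \<le> 3 * K)"
proof -
 have ne: "A \<noteq> {}" using A(3) by auto
 interpret C: prime_points n adj "blkt t" K "wgt t" "4 * K" unfolding t_def by (rule ix_ctx[OF A(2) ne])
 note tb = two_blocks[OF A, folded t_def]
 have tg: "t < g" unfolding t_def by (rule ix_props(1)[OF A(2)])
 have At: "A \<subseteq> fam t" unfolding t_def by (rule ix_props(2)[OF A(2)])
 have f0: "0 \<notin> fam t" using fam_sub[OF tg] by auto
 have b0: "blkt t 0 = 0" using f0 blkt_0[OF tg] by simp
 have 0: "0 \<in> C.BL" using n b0 unfolding C.BL_def by (metis imageI lessThan_iff less_eq_Suc_le One_nat_def)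
 have U: "C.BL - {0} = blkt t ` fam t"
 using C.BL_def blkt_0 tg fam_sub by fastforce
 have "C.small Y" if "Y \<in> subs T" "Y \<noteq> {..<n}" for Y
  using T that unfolding small_tree_def C.small_def by blast
 then obtain t' where t': "dis t'" "lv t' = C.BL - {0}" "\<forall>W\<in>subs t'. C.fine (C.BL - {0}) W"
  using C.block_tree[OF _ _ _ 0, of T] T unfolding small_tree_def by blast
 have sub: "blkt t ` A \<subseteq> C.BL - {0}" unfolding U using At by blast
 have or: "blkt t ` A = C.BL - {0} \<or> (\<exists>S. C.cov S (blkt t ` A) \<and> C.wt S < 4 * K)"
  using tb(3) unfolding U covered_def by auto
 have fineW: "C.fine (C.BL - {0}) W" if "W \<in> subs t'" for W using t'(3) that by blast
 show ?thesis
  unfolding cov_eq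
  by (rule C.cut_exists[OF t'(1,2) fineW refl sub tb(1) or K0]) (use S cov_eq in simp_all)
qed

end

section \<open>Decompositions as binary trees\<close>

lemma connected_iff_rtrancl:
 assumes "pair_graph G"
 shows "connected (with_proj G) \<longleftrightarrow>
  pverts G \<noteq> {} \<and> (\<forall>u\<in>pverts G. \<forall>v\<in>pverts G. (u, v) \<in> (parcs G)\<^sup>*)"
proof -
 interpret pair_graph G by fact
 have s: "(parcs G)\<^sup>s = parcs G" unfolding symcl_def using arcs_symmetric by auto
 have r: "(u, v) \<in> rtrancl_on (pverts G) (parcs G) \<longleftrightarrow> (u, v) \<in> (parcs G)\<^sup>*" if "u \<in> pverts G" for u v
  using reachable_conv'[OF that, of v] unfolding reachable_def with_proj_simps .
 show ?thesis
  unfolding connected_conv with_proj_simps s using r by blast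
qed

lemma out_degree_card: "out_degree (with_proj G) v = card {w. (v, w) \<in> parcs G}"
proof -
 have "out_arcs (with_proj G) v = Pair v ` {w. (v, w) \<in> parcs G}"
  unfolding out_arcs_def with_proj_simps by (auto simp: image_iff)
 then show ?thesis unfolding out_degree_def by (simp add: card_image inj_on_def)
qed

locale utree = pair_graph T for T :: "'b pair_pre_digraph" +
 assumes tree: "undirected_tree T"
begin

text \<open>The component on the side of \<open>v\<close>; the order of arguments is opposite to
  that of \<open>cut_side\<close>.\<close>

definition C :: "'b \<Rightarrow> 'b \<Rightarrow> 'b set" where
 "C u v = {x. (v, x) \<in> (parcs T - {(u, v), (v, u)})\<^sup>*}"

lemma arcs_sym: "(a, b) \<in> parcs T \<Longrightarrow> (b, a) \<in> parcs T"
 by (rule arcs_symmetric)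

lemma no_back_path:
 assumes "apath a p b" "length p \<ge> 2" "(b, a) \<in> parcs T"
 shows False
proof -
 have p: "awalk a p b" "distinct (pawalk_verts a p)" using assms(1) unfolding apath_def by auto
 have p0: "p \<noteq> []" using assms(2) by auto
 have v: "pawalk_verts x (q @ [(y, z)]) = pawalk_verts x q @ [z]" if "pcas x q y" for x q y z
  using that by (induction q arbitrary: x) auto
 have c: "pcas a p b" using p(1) unfolding awalk_def by simp
 have vs: "pawalk_verts a (p @ [(b, a)]) = pawalk_verts a p @ [a]" by (rule v[OF c])
 have h: "pawalk_verts a p = a # tl (pawalk_verts a p)" using p0 c by (cases p) auto
 have "distinct (tl (pawalk_verts a p) @ [a])"
  using p(2) h by (metis distinct.simps(2) distinct_append distinct_singleton disjoint_insert(1) inf_bot_right list.simps(15) empty_set)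
 moreover have "tl (pawalk_verts a (p @ [(b, a)])) = tl (pawalk_verts a p) @ [a]"
  unfolding vs using h by (metis append_Cons list.sel(3))
 moreover have "awalk a (p @ [(b, a)]) a"
  using p(1) assms(3) by (auto simp: awalk_append_iff awalk_simps)
 ultimately have "cycle (p @ [(b, a)])" unfolding cycle_def by auto
 moreover have "length (p @ [(b, a)]) \<ge> 3" using assms(2) by simp
 ultimately show False using tree unfolding undirected_tree_def by blast
qed

lemma C_self: "v \<in> C u v" unfolding C_def by simp

text \<open>Another path from \<open>v\<close> to \<open>u\<close> would close with the edge to a
  cycle of length at least three.\<close>

lemma C_not:
 assumes "(u, v) \<in> parcs T"
 shows "u \<notin> C u v"
proof
 assume "u \<in> C u v"
 let ?A = "parcs T - {(u, v), (v, u)}"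
 let ?H = "\<lparr>pverts = pverts T, parcs = ?A\<rparr>"
 interpret H: pair_wf_digraph ?H by unfold_locales (auto dest: in_arcsD1 in_arcsD2)
 have vV: "v \<in> pverts T" using assms by (rule in_arcsD2)
 have ne: "u \<noteq> v" using no_loops'[OF assms] .
 have "reachable (with_proj ?H) v u" using H.reachable_conv'[of v u] \<open>u \<in> C u v\<close> vV unfolding C_def by simp
 then obtain p where p: "H.apath v p u" using H.reachable_apath by blast
 have pT: "apath v p u"
  using p unfolding H.apath_def apath_def H.awalk_def awalk_def by auto
 have "p \<noteq> []" using p ne unfolding H.apath_def H.awalk_def by auto
 moreover have "p \<noteq> [e]" for e
 proof
  assume "p = [e]"
  then have "e = (v, u)" "e \<in> ?A" using p unfolding H.apath_def H.awalk_def by (auto simp: prod_eq_iff)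
  then show False by simp
 qed
 ultimately have "length p \<ge> 2" by (cases p; cases "tl p") auto
 from no_back_path[OF pT this assms] show False .
qed

text \<open>As \<open>v\<close> itself is out of reach, paths on the side of \<open>w\<close> avoid
  it altogether; in this form they survive the removal of any other edge at
  \<open>v\<close>.\<close>

lemma C_avoids:
 assumes vw: "(v, w) \<in> parcs T" and x: "x \<in> C v w"
 shows "(w, x) \<in> {(a, b) \<in> parcs T. a \<noteq> v \<and> b \<noteq> v}\<^sup>*"
proof -
 have "(w, x) \<in> (parcs T - {(v, w), (w, v)})\<^sup>*" using x unfolding C_def by simp
 then show ?thesis
 proof (induction rule: rtrancl_induct)
  case (step a b)
  have "a \<in> C v w" "b \<in> C v w" using step(1,2) unfolding C_def by (auto intro: rtrancl_into_rtrancl)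
  then have "a \<noteq> v" "b \<noteq> v" using C_not[OF vw] by auto
  then have "(a, b) \<in> {(a, b) \<in> parcs T. a \<noteq> v \<and> b \<noteq> v}" using step(2) by blast
  then show ?case using step(3) by (rule rtrancl_into_rtrancl[rotated])
 qed simp
qed

lemma avoid_mono:
 assumes "(w, x) \<in> {(a, b) \<in> parcs T. a \<noteq> v \<and> b \<noteq> v}\<^sup>*"
 shows "(w, x) \<in> (parcs T - {(u, v), (v, u)})\<^sup>*"
 using assms by (rule rtrancl_mono[THEN subsetD, rotated]) auto

lemma C_split:
 assumes uv: "(u, v) \<in> parcs T"
 shows "C u v = insert v (\<Union>w\<in>{w. (v, w) \<in> parcs T} - {u}. C v w)" (is "_ = ?R")
proof
 have ne: "u \<noteq> v" using no_loops'[OF uv] .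
 show "C u v \<subseteq> ?R"
 proof
  fix x assume "x \<in> C u v"
  then have "(v, x) \<in> (parcs T - {(u, v), (v, u)})\<^sup>*" unfolding C_def by simp
  then show "x \<in> ?R"
  proof (induction rule: rtrancl_induct)
   case (step a b)
   show ?case
   proof (cases "a = v")
    case True
    then have "b \<in> {w. (v, w) \<in> parcs T} - {u}" using step(2) by auto
    then show ?thesis using C_self[of b v] by blast
   next
    case False
    then obtain w where w: "(v, w) \<in> parcs T" "w \<noteq> u" "a \<in> C v w" using step(3) by blast
    show ?thesis
    proof (cases "b = v")
     case False
     have "(a, b) \<in> parcs T - {(v, w), (w, v)}" using step(2) False \<open>a \<noteq> v\<close> by blast
     then have "b \<in> C v w" using w(3) unfolding C_def by (auto intro: rtrancl_into_rtrancl)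
     then show ?thesis using w by blast
    qed simp
   qed
  qed simp
 qed
 show "?R \<subseteq> C u v"
 proof
  fix x assume "x \<in> ?R"
  then consider "x = v" | w where "(v, w) \<in> parcs T" "w \<noteq> u" "x \<in> C v w" by blast
  then show "x \<in> C u v"
  proof cases
   case 2
   have "(v, w) \<in> parcs T - {(u, v), (v, u)}" using 2 ne by auto
   moreover have "(w, x) \<in> (parcs T - {(u, v), (v, u)})\<^sup>*"
    by (rule avoid_mono[OF C_avoids[OF 2(1,3)]])
   ultimately show ?thesis unfolding C_def by (simp add: converse_rtrancl_into_rtrancl)
  qed (simp add: C_self)
 qed
qed

lemma avoid_sym:
 assumes "(w, x) \<in> {(a, b) \<in> parcs T. a \<noteq> v \<and> b \<noteq> v}\<^sup>*"
 shows "(x, w) \<in> {(a, b) \<in> parcs T. a \<noteq> v \<and> b \<noteq> v}\<^sup>*"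
proof -
 have "sym {(a, b) \<in> parcs T. a \<noteq> v \<and> b \<noteq> v}" using arcs_sym by (auto intro: symI)
 then have "sym ({(a, b) \<in> parcs T. a \<noteq> v \<and> b \<noteq> v}\<^sup>*)" by (rule sym_rtrancl)
 then show ?thesis using assms by (rule symD)
qed

lemma C_disjoint:
 assumes w: "(v, w1) \<in> parcs T" "(v, w2) \<in> parcs T" "w1 \<noteq> w2"
 shows "C v w1 \<inter> C v w2 = {}"
proof (rule ccontr)
 assume "\<not> ?thesis"
 then obtain x where x: "x \<in> C v w1" "x \<in> C v w2" by blast
 from C_avoids[OF w(1) x(1)] avoid_sym[OF C_avoids[OF w(2) x(2)]]
 have "(w1, w2) \<in> {(a, b) \<in> parcs T. a \<noteq> v \<and> b \<noteq> v}\<^sup>*" by (rule rtrancl_trans)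
 from avoid_mono[OF this, of w1] have "(w1, w2) \<in> (parcs T - {(w1, v), (v, w1)})\<^sup>*" .
 moreover have "(w2, v) \<in> parcs T - {(w1, v), (v, w1)}"
  using arcs_sym[OF w(2)] w(3) no_loops'[OF w(2)] by auto
 ultimately have "(w1, v) \<in> (parcs T - {(w1, v), (v, w1)})\<^sup>*"
  by (rule rtrancl_into_rtrancl)
 then have "(w1, v) \<in> (parcs T - {(v, w1), (w1, v)})\<^sup>*" by (simp only: insert_commute)
 then have "v \<in> C v w1" unfolding C_def by simp
 then show False using C_not[OF w(1)] by simp
qed

lemma C_sub: "(u, v) \<in> parcs T \<Longrightarrow> C u v \<subseteq> pverts T"
proof
 fix x assume uv: "(u, v) \<in> parcs T" and "x \<in> C u v"
 then have "(v, x) \<in> (parcs T - {(u, v), (v, u)})\<^sup>*" unfolding C_def by simp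
 then show "x \<in> pverts T"
  by cases (use uv in_arcsD2 in auto)
qed

lemma leaves_iff: "v \<in> leaves T \<longleftrightarrow> v \<in> pverts T \<and> card {w. (v, w) \<in> parcs T} \<le> 1"
 unfolding leaves_def out_degree_card by simp

lemma fin_nb: "finite {w. (v, w) \<in> parcs T}"
 by (rule finite_subset[OF _ pair_finite_verts]) (auto dest: in_arcsD2)

text \<open>Induction on the size of the side of \<open>v\<close>. Besides \<open>u\<close>, the
  vertex \<open>v\<close> has at most two neighbours: with none it is a leaf, with two a binary
  node, and with one it is skipped, as the edges on both sides of it induce the same cut.\<close>

lemma side_tree:
 assumes deg: "\<And>v. v \<in> pverts T \<Longrightarrow> card {w. (v, w) \<in> parcs T} \<le> 3"
  and inj: "inj_on \<delta> (leaves T)"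
 shows "(u, v) \<in> parcs T \<Longrightarrow> \<exists>t. dis t \<and> lv t = \<delta> ` (leaves T \<inter> C u v) \<and>
   (\<forall>Y\<in>subs t. \<exists>a b. (a, b) \<in> parcs T \<and> Y = \<delta> ` (leaves T \<inter> C a b))"
proof (induction "card (C u v)" arbitrary: u v rule: less_induct)
 case less
 let ?N = "{w. (v, w) \<in> parcs T} - {u}"
 let ?S = "\<lambda>a b. \<delta> ` (leaves T \<inter> C a b)"
 have vT: "v \<in> pverts T" using less.prems by (rule in_arcsD2)
 have uN: "u \<in> {w. (v, w) \<in> parcs T}" using arcs_sym[OF less.prems] by simp
 have cN: "card {w. (v, w) \<in> parcs T} = Suc (card ?N)"
  using card.remove[OF fin_nb uN] .
 then have le2: "card ?N \<le> 2" using deg[OF vT] by simp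
 have finC: "finite (C u v)" using C_sub[OF less.prems] pair_finite_verts finite_subset by blast
 have IH: "\<exists>t. dis t \<and> lv t = ?S v w \<and> (\<forall>Y\<in>subs t. \<exists>a b. (a, b) \<in> parcs T \<and> Y = ?S a b)"
  if "w \<in> ?N" for w
 proof (rule less.hyps)
  show vw: "(v, w) \<in> parcs T" using that by simp
  have "C v w \<subseteq> C u v - {v}"
   using C_split[OF less.prems] that C_not[OF vw] by blast
  also have "\<dots> \<subset> C u v" using C_self[of v u] by blast
  finally show "card (C v w) < card (C u v)" by (rule psubset_card_mono[OF finC])
 qed
 have vl: "v \<in> leaves T \<longleftrightarrow> ?N = {}"
  unfolding leaves_iff using vT cN fin_nb[of v] by (simp add: card_eq_0_iff)
 have "card ?N = 0 \<or> card ?N = 1 \<or> card ?N = 2" using le2 by linarith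
 then show ?case
 proof (elim disjE)
  assume "card ?N = 0"
  then have e: "?N = {}" using fin_nb[of v] by simp
  have "C u v = {v}" using C_split[OF less.prems] unfolding e by simp
  then have "?S u v = {\<delta> v}" using e vl by simp
  then show ?thesis using less.prems by (intro exI[of _ "Lf (\<delta> v)"]) auto
 next
  assume "card ?N = 1"
  then obtain w where w: "?N = {w}" by (rule card_1_singletonE)
  have "C u v = insert v (C v w)" using C_split[OF less.prems] unfolding w by simp
  moreover have "v \<notin> leaves T" using vl w by simp
  ultimately have "?S u v = ?S v w" by simp
  then show ?thesis using IH[of w] w by simp
 next
  assume "card ?N = 2"
  then obtain w1 w2 where w: "?N = {w1, w2}" "w1 \<noteq> w2" by (meson card_2_iff)
  have ar: "(v, w1) \<in> parcs T" "(v, w2) \<in> parcs T" using w(1) by blast+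
  have "C u v = insert v (C v w1 \<union> C v w2)" using C_split[OF less.prems] unfolding w by simp
  moreover have "v \<notin> leaves T" using vl w by simp
  ultimately have S: "?S u v = ?S v w1 \<union> ?S v w2" by (simp add: Int_Un_distrib image_Un)
  obtain t1 where t1: "dis t1" "lv t1 = ?S v w1" "\<forall>Y\<in>subs t1. \<exists>a b. (a, b) \<in> parcs T \<and> Y = ?S a b"
   using IH[of w1] w(1) by auto
  obtain t2 where t2: "dis t2" "lv t2 = ?S v w2" "\<forall>Y\<in>subs t2. \<exists>a b. (a, b) \<in> parcs T \<and> Y = ?S a b"
   using IH[of w2] w(1) by auto
  have "?S v w1 \<inter> ?S v w2 = \<delta> ` ((leaves T \<inter> C v w1) \<inter> (leaves T \<inter> C v w2))"
   by (rule inj_on_image_Int[symmetric, OF inj]) auto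
  also have "\<dots> = {}" using C_disjoint[OF ar w(2)] by auto
  finally have "dis (Nd t1 t2)" using t1 t2 by simp
  moreover have "lv (Nd t1 t2) = ?S u v" using t1 t2 S by simp
  moreover have "\<exists>a b. (a, b) \<in> parcs T \<and> Y = ?S a b" if "Y \<in> subs (Nd t1 t2)" for Y
  proof -
   from that have "Y = ?S u v \<or> Y \<in> subs t1 \<or> Y \<in> subs t2" using t1(2) t2(2) S by simp
   then show ?thesis using t1(3) t2(3) less.prems by blast
  qed
  ultimately show ?thesis by blast
 qed
qed

text \<open>The new root subdivides the edge between \<open>u\<close> and \<open>v\<close>. The two
  sides are disjoint by acyclicity and exhaustive by connectedness.\<close>

lemma whole_tree:
 assumes deg: "\<And>v. v \<in> pverts T \<Longrightarrow> card {w. (v, w) \<in> parcs T} \<le> 3"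
  and inj: "inj_on \<delta> (leaves T)" and uv: "(u, v) \<in> parcs T"
 shows "\<exists>t. dis t \<and> lv t = \<delta> ` leaves T \<and>
   (\<forall>Y\<in>subs t. Y = \<delta> ` leaves T \<or> (\<exists>a b. (a, b) \<in> parcs T \<and> Y = \<delta> ` (leaves T \<inter> C a b)))"
proof -
 let ?S = "\<lambda>a b. \<delta> ` (leaves T \<inter> C a b)"
 have vu: "(v, u) \<in> parcs T" using arcs_sym[OF uv] .
 have "pverts T \<subseteq> C u v \<union> C v u"
 proof
  fix x assume "x \<in> pverts T"
  moreover have "pair_graph T" ..
  ultimately have "(v, x) \<in> (parcs T)\<^sup>*"
   using tree connected_iff_rtrancl in_arcsD2[OF uv] unfolding undirected_tree_def by blast
  then show "x \<in> C u v \<union> C v u"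
  proof (induction rule: rtrancl_induct)
   case base
   then show ?case using C_self by blast
  next
   case (step a b)
   show ?case
   proof (cases "(a, b) = (u, v) \<or> (a, b) = (v, u)")
    case True
    then show ?thesis using C_self by blast
   next
    case False
    then have "(a, b) \<in> parcs T - {(u, v), (v, u)}" "(a, b) \<in> parcs T - {(v, u), (u, v)}"
     using step(2) by auto
    then show ?thesis using step(3) unfolding C_def by (blast intro: rtrancl_into_rtrancl)
   qed
  qed
 qed
 then have un: "leaves T \<inter> C u v \<union> leaves T \<inter> C v u = leaves T" unfolding leaves_def by blast
 have "C u v \<inter> C v u = {}"
 proof (rule ccontr)
  assume "\<not> ?thesis"
  then obtain x where x: "(v, x) \<in> (parcs T - {(u, v), (v, u)})\<^sup>*" "(u, x) \<in> (parcs T - {(u, v), (v, u)})\<^sup>*"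
   unfolding C_def by (auto simp: insert_commute)
  have "sym (parcs T - {(u, v), (v, u)})" using arcs_sym by (auto intro: symI)
  then have "sym ((parcs T - {(u, v), (v, u)})\<^sup>*)" by (rule sym_rtrancl)
  then have "(x, u) \<in> (parcs T - {(u, v), (v, u)})\<^sup>*" using x(2) by (rule symD)
  with x(1) have "u \<in> C u v" unfolding C_def by (auto intro: rtrancl_trans)
  then show False using C_not[OF uv] by simp
 qed
 then have d: "?S u v \<inter> ?S v u = {}"
  by (subst inj_on_image_Int[symmetric, OF inj]) auto
 obtain t1 where t1: "dis t1" "lv t1 = ?S u v" "\<forall>Y\<in>subs t1. \<exists>a b. (a, b) \<in> parcs T \<and> Y = ?S a b"
  using side_tree[OF deg inj uv] by auto
 obtain t2 where t2: "dis t2" "lv t2 = ?S v u" "\<forall>Y\<in>subs t2. \<exists>a b. (a, b) \<in> parcs T \<and> Y = ?S a b"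
  using side_tree[OF deg inj vu] by auto
 have l: "lv (Nd t1 t2) = \<delta> ` leaves T"
  using t1(2) t2(2) un by (metis image_Un lv.simps(2))
 have "Y = \<delta> ` leaves T \<or> (\<exists>a b. (a, b) \<in> parcs T \<and> Y = ?S a b)" if "Y \<in> subs (Nd t1 t2)" for Y
 proof -
  from that have "Y = \<delta> ` leaves T \<or> Y \<in> subs t1 \<or> Y \<in> subs t2" using l by auto
  then show ?thesis using t1(3) t2(3) by blast
 qed
 moreover have "dis (Nd t1 t2)" using t1 t2 d by simp
 ultimately show ?thesis using l by blast
qed

lemma cut_side_C:
 assumes "(a, b) \<in> parcs T"
 shows "cut_side T \<delta> b a = \<delta> ` (leaves T \<inter> C a b)"
proof -
 let ?H = "delete_edge T b a"
 have p: "pverts ?H = pverts T" "parcs ?H = parcs T - {(b, a), (a, b)}" unfolding delete_edge_def by simp_all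
 interpret H: pair_wf_digraph ?H
  by unfold_locales (auto simp: p dest: in_arcsD1 in_arcsD2)
 have bT: "b \<in> pverts T" using assms by (rule in_arcsD2)
 have "reachable (with_proj ?H) b l \<longleftrightarrow> l \<in> C a b" for l
  using H.reachable_conv'[of b l] bT p unfolding C_def by (simp add: insert_commute)
 then show ?thesis unfolding cut_side_def by (auto intro: arg_cong[where f = "image \<delta>"])
qed

end

section \<open>Trees given by parent pointers\<close>

text \<open>The shape in which the program builds its output: node 0 is the root, parents have
  smaller numbers, and \<open>L\<close> gives the vertex set below a node.\<close>

locale ptree =
 fixes n m :: nat and par :: "nat \<Rightarrow> nat" and L :: "nat \<Rightarrow> nat set" and \<delta> :: "nat \<Rightarrow> nat"
 assumes m: "m \<ge> 1" and L0: "L 0 = {..<n}" and par: "\<And>c. 0 < c \<Longrightarrow> c < m \<Longrightarrow> par c < c"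
  and node: "\<And>a. a < m \<Longrightarrow>
   (L a = {\<delta> a} \<and> {c. 0 < c \<and> c < m \<and> par c = a} = {}) \<or>
   (\<exists>c d. c \<noteq> d \<and> {c. 0 < c \<and> c < m \<and> par c = a} = {c, d} \<and> L a = L c \<union> L d \<and> L c \<inter> L d = {})"
begin

definition ch :: "nat \<Rightarrow> nat set" where "ch a = {c. 0 < c \<and> c < m \<and> par c = a}"

definition up :: "(nat \<times> nat) set" where "up = {(c, par c) | c. 0 < c \<and> c < m}"

definition T :: "nat pair_pre_digraph" where
 "T = \<lparr>pverts = {..<m}, parcs = up \<union> up\<inverse>\<rparr>"

lemma up_less: "(a, b) \<in> up \<Longrightarrow> b < a \<and> a < m \<and> b = par a \<and> 0 < a"
 unfolding up_def using par by auto

lemma upI: "0 < c \<Longrightarrow> c < m \<Longrightarrow> (c, par c) \<in> up"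
 unfolding up_def by blast

lemma T_simps [simp]: "pverts T = {..<m}" "parcs T = up \<union> up\<inverse>"
 unfolding T_def by simp_all

lemma graph_T: "pair_graph T"
proof
 have fin: "up \<subseteq> {..<m} \<times> {..<m}" using up_less by fastforce
 have finup: "finite up" by (rule finite_subset[OF fin]) simp
 show "finite (pverts T)" "finite (parcs T)" using finup by simp_all
 show "fst e \<in> pverts T" "snd e \<in> pverts T" if "e \<in> parcs T" for e
  using that fin by auto
 show "fst e \<noteq> snd e" if "e \<in> parcs T" for e
  using that up_less by (cases e) auto
 show "symmetric (with_proj T)"
  unfolding symmetric_def with_proj_simps T_simps by (rule symI) auto
qed

sublocale pair_graph T by (rule graph_T)

definition D :: "nat \<Rightarrow> nat set" where "D u = {x. (x, u) \<in> up\<^sup>*}"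

lemma D_ge: "x \<in> D u \<Longrightarrow> u \<le> x \<and> (x = u \<or> x < m)"
proof -
 assume "x \<in> D u"
 then have "(x, u) \<in> up\<^sup>*" unfolding D_def by simp
 then show ?thesis
  by (induction rule: converse_rtrancl_induct) (use up_less in fastforce)+
qed

lemma D_self: "u \<in> D u" unfolding D_def by simp

lemma D_up: "x \<in> D u \<Longrightarrow> x \<noteq> u \<Longrightarrow> (x, par x) \<in> up \<and> par x \<in> D u"
proof -
 assume "x \<in> D u" "x \<noteq> u"
 then obtain y where "(x, y) \<in> up" "(y, u) \<in> up\<^sup>*"
  unfolding D_def by (auto elim: converse_rtranclE)
 moreover from this have "y = par x" using up_less by blast
 ultimately show ?thesis unfolding D_def by simp
qed

lemma D_down: "\<lbrakk>par x \<in> D u; 0 < x; x < m\<rbrakk> \<Longrightarrow> x \<in> D u"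
 unfolding D_def using upI by (auto intro: converse_rtrancl_into_rtrancl)

lemma D_root: "x < m \<Longrightarrow> x \<in> D 0"
proof (induction x rule: less_induct)
 case (less x)
 show ?case
 proof (cases "x = 0")
  case False
  then have "par x < x" using par less.prems by simp
  then show ?thesis using less D_down[of x 0] False by simp
 qed (simp add: D_self)
qed

lemma D_split: "D u = insert u (\<Union>c\<in>ch u. D c)"
proof (intro set_eqI iffI)
 fix x assume "x \<in> D u"
 then have "(x, u) \<in> up\<^sup>*" unfolding D_def by simp
 then show "x \<in> insert u (\<Union>c\<in>ch u. D c)"
 proof cases
  case (step c)
  then have "c \<in> ch u" unfolding ch_def using up_less[of c u] by simp
  moreover have "x \<in> D c" using step unfolding D_def by simp
  ultimately show ?thesis by blast
 qed simp
next
 fix x assume "x \<in> insert u (\<Union>c\<in>ch u. D c)"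
 then consider "x = u" | c where "c \<in> ch u" "x \<in> D c" by blast
 then show "x \<in> D u"
 proof cases
  case 2
  have "(c, u) \<in> up" using 2(1) upI unfolding ch_def by auto
  then show ?thesis using 2(2) unfolding D_def by (auto intro: rtrancl_into_rtrancl)
 qed (simp add: D_self)
qed

lemma node_cases:
 assumes "a < m"
 obtains (leaf) "L a = {\<delta> a}" "ch a = {}"
 | (inner) c d where "c \<noteq> d" "ch a = {c, d}" "L a = L c \<union> L d" "L c \<inter> L d = {}" "a < c" "a < d" "c < m" "d < m"
proof -
 from node[OF assms, folded ch_def] show thesis
 proof (elim disjE exE conjE)
  fix c d assume h: "c \<noteq> d" "ch a = {c, d}" "L a = L c \<union> L d" "L c \<inter> L d = {}"
  then have "c \<in> ch a" "d \<in> ch a" by simp_all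
  then have "a < c" "c < m" "a < d" "d < m" unfolding ch_def using par[of c] par[of d] by auto
  then show thesis using inner h by blast
 qed (rule leaf)
qed

lemma nb: "{w. (v, w) \<in> parcs T} = (if 0 < v \<and> v < m then insert (par v) (ch v) else ch v)"
 unfolding T_simps ch_def up_def by auto

lemma par_notin_ch: "0 < v \<Longrightarrow> v < m \<Longrightarrow> par v \<notin> ch v"
 unfolding ch_def using par[of "par v"] par[of v] by auto

lemma card_ch: "v < m \<Longrightarrow> card (ch v) = (if ch v = {} then 0 else 2)"
 by (erule node_cases) auto

lemma fin_ch: "finite (ch v)"
 unfolding ch_def by simp

lemma degree: "v < m \<Longrightarrow> card {w. (v, w) \<in> parcs T} \<le> 3"
 unfolding nb using card_ch[of v] par_notin_ch[of v] fin_ch[of v] by auto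

lemma leaves_T: "leaves T = {v. v < m \<and> ch v = {}}"
proof -
 have "card {w. (v, w) \<in> parcs T} \<le> 1 \<longleftrightarrow> ch v = {}" if "v < m" for v
 proof (cases "ch v = {}")
  case True
  then show ?thesis unfolding nb by simp
 next
  case False
  then have "card (ch v) = 2" using card_ch[OF that] by simp
  moreover have "ch v \<subseteq> {w. (v, w) \<in> parcs T}" unfolding nb by auto
  moreover have "finite {w. (v, w) \<in> parcs T}" unfolding nb using fin_ch[of v] by simp
  ultimately have "card {w. (v, w) \<in> parcs T} \<ge> 2" by (metis card_mono)
  then show ?thesis using False by simp
 qed
 then show ?thesis unfolding leaves_def out_degree_card by auto
qed

lemma leaf_sets: "u < m \<Longrightarrow> \<delta> ` (leaves T \<inter> D u) = L u \<and> inj_on \<delta> (leaves T \<inter> D u)"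
proof (induction "m - u" arbitrary: u rule: less_induct)
 case less
 from less.prems show ?case
 proof (cases rule: node_cases)
  case leaf
  have "D u = {u}" using D_split[of u] leaf(2) by simp
  moreover have "u \<in> leaves T" unfolding leaves_T using leaf less.prems by simp
  ultimately have "leaves T \<inter> D u = {u}" by blast
  then show ?thesis using leaf(1) by simp
 next
  case (inner c d)
  have "u \<notin> leaves T" unfolding leaves_T using inner by simp
  moreover have "D u = insert u (D c \<union> D d)" using D_split[of u] inner(2) by simp
  ultimately have e: "leaves T \<inter> D u = leaves T \<inter> D c \<union> leaves T \<inter> D d" by auto
  have c: "\<delta> ` (leaves T \<inter> D c) = L c" "inj_on \<delta> (leaves T \<inter> D c)"
   using less.hyps[of c] inner by simp_all
  have d: "\<delta> ` (leaves T \<inter> D d) = L d" "inj_on \<delta> (leaves T \<inter> D d)"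
   using less.hyps[of d] inner by simp_all
  have "\<delta> ` (leaves T \<inter> D u) = L u" unfolding e image_Un c(1) d(1) inner(3) ..
  moreover have "inj_on \<delta> (leaves T \<inter> D u)"
   unfolding e inj_on_Un
  proof (intro conjI c(2) d(2))
   have "\<delta> ` (leaves T \<inter> D c - leaves T \<inter> D d) \<subseteq> L c" "\<delta> ` (leaves T \<inter> D d - leaves T \<inter> D c) \<subseteq> L d"
    using c(1) d(1) by blast+
   then show "\<delta> ` (leaves T \<inter> D c - leaves T \<inter> D d) \<inter> \<delta> ` (leaves T \<inter> D d - leaves T \<inter> D c) = {}"
    using inner(4) by blast
  qed
  ultimately show ?thesis ..
 qed
qed

lemma leaves_D0: "leaves T \<inter> D 0 = leaves T"
 using D_root unfolding leaves_T by auto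

lemma bij_leaves: "bij_betw \<delta> (leaves T) {..<n}"
 using leaf_sets[of 0] m L0 unfolding leaves_D0 bij_betw_def by simp

lemma connected_T: "connected (with_proj T)"
proof -
 have to0: "(x, 0) \<in> (parcs T)\<^sup>*" if "x < m" for x
 proof -
  have "(x, 0) \<in> up\<^sup>*" using D_root[OF that] unfolding D_def by simp
  then show ?thesis by (rule rtrancl_mono[THEN subsetD, rotated]) simp
 qed
 have "sym (parcs T)" by (rule symI) auto
 then have s: "sym ((parcs T)\<^sup>*)" by (rule sym_rtrancl)
 have "(x, y) \<in> (parcs T)\<^sup>*" if "x < m" "y < m" for x y
  using to0[OF that(1)] symD[OF s to0[OF that(2)]] by (rule rtrancl_trans)
 moreover have "0 \<in> pverts T" using m by simp
 ultimately show ?thesis unfolding connected_iff_rtrancl[OF graph_T] by auto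
qed

text \<open>The largest vertex of the cycle has two smaller neighbours on it, so both are its
  parent; but on a cycle of length at least three they are distinct.\<close>

lemma acyclic_T:
 assumes c: "cycle p" and l: "length p \<ge> 3"
 shows False
proof -
 obtain u where u: "awalk u p u" "distinct (tl (pawalk_verts u p))" "p \<noteq> []"
  using c unfolding cycle_def by blast
 have pc: "pcas u p u" and sub: "set p \<subseteq> parcs T" using u(1) unfolding awalk_def by simp_all
 have 1: "pcas a q b \<Longrightarrow> q \<noteq> [] \<Longrightarrow> fst (hd q) = a \<and> snd (last q) = b" for a b q
  by (induction q arbitrary: a) auto
 have 2: "pcas a q b \<Longrightarrow> Suc i < length q \<Longrightarrow> snd (q ! i) = fst (q ! Suc i)" for a b q i
 proof (induction q arbitrary: a i)
  case (Cons e q)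
  show ?case
  proof (cases i)
   case 0
   then have "q \<noteq> []" using Cons.prems by auto
   then show ?thesis using Cons.prems 1[of "snd e" q b] 0 by (simp add: hd_conv_nth)
  next
   case (Suc j)
   then show ?thesis using Cons.IH[of "snd e" j] Cons.prems by simp
  qed
 qed simp
 have 3: "pcas a q b \<Longrightarrow> tl (pawalk_verts a q) = map snd q" for a b q
 proof (induction q arbitrary: a)
  case (Cons e q)
  have "pawalk_verts (snd e) q = snd e # map snd q"
   using Cons by (cases q) auto
  then show ?case by simp
 qed simp
 let ?l = "length p"
 let ?w = "\<lambda>i. snd (p ! i)"
 have l0: "?l > 0" using l by linarith
 have dist: "?w i \<noteq> ?w j" if "i < ?l" "j < ?l" "i \<noteq> j" for i j
  using u(2) that unfolding 3[OF pc] by (metis distinct_conv_nth length_map nth_map)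
 have nxt: "fst (p ! (Suc i mod ?l)) = ?w i" if "i < ?l" for i
 proof (cases "Suc i < ?l")
  case True
  then show ?thesis using 2[OF pc True] by simp
 next
  case False
  then have e: "Suc i = ?l" using that by simp
  then have "last p = p ! i" by (metis diff_Suc_1 last_conv_nth u(3))
  then show ?thesis using 1[OF pc u(3)] e u(3) by (simp add: hd_conv_nth)
 qed
 have "finite (?w ` {..<?l})" "?w ` {..<?l} \<noteq> {}" using l0 by auto
 from Max_in[OF this] obtain i where i: "i < ?l" "?w i = Max (?w ` {..<?l})" by auto
 have mx: "?w j \<le> ?w i" if "j < ?l" for j
  unfolding i(2) by (rule Max_ge) (use that in auto)
 let ?n = "Suc i mod ?l"
 define pv where "pv = (if i = 0 then ?l - 1 else i - 1)"
 have pv: "pv < ?l" "Suc pv mod ?l = i" unfolding pv_def using i l0 by auto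
 have n: "?n < ?l" using l0 by simp
 have edge: "p ! j \<in> up \<union> up\<inverse>" if "j < ?l" for j using sub that nth_mem by fastforce
 have "(?w i, ?w ?n) \<in> up \<union> up\<inverse>" using edge[OF n] nxt[OF i(1)] by (metis prod.collapse)
 then have a: "?w ?n = par (?w i)" using mx[OF n] up_less by fastforce
 have "(?w pv, ?w i) \<in> up \<union> up\<inverse>" using edge[OF i(1)] nxt[OF pv(1)] pv(2) by (metis prod.collapse)
 then have b: "?w pv = par (?w i)" using mx[OF pv(1)] up_less by fastforce
 have "pv \<noteq> ?n"
 proof (cases "Suc i < ?l")
  case True
  then show ?thesis unfolding pv_def using l by auto
 next
  case False
  then have "Suc i = ?l" using i by simp
  then show ?thesis unfolding pv_def using l by auto
 qed
 then show False using dist[OF pv(1) n] a b by simp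
qed

lemma branch_T:
 assumes "pverts G = {..<n}"
 shows "branch_decomposition G T \<delta>"
 unfolding branch_decomposition_def undirected_tree_def
 using graph_T connected_T acyclic_T bij_leaves degree assms by (auto simp: out_degree_card)

context
 fixes c assumes c: "0 < c" "c < m"
begin

abbreviation "R \<equiv> parcs T - {(c, par c), (par c, c)}"

lemma R_sym: "sym R"
 by (rule symI) auto

lemma R_step: "x \<in> D c \<Longrightarrow> (x, y) \<in> R \<Longrightarrow> y \<in> D c"
proof -
 assume x: "x \<in> D c" and xy: "(x, y) \<in> R"
 from xy consider "(x, y) \<in> up" "x \<noteq> c" | "(y, x) \<in> up"
  using up_less by fastforce
 then show "y \<in> D c"
 proof cases
  case 1
  then show ?thesis using D_up[OF x] up_less by blast
 next
  case 2
  then show ?thesis using D_down[of y c] x up_less[OF 2] by auto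
 qed
qed

lemma R_closed: "(x, y) \<in> R\<^sup>* \<Longrightarrow> x \<in> D c \<longleftrightarrow> y \<in> D c"
proof (induction rule: rtrancl_induct)
 case (step y z)
 have "(z, y) \<in> R" using symD[OF R_sym step(2)] .
 then show ?case using R_step step by blast
qed simp

lemma D_reach: "x \<in> D c \<Longrightarrow> (c, x) \<in> R\<^sup>*"
proof -
 assume "x \<in> D c"
 then have "(x, c) \<in> up\<^sup>*" unfolding D_def by simp
 then show ?thesis
 proof (induction rule: converse_rtrancl_induct)
  case (step x y)
  have "y \<in> D c" using step(2) unfolding D_def by simp
  then have "c \<le> y" using D_ge by blast
  then have "(y, x) \<in> R" using step(1) up_less[OF step(1)] par[OF c] by auto
  then show ?case using step(3) by (rule rtrancl_into_rtrancl[rotated])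
 qed simp
qed

lemma out_reach: "x < m \<Longrightarrow> x \<notin> D c \<Longrightarrow> (x, 0) \<in> R\<^sup>*"
proof (induction x rule: less_induct)
 case (less x)
 show ?case
 proof (cases "x = 0")
  case False
  then have p: "par x < x" using par less.prems by simp
  have np: "par x \<notin> D c" using D_down[of x c] less.prems False by blast
  have "x \<noteq> c" "par x \<noteq> c" using less.prems np D_self by blast+
  then have r: "(x, par x) \<in> R" using upI[of x] False less.prems by auto
  have "par x < m" using p less.prems by simp
  from converse_rtrancl_into_rtrancl[OF r less.IH[OF p this np]] show ?thesis .
 qed simp
qed

lemma par_out: "par c \<notin> D c"
 using D_ge[of "par c" c] par[OF c] by auto

text \<open>After the deletion no edge leaves the descendants of \<open>c\<close>, while all other
  nodes still reach the root.\<close>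

lemma cut_down: "cut_side T \<delta> c (par c) = L c"
 and cut_up: "cut_side T \<delta> (par c) c = {..<n} - L c"
proof -
 have H: "pair_wf_digraph (delete_edge T x y)" for x y
  by unfold_locales (auto simp: delete_edge_def up_def dest: par)
 have r1: "reachable (with_proj (delete_edge T c (par c))) c l \<longleftrightarrow> l \<in> D c" for l
 proof -
  interpret H: pair_wf_digraph "delete_edge T c (par c)" by (rule H)
  have "reachable (with_proj (delete_edge T c (par c))) c l \<longleftrightarrow> (c, l) \<in> R\<^sup>*"
   using H.reachable_conv'[of c l] c unfolding delete_edge_def by simp
  then show ?thesis using R_closed[of c l] D_reach D_self by blast
 qed
 show 1: "cut_side T \<delta> c (par c) = L c"
  unfolding cut_side_def r1 using leaf_sets[OF c(2)] by (simp add: Int_def)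
 have r2: "reachable (with_proj (delete_edge T (par c) c)) (par c) l \<longleftrightarrow> l \<notin> D c" if "l < m" for l
 proof -
  interpret H: pair_wf_digraph "delete_edge T (par c) c" by (rule H)
  have pm: "par c < m" using par[OF c] c by simp
  have "reachable (with_proj (delete_edge T (par c) c)) (par c) l \<longleftrightarrow> (par c, l) \<in> R\<^sup>*"
   using H.reachable_conv'[of "par c" l] pm unfolding delete_edge_def by (simp add: insert_commute)
  moreover have "(par c, l) \<in> R\<^sup>*" if nl: "l \<notin> D c"
  proof -
   have "(0, l) \<in> R\<^sup>*" using symD[OF sym_rtrancl[OF R_sym] out_reach[OF \<open>l < m\<close> nl]] .
   with out_reach[OF pm par_out] show ?thesis by (rule rtrancl_trans)
  qed
  ultimately show ?thesis using R_closed[of "par c" l] par_out by blast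
 qed
 have "cut_side T \<delta> (par c) c = \<delta> ` (leaves T - leaves T \<inter> D c)"
  unfolding cut_side_def by (rule arg_cong[where f = "image \<delta>"]) (use r2 leaves_T in auto)
 also have "\<dots> = \<delta> ` leaves T - \<delta> ` (leaves T \<inter> D c)"
  using bij_leaves unfolding bij_betw_def by (intro inj_on_image_set_diff) auto
 also have "\<dots> = {..<n} - L c"
  using bij_leaves leaf_sets[OF c(2)] unfolding bij_betw_def by simp
 finally show "cut_side T \<delta> (par c) c = {..<n} - L c" .
qed

end

lemma width_T:
 assumes "0 < w" "\<And>c. 0 < c \<Longrightarrow> c < m \<Longrightarrow> f (L c) < w \<and> f ({..<n} - L c) < w"
 shows "decomposition_width f T \<delta> < w"
proof -
 let ?S = "{f (cut_side T \<delta> u v) | u v. (u, v) \<in> parcs T}"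
 have "?S = (\<lambda>(u, v). f (cut_side T \<delta> u v)) ` parcs T" by auto
 then have fin: "finite ?S" using pair_finite_arcs by (metis finite_imageI)
 have "x < w" if "x \<in> insert 0 ?S" for x
 proof -
  from that consider "x = 0" | u v where "x = f (cut_side T \<delta> u v)" "(u, v) \<in> parcs T" by blast
  then show ?thesis
  proof cases
   case 2
   from 2(2) consider "(u, v) \<in> up" | "(v, u) \<in> up" by auto
   then show ?thesis
   proof cases
    case 1
    then have "0 < u" "u < m" "v = par u" using up_less by auto
    then show ?thesis using cut_down[of u] assms(2)[of u] 2(1) by simp
   next
    case c: 2
    then have "0 < v" "v < m" "u = par v" using up_less by auto
    then show ?thesis using cut_up[of v] assms(2)[of v] 2(1) by simp
   qed
  qed (use assms(1) in simp)
 qed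
 then show ?thesis unfolding decomposition_width_def using fin by (subst Max_less_iff) auto
qed

end

text \<open>A caterpillar: even numbers form the spine, \<open>2 * j + 1\<close> is the leaf for
  vertex \<open>j\<close>, and the last spine node is the leaf for \<open>n - 1\<close>. Since
  \<open>graph_width\<close> is a \<open>LEAST\<close>, something must attain it.\<close>

lemma branch_decomposition_exists:
 fixes n :: nat
 assumes n: "n \<ge> 1" and G: "pverts G = {..<n}"
 shows "\<exists>(T :: nat pair_pre_digraph) \<delta>. branch_decomposition G T \<delta>"
proof -
 define par where "par c = (if even c then c - 2 else c - 1 :: nat)" for c
 define L where "L c = (if even c then {c div 2..<n} else {c div 2})" for c
 interpret ptree n "2 * n - 1" par L "\<lambda>c. c div 2"
 proof
  show "1 \<le> 2 * n - 1" using n by simp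
  show "L 0 = {..<n}" unfolding L_def by auto
  show "par c < c" if "0 < c" for c using that unfolding par_def by (auto elim: evenE)
  fix a assume a: "a < 2 * n - 1"
  let ?ch = "{c. 0 < c \<and> c < 2 * n - 1 \<and> par c = a}"
  show "(L a = {a div 2} \<and> ?ch = {}) \<or>
   (\<exists>c d. c \<noteq> d \<and> ?ch = {c, d} \<and> L a = L c \<union> L d \<and> L c \<inter> L d = {})"
  proof (cases "odd a \<or> a = 2 * n - 2")
   case True
   have "\<not> (0 < c \<and> c < 2 * n - 1 \<and> par c = a)" for c
    using True n unfolding par_def by presburger
   then have "?ch = {}" by blast
   moreover have "L a = {a div 2}" using True n unfolding L_def by auto
   ultimately show ?thesis by blast
  next
   case False
   then obtain j where j: "a = 2 * j" by blast
   then have jn: "Suc j < n" using a False by simp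
   have "(0 < c \<and> c < 2 * n - 1 \<and> par c = a) \<longleftrightarrow> c = 2 * j + 1 \<or> c = 2 * j + 2" for c
    using jn unfolding par_def j by presburger
   then have "?ch = {2 * j + 1, 2 * j + 2}" unfolding set_eq_iff by simp
   moreover have "L a = L (2 * j + 1) \<union> L (2 * j + 2)" "L (2 * j + 1) \<inter> L (2 * j + 2) = {}"
    using jn unfolding L_def j by auto
   ultimately show ?thesis by (intro disjI2 exI[of _ "2 * j + 1"] exI[of _ "2 * j + 2"]) simp
  qed
 qed
 show ?thesis using branch_T[OF G] by blast
qed

section \<open>Split-matching-width by vertex covers\<close>

locale gr = pair_graph G for G :: "nat pair_pre_digraph" +
 fixes n :: nat
 assumes verts: "pverts G = {..<n}" and n1: "n \<ge> 1"
begin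

abbreviation "adjG u v \<equiv> (u, v) \<in> parcs G"

sublocale U: ugraph n adjG
proof
 show "u < n \<and> v < n" if "adjG u v" for u v using in_arcsD1[OF that] in_arcsD2[OF that] verts by simp
qed (use n1 arcs_symmetric no_loops' in auto)

lemma pg: "pair_graph G" ..

lemma conn_iff: "connected (with_proj G) \<longleftrightarrow> U.conn"
proof
 assume c: "connected (with_proj G)"
 show U.conn
  unfolding U.conn_def
 proof (intro allI impI)
  fix X assume X: "X \<noteq> {}" "X \<subset> {..<n}"
  then obtain u v where uv: "u \<in> X" "v \<notin> X" "u < n" "v < n" by (auto simp: psubset_eq)
  then have "(u, v) \<in> (parcs G)\<^sup>*" using c verts unfolding connected_iff_rtrancl[OF pg] by simp
  then have "v \<notin> X \<longrightarrow> (\<exists>u\<in>X. \<exists>v. v \<notin> X \<and> adjG u v)"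
   by (induction rule: rtrancl_induct) (use uv in blast)+
  then show "\<exists>u\<in>X. \<exists>v. v \<notin> X \<and> adjG u v" using uv by blast
 qed
next
 assume c: U.conn
 have "(u, v) \<in> (parcs G)\<^sup>*" if "u < n" "v < n" for u v
 proof (rule ccontr)
  assume no: "(u, v) \<notin> (parcs G)\<^sup>*"
  let ?X = "{x. x < n \<and> (u, x) \<in> (parcs G)\<^sup>*}"
  have "?X \<noteq> {}" "?X \<subset> {..<n}" using that no by auto
  from U.connD[OF c this] obtain x y where xy: "x \<in> ?X" "y \<notin> ?X" "adjG x y" .
  then have "(u, y) \<in> (parcs G)\<^sup>*" by (auto intro: rtrancl_into_rtrancl)
  then show False using xy U.adj_n[OF xy(3)] by simp
 qed
 moreover have "0 \<in> pverts G" using verts n1 by simp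
 ultimately show "connected (with_proj G)" unfolding connected_iff_rtrancl[OF pg] using verts by auto
qed

lemma split_iff:
 assumes A: "A \<subseteq> {..<n}"
 shows "split G A ({..<n} - A) \<longleftrightarrow> U.conn \<and> 2 \<le> card A \<and> 2 \<le> card ({..<n} - A) \<and> U.good A"
proof -
 let ?B = "{..<n} - A"
 have N1: "neighbourhood G ?B = {a \<in> A. \<exists>y. y \<notin> A \<and> adjG a y}"
 proof (intro set_eqI iffI)
  fix a assume "a \<in> neighbourhood G ?B"
  then show "a \<in> {a \<in> A. \<exists>y. y \<notin> A \<and> adjG a y}"
   unfolding neighbourhood_def verts using U.adj_sym by auto
 next
  fix a assume "a \<in> {a \<in> A. \<exists>y. y \<notin> A \<and> adjG a y}"
  then obtain y where y: "a \<in> A" "y \<notin> A" "adjG a y" by blast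
  then have "y \<in> ?B" "adjG y a" "a < n" using U.adj_n[OF y(3)] U.adj_sym by auto
  then show "a \<in> neighbourhood G ?B"
   unfolding neighbourhood_def verts using y(1) by blast
 qed
 have N2: "neighbourhood G A = {y. y \<notin> A \<and> (\<exists>a\<in>A. adjG a y)}"
  unfolding neighbourhood_def verts using A U.adj_n by auto
 have N3: "neighbourhood G {a} \<inter> ?B = {y. y \<notin> A \<and> adjG a y}" if "a \<in> A" for a
  unfolding neighbourhood_def verts using that A U.adj_n U.adj_irr by auto
 have "(\<forall>a\<in>neighbourhood G ?B. neighbourhood G {a} \<inter> ?B = neighbourhood G A) \<longleftrightarrow>
   (\<forall>a\<in>A. (\<exists>y. y \<notin> A \<and> adjG a y) \<longrightarrow> {y. y \<notin> A \<and> adjG a y} = {y. y \<notin> A \<and> (\<exists>a\<in>A. adjG a y)})"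
  unfolding N1 N2
 proof (intro iffI ballI impI)
  fix a assume h: "\<forall>a\<in>{a \<in> A. \<exists>y. y \<notin> A \<and> adjG a y}.
    neighbourhood G {a} \<inter> ?B = {y. y \<notin> A \<and> (\<exists>a\<in>A. adjG a y)}" and a: "a \<in> A" "\<exists>y. y \<notin> A \<and> adjG a y"
  have "neighbourhood G {a} \<inter> ?B = {y. y \<notin> A \<and> (\<exists>a\<in>A. adjG a y)}"
   by (rule bspec[OF h]) (use a in simp)
  then show "{y. y \<notin> A \<and> adjG a y} = {y. y \<notin> A \<and> (\<exists>a\<in>A. adjG a y)}" unfolding N3[OF a(1)] .
 next
  fix a assume h: "\<forall>a\<in>A. (\<exists>y. y \<notin> A \<and> adjG a y) \<longrightarrow>
    {y. y \<notin> A \<and> adjG a y} = {y. y \<notin> A \<and> (\<exists>a\<in>A. adjG a y)}"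
   and "a \<in> {a \<in> A. \<exists>y. y \<notin> A \<and> adjG a y}"
  then have a: "a \<in> A" "\<exists>y. y \<notin> A \<and> adjG a y" by simp_all
  show "neighbourhood G {a} \<inter> ?B = {y. y \<notin> A \<and> (\<exists>a\<in>A. adjG a y)}"
   unfolding N3[OF a(1)] by (rule h[rule_format, OF a])
 qed
 also have "\<dots> \<longleftrightarrow> U.good A"
 proof
  assume h: "\<forall>a\<in>A. (\<exists>y. y \<notin> A \<and> adjG a y) \<longrightarrow> {y. y \<notin> A \<and> adjG a y} = {y. y \<notin> A \<and> (\<exists>a\<in>A. adjG a y)}"
  show "U.good A"
   unfolding U.good_def
  using h by blast
 next
  assume g: "U.good A"
  show "\<forall>a\<in>A. (\<exists>y. y \<notin> A \<and> adjG a y) \<longrightarrow> {y. y \<notin> A \<and> adjG a y} = {y. y \<notin> A \<and> (\<exists>a\<in>A. adjG a y)}"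
  using U.goodD g by blast
 qed
 finally have e: "(\<forall>a\<in>neighbourhood G ?B. neighbourhood G {a} \<inter> ?B = neighbourhood G A) \<longleftrightarrow> U.good A" .
 have "A \<union> ?B = pverts G" "A \<inter> ?B = {}" using A verts by auto
 then show ?thesis unfolding split_def e conn_iff by blast
qed

lemma edges_cut: "edges (cut_graph G A) = {{u, v} | u v. adjG u v \<and> u \<in> A \<and> v \<notin> A}"
proof (intro set_eqI iffI)
 fix e assume "e \<in> edges (cut_graph G A)"
 then obtain u v where "e = {u, v}" "adjG u v" "(u \<in> A) \<noteq> (v \<in> A)" unfolding edges_def cut_graph_def by auto
 then consider "e = {u, v}" "adjG u v" "u \<in> A" "v \<notin> A" | "e = {v, u}" "adjG v u" "v \<in> A" "u \<notin> A"
  using U.adj_sym by blast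
 then show "e \<in> {{u, v} | u v. adjG u v \<and> u \<in> A \<and> v \<notin> A}" by cases blast+
next
 fix e assume "e \<in> {{u, v} | u v. adjG u v \<and> u \<in> A \<and> v \<notin> A}"
 then show "e \<in> edges (cut_graph G A)" unfolding edges_def cut_graph_def by auto
qed

lemma mm_finite: "finite {card M | M. matching (cut_graph G A) M}"
proof -
 have "edges (cut_graph G A) \<subseteq> Pow {..<n}" unfolding edges_cut using U.adj_n by auto
 then have "finite (edges (cut_graph G A))" by (rule finite_subset) simp
 then have "finite (card ` Pow (edges (cut_graph G A)))" by simp
 then show ?thesis by (rule finite_subset[rotated]) (auto simp: matching_def)
qed

lemma mm_le:
 assumes "U.vcov Z A"
 shows "mm G A \<le> card Z"
proof -
 have "card M \<le> card Z" if M: "matching (cut_graph G A) M" for M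
 proof -
  have "\<exists>z. z \<in> e \<and> z \<in> Z" if "e \<in> M" for e
  proof -
   have "e \<in> edges (cut_graph G A)" using M that unfolding matching_def by blast
   then show ?thesis using assms unfolding edges_cut U.vcov_def by blast
  qed
  then have "\<forall>e\<in>M. \<exists>z. z \<in> e \<and> z \<in> Z" by blast
  from bchoice[OF this] obtain f where f: "\<forall>e\<in>M. f e \<in> e \<and> f e \<in> Z" ..
  have "inj_on f M"
  proof (rule inj_onI, rule ccontr)
   fix e e' assume h: "e \<in> M" "e' \<in> M" "f e = f e'" "e \<noteq> e'"
   then have "e \<inter> e' = {}" using M unfolding matching_def by blast
   moreover have "f e \<in> e" "f e \<in> e'" using f h(1,2) h(3) by auto
   ultimately show False by blast
  qed
  moreover have "f ` M \<subseteq> Z" using f by blast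
  moreover have "finite Z" using assms unfolding U.vcov_def by blast
  ultimately show ?thesis by (rule card_inj_on_le)
 qed
 moreover have "matching (cut_graph G A) {}" unfolding matching_def by simp
 ultimately show ?thesis unfolding mm_def using mm_finite by (subst Max_le_iff) auto
qed

text \<open>Koenig's theorem with left side \<open>A\<close>. The owner is stored shifted by one,
  hence the edges \<open>{ow q - 1, q}\<close>; they are disjoint because left ends lie in
  \<open>A\<close> and right ends outside.\<close>

lemma mm_cover: "\<exists>Z. U.vcov Z A \<and> card Z \<le> mm G A"
proof -
 let ?E = "\<lambda>p q. p \<in> A \<and> q \<notin> A \<and> adjG p q"
 have "\<exists>ow C D. (\<forall>q<n. \<forall>p. ow q = Suc p \<longrightarrow> ?E p q) \<and>
   (\<forall>q<n. \<forall>q'<n. ow q = ow q' \<longrightarrow> ow q \<noteq> 0 \<longrightarrow> q = q') \<and>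
   bcover ?E C D \<and> finite C \<and> finite D \<and> card C + card D \<le> card {q. q < n \<and> ow q \<noteq> 0}"
  by (rule koenig) (use U.adj_n in blast)
 then obtain ow C D where
  k: "\<forall>q<n. \<forall>p. ow q = Suc p \<longrightarrow> ?E p q" "\<forall>q<n. \<forall>q'<n. ow q = ow q' \<longrightarrow> ow q \<noteq> 0 \<longrightarrow> q = q'"
   "bcover ?E C D" "finite C" "finite D" "card C + card D \<le> card {q. q < n \<and> ow q \<noteq> 0}"
  by (elim exE conjE)
 let ?Q = "{q. q < n \<and> ow q \<noteq> 0}"
 let ?f = "\<lambda>q. {ow q - 1, q}"
 have E: "ow q - 1 \<in> A" "q \<notin> A" "adjG (ow q - 1) q" if "q \<in> ?Q" for q
 proof -
  have "ow q = Suc (ow q - 1)" "q < n" using that by simp_all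
  then have "?E (ow q - 1) q" using k(1) by blast
  then show "ow q - 1 \<in> A" "q \<notin> A" "adjG (ow q - 1) q" by simp_all
 qed
 have share: "q = q'" if h: "q \<in> ?Q" "q' \<in> ?Q" "?f q \<inter> ?f q' \<noteq> {}" for q q'
 proof -
  from h(3) have "ow q - 1 = ow q' - 1 \<or> q = q' \<or> ow q - 1 = q' \<or> q = ow q' - 1" by auto
  moreover have "ow q - 1 \<noteq> q'" "q \<noteq> ow q' - 1" using E[OF h(1)] E[OF h(2)] by metis+
  moreover have "q = q'" if "ow q - 1 = ow q' - 1"
  proof -
   have "ow q = ow q'" using that h(1,2) by auto
   then show ?thesis using k(2) h(1,2) by blast
  qed
  ultimately show ?thesis by blast
 qed
 have inj: "inj_on ?f ?Q"
 proof (rule inj_onI)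
  fix q q' assume h: "q \<in> ?Q" "q' \<in> ?Q" "?f q = ?f q'"
  have "?f q \<inter> ?f q' \<noteq> {}" unfolding h(3) by simp
  from share[OF h(1,2) this] show "q = q'" .
 qed
 have "matching (cut_graph G A) (?f ` ?Q)"
  unfolding matching_def
 proof (intro conjI ballI impI)
  show "?f ` ?Q \<subseteq> edges (cut_graph G A)" unfolding edges_cut using E by blast
  fix e e' assume "e \<in> ?f ` ?Q" "e' \<in> ?f ` ?Q" "e \<noteq> e'"
  then obtain q q' where "q \<in> ?Q" "q' \<in> ?Q" "e = ?f q" "e' = ?f q'" by blast
  then show "e \<inter> e' = {}" using share[of q q'] \<open>e \<noteq> e'\<close> by metis
 qed
 then have "card (?f ` ?Q) \<le> mm G A" unfolding mm_def using mm_finite by (intro Max_ge) auto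
 then have le: "card C + card D \<le> mm G A" using k(6) card_image[OF inj] by simp
 have "U.vcov (C \<union> D) A" using k(3-5) unfolding U.vcov_def bcover_def by blast
 moreover have "card (C \<union> D) \<le> card C + card D" by (rule card_Un_le)
 ultimately show ?thesis using le by (meson order_trans)
qed

lemma sm_small:
 assumes "sm G A < k" "A \<subseteq> {..<n}"
 shows "(\<exists>Z. U.vcov Z A \<and> card Z < k) \<or> (U.conn \<and> U.good A)"
proof (cases "split G A ({..<n} - A)")
 case True
 then show ?thesis using split_iff[OF assms(2)] by blast
next
 case False
 then have "mm G A < k" using assms(1) unfolding sm_def verts by simp
 then show ?thesis using mm_cover[of A] by (meson le_less_trans)
qed

text \<open>In a connected graph a good cut that is no split has a side with at most one vertex, and
  this side covers the cut. Both this case and the value 1 of splits are below \<open>w\<close> as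
  \<open>w \<ge> 2\<close>.\<close>

lemma sm_bound:
 assumes h: "(\<exists>Z. U.vcov Z A \<and> card Z < w) \<or> (U.conn \<and> U.good A)" and A: "A \<subseteq> {..<n}" and w: "w \<ge> 2"
 shows "sm G A < w"
proof (cases "split G A ({..<n} - A)")
 case True
 then show ?thesis unfolding sm_def verts using w by simp
next
 case False
 have "mm G A < w"
  using h
 proof
  assume "\<exists>Z. U.vcov Z A \<and> card Z < w"
  then show ?thesis using mm_le by (meson le_less_trans)
 next
  assume "U.conn \<and> U.good A"
  then have "card A < 2 \<or> card ({..<n} - A) < 2" using False split_iff[OF A] by linarith
  moreover have "U.vcov A A" "U.vcov ({..<n} - A) A"
   unfolding U.vcov_def using finite_subset[OF A] U.adj_n by auto
  ultimately show ?thesis using mm_le[of A A] mm_le[of "{..<n} - A" A] w by linarith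
 qed
 then show ?thesis unfolding sm_def verts using False by simp
qed

lemma sm_bound_both:
 assumes h: "(\<exists>Z. U.vcov Z A \<and> card Z < w) \<or> (U.conn \<and> U.good A)" and A: "A \<subseteq> {..<n}" and w: "w \<ge> 2"
 shows "sm G A < w" "sm G ({..<n} - A) < w"
proof -
 show "sm G A < w" by (rule sm_bound[OF assms])
 have "U.vcov Z ({..<n} - A)" if "U.vcov Z A" for Z
  using that U.adj_n U.adj_sym unfolding U.vcov_def by blast
 then show "sm G ({..<n} - A) < w"
  using h U.good_compl[of A] by (intro sm_bound) (use w in auto)
qed

text \<open>Two vertices guarantee two leaves, hence an edge at which the tree can be
  rooted.\<close>

lemma width_tree:
 assumes w: "split_matching_width G < k" and n2: "n \<ge> 2"
 shows "\<exists>T. dis T \<and> lv T = {..<n} \<and>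
   (\<forall>Y\<in>subs T. Y = {..<n} \<or> (\<exists>Z. U.vcov Z Y \<and> card Z < k) \<or> (U.conn \<and> U.good Y))"
proof -
 let ?P = "\<lambda>w. \<exists>(T :: nat pair_pre_digraph) \<delta>. branch_decomposition G T \<delta> \<and> decomposition_width (sm G) T \<delta> = w"
 have "\<exists>w. ?P w" using branch_decomposition_exists[OF n1 verts] by blast
 then have "?P (graph_width (sm G) G)" unfolding graph_width_def by (rule LeastI_ex)
 then obtain T :: "nat pair_pre_digraph" and \<delta> where
  T: "branch_decomposition G T \<delta>" "decomposition_width (sm G) T \<delta> < k"
  using w unfolding split_matching_width_def by auto
 interpret T: utree T
  using T(1) unfolding branch_decomposition_def undirected_tree_def utree_def utree_axioms_def by blast
 have bij: "bij_betw \<delta> (leaves T) {..<n}" using T(1) verts unfolding branch_decomposition_def by simp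
 have deg: "card {w. (v, w) \<in> parcs T} \<le> 3" if "v \<in> pverts T" for v
  using T(1) that unfolding branch_decomposition_def out_degree_card by blast
 have "\<exists>u v. (u, v) \<in> parcs T"
 proof -
  obtain a b where ab: "a \<in> leaves T" "\<delta> a = 0" "b \<in> leaves T" "\<delta> b = 1"
   using bij n2 unfolding bij_betw_def by (metis imageE lessThan_iff less_le_trans one_less_numeral_iff pos2 semiring_norm(76))
  have pT: "pair_graph T" ..
  have "connected (with_proj T)" using T.tree unfolding undirected_tree_def by blast
  moreover have "a \<in> pverts T" "b \<in> pverts T" using ab(1,3) unfolding leaves_def by simp_all
  ultimately have "(a, b) \<in> (parcs T)\<^sup>*" unfolding connected_iff_rtrancl[OF pT] by blast
  moreover have "a \<noteq> b" using ab by auto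
  ultimately show ?thesis by (meson converse_rtranclE)
 qed
 then obtain u v where uv: "(u, v) \<in> parcs T" by blast
 have inj: "inj_on \<delta> (leaves T)" and im: "\<delta> ` leaves T = {..<n}" using bij unfolding bij_betw_def by auto
 have "\<exists>t. dis t \<and> lv t = \<delta> ` leaves T \<and>
   (\<forall>Y\<in>subs t. Y = \<delta> ` leaves T \<or> (\<exists>a b. (a, b) \<in> parcs T \<and> Y = \<delta> ` (leaves T \<inter> T.C a b)))"
  by (rule T.whole_tree[OF _ inj uv]) (rule deg)
 then obtain t where t: "dis t" "lv t = \<delta> ` leaves T"
   "\<forall>Y\<in>subs t. Y = \<delta> ` leaves T \<or> (\<exists>a b. (a, b) \<in> parcs T \<and> Y = \<delta> ` (leaves T \<inter> T.C a b))"
  by (elim exE conjE)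
 have "(\<exists>Z. U.vcov Z Y \<and> card Z < k) \<or> (U.conn \<and> U.good Y)"
  if ab: "(a, b) \<in> parcs T" "Y = \<delta> ` (leaves T \<inter> T.C a b)" for a b Y
 proof (rule sm_small)
  show "Y \<subseteq> {..<n}" unfolding ab(2) using im by blast
  have "Y = cut_side T \<delta> b a" using T.cut_side_C[OF ab(1), of \<delta>] ab(2) by simp
  moreover have "(b, a) \<in> parcs T" by (rule T.arcs_sym[OF ab(1)])
  ultimately have mem: "sm G Y \<in> {sm G (cut_side T \<delta> u v) | u v. (u, v) \<in> parcs T}" by blast
  have "{sm G (cut_side T \<delta> u v) | u v. (u, v) \<in> parcs T} = (\<lambda>(u, v). sm G (cut_side T \<delta> u v)) ` parcs T"
   by auto
  then have "finite {sm G (cut_side T \<delta> u v) | u v. (u, v) \<in> parcs T}"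
   using T.pair_finite_arcs by simp
  then have "sm G Y \<le> decomposition_width (sm G) T \<delta>"
   unfolding decomposition_width_def using mem by (intro Max_ge) auto
  then show "sm G Y < k" using T(2) by simp
 qed
 note cut = this
 have "Y = {..<n} \<or> (\<exists>Z. U.vcov Z Y \<and> card Z < k) \<or> (U.conn \<and> U.good Y)" if Y: "Y \<in> subs t" for Y
  using bspec[OF t(3) Y] unfolding im
 proof (elim disjE exE conjE)
  fix a b assume "(a, b) \<in> parcs T" "Y = \<delta> ` (leaves T \<inter> T.C a b)"
  from cut[OF this] show ?thesis by (rule disjI2)
 qed (rule disjI1)
 moreover have "lv t = {..<n}" using t(2) im by simp
 ultimately show ?thesis using t(1) by blast
qed

end

section \<open>Computing the family\<close>

declare xval_xmul [simp]

lemma wp_ARR0: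
 assumes "2 \<le> B" "ok B s e \<and> s b 0 \<le> B \<and> i \<noteq> b \<and> i \<noteq> tmp \<and> b \<noteq> tmp \<and> x \<noteq> tmp \<and>
   x \<noteq> i \<and> x \<noteq> b \<and> x \<notin> names e"
  "Q (s(x := \<lambda>p. if p < s b 0 then xval e (sc s i p) else s x p))"
 shows "wp B (ARR x (XN 0) i b e) s Q"
 by (rule wp_ARR) (use assms in \<open>simp_all cong: if_cong\<close>)

lemma wp_SET1:
 assumes "2 \<le> B" "ok B s i \<and> ok B s e \<and> x \<noteq> tmp" "Q (s(x := (s x)(xval i s := xval e s)))"
 shows "wp B (SET x i e) s Q"
 by (rule wp_SET) (use assms in simp_all)

lemma wp_SET0:
 assumes "2 \<le> B" "ok B s e \<and> x \<noteq> tmp" "Q (sc s x (xval e s))"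
 shows "wp B (SET x (XN 0) e) s Q"
 by (rule wp_SET) (use assms in simp_all)

text \<open>Frame condition: \<open>M\<close> lists the arrays that may change, including the
  counters of \<open>FOR\<close> loops.\<close>

definition eqx :: "string set \<Rightarrow> state \<Rightarrow> state \<Rightarrow> bool" where
 "eqx M s s' \<longleftrightarrow> (\<forall>x. x \<notin> M \<longrightarrow> s' x = s x)"

lemma eqxD: "eqx M s s' \<Longrightarrow> x \<notin> M \<Longrightarrow> s' x = s x"
 unfolding eqx_def by simp

lemma eqx1: "eqx {y} s s' \<Longrightarrow> x \<noteq> y \<Longrightarrow> s' x = s x"
 unfolding eqx_def by simp

lemma eqx_refl: "eqx M s s"
 unfolding eqx_def by simp

lemma eqx_upd: "eqx M s s' \<Longrightarrow> x \<in> M \<Longrightarrow> eqx M s (s'(x := f))"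
 unfolding eqx_def by simp

lemma eqx_trans: "\<lbrakk>eqx M s s'; eqx M' s' s''; M \<subseteq> M''; M' \<subseteq> M''\<rbrakk> \<Longrightarrow> eqx M'' s s''"
 unfolding eqx_def by (metis subsetD)

lemma xval_cong: "(\<And>x. x \<in> names e \<Longrightarrow> s x = s' x) \<Longrightarrow> xval e s = xval e s'"
proof (induction e arbitrary: s s')
 case (XSum i b e)
 have "s b = s' b" using XSum.prems by simp
 moreover have "xval e (sc s i j) = xval e (sc s' i j)" for j
 using XSum.IH XSum.prems by fastforce
 ultimately show ?case by simp
next
 case (XG x e)
 have "s x = s' x" using XG.prems by simp
 moreover have "xval e s = xval e s'" by (rule XG.IH) (use XG.prems in simp)
 ultimately show ?case by simp
next
 case (XA a b)
 have "xval a s = xval a s'" by (rule XA.IH(1)) (use XA.prems in simp)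
 moreover have "xval b s = xval b s'" by (rule XA.IH(2)) (use XA.prems in simp)
 ultimately show ?case by simp
next
 case (XS a b)
 have "xval a s = xval a s'" by (rule XS.IH(1)) (use XS.prems in simp)
 moreover have "xval b s = xval b s'" by (rule XS.IH(2)) (use XS.prems in simp)
 ultimately show ?case by simp
qed simp

lemma ok_cong: "(\<And>x. x \<in> names e \<Longrightarrow> s x 0 = s' x 0) \<Longrightarrow> ok B s e = ok B s' e"
 by (induction e) auto

text \<open>Made for exhaustive searches: the invariant speaks of the set of cases visited so far,
  so nested loops compose by uniting sets.\<close>

lemma wp_FOR_visit:
 assumes B: "2 \<le> B" and ne: "i \<noteq> b" "i \<noteq> tmp" "b \<noteq> tmp" and m: "s b 0 = m" "m \<le> B"
  and J: "J D s" and Jupd: "\<And>D s j. J D s \<Longrightarrow> J D (sc s i j)" and Jb: "\<And>D s. J D s \<Longrightarrow> s b 0 = m"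
  and step: "\<And>j s D'. \<lbrakk>j < m; J D' s; s i 0 = j\<rbrakk> \<Longrightarrow> wp B c s (\<lambda>s'. s' i 0 = j \<and> J (D' \<union> S j) s')"
  and Q: "\<And>s. J (D \<union> (\<Union>j<m. S j)) s \<Longrightarrow> Q s"
 shows "wp B (FOR i b c) s Q"
proof (rule wp_FOR[where m = m and I = "\<lambda>j s. J (D \<union> (\<Union>i<j. S i)) s", OF B ne])
 show "s b 0 = m" "m \<le> B" by (rule m)+
 show "J (D \<union> \<Union> (S ` {..<0})) (sc s i 0)" using Jupd[OF J] by simp
 fix j s assume h: "j < m" "J (D \<union> \<Union> (S ` {..<j})) s" "s i 0 = j" "s b 0 = m"
 show "wp B c s (\<lambda>s'. s' i 0 = j \<and> s' b 0 = m \<and> J (D \<union> \<Union> (S ` {..<Suc j})) (sc s' i (Suc j)))"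
 proof (rule wp_mono[OF step[OF h(1,2,3)]])
  fix s' assume s': "s' i 0 = j \<and> J (D \<union> \<Union> (S ` {..<j}) \<union> S j) s'"
  have e: "D \<union> \<Union> (S ` {..<j}) \<union> S j = D \<union> \<Union> (S ` {..<Suc j})" by (auto simp: lessThan_Suc)
  then have "J (D \<union> \<Union> (S ` {..<Suc j})) s'" using s' by simp
  then show "s' i 0 = j \<and> s' b 0 = m \<and> J (D \<union> \<Union> (S ` {..<Suc j})) (sc s' i (Suc j))"
   using s' Jupd Jb by blast
 qed
next
 fix s assume "J (D \<union> \<Union> (S ` {..<m})) s"
 then show "Q s" by (rule Q)
qed

lemma wp_ARR1:
 assumes "2 \<le> B" "ok B s e \<and> s b 0 \<le> B \<and> i \<noteq> b \<and> i \<noteq> tmp \<and> b \<noteq> tmp \<and> x \<noteq> tmp \<and>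
   x \<noteq> i \<and> x \<noteq> b \<and> x \<notin> names e"
  "\<And>s'. \<lbrakk>eqx {x} s s'; (\<And>p. p < s b 0 \<Longrightarrow> s' x p = xval e (sc s i p));
    (\<And>p. p < s b 0 \<Longrightarrow> s' x p \<noteq> 0 \<longleftrightarrow> tr e (sc s i p))\<rbrakk> \<Longrightarrow> Q s'"
 shows "wp B (ARR x (XN 0) i b e) s Q"
 by (rule wp_ARR0[OF assms(1,2)], rule assms(3)) (simp_all add: eqx_def tr_def)

lemmas wp_Seq_ARR = wp_Seq[OF _ wp_ARR1] and wp_Seq_SET = wp_Seq[OF _ wp_SET0]

lemma wp_Seq_cut: "\<lbrakk>2 \<le> B; wp B c1 s P; (\<And>s'. P s' \<Longrightarrow> wp B c2 s' Q)\<rbrakk> \<Longrightarrow> wp B (Seq c1 c2) s Q"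
 by (rule wp_Seq) (auto elim: wp_mono)

section \<open>Closing a vertex set under a relation\<close>

definition aset :: "state \<Rightarrow> string \<Rightarrow> nat \<Rightarrow> nat set" where
 "aset s x n = {v. v < n \<and> s x v \<noteq> 0}"

text \<open>The enlarged set is built in \<open>Y\<close> before it is copied back, since
  \<open>ARR\<close> must not read the array that it writes.\<close>

definition CLOSE :: "xexp \<Rightarrow> com" where
 "CLOSE e = FOR ''z'' ''nn''
   (Seq (ARR ''Y'' (XN 0) ''b'' ''n''
      (xor (XG ''X'' (V ''b'')) (xex ''a'' ''n'' (xand (XG ''X'' (V ''a'')) e))))
     (ARR ''X'' (XN 0) ''b'' ''n'' (XG ''Y'' (V ''b''))))"

definition crl :: "xexp \<Rightarrow> nat \<Rightarrow> state \<Rightarrow> (nat \<times> nat) set" where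
 "crl e n s = {(a, b). a < n \<and> b < n \<and> tr e (sc (sc s ''b'' b) ''a'' a)}"

text \<open>Reachability needs no more steps than the relation has pairs. The resulting number of
  rounds is crude, but independent of the relation.\<close>

lemma reach_bounded:
 fixes r :: "(nat \<times> nat) set"
 assumes "r \<subseteq> {..<n} \<times> {..<n}" "X \<subseteq> {..<n}"
 shows "{v. \<exists>i\<le>n * n. \<exists>x\<in>X. (x, v) \<in> r ^^ i} = r\<^sup>* `` X"
proof -
 have fin: "finite r" using assms(1) by (rule finite_subset) simp
 have "card r \<le> card ({..<n} \<times> {..<n})" by (rule card_mono[OF _ assms(1)]) simp
 then have c: "card r \<le> n * n" by (simp add: card_cartesian_product)
 show ?thesis
 proof (intro set_eqI iffI)
  fix v assume "v \<in> {v. \<exists>i\<le>n * n. \<exists>x\<in>X. (x, v) \<in> r ^^ i}"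
  then obtain i x where "x \<in> X" "(x, v) \<in> r ^^ i" by blast
  moreover from this(2) have "(x, v) \<in> r\<^sup>*" by (rule relpow_imp_rtrancl)
  ultimately show "v \<in> r\<^sup>* `` X" by blast
 next
  fix v assume "v \<in> r\<^sup>* `` X"
  then obtain x where x: "x \<in> X" "(x, v) \<in> r\<^sup>*" by blast
  then obtain i where "i \<le> card r" "(x, v) \<in> r ^^ i"
   unfolding rtrancl_finite_eq_relpow[OF fin] by blast
  then show "v \<in> {v. \<exists>i\<le>n * n. \<exists>x\<in>X. (x, v) \<in> r ^^ i}" using x(1) c le_trans by blast
 qed
qed

lemma wp_CLOSE:
 assumes B: "2 \<le> B" and s: "s ''n'' 0 = n" "s ''nn'' 0 = n * n" "n * n \<le> B" "n \<le> B"
  and e: "ok B s e" "''X'' \<notin> names e" "''Y'' \<notin> names e" "''z'' \<notin> names e"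
  and Q: "\<And>s'. eqx {''X'', ''Y'', ''z''} s s' \<Longrightarrow>
    aset s' ''X'' n = (crl e n s)\<^sup>* `` (aset s ''X'' n) \<Longrightarrow> Q s'"
 shows "wp B (CLOSE e) s Q"
proof -
 let ?grow = "xor (XG ''X'' (V ''b'')) (xex ''a'' ''n'' (xand (XG ''X'' (V ''a'')) e))"
 let ?r = "crl e n s" and ?M = "{''X'', ''Y'', ''z''}"
 let ?R = "\<lambda>j. {v. \<exists>i\<le>j. \<exists>x\<in>aset s ''X'' n. (x, v) \<in> ?r ^^ i}"
 have tre: "tr e (sc (sc s' ''b'' b) ''a'' a) = tr e (sc (sc s ''b'' b) ''a'' a)"
  if h: "eqx ?M s s'" for s' a b
  unfolding tr_def
 proof (rule arg_cong[where f = "\<lambda>v. v \<noteq> 0"], rule xval_cong)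
  fix x assume "x \<in> names e"
  then have "x \<notin> ?M" using e by auto
  then have "s' x = s x" by (rule eqxD[OF h])
  moreover have "s' ''a'' = s ''a''" "s' ''b'' = s ''b''" using eqxD[OF h] by simp_all
  ultimately show "sc (sc s' ''b'' b) ''a'' a x = sc (sc s ''b'' b) ''a'' a x" by simp
 qed
 have oke: "ok B s' e" if h: "eqx ?M s s'" for s'
 proof -
  have "ok B s' e = ok B s e"
  proof (rule ok_cong)
   fix x assume "x \<in> names e"
   then have "x \<notin> ?M" using e by auto
   then show "s' x 0 = s x 0" using eqxD[OF h] by simp
  qed
  then show ?thesis using e(1) by simp
 qed
 show ?thesis
  unfolding CLOSE_def
 proof (rule wp_FOR[where I = "\<lambda>j s'. eqx ?M s s' \<and> aset s' ''X'' n = ?R j" and m = "n * n", OF B])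
  show "s ''nn'' 0 = n * n" "n * n \<le> B" using s by simp_all
  show "eqx ?M s (sc s ''z'' 0) \<and> aset (sc s ''z'' 0) ''X'' n = ?R 0"
   unfolding eqx_def aset_def by auto
  fix j s' assume "j < n * n" and "eqx ?M s s' \<and> aset s' ''X'' n = ?R j" and z: "s' ''z'' 0 = j" "s' ''nn'' 0 = n * n"
  then have h: "eqx ?M s s'" and R: "aset s' ''X'' n = ?R j" by simp_all
  have n': "s' ''n'' 0 = n" using eqxD[OF h, of "''n''"] s(1) by simp
  let ?f = "\<lambda>p. if p < n then xval ?grow (sc s' ''b'' p) else s' ''Y'' p"
  let ?s1 = "s'(''Y'' := ?f)"
  let ?s2 = "?s1(''X'' := \<lambda>p. if p < n then ?f p else s' ''X'' p)"
  have h2: "eqx ?M s (?s2(''z'' := q))" for q using h unfolding eqx_def by simp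
  have "?f v \<noteq> 0 \<longleftrightarrow> v \<in> ?R (Suc j)" if v: "v < n" for v
  proof -
   have "?f v \<noteq> 0 \<longleftrightarrow> tr ?grow (sc s' ''b'' v)"
    using v unfolding tr_def by simp
   also have "\<dots> \<longleftrightarrow> s' ''X'' v \<noteq> 0 \<or> (\<exists>a<n. s' ''X'' a \<noteq> 0 \<and> tr e (sc (sc s ''b'' v) ''a'' a))"
    using n' tre[OF h, of v] by simp
   also have "\<dots> \<longleftrightarrow> v \<in> aset s' ''X'' n \<or> (\<exists>a. a \<in> aset s' ''X'' n \<and> (a, v) \<in> ?r)"
    unfolding aset_def crl_def using v by auto
   also have "\<dots> \<longleftrightarrow> v \<in> ?R j \<or> (\<exists>a. a \<in> ?R j \<and> (a, v) \<in> ?r)" unfolding R ..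
   also have "\<dots> \<longleftrightarrow> v \<in> ?R (Suc j)"
   proof
    assume "v \<in> ?R j \<or> (\<exists>a. a \<in> ?R j \<and> (a, v) \<in> ?r)"
    then show "v \<in> ?R (Suc j)"
    proof
     assume "v \<in> ?R j"
     then show ?thesis using le_SucI by blast
    next
     assume "\<exists>a. a \<in> ?R j \<and> (a, v) \<in> ?r"
     then obtain a i x where "i \<le> j" "x \<in> aset s ''X'' n" "(x, a) \<in> ?r ^^ i" "(a, v) \<in> ?r" by blast
     then have "Suc i \<le> Suc j" "(x, v) \<in> ?r ^^ Suc i" by auto
     then show ?thesis using \<open>x \<in> aset s ''X'' n\<close> by blast
    qed
   next
    assume "v \<in> ?R (Suc j)"
    then obtain i x where ix: "i \<le> Suc j" "x \<in> aset s ''X'' n" "(x, v) \<in> ?r ^^ i" by blast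
    show "v \<in> ?R j \<or> (\<exists>a. a \<in> ?R j \<and> (a, v) \<in> ?r)"
    proof (cases "i \<le> j")
     case False
     then have "(x, v) \<in> ?r ^^ Suc j" using ix by (simp add: le_Suc_eq)
     then obtain a where "(x, a) \<in> ?r ^^ j" "(a, v) \<in> ?r" by auto
     then show ?thesis using ix(2) by blast
    qed (use ix in blast)
   qed
   finally show ?thesis .
  qed
  moreover have "?R (Suc j) \<subseteq> {..<n}"
  proof
   fix v assume "v \<in> ?R (Suc j)"
   then obtain i x where ix: "x \<in> aset s ''X'' n" "(x, v) \<in> ?r ^^ i" by blast
   show "v \<in> {..<n}"
    using ix by (cases i) (auto simp: aset_def crl_def)
  qed
  ultimately have R2: "aset (?s2(''z'' := q)) ''X'' n = ?R (Suc j)" for q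
   unfolding aset_def by auto
  show "wp B (Seq (ARR ''Y'' (XN 0) ''b'' ''n''
      ?grow)
     (ARR ''X'' (XN 0) ''b'' ''n'' (XG ''Y'' (V ''b'')))) s'
    (\<lambda>s'. s' ''z'' 0 = j \<and> s' ''nn'' 0 = n * n \<and>
     (eqx ?M s (sc s' ''z'' (Suc j)) \<and> aset (sc s' ''z'' (Suc j)) ''X'' n = ?R (Suc j)))"
  proof (rule wp_Seq[OF B], rule wp_ARR0[OF B], goal_cases)
   case 1
   show ?case using s n' oke[OF h] e by simp
  next
   case 2
   have e1: "(\<lambda>p. if p < s' ''n'' 0 then xval ?grow (sc s' ''b'' p) else s' ''Y'' p) = ?f"
    using n' by simp
   show ?case
    unfolding e1
   proof (rule wp_ARR0[OF B], goal_cases)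
    case 1
    show ?case using s n' by simp
   next
    case 2
    have e2: "(\<lambda>p. if p < ?s1 ''n'' 0 then xval (XG ''Y'' (V ''b'')) (sc ?s1 ''b'' p) else ?s1 ''X'' p) =
      (\<lambda>p. if p < n then ?f p else s' ''X'' p)"
     using n' by (simp cong: if_cong)
    show ?case unfolding e2 using z h2 R2 by simp
   qed
  qed
 next
  fix s' assume "eqx ?M s s' \<and> aset s' ''X'' n = ?R (n * n)"
  moreover have "?R (n * n) = ?r\<^sup>* `` (aset s ''X'' n)"
   by (rule reach_bounded) (auto simp: crl_def aset_def)
  ultimately show "Q s'" using Q by simp
 qed simp_all
qed

section \<open>Computing one member of the family per round\<close>

definition gadj :: "xexp \<Rightarrow> xexp \<Rightarrow> xexp" where
 "gadj a b = XG ''G'' (XA (xmul ''n'' a) b)"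

definition row :: "string \<Rightarrow> xexp \<Rightarrow> xexp \<Rightarrow> xexp" where
 "row x t v = XG x (XA (xmul ''n'' t) v)"

lemma gadj_simps [simp]:
 "''_'' \<notin> names a \<Longrightarrow> tr (gadj a b) s \<longleftrightarrow> s ''G'' (s ''n'' 0 * xval a s + xval b s) \<noteq> 0"
 "''_'' \<notin> names t \<Longrightarrow> tr (row x t b) s \<longleftrightarrow> s x (s ''n'' 0 * xval t s + xval b s) \<noteq> 0"
 "ok B s (gadj a b) \<longleftrightarrow> s ''n'' 0 \<le> B \<and> ok B s a \<and> ok B s b"
 "ok B s (row x a b) \<longleftrightarrow> x \<noteq> tmp \<and> s ''n'' 0 \<le> B \<and> ok B s a \<and> ok B s b"
 "names (gadj a b) = {''G'', ''_'', ''n''} \<union> names a \<union> names b"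
 "names (row x a b) = {x, ''_'', ''n''} \<union> names a \<union> names b"
 unfolding gadj_def row_def by auto

definition samex :: "string \<Rightarrow> string \<Rightarrow> xexp" where
 "samex a b = xor (xeq (V a) (V b)) (xex ''t'' ''g'' (xand (row ''gs'' (V ''t'') (V a)) (row ''gs'' (V ''t'') (V b))))"

text \<open>The relation generating \<open>clos\<close>, with the inequality of truth values spelled
  out as two cases.\<close>

definition closex :: xexp where
 "closex = xor (samex ''a'' ''b'')
   (xor (xand (gadj (V ''a'') (V ''b'')) (xnot (xand (gadj (V ''b'') (V ''u'')) (gadj (V ''a'') (V ''w'')))))
     (xand (xnot (gadj (V ''a'') (V ''b''))) (xand (gadj (V ''b'') (V ''u'')) (gadj (V ''a'') (V ''w'')))))"

definition TRIP :: com where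
 "TRIP = IFF (xand (gadj (V ''u'') (V ''w'')) (xnot (samex ''u'' ''y'')))
   (Seq (ARR ''X'' (XN 0) ''b'' ''n'' (xor (xeq (V ''b'') (V ''u'')) (xeq (V ''b'') (V ''y''))))
   (Seq (CLOSE closex)
    (IFF (xand (xnot (XG ''X'' (XN 0))) (xand (xall ''b'' ''n'' (ximp (XG ''X'' (V ''b'')) (XG ''B'' (V ''b''))))
      (xex ''b'' ''n'' (xand (XG ''B'' (V ''b'')) (xnot (XG ''X'' (V ''b'')))))))
     (ARR ''B'' (XN 0) ''b'' ''n'' (XG ''X'' (V ''b'')))
     Skip)))
   Skip"

text \<open>\<open>B\<close> only shrinks, so a triple once examined never again has its closure
  strictly inside \<open>B\<close>; at the end this holds for all triples. In a disconnected graph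
  the search is skipped and the member is everything but 0.\<close>

definition ROUND :: com where
 "ROUND = Seq (ARR ''B'' (XN 0) ''b'' ''n'' (xlt (XN 0) (V ''b'')))
   (Seq (IFF (V ''cn'') (FOR ''u'' ''n'' (FOR ''y'' ''n'' (FOR ''w'' ''n'' TRIP))) Skip)
   (Seq (ARR ''gs'' (xmul ''n'' (V ''g'')) ''b'' ''n'' (XG ''B'' (V ''b'')))
     (SET ''g'' (XN 0) (XA (V ''g'') (XN 1)))))"

definition PH1 :: com where
 "PH1 = Seq (SET ''g'' (XN 0) (XN 0)) (FOR ''r'' ''rr'' ROUND)"

definition rows :: "state \<Rightarrow> string \<Rightarrow> nat \<Rightarrow> nat \<Rightarrow> nat set" where
 "rows s x n t = {v. v < n \<and> s x (n * t + v) \<noteq> 0}"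

context ugraph
begin

definition inp :: "nat \<Rightarrow> state \<Rightarrow> bool" where
 "inp B s \<longleftrightarrow> s ''n'' 0 = n \<and> n \<le> B \<and> n * n + 1 \<le> B \<and> s ''nn'' 0 = n * n \<and> s ''rr'' 0 = n * n + 1 \<and>
   (\<forall>u<n. \<forall>v<n. s ''G'' (n * u + v) \<noteq> 0 \<longleftrightarrow> adj u v)"

lemma inp_eqx: "\<lbrakk>inp B s; eqx M s s'; {''n'', ''nn'', ''rr'', ''G''} \<inter> M = {}\<rbrakk> \<Longrightarrow> inp B s'"
 unfolding inp_def using eqxD[of M s s'] by simp

definition fm :: "state \<Rightarrow> nat \<Rightarrow> nat set" where "fm s = rows s ''gs'' n"

lemma tr_samex:
 assumes "s ''n'' 0 = n" "s a 0 < n" "s b 0 < n" "a \<noteq> ''_''" "b \<noteq> ''_''" "a \<noteq> ''t''" "b \<noteq> ''t''"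
 shows "tr (samex a b) s \<longleftrightarrow> same (s ''g'' 0) (fm s) (s a 0) (s b 0)"
 unfolding samex_def same_def fm_def rows_def using assms by simp

lemma wp_TRIP:
 assumes B: "2 \<le> B" and s: "inp B s" "s ''g'' 0 \<le> B" "s ''u'' 0 = u" "s ''y'' 0 = y" "s ''w'' 0 = w"
   "u < n" "y < n" "w < n"
  and Q: "\<And>s'. eqx {''X'', ''Y'', ''z'', ''B''} s s' \<Longrightarrow>
   (let E = same (s ''g'' 0) (fm s) in
    if triple E u y w \<and> clos E u y w \<subset> aset s ''B'' n then aset s' ''B'' n = clos E u y w
    else aset s' ''B'' n = aset s ''B'' n) \<Longrightarrow> Q s'"
 shows "wp B TRIP s Q"
proof -
 let ?M = "{''X'', ''Y'', ''z'', ''B''}"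
 let ?E = "same (s ''g'' 0) (fm s)"
 have n': "s ''n'' 0 = n" "n \<le> B" "n * n \<le> B" "s ''nn'' 0 = n * n" using s(1) unfolding inp_def by simp_all
 have G: "s ''G'' (n * u + v) \<noteq> 0 \<longleftrightarrow> adj u v" if "u < n" "v < n" for u v using s(1) that unfolding inp_def by blast
 have esuy: "tr (samex ''u'' ''y'') s \<longleftrightarrow> ?E u y" using tr_samex[of s "''u''" "''y''"] n' s by simp
 show ?thesis
  unfolding TRIP_def
 proof (rule wp_IFF'[OF B], goal_cases)
  case 1
  show ?case using n' s(2) by (simp add: samex_def)
 next
  case 2
  then have c: "adj u w" "\<not> ?E u y" using n' esuy s G by simp_all
  show ?case
  proof (rule wp_Seq_ARR[OF B B], goal_cases)
   case 1
   show ?case using n' by simp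
  next
   case (2 s1)
   note e1 = eqx1[OF 2(1)]
   have X1: "aset s1 ''X'' n = {u, y}"
    unfolding aset_def using 2(3) n' s by auto
   have fm1: "fm s1 = fm s" unfolding fm_def rows_def by (simp add: e1)
   have cr: "crl closex n s1 = crel ?E u w"
   proof -
    have "tr closex (sc (sc s1 ''b'' b) ''a'' a) \<longleftrightarrow> ?E a b \<or> adj a b \<noteq> (adj b u \<and> adj a w)"
     if ab: "a < n" "b < n" for a b
    proof -
     let ?s = "sc (sc s1 ''b'' b) ''a'' a"
     have "tr (samex ''a'' ''b'') ?s \<longleftrightarrow> same (?s ''g'' 0) (fm ?s) (?s ''a'' 0) (?s ''b'' 0)"
      by (rule tr_samex) (use e1 n' ab in simp_all)
     moreover have "fm ?s = fm s" unfolding fm1[symmetric] unfolding fm_def rows_def by simp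
     moreover have "?s ''g'' 0 = s ''g'' 0" "?s ''a'' 0 = a" "?s ''b'' 0 = b" using e1[of "''g''"] by simp_all
     ultimately have es: "tr (samex ''a'' ''b'') ?s \<longleftrightarrow> ?E a b" by (simp only:)
     have g: "tr (gadj (V ''a'') (V ''b'')) ?s \<longleftrightarrow> adj a b" "tr (gadj (V ''b'') (V ''u'')) ?s \<longleftrightarrow> adj b u"
      "tr (gadj (V ''a'') (V ''w'')) ?s \<longleftrightarrow> adj a w"
      using e1[of "''G''"] e1[of "''n''"] e1[of "''u''"] e1[of "''w''"] n' ab s(3,5-8) G by simp_all
     show ?thesis unfolding closex_def tr_simps es g by blast
    qed
    then show ?thesis unfolding crl_def crel_def by blast
   qed
   show ?case
   proof (rule wp_Seq[OF B], rule wp_CLOSE[where n = n, OF B], goal_cases)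
    case (9 s2)
    have e2: "s2 x = s x" if "x \<noteq> ''X''" "x \<noteq> ''Y''" "x \<noteq> ''z''" for x
     using eqxD[OF 9(1), of x] e1[of x] that by simp
    have X2: "aset s2 ''X'' n = clos ?E u y w" using 9(2) unfolding cr X1 clos_def .
    have mem: "s2 ''X'' v \<noteq> 0 \<longleftrightarrow> v \<in> clos ?E u y w" if "v < n" for v
     using X2 that unfolding aset_def by blast
    have csub: "clos ?E u y w \<subseteq> {..<n}" by (rule clos_sub[OF s(6,7)])
    have Bmem: "s ''B'' v \<noteq> 0 \<longleftrightarrow> v \<in> aset s ''B'' n" if "v < n" for v
     using that unfolding aset_def by blast
    have eq2: "eqx ?M s s2" unfolding eqx_def using e2 by simp
    have cond: "tr (xand (xnot (XG ''X'' (XN 0))) (xand (xall ''b'' ''n'' (ximp (XG ''X'' (V ''b'')) (XG ''B'' (V ''b''))))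
      (xex ''b'' ''n'' (xand (XG ''B'' (V ''b'')) (xnot (XG ''X'' (V ''b''))))))) s2 \<longleftrightarrow>
      triple ?E u y w \<and> clos ?E u y w \<subset> aset s ''B'' n" (is "tr ?c _ \<longleftrightarrow> _")
    proof -
     have "tr ?c s2 \<longleftrightarrow>
      \<not> s2 ''X'' 0 \<noteq> 0 \<and> (\<forall>v<n. s2 ''X'' v \<noteq> 0 \<longrightarrow> s ''B'' v \<noteq> 0) \<and> (\<exists>v<n. s ''B'' v \<noteq> 0 \<and> \<not> s2 ''X'' v \<noteq> 0)"
      using e2 n' by simp
     also have "\<dots> \<longleftrightarrow> 0 \<notin> clos ?E u y w \<and> (\<forall>v<n. v \<in> clos ?E u y w \<longrightarrow> v \<in> aset s ''B'' n) \<and>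
       (\<exists>v<n. v \<in> aset s ''B'' n \<and> v \<notin> clos ?E u y w)"
     using mem Bmem by blast
     also have "\<dots> \<longleftrightarrow> triple ?E u y w \<and> clos ?E u y w \<subset> aset s ''B'' n"
      unfolding triple_def psubset_eq using c s(6-8) csub unfolding aset_def by auto
     finally show ?thesis .
    qed
    show ?case
    proof (rule wp_IFF'[OF B], goal_cases)
     case 1
     show ?case using e2 n' by simp
    next
     case 2
     then have t: "triple ?E u y w \<and> clos ?E u y w \<subset> aset s ''B'' n" unfolding cond .
     show ?case
     proof (rule wp_ARR1[OF B], goal_cases)
      case 1
      show ?case using e2 n' by simp
     next
      case (2 s3)
      have "eqx ?M s s3" by (rule eqx_trans[OF eq2 2(1)]) auto
      moreover have "aset s3 ''B'' n = clos ?E u y w"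
       unfolding aset_def using 2(3) mem csub e2 n' by auto
      ultimately show ?case using t by (intro Q) (simp_all add: Let_def)
     qed
    next
     case 3
     then have t: "\<not> (triple ?E u y w \<and> clos ?E u y w \<subset> aset s ''B'' n)" unfolding cond .
     have "aset s2 ''B'' n = aset s ''B'' n" unfolding aset_def using e2 by simp
     then show ?case using t eq2 by (intro wp_Skip[OF B] Q) (simp_all only: Let_def if_False)
    qed
   qed (use e1 n' s(2) in \<open>simp_all add: closex_def samex_def\<close>)
  qed
 next
  case 3
  have "tr (gadj (V ''u'') (V ''w'')) s \<longleftrightarrow> adj u w" using G[OF s(6,8)] n' s(3,5) by simp
  with 3 have "\<not> (adj u w \<and> \<not> ?E u y)" unfolding tr_simps esuy by blast
  then have c: "\<not> triple ?E u y w" unfolding triple_def by blast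
  show ?case
   by (rule wp_Skip[OF B], rule Q[OF eqx_refl]) (use c in \<open>simp add: Let_def\<close>)
 qed
qed

lemma same_cong: "(\<And>t. t < g \<Longrightarrow> fam t = fam' t) \<Longrightarrow> same g fam = same g fam'"
 unfolding same_def by (intro ext) auto

lemma famok_Suc:
 assumes "famok g fam" "\<And>t. t < g \<Longrightarrow> fam' t = fam t" "rok (same g fam) (fam' g)"
 shows "famok (Suc g) fam'"
 unfolding famok_def
proof (intro allI impI)
 fix t assume t: "t < Suc g"
 have e: "same t fam' = same t fam" by (rule same_cong) (use t assms(2) in simp)
 show "rok (same t fam') (fam' t)"
 proof (cases "t = g")
  case True
  then show ?thesis using e assms(3) by simp
 next
  case False
  then have "t < g" using t by simp
  then show ?thesis using e assms(1,2) unfolding famok_def by simp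
 qed
qed

lemma wp_ROUND:
 assumes B: "2 \<le> B" and s: "inp B s" "s ''g'' 0 = g" "g \<le> n * n" "s ''cn'' 0 \<noteq> 0 \<longleftrightarrow> conn" "famok g (fm s)"
  and Q: "\<And>s'. \<lbrakk>eqx {''X'', ''Y'', ''z'', ''B'', ''u'', ''y'', ''w'', ''gs'', ''g''} s s';
   s' ''g'' 0 = Suc g; famok (Suc g) (fm s')\<rbrakk> \<Longrightarrow> Q s'"
 shows "wp B ROUND s Q"
proof -
 let ?M = "{''X'', ''Y'', ''z'', ''B'', ''u'', ''y'', ''w''}"
 define E where "E = same g (fm s)"
 have n': "s ''n'' 0 = n" "n \<le> B" "n * n \<le> B" "s ''nn'' 0 = n * n" using s(1) unfolding inp_def by simp_all
 have gB: "g \<le> B" using s(3) n'(3) by simp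
 define Bok where "Bok X \<longleftrightarrow> X = {1..<n} \<or> (\<exists>u y w. triple E u y w \<and> X = clos E u y w)" for X
 define J where "J D s' \<longleftrightarrow> eqx ?M s s' \<and> Bok (aset s' ''B'' n) \<and>
   (\<forall>(u, y, w)\<in>D. triple E u y w \<longrightarrow> \<not> clos E u y w \<subset> aset s' ''B'' n)" for D s'
 have Jx: "s' x = s x" if "J D s'" "x \<notin> ?M" for D s' x using that eqxD unfolding J_def by blast
 have Jupd: "J D (sc s' i j)" if "J D s'" "i \<in> {''u'', ''y'', ''w''}" for D s' i j
 proof -
  have "i \<noteq> ''B''" "i \<in> ?M" using that(2) by auto
  moreover from this have "aset (sc s' i j) ''B'' n = aset s' ''B'' n" unfolding aset_def by simp
  ultimately show ?thesis using that(1) unfolding J_def by (auto intro: eqx_upd)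
 qed
 have trip: "wp B TRIP s' (\<lambda>s''. s'' ''w'' 0 = w \<and> s'' ''y'' 0 = y \<and> s'' ''u'' 0 = u \<and> J (D \<union> {(u, y, w)}) s'')"
  if h: "u < n" "y < n" "w < n" "J D s'" "s' ''u'' 0 = u" "s' ''y'' 0 = y" "s' ''w'' 0 = w" for u y w D s'
 proof (rule wp_TRIP[OF B])
  show "inp B s'" by (rule inp_eqx[OF s(1), of ?M]) (use h(4) in \<open>simp_all add: J_def\<close>)
  show "s' ''g'' 0 \<le> B" using Jx[OF h(4), of "''g''"] s(2) gB by simp
  fix s'' assume q: "eqx {''X'', ''Y'', ''z'', ''B''} s' s''"
   "let E = same (s' ''g'' 0) (fm s') in
    if triple E u y w \<and> clos E u y w \<subset> aset s' ''B'' n then aset s'' ''B'' n = clos E u y w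
    else aset s'' ''B'' n = aset s' ''B'' n"
  have E': "same (s' ''g'' 0) (fm s') = E"
   unfolding E_def fm_def rows_def using Jx[OF h(4), of "''g''"] Jx[OF h(4), of "''gs''"] s(2) by simp
  note q2 = q(2)[unfolded Let_def E']
  have "eqx ?M s s''" by (rule eqx_trans[OF _ q(1), of ?M]) (use h(4) in \<open>auto simp: J_def\<close>)
  moreover have "Bok (aset s'' ''B'' n) \<and>
   (\<forall>(u, y, w)\<in>D \<union> {(u, y, w)}. triple E u y w \<longrightarrow> \<not> clos E u y w \<subset> aset s'' ''B'' n)"
  proof (cases "triple E u y w \<and> clos E u y w \<subset> aset s' ''B'' n")
   case True
   then have e: "aset s'' ''B'' n = clos E u y w" using q2 by simp
   have "Bok (aset s'' ''B'' n)" unfolding e Bok_def using True by blast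
   moreover have "\<not> clos E u1 y1 w1 \<subset> aset s'' ''B'' n"
    if "(u1, y1, w1) \<in> D \<union> {(u, y, w)}" "triple E u1 y1 w1" for u1 y1 w1
   proof
    assume ps: "clos E u1 y1 w1 \<subset> aset s'' ''B'' n"
    then have "clos E u1 y1 w1 \<subset> aset s' ''B'' n" using e True by (metis psubset_trans)
    moreover have "(u1, y1, w1) \<in> D" using that(1) ps e by auto
    ultimately show False using h(4) that(2) unfolding J_def by blast
   qed
   ultimately show ?thesis by blast
  next
   case False
   then have e: "aset s'' ''B'' n = aset s' ''B'' n" using q2 by (simp only: if_False)
   show ?thesis using False h(4) unfolding e J_def by auto
  qed
  ultimately have "J (D \<union> {(u, y, w)}) s''" unfolding J_def by blast
  moreover have "s'' ''w'' 0 = w" "s'' ''y'' 0 = y" "s'' ''u'' 0 = u"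
   using eqxD[OF q(1), of "''w''"] eqxD[OF q(1), of "''y''"] eqxD[OF q(1), of "''u''"] h(5-7) by simp_all
  ultimately show "s'' ''w'' 0 = w \<and> s'' ''y'' 0 = y \<and> s'' ''u'' 0 = u \<and> J (D \<union> {(u, y, w)}) s''" by blast
 qed (use h in simp_all)
 have Jn: "s' ''n'' 0 = n" if "J D s'" for D s' using Jx[OF that, of "''n''"] n' by simp
 have wloop: "wp B (FOR ''w'' ''n'' TRIP) s' (\<lambda>s''. s'' ''y'' 0 = y \<and> s'' ''u'' 0 = u \<and> J (D \<union> {u} \<times> {y} \<times> {..<n}) s'')"
  if h: "u < n" "y < n" "J D s'" "s' ''u'' 0 = u" "s' ''y'' 0 = y" for u y D s'
 proof (rule wp_FOR_visit[where J = "\<lambda>D s. J D s \<and> s ''u'' 0 = u \<and> s ''y'' 0 = y" and m = n and D = D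
    and S = "\<lambda>w. {(u, y, w)}", OF B])
  fix w s'' D' assume "w < n" "J D' s'' \<and> s'' ''u'' 0 = u \<and> s'' ''y'' 0 = y" "s'' ''w'' 0 = w"
  with trip[OF h(1,2), of w D' s'']
  show "wp B TRIP s'' (\<lambda>s'. s' ''w'' 0 = w \<and> J (D' \<union> {(u, y, w)}) s' \<and> s' ''u'' 0 = u \<and> s' ''y'' 0 = y)"
   by (auto elim!: wp_mono)
 next
  fix s'' assume a: "J (D \<union> (\<Union>w<n. {(u, y, w)})) s'' \<and> s'' ''u'' 0 = u \<and> s'' ''y'' 0 = y"
  have "(\<Union>w<n. {(u, y, w)}) = {u} \<times> {y} \<times> {..<n}" by auto
  then show "s'' ''y'' 0 = y \<and> s'' ''u'' 0 = u \<and> J (D \<union> {u} \<times> {y} \<times> {..<n}) s''" using a by simp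
 next
  show "s' ''n'' 0 = n" by (rule Jn) (rule h(3))
  show "J D s' \<and> s' ''u'' 0 = u \<and> s' ''y'' 0 = y" using h by simp
  fix D s j assume a: "J D s \<and> s ''u'' 0 = u \<and> s ''y'' 0 = y"
  then have "J D (sc s ''w'' j)" by (intro Jupd) simp_all
  then show "J D (sc s ''w'' j) \<and> sc s ''w'' j ''u'' 0 = u \<and> sc s ''w'' j ''y'' 0 = y" using a by simp
  show "s ''n'' 0 = n" by (rule Jn) (use a in blast)
 qed (use n' in simp_all)
 have yloop: "wp B (FOR ''y'' ''n'' (FOR ''w'' ''n'' TRIP)) s' (\<lambda>s''. s'' ''u'' 0 = u \<and> J (D \<union> {u} \<times> {..<n} \<times> {..<n}) s'')"
  if h: "u < n" "J D s'" "s' ''u'' 0 = u" for u D s'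
 proof (rule wp_FOR_visit[where J = "\<lambda>D s. J D s \<and> s ''u'' 0 = u" and m = n and D = D
    and S = "\<lambda>y. {u} \<times> {y} \<times> {..<n}", OF B])
  fix y s'' D' assume "y < n" "J D' s'' \<and> s'' ''u'' 0 = u" "s'' ''y'' 0 = y"
  with wloop[OF h(1), of y D' s'']
  show "wp B (FOR ''w'' ''n'' TRIP) s'' (\<lambda>s'. s' ''y'' 0 = y \<and> J (D' \<union> {u} \<times> {y} \<times> {..<n}) s' \<and> s' ''u'' 0 = u)"
   by (auto elim!: wp_mono)
 next
  fix s'' assume a: "J (D \<union> (\<Union>y<n. {u} \<times> {y} \<times> {..<n})) s'' \<and> s'' ''u'' 0 = u"
  have "(\<Union>y<n. {u} \<times> {y} \<times> {..<n}) = {u} \<times> {..<n} \<times> {..<n}" by auto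
  then show "s'' ''u'' 0 = u \<and> J (D \<union> {u} \<times> {..<n} \<times> {..<n}) s''" using a by simp
 next
  show "s' ''n'' 0 = n" by (rule Jn) (rule h(2))
  show "J D s' \<and> s' ''u'' 0 = u" using h by simp
  fix D s j assume a: "J D s \<and> s ''u'' 0 = u"
  then have "J D (sc s ''y'' j)" by (intro Jupd) simp_all
  then show "J D (sc s ''y'' j) \<and> sc s ''y'' j ''u'' 0 = u" using a by simp
  show "s ''n'' 0 = n" by (rule Jn) (use a in blast)
 qed (use n' in simp_all)
 have uloop: "wp B (FOR ''u'' ''n'' (FOR ''y'' ''n'' (FOR ''w'' ''n'' TRIP))) s' (J ({..<n} \<times> {..<n} \<times> {..<n}))"
  if h: "J {} s'" for s'
 proof (rule wp_FOR_visit[where J = J and m = n and D = "{}" and S = "\<lambda>u. {u} \<times> {..<n} \<times> {..<n}", OF B])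
  fix u s'' D' assume "u < n" "J D' s''" "s'' ''u'' 0 = u"
  from yloop[OF this]
  show "wp B (FOR ''y'' ''n'' (FOR ''w'' ''n'' TRIP)) s'' (\<lambda>s'. s' ''u'' 0 = u \<and> J (D' \<union> {u} \<times> {..<n} \<times> {..<n}) s')" .
 next
  fix s'' assume a: "J ({} \<union> (\<Union>u<n. {u} \<times> {..<n} \<times> {..<n})) s''"
  have "{} \<union> (\<Union>u<n. {u} \<times> {..<n} \<times> {..<n}) = {..<n} \<times> {..<n} \<times> {..<n}" by auto
  then show "J ({..<n} \<times> {..<n} \<times> {..<n}) s''" using a by simp
 next
  show "s' ''n'' 0 = n" by (rule Jn) (rule h)
  show "J {} s'" by (rule h)
  fix D s j assume a: "J D s"
  then show "J D (sc s ''u'' j)" by (intro Jupd) simp_all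
  show "s ''n'' 0 = n" by (rule Jn) (rule a)
 qed (use n' in simp_all)
 have fin: "wp B (Seq (ARR ''gs'' (xmul ''n'' (V ''g'')) ''b'' ''n'' (XG ''B'' (V ''b'')))
     (SET ''g'' (XN 0) (XA (V ''g'') (XN 1)))) s' Q"
  if h: "eqx ?M s s'" and r: "rok E (aset s' ''B'' n)" for s'
 proof (rule wp_Seq[OF B], rule wp_ARR[OF B], goal_cases)
  case 1
  show ?case using eqxD[OF h, of "''n''"] n' by simp
 next
  case 2
  have x: "s' x = s x" if "x \<notin> ?M" for x using eqxD[OF h that] .
  define f where "f = (\<lambda>p. if n * g \<le> p \<and> p < n * g + n then s' ''B'' (p - n * g) else s ''gs'' p)"
  have fe: "(\<lambda>p. if xval (xmul ''n'' (V ''g'')) s' \<le> p \<and> p < xval (xmul ''n'' (V ''g'')) s' + s' ''n'' 0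
     then xval (XG ''B'' (V ''b'')) (sc s' ''b'' (p - xval (xmul ''n'' (V ''g'')) s')) else s' ''gs'' p) = f"
   unfolding f_def using x[of "''n''"] x[of "''g''"] x[of "''gs''"] n' s(2) by (simp cong: if_cong)
  show ?case
   unfolding fe
  proof (rule wp_SET0[OF B], goal_cases)
   case 1
   show ?case by simp
  next
   case 2
   let ?s = "sc (s'(''gs'' := f)) ''g'' (xval (XA (V ''g'') (XN 1)) (s'(''gs'' := f)))"
   have gs: "?s ''gs'' = f" "?s ''g'' 0 = Suc g" using x[of "''g''"] s(2) by simp_all
   have f1: "fm ?s t = fm s t" if "t < g" for t
   proof -
    have "f (n * t + v) = s ''gs'' (n * t + v)" if "v < n" for v
    proof -
     have "n * t + v < n * Suc t" using that by simp
     also have "\<dots> \<le> n * g" using \<open>t < g\<close> by (intro mult_le_mono2) simp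
     finally show ?thesis unfolding f_def by simp
    qed
    then show ?thesis unfolding fm_def rows_def gs by auto
   qed
   have f2: "fm ?s g = aset s' ''B'' n"
    unfolding fm_def rows_def gs f_def aset_def by auto
   show ?case
   using Q h eqx_def gs(2) famok_Suc s(5) f1 r f2 E_def by simp_all
  qed
 qed
 have equiv: "\<And>x. E x x" "\<And>x y. E x y \<Longrightarrow> E y x" "\<And>x y z. E x y \<Longrightarrow> E y z \<Longrightarrow> E x z" "\<And>y. E 0 y \<Longrightarrow> y = 0"
  unfolding E_def using same_equiv[OF s(5) order_refl] by blast+
 have rk: "rok E X" if "Bok X" "\<And>u y w. conn \<Longrightarrow> triple E u y w \<Longrightarrow> \<not> clos E u y w \<subset> X"
  "\<not> conn \<Longrightarrow> X = {1..<n}" for X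
  by (rule rokI[OF equiv]) (use that in \<open>simp_all add: Bok_def\<close>)
 show ?thesis
  unfolding ROUND_def
 proof (rule wp_Seq_ARR[OF B B], goal_cases)
  case 1
  show ?case using n' by simp
 next
  case (2 s1)
  note x1 = eqx1[OF 2(1)]
  have B1: "aset s1 ''B'' n = {1..<n}" unfolding aset_def using 2(3) n' by auto
  have eq1: "eqx ?M s s1" unfolding eqx_def using x1 by simp
  have J1: "J {} s1" unfolding J_def Bok_def using eq1 B1 by simp
  show ?case
  proof (rule wp_Seq_cut[OF B, where P = "\<lambda>s'. eqx ?M s s' \<and> rok E (aset s' ''B'' n)"], goal_cases)
   case 1
   show ?case
   proof (rule wp_IFF'[OF B], goal_cases)
    case 2
    then have c: conn using x1[of "''cn''"] s(4) by simp
    show ?case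
    proof (rule wp_mono[OF uloop[OF J1]])
     fix s' assume a: "J ({..<n} \<times> {..<n} \<times> {..<n}) s'"
     have "rok E (aset s' ''B'' n)"
     proof (rule rk)
      show "Bok (aset s' ''B'' n)" using a unfolding J_def by blast
      show "\<not> clos E u y w \<subset> aset s' ''B'' n" if "triple E u y w" for u y w
       using a that unfolding J_def triple_def by blast
     qed (use c in simp)
     then show "eqx ?M s s' \<and> rok E (aset s' ''B'' n)" using a unfolding J_def by blast
    qed
   next
    case 3
    then have c: "\<not> conn" using x1[of "''cn''"] s(4) by simp
    have "rok E (aset s1 ''B'' n)" by (rule rk) (use c B1 in \<open>simp_all add: Bok_def\<close>)
    then show ?case using eq1 by (intro wp_Skip[OF B]) simp
   qed simp
  next
   case (2 s')
   then show ?case using fin by blast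
  qed
 qed
qed

lemma wp_PH1:
 assumes B: "2 \<le> B" and s: "inp B s" "s ''cn'' 0 \<noteq> 0 \<longleftrightarrow> conn"
  and Q: "\<And>s'. \<lbrakk>eqx {''X'', ''Y'', ''z'', ''B'', ''u'', ''y'', ''w'', ''gs'', ''g'', ''r''} s s';
   s' ''g'' 0 = n * n + 1; famok (n * n + 1) (fm s'); (\<exists>t<n * n + 1. fm s' t = {1..<n})\<rbrakk> \<Longrightarrow> Q s'"
 shows "wp B PH1 s Q"
 unfolding PH1_def
proof (rule wp_Seq_SET[OF B B], goal_cases)
 case 1
 show ?case by simp
next
 case 2
 let ?M = "{''X'', ''Y'', ''z'', ''B'', ''u'', ''y'', ''w'', ''gs'', ''g'', ''r''}"
 have rr: "s ''rr'' 0 = n * n + 1" "n * n + 1 \<le> B" using s(1) unfolding inp_def by simp_all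
 let ?I = "\<lambda>j s'. eqx ?M s s' \<and> s' ''g'' 0 = j \<and> famok j (fm s')"
 show ?case
 proof (rule wp_FOR[where m = "n * n + 1" and I = ?I, OF B])
  show "?I 0 (sc (sc s ''g'' (xval (XN 0) s)) ''r'' 0)"
   by (simp add: eqx_def famok_def)
  fix j s' assume j: "j < n * n + 1" and I: "?I j s'" and r: "s' ''r'' 0 = j" "s' ''rr'' 0 = n * n + 1"
  show "wp B ROUND s' (\<lambda>s''. s'' ''r'' 0 = j \<and> s'' ''rr'' 0 = n * n + 1 \<and> ?I (Suc j) (sc s'' ''r'' (Suc j)))"
  proof (rule wp_ROUND[OF B])
   show "inp B s'" by (rule inp_eqx[OF s(1), of ?M]) (use I in simp_all)
   show "s' ''cn'' 0 \<noteq> 0 \<longleftrightarrow> conn" using eqxD[of ?M s s' "''cn''"] I s(2) by simp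
   fix s'' assume q: "eqx {''X'', ''Y'', ''z'', ''B'', ''u'', ''y'', ''w'', ''gs'', ''g''} s' s''"
    "s'' ''g'' 0 = Suc j" "famok (Suc j) (fm s'')"
   have "eqx ?M s s''" by (rule eqx_trans[OF _ q(1), of ?M]) (use I in auto)
   then have "eqx ?M s (sc s'' ''r'' (Suc j))" by (rule eqx_upd) simp
   moreover have "fm (sc s'' ''r'' (Suc j)) = fm s''" unfolding fm_def rows_def by simp
   ultimately show "s'' ''r'' 0 = j \<and> s'' ''rr'' 0 = n * n + 1 \<and> ?I (Suc j) (sc s'' ''r'' (Suc j))"
    using q(2,3) eqxD[OF q(1), of "''r''"] eqxD[OF q(1), of "''rr''"] r by simp
  qed (use I j in simp_all)
 next
  fix s' assume I: "?I (n * n + 1) s'"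
  have "\<exists>t<n * n + 1. fm s' t = {1..<n}" by (rule fam_full) (use I in auto)
  then show "Q s'" using I Q by blast
 qed (use rr in simp_all)
qed

end

section \<open>Computing minimum separations\<close>

context separation
begin

text \<open>Besides minimality it records closure of \<open>Z\<close> under classes, so that the
  result can be read as a set of blocks.\<close>

definition best :: "nat set \<Rightarrow> (nat \<Rightarrow> bool) \<Rightarrow> bool" where
 "best Z Y \<longleftrightarrow> (\<forall>p\<in>S1. Y (cls p)) \<and> (\<forall>p\<in>S2. \<not> Y (cls p)) \<and> pcover Z Y \<and> Z \<subseteq> P \<and>
   (\<forall>p\<in>Z. \<forall>q\<in>P. cls p = cls q \<longrightarrow> q \<in> Z) \<and>
   (\<forall>W Z'. (\<forall>p\<in>S1. W (cls p)) \<longrightarrow> (\<forall>p\<in>S2. \<not> W (cls p)) \<longrightarrow> pcover Z' W \<longrightarrow> Z' \<subseteq> P \<longrightarrow> card Z \<le> card Z')"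

lemma best_Zc:
 assumes C: "bcover E C D" "finite C" "finite D"
  and min: "\<And>C' D'. \<lbrakk>bcover E C' D'; finite C'; finite D'\<rbrakk> \<Longrightarrow> card C + card D \<le> card C' + card D'"
 shows "best (Zc C) (Yb C)"
 unfolding best_def
proof (intro conjI allI impI)
 show "\<forall>p\<in>S1. Yb C (cls p)" using Yb_props(1) by blast
 show "\<forall>p\<in>S2. \<not> Yb C (cls p)" using Yb_props(2) by blast
 show "pcover (Zc C) (Yb C)" "Zc C \<subseteq> P" by (rule Yb_props)+
 show "\<forall>p\<in>Zc C. \<forall>q\<in>P. cls p = cls q \<longrightarrow> q \<in> Zc C" using Yb_props(5) by blast
 fix W Z' assume h: "\<forall>p\<in>S1. W (cls p)" "\<forall>p\<in>S2. \<not> W (cls p)" "pcover Z' W" "Z' \<subseteq> P"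
 show "card (Zc C) \<le> card Z'"
  by (rule Zc_minimal[OF C min _ _ h(3,4)]) (use h(1,2) in simp_all)
qed

end

text \<open>Adjacency of blocks is tested on two of their points; this is decisive because frontiers
  of adjacent blocks are completely joined.\<close>

definition crossx :: "string \<Rightarrow> string \<Rightarrow> xexp" where
 "crossx a b = xand (xnot (xeq (XG ''cl'' (V a)) (XG ''cl'' (V b)))) (gadj (XG ''pv'' (V a)) (XG ''pv'' (V b)))"

definition edgex :: "string \<Rightarrow> string \<Rightarrow> xexp" where
 "edgex a b = xand (XG ''L'' (V a)) (xand (XG ''R'' (V b)) (xor (xeq (V a) (V b)) (crossx a b)))"

definition bidx :: xexp where
 "bidx = xand (xall ''q'' ''N'' (xnot (xeq (XG ''ow'' (V ''q'')) (XA (V ''p'') (XN 1)))))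
   (xex ''q'' ''N'' (xand (edgex ''p'' ''q'') (xle (XG ''pr'' (V ''q'')) (V ''N''))))"

definition pickx :: xexp where
 "pickx = xand (xand (edgex ''P'' ''q'') (xle (XG ''pr'' (V ''q'')) (V ''N'')))
   (xall ''p'' ''N'' (ximp (edgex ''P'' ''p'') (xle (XG ''pr'' (V ''q'')) (XG ''pr'' (V ''p'')))))"

abbreviation sepmods :: "string set" where
 "sepmods \<equiv> {''L'', ''R'', ''pr'', ''ow'', ''P'', ''Q'', ''l'', ''xx'', ''xb'', ''zz'', ''yb''}"

definition BID :: com where
 "BID = Seq (SET ''P'' (XN 0) (xleast ''p'' ''N'' bidx))
   (Seq (SET ''Q'' (XN 0) (xleast ''q'' ''N'' pickx))
   (Seq (SET ''ow'' (V ''Q'') (XA (V ''P'') (XN 1)))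
     (SET ''pr'' (V ''Q'') (XA (XG ''pr'' (V ''Q'')) (XN 1)))))"

definition SEPA :: com where
 "SEPA = Seq (ARR ''L'' (XN 0) ''p'' ''N'' (xand (XG ''ac'' (V ''p'')) (xnot (XG ''p2'' (V ''p'')))))
   (Seq (ARR ''R'' (XN 0) ''p'' ''N'' (xand (XG ''ac'' (V ''p'')) (xnot (XG ''p1'' (V ''p'')))))
   (Seq (ARR ''pr'' (XN 0) ''p'' ''N'' (XN 0))
   (Seq (ARR ''ow'' (XN 0) ''p'' ''N'' (XN 0))
     (WHILE (xex ''p'' ''N'' bidx) BID))))"

definition SEPB :: com where
 "SEPB = Seq (SET ''l'' (XN 0) (xleast ''i'' ''NN'' (xand (xle (XN 1) (V ''i''))
      (xall ''q'' ''N'' (xnot (xeq (XG ''pr'' (V ''q'')) (V ''i'')))))))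
   (Seq (ARR ''xx'' (XN 0) ''p'' ''N'' (xand (XG ''L'' (V ''p''))
      (xnot (xex ''q'' ''N'' (xand (edgex ''p'' ''q'') (xlt (XG ''pr'' (V ''q'')) (V ''l'')))))))
   (Seq (ARR ''xb'' (XN 0) ''p'' ''N'' (xex ''q'' ''N'' (xand (XG ''xx'' (V ''q'')) (xeq (XG ''cl'' (V ''q'')) (XG ''cl'' (V ''p''))))))
   (Seq (ARR ''zz'' (XN 0) ''p'' ''N'' (xand (XG ''ac'' (V ''p'')) (xand (xnot (XG ''xb'' (V ''p'')))
      (xor (XG ''p1'' (V ''p'')) (xex ''q'' ''N'' (xand (XG ''xx'' (V ''q'')) (crossx ''q'' ''p'')))))))
     (ARR ''yb'' (XN 0) ''p'' ''N'' (xor (XG ''xb'' (V ''p''))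
       (xex ''q'' ''N'' (xand (XG ''p1'' (V ''q'')) (xeq (XG ''cl'' (V ''q'')) (XG ''cl'' (V ''p''))))))))))"

definition SEP :: com where "SEP = Seq SEPA SEPB"

text \<open>The bound on \<open>N * Suc N\<close> accommodates the potential of the auction, and
  \<open>N + 2\<close> the search for a price level, which may be as high as
  \<open>Suc N\<close>.\<close>

definition pinp :: "nat \<Rightarrow> nat \<Rightarrow> nat set \<Rightarrow> (nat \<Rightarrow> nat) \<Rightarrow> (nat \<Rightarrow> nat \<Rightarrow> bool) \<Rightarrow> state \<Rightarrow> bool" where
 "pinp B N P cls badj s \<longleftrightarrow> s ''N'' 0 = N \<and> s ''NN'' 0 = N + 2 \<and> N + 2 \<le> B \<and> N * Suc N \<le> B \<and> s ''n'' 0 \<le> B \<and>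
   P \<subseteq> {..<N} \<and> (\<forall>p<N. s ''ac'' p \<noteq> 0 \<longleftrightarrow> p \<in> P) \<and> (\<forall>p\<in>P. s ''cl'' p = cls p) \<and>
   (\<forall>p\<in>P. \<forall>q\<in>P. badj (cls p) (cls q) \<longleftrightarrow>
    cls p \<noteq> cls q \<and> s ''G'' (s ''n'' 0 * s ''pv'' p + s ''pv'' q) \<noteq> 0)"

lemma pinp_eqx: "\<lbrakk>pinp B N P cls badj s; eqx M s s'; {''N'', ''NN'', ''n'', ''ac'', ''cl'', ''G'', ''pv''} \<inter> M = {}\<rbrakk> \<Longrightarrow>
  pinp B N P cls badj s'"
 unfolding pinp_def using eqxD[of M s s'] by simp

lemma pinp_N: "pinp B N P cls badj s \<Longrightarrow> s ''N'' 0 = N \<and> s ''NN'' 0 = N + 2 \<and> N \<le> B \<and> N + 2 \<le> B \<and> s ''n'' 0 \<le> B"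
 unfolding pinp_def by simp

lemma tr_crossx:
 assumes "pinp B N P cls badj s" "s a 0 \<in> P" "s b 0 \<in> P" "a \<noteq> ''_''" "b \<noteq> ''_''"
 shows "tr (crossx a b) s \<longleftrightarrow> badj (cls (s a 0)) (cls (s b 0))"
using crossx_def assms pinp_def by simp_all

context separation
begin

definition LR :: "nat \<Rightarrow> state \<Rightarrow> bool" where
 "LR N s \<longleftrightarrow> (\<forall>p<N. (s ''L'' p \<noteq> 0 \<longleftrightarrow> p \<in> P - S2) \<and> (s ''R'' p \<noteq> 0 \<longleftrightarrow> p \<in> P - S1))"

lemma tr_edgex:
 assumes "pinp B N P cls badj s" "LR N s" "s a 0 < N" "s b 0 < N" "a \<noteq> ''_''" "b \<noteq> ''_''"
 shows "tr (edgex a b) s \<longleftrightarrow> E (s a 0) (s b 0)"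
using edgex_def assms(2-4) LR_def tr_crossx assms(1) assms(5,6) E_def by auto

lemma tr_bidx:
 assumes "pinp B N P cls badj s" "LR N s" "s ''p'' 0 < N"
 shows "tr bidx s \<longleftrightarrow> auc_free N (s ''ow'') (s ''p'' 0) \<and> (\<exists>q<N. E (s ''p'' 0) q \<and> s ''pr'' q \<le> N)"
proof -
 have e: "tr (edgex ''p'' ''q'') (sc s ''q'' q) \<longleftrightarrow> E (s ''p'' 0) q" if "q < N" for q
 proof -
  have "pinp B N P cls badj (sc s ''q'' q)" "LR N (sc s ''q'' q)"
   using assms(1,2) unfolding pinp_def LR_def by simp_all
  from tr_edgex[OF this, of "''p''" "''q''"] show ?thesis using assms(3) that by simp
 qed
 show ?thesis unfolding bidx_def auc_free_def tr_simps using e pinp_N[OF assms(1)] by (simp cong: conj_cong)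
qed

lemma tr_pickx:
 assumes "pinp B N P cls badj s" "LR N s" "s ''P'' 0 < N" "s ''q'' 0 < N"
 shows "tr pickx s \<longleftrightarrow> E (s ''P'' 0) (s ''q'' 0) \<and> s ''pr'' (s ''q'' 0) \<le> N \<and>
  (\<forall>q'<N. E (s ''P'' 0) q' \<longrightarrow> s ''pr'' (s ''q'' 0) \<le> s ''pr'' q')"
proof -
 have e: "tr (edgex ''P'' ''p'') (sc s ''p'' q) \<longleftrightarrow> E (s ''P'' 0) q" if "q < N" for q
 proof -
  have "pinp B N P cls badj (sc s ''p'' q)" "LR N (sc s ''p'' q)"
   using assms(1,2) unfolding pinp_def LR_def by simp_all
  from tr_edgex[OF this, of "''P''" "''p''"] show ?thesis using assms(3) that by simp
 qed
 have e2: "tr (edgex ''P'' ''q'') s \<longleftrightarrow> E (s ''P'' 0) (s ''q'' 0)"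
  using tr_edgex[OF assms(1,2), of "''P''" "''q''"] assms(3,4) by simp
 show ?thesis unfolding pickx_def tr_simps e2 using e pinp_N[OF assms(1)] by simp
qed

lemma ok_edgex: "\<lbrakk>pinp B N P cls badj s; a \<noteq> tmp; b \<noteq> tmp\<rbrakk> \<Longrightarrow> ok B s (edgex a b)"
 unfolding edgex_def crossx_def using pinp_N by simp

lemma names_edgex [simp]: "names (edgex a b) = {''L'', ''R'', ''cl'', ''pv'', ''G'', ''_'', ''n'', a, b}"
 "names (crossx a b) = {''cl'', ''pv'', ''G'', ''_'', ''n'', a, b}"
 unfolding edgex_def crossx_def by auto

definition bid_state :: "nat \<Rightarrow> state \<Rightarrow> state \<Rightarrow> bool" where
 "bid_state N s s' \<longleftrightarrow> eqx {''L'', ''R'', ''pr'', ''ow'', ''P'', ''Q''} s s' \<and> LR N s' \<and> auc_inv N E (s' ''pr'') (s' ''ow'')"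

lemma E_N: "P \<subseteq> {..<N} \<Longrightarrow> E p q \<Longrightarrow> p < N \<and> q < N"
 unfolding E_def by auto

lemma min_price:
 assumes "q < (N :: nat)" "E p q" "f q \<le> (N :: nat)"
 shows "\<exists>q<N. E p q \<and> f q \<le> N \<and> (\<forall>q'<N. E p q' \<longrightarrow> f q \<le> f q')"
proof -
 obtain r where r: "r < N \<and> E p r" "\<And>y. y < N \<and> E p y \<Longrightarrow> f r \<le> f y"
  using ex_has_least_nat[of "\<lambda>q. q < N \<and> E p q" q f] assms by blast
 have "f r \<le> f q" by (rule r(2)) (use assms in simp)
 then show ?thesis using r assms(3) by (intro exI[of _ r]) auto
qed

lemma wp_BID:
 assumes B: "2 \<le> B" and s: "pinp B N P cls badj s" "bid_state N s0 s" "tr (xex ''p'' ''N'' bidx) s"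
  and Q: "\<And>s'. \<lbrakk>pinp B N P cls badj s'; bid_state N s0 s'; auc_meas N (s' ''pr'') < auc_meas N (s ''pr'')\<rbrakk> \<Longrightarrow> Q s'"
 shows "wp B BID s Q"
proof -
 let ?M = "{''L'', ''R'', ''pr'', ''ow'', ''P'', ''Q''}"
 note nn = pinp_N[OF s(1)]
 have m: "eqx ?M s0 s" "LR N s" "auc_inv N E (s ''pr'') (s ''ow'')" using s(2) unfolding bid_state_def by simp_all
 have okf: "ok B s bidx" unfolding bidx_def using ok_edgex[OF s(1)] nn by simp
 have fr: "tr bidx (sc s ''p'' p) \<longleftrightarrow> auc_free N (s ''ow'') p \<and> (\<exists>q<N. E p q \<and> s ''pr'' q \<le> N)" if "p < N" for p
 proof -
  have "pinp B N P cls badj (sc s ''p'' p)" "LR N (sc s ''p'' p)"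
   using s(1) m(2) unfolding pinp_def LR_def by simp_all
  from tr_bidx[OF this] show ?thesis using that by simp
 qed
 obtain p0 where p0: "p0 < N" "tr bidx (sc s ''p'' p0)" using s(3) nn by auto
 have xv: "xval (xleast ''p'' ''N'' bidx) s = (LEAST p. tr bidx (sc s ''p'' p))"
  by (rule xval_xleast[where m = p0]) (use p0 nn in \<open>simp_all add: bidx_def\<close>)
 define p where "p = (LEAST p. tr bidx (sc s ''p'' p))"
 have "tr bidx (sc s ''p'' p)" "p \<le> p0" unfolding p_def by (rule LeastI[of _ p0], rule p0(2)) (rule Least_le, rule p0(2))
 then have p: "p < N" "auc_free N (s ''ow'') p" "\<exists>q<N. E p q \<and> s ''pr'' q \<le> N" using fr[of p] p0(1) by simp_all
 let ?s1 = "sc s ''P'' p"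
 have s1: "pinp B N P cls badj (sc ?s1 ''q'' q)" "LR N (sc ?s1 ''q'' q)" for q
  using s(1) m(2) unfolding pinp_def LR_def by simp_all
 have ch: "tr pickx (sc ?s1 ''q'' q) \<longleftrightarrow> E p q \<and> s ''pr'' q \<le> N \<and> (\<forall>q'<N. E p q' \<longrightarrow> s ''pr'' q \<le> s ''pr'' q')"
  if "q < N" for q
  using tr_pickx[OF s1, of q] p(1) that by simp
 obtain q0 where q0: "q0 < N" "tr pickx (sc ?s1 ''q'' q0)" using p(3) min_price[of _ N p "s ''pr''"] ch by blast
 have okc: "ok B ?s1 pickx"
 proof -
  have "pinp B N P cls badj ?s1" using s(1) unfolding pinp_def by simp
  from ok_edgex[OF this] nn show ?thesis unfolding pickx_def by simp
 qed
 have xv2: "xval (xleast ''q'' ''N'' pickx) ?s1 = (LEAST q. tr pickx (sc ?s1 ''q'' q))"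
  by (rule xval_xleast[where m = q0]) (use q0 nn in \<open>simp_all add: pickx_def\<close>)
 define q where "q = (LEAST q. tr pickx (sc ?s1 ''q'' q))"
 have "tr pickx (sc ?s1 ''q'' q)" "q \<le> q0" unfolding q_def by (rule LeastI[of _ q0], rule q0(2)) (rule Least_le, rule q0(2))
 then have q: "q < N" "E p q" "s ''pr'' q \<le> N" "\<forall>q'<N. E p q' \<longrightarrow> s ''pr'' q \<le> s ''pr'' q'"
  using ch[of q] q0(1) by simp_all
 show ?thesis
  unfolding BID_def
 proof (rule wp_Seq_SET[OF B B], goal_cases)
  case 1
  show ?case using okf nn by simp
 next
  case 2
  show ?case
   unfolding xv p_def[symmetric]
  proof (rule wp_Seq_SET[OF B B], goal_cases)
   case 1
   show ?case using okc nn by simp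
  next
   case 2
   show ?case
    unfolding xv2 q_def[symmetric]
   proof (rule wp_Seq[OF B], rule wp_SET1[OF B], goal_cases)
    case 1
    show ?case by simp
   next
    case 2
    show ?case
    proof (rule wp_SET1[OF B], goal_cases)
     case 1
     show ?case by simp
    next
     case 2
     let ?s = "((sc ?s1 ''Q'' q)(''ow'' := (s ''ow'')(q := Suc p)))(''pr'' := (s ''pr'')(q := Suc (s ''pr'' q)))"
     have "Q ?s"
     proof (rule Q)
      show "pinp B N P cls badj ?s" using s(1) unfolding pinp_def by simp
      have "auc_inv N E ((s ''pr'')(q := Suc (s ''pr'' q))) ((s ''ow'')(q := Suc p))"
       by (rule auc_step[OF m(3) p(2) q])
      moreover have "eqx ?M s0 ?s" by (intro eqx_upd m(1)) simp_all
      moreover have "LR N ?s" using m(2) unfolding LR_def by simp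
      ultimately show "bid_state N s0 ?s" unfolding bid_state_def by simp
      show "auc_meas N (?s ''pr'') < auc_meas N (s ''pr'')" using auc_meas_step[of q N "s ''pr''"] q by simp
     qed
     then show ?case by simp
    qed
   qed
  qed
 qed
qed

definition point_sets :: "nat \<Rightarrow> state \<Rightarrow> bool" where
 "point_sets N s \<longleftrightarrow> (\<forall>p<N. (s ''p1'' p \<noteq> 0 \<longleftrightarrow> p \<in> S1) \<and> (s ''p2'' p \<noteq> 0 \<longleftrightarrow> p \<in> S2))"

lemma wp_SEPA:
 assumes B: "2 \<le> B" and s: "pinp B N P cls badj s" "point_sets N s"
  and Q: "\<And>s'. \<lbrakk>pinp B N P cls badj s'; bid_state N s s';
   (\<And>p q. auc_free N (s' ''ow'') p \<Longrightarrow> E p q \<Longrightarrow> s' ''pr'' q > N)\<rbrakk> \<Longrightarrow> Q s'"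
 shows "wp B SEPA s Q"
 unfolding SEPA_def
proof (rule wp_Seq_ARR[OF B B], goal_cases)
 note nn = pinp_N[OF s(1)]
 case 1
 show ?case using nn by simp
 case (2 s1)
 note x1 = eqx1[OF 2(1)]
 have at: "s ''ac'' p \<noteq> 0 \<longleftrightarrow> p \<in> P" "s ''p1'' p = 0 \<longleftrightarrow> p \<notin> S1" "s ''p2'' p = 0 \<longleftrightarrow> p \<notin> S2" if "p < N" for p
  using s that unfolding pinp_def point_sets_def by (simp, metis not_gr_zero, metis not_gr_zero)
 have L1: "s1 ''L'' p \<noteq> 0 \<longleftrightarrow> p \<in> P - S2" if "p < N" for p
  using 2(3)[of p] at[OF that] that nn by simp
 show ?case
 proof (rule wp_Seq_ARR[OF B B], goal_cases)
  case 1
  show ?case using nn x1 by simp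
 next
  case (2 s2)
  note x2 = eqx1[OF 2(1)]
  have R2: "s2 ''R'' p \<noteq> 0 \<longleftrightarrow> p \<in> P - S1" if "p < N" for p
   using 2(3)[of p] at[OF that] that nn x1 by simp
  show ?case
  proof (rule wp_Seq_ARR[OF B B], goal_cases)
   case 1
   show ?case using nn x1 x2 by simp
  next
   case (2 s3)
   note x3 = eqx1[OF 2(1)]
   have pr3: "s3 ''pr'' p = 0" if "p < N" for p using 2(2)[of p] that nn x1 x2 by simp
   show ?case
   proof (rule wp_Seq_ARR[OF B B], goal_cases)
    case 1
    show ?case using nn x1 x2 x3 by simp
   next
    case (2 s4)
    note x4 = eqx1[OF 2(1)]
    have ow4: "s4 ''ow'' p = 0" if "p < N" for p using 2(2)[of p] that nn x1 x2 x3 by simp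
    have pr4: "s4 ''pr'' p = 0" if "p < N" for p using pr3 that x4 by simp
    let ?M = "{''L'', ''R'', ''pr'', ''ow'', ''P'', ''Q''}"
    have e4: "eqx ?M s s4" unfolding eqx_def using x1 x2 x3 x4 by simp
    have "auc_inv N E (s4 ''pr'') (s4 ''ow'')" unfolding auc_inv_def using pr4 ow4 by simp
    moreover have "LR N s4" unfolding LR_def using L1 R2 x2 x3 x4 by simp
    ultimately have ms: "bid_state N s s4" unfolding bid_state_def using e4 by simp
    have pi: "pinp B N P cls badj s4" by (rule pinp_eqx[OF s(1) e4]) simp
    let ?I = "\<lambda>s'. pinp B N P cls badj s' \<and> bid_state N s s'"
    show ?case
    proof (rule wp_WHILE'[where I = ?I and \<mu> = "\<lambda>s. auc_meas N (s ''pr'')", OF B])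
     show "?I s4" using ms pi by simp
     show "auc_meas N (s4 ''pr'') \<le> B" using auc_meas_le[of N "s4 ''pr''"] s(1) unfolding pinp_def by simp
     fix s' assume I: "?I s'"
     have n': "s' ''N'' 0 = N" "N \<le> B" using pinp_N I by auto
     show "ok B s' (xex ''p'' ''N'' bidx)" unfolding bidx_def using ok_edgex[OF conjunct1[OF I]] n' by simp
     show "wp B BID s' (\<lambda>s''. ?I s'' \<and> auc_meas N (s'' ''pr'') < auc_meas N (s' ''pr''))"
      if "tr (xex ''p'' ''N'' bidx) s'"
      by (rule wp_BID[OF B _ _ that]) (use I in simp_all)
     assume no: "\<not> tr (xex ''p'' ''N'' bidx) s'"
     show "Q s'"
     proof (rule Q)
      show "pinp B N P cls badj s'" "bid_state N s s'" using I by simp_all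
      fix p q assume a: "auc_free N (s' ''ow'') p" "E p q"
      have PN: "P \<subseteq> {..<N}" using I unfolding pinp_def by blast
      have pq: "p < N" "q < N" using E_N[OF PN a(2)] by simp_all
      have "pinp B N P cls badj (sc s' ''p'' p)" "LR N (sc s' ''p'' p)"
       using I unfolding pinp_def LR_def bid_state_def by simp_all
      from tr_bidx[OF this] have "tr bidx (sc s' ''p'' p) \<longleftrightarrow> auc_free N (s' ''ow'') p \<and> (\<exists>q<N. E p q \<and> s' ''pr'' q \<le> N)"
       using pq by simp
      moreover have "\<not> tr bidx (sc s' ''p'' p)" using no pq n' by simp
      ultimately show "s' ''pr'' q > N" using a pq by (meson not_le)
     qed
    qed
   qed
  qed
 qed
qed

lemma wp_SEPB:
 assumes B: "2 \<le> B" and s: "pinp B N P cls badj s" "point_sets N s" "LR N s" "auc_inv N E (s ''pr'') (s ''ow'')"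
   "\<And>p q. auc_free N (s ''ow'') p \<Longrightarrow> E p q \<Longrightarrow> s ''pr'' q > N"
  and Q: "\<And>s' Z Y. \<lbrakk>eqx {''l'', ''xx'', ''xb'', ''zz'', ''yb''} s s'; best Z Y;
    (\<And>p. p < N \<Longrightarrow> s' ''zz'' p \<noteq> 0 \<longleftrightarrow> p \<in> Z); (\<And>p. p \<in> P \<Longrightarrow> s' ''yb'' p \<noteq> 0 \<longleftrightarrow> Y (cls p))\<rbrakk> \<Longrightarrow> Q s'"
 shows "wp B SEPB s Q"
proof -
 note nn = pinp_N[OF s(1)]
 have PN: "P \<subseteq> {..<N}" using s(1) unfolding pinp_def by blast
 have EN: "p < N \<and> q < N" if "E p q" for p q using E_N[OF PN that] .
 have acP: "s ''ac'' p \<noteq> 0 \<longleftrightarrow> p \<in> P" if "p < N" for p using s(1) that unfolding pinp_def by blast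
 have p1S: "s ''p1'' p \<noteq> 0 \<longleftrightarrow> p \<in> S1" if "p < N" for p using s(2) that unfolding point_sets_def by blast
 have LP: "s ''L'' p \<noteq> 0 \<longleftrightarrow> p \<in> P - S2" if "p < N" for p using s(3) that unfolding LR_def by blast
 have clP: "s ''cl'' p = cls p" if "p \<in> P" for p using s(1) that unfolding pinp_def by blast
 let ?e = "xand (xle (XN 1) (V ''i'')) (xall ''q'' ''N'' (xnot (xeq (XG ''pr'' (V ''q'')) (V ''i''))))"
 have te: "tr ?e (sc s ''i'' i) \<longleftrightarrow> 1 \<le> i \<and> (\<forall>q<N. s ''pr'' q \<noteq> i)" for i
  using nn by simp
 obtain l0 where l0: "l0 \<in> {1..Suc N}" "\<forall>q<N. s ''pr'' q \<noteq> l0" using gap_exists[of N "s ''pr''"] by blast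
 have l0': "tr ?e (sc s ''i'' l0)" unfolding te using l0 by simp
 have xv: "xval (xleast ''i'' ''NN'' ?e) s = (LEAST i. tr ?e (sc s ''i'' i))"
  by (rule xval_xleast[where m = l0]) (use l0' l0(1) nn in simp_all)
 define l where "l = (LEAST i. tr ?e (sc s ''i'' i))"
 have "tr ?e (sc s ''i'' l)" "l \<le> l0" unfolding l_def by (rule LeastI[of _ l0], rule l0') (rule Least_le, rule l0')
 then have l: "1 \<le> l" "l \<le> Suc N" "\<And>q. q < N \<Longrightarrow> s ''pr'' q \<noteq> l" unfolding te using l0(1) by simp_all
 define C where "C = {p. \<exists>q. E p q \<and> s ''pr'' q < l}"
 define D where "D = {q. q < N \<and> s ''pr'' q > l}"
 have ac: "bcover E C D" "finite C" "card C + card D \<le> card {q. q < N \<and> s ''ow'' q \<noteq> 0}"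
  by (rule auc_cover[OF s(4) _ _ l C_def D_def], erule EN, rule s(5), assumption+)+
 have finD: "finite D" unfolding D_def by simp
 \<comment> \<open>Weak duality against the final assignment shows that the cover at level
   \<open>l\<close> is minimum.\<close>
 have bst: "best (Zc C) (Yb C)"
 proof (rule best_Zc[OF ac(1,2) finD])
  fix C' D' assume "bcover E C' D'" "finite C'" "finite D'"
  from auc_weak_duality[OF s(4) this] ac(3) show "card C + card D \<le> card C' + card D'" by simp
 qed
 show ?thesis
  unfolding SEPB_def
 proof (rule wp_Seq_SET[OF B B], goal_cases)
  case 1
  show ?case using nn by simp
 next
  case 2
  let ?s1 = "sc s ''l'' l"
  have x1: "?s1 x = s x" if "x \<noteq> ''l''" for x using that by simp
  have pi1: "pinp B N P cls badj ?s1" using s(1) unfolding pinp_def by simp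
  have lr1: "LR N ?s1" using s(3) unfolding LR_def by simp
  show ?case
   unfolding xv l_def[symmetric]
  proof (rule wp_Seq_ARR[OF B B], goal_cases)
   case 1
   show ?case using nn ok_edgex[OF pi1, of "''p''" "''q''"] by simp
  next
   case (2 s2)
   have x2: "s2 x = s x" if "x \<noteq> ''l''" "x \<noteq> ''xx''" for x using eqxD[OF 2(1), of x] that by simp
   have xx: "s2 ''xx'' p \<noteq> 0 \<longleftrightarrow> p \<in> P - S2 \<and> p \<notin> C" if p: "p < N" for p
   proof -
    have e: "tr (edgex ''p'' ''q'') (sc (sc ?s1 ''p'' p) ''q'' q) \<longleftrightarrow> E p q" if "q < N" for q
    proof -
     have "pinp B N P cls badj (sc (sc ?s1 ''p'' p) ''q'' q)" "LR N (sc (sc ?s1 ''p'' p) ''q'' q)"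
      using pi1 lr1 unfolding pinp_def LR_def by simp_all
     from tr_edgex[OF this, of "''p''" "''q''"] show ?thesis using p that by simp
    qed
    have "s2 ''xx'' p \<noteq> 0 \<longleftrightarrow> s ''L'' p \<noteq> 0 \<and> \<not> (\<exists>q<N. E p q \<and> s ''pr'' q < l)"
     using 2(3)[of p] nn p e by auto
    also have "\<dots> \<longleftrightarrow> p \<in> P - S2 \<and> p \<notin> C" unfolding LP[OF p] C_def using EN by blast
    finally show ?thesis .
   qed
   have XbC: "Xb C b \<longleftrightarrow> (\<exists>q<N. s2 ''xx'' q \<noteq> 0 \<and> cls q = b)" for b
    unfolding Xb_def using xx PN by (metis DiffD1 lessThan_iff subsetD)
   have xxP: "q \<in> P" if "q < N" "s2 ''xx'' q \<noteq> 0" for q using xx[OF that(1)] that(2) by simp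
   show ?case
   proof (rule wp_Seq_ARR[OF B B], goal_cases)
    case 1
    show ?case using nn x2 by simp
   next
    case (2 s3)
    note x3 = eqx1[OF 2(1)]
    have xb: "s3 ''xb'' p \<noteq> 0 \<longleftrightarrow> Xb C (cls p)" if p: "p < N" "p \<in> P" for p
    proof -
     have "s3 ''xb'' p \<noteq> 0 \<longleftrightarrow> (\<exists>q<N. s2 ''xx'' q \<noteq> 0 \<and> s ''cl'' q = s ''cl'' p)"
      using 2(3)[of p] nn x2 p by simp
     also have "\<dots> \<longleftrightarrow> (\<exists>q<N. s2 ''xx'' q \<noteq> 0 \<and> cls q = cls p)"
      using clP[OF p(2)] clP[OF xxP] by (metis (no_types, lifting))
     finally show ?thesis unfolding XbC .
    qed
    have pi3: "pinp B N P cls badj s3"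
     by (rule pinp_eqx[OF s(1), of "{''l'', ''xx'', ''xb''}"]) (simp_all add: eqx_def x2 x3)
    show ?case
    proof (rule wp_Seq_ARR[OF B B], goal_cases)
     case 1
     show ?case using nn x2 x3 unfolding crossx_def by simp
    next
     case (2 s4)
     note x4 = eqx1[OF 2(1)]
     have zz: "s4 ''zz'' p \<noteq> 0 \<longleftrightarrow> p \<in> Zc C" if p: "p < N" for p
     proof (cases "p \<in> P")
      case True
      have b: "tr (crossx ''q'' ''p'') (sc (sc s3 ''p'' p) ''q'' q) \<longleftrightarrow> badj (cls q) (cls p)" if "q < N" "s2 ''xx'' q \<noteq> 0" for q
      proof -
       have "pinp B N P cls badj (sc (sc s3 ''p'' p) ''q'' q)"
        using pi3 unfolding pinp_def by simp
       from tr_crossx[OF this, of "''q''" "''p''"] show ?thesis using True xxP[OF that] by simp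
      qed
      have "s4 ''zz'' p \<noteq> 0 \<longleftrightarrow> s ''ac'' p \<noteq> 0 \<and> \<not> s3 ''xb'' p \<noteq> 0 \<and>
        (s ''p1'' p \<noteq> 0 \<or> (\<exists>q<N. s2 ''xx'' q \<noteq> 0 \<and> tr (crossx ''q'' ''p'') (sc (sc s3 ''p'' p) ''q'' q)))"
       using 2(3)[of p] nn x2 x3 p by simp
      also have "\<dots> \<longleftrightarrow> p \<in> P \<and> \<not> Xb C (cls p) \<and> (p \<in> S1 \<or> (\<exists>q<N. s2 ''xx'' q \<noteq> 0 \<and> badj (cls q) (cls p)))"
       unfolding acP[OF p] p1S[OF p] xb[OF p True] using b by (metis (no_types, lifting))
      also have "\<dots> \<longleftrightarrow> p \<in> Zc C" unfolding Zc_def XbC by blast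
      finally show ?thesis .
     next
      case False
      have "s4 ''zz'' p \<noteq> 0 \<Longrightarrow> s ''ac'' p \<noteq> 0" using 2(3)[of p] nn x2 x3 p by simp
      then show ?thesis using acP[OF p] False unfolding Zc_def by blast
     qed
     show ?case
     proof (rule wp_ARR1[OF B], goal_cases)
      case 1
      show ?case using nn x2 x3 x4 by simp
     next
      case (2 s5)
      note x5 = eqx1[OF 2(1)]
      have yb: "s5 ''yb'' p \<noteq> 0 \<longleftrightarrow> Yb C (cls p)" if p: "p \<in> P" for p
      proof -
       have pN: "p < N" using p PN by blast
       have "s5 ''yb'' p \<noteq> 0 \<longleftrightarrow> s3 ''xb'' p \<noteq> 0 \<or> (\<exists>q<N. s ''p1'' q \<noteq> 0 \<and> s ''cl'' q = s ''cl'' p)"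
        using 2(3)[of p] nn x2 x3 x4 pN by simp
       also have "\<dots> \<longleftrightarrow> Xb C (cls p) \<or> (\<exists>q<N. q \<in> S1 \<and> s ''cl'' q = s ''cl'' p)"
        unfolding xb[OF pN p] using p1S by (metis (no_types, lifting))
       also have "\<dots> \<longleftrightarrow> Xb C (cls p) \<or> (\<exists>q<N. q \<in> S1 \<and> cls q = cls p)"
        using clP[OF p] clP S1 by (metis (no_types, lifting) subsetD)
       also have "\<dots> \<longleftrightarrow> Yb C (cls p)" unfolding Yb_def using S1 PN by (metis lessThan_iff subsetD)
       finally show ?thesis .
      qed
      show ?case
      using Q bst eqx_def x2 x3 x4 x5 zz yb by simp_all
     qed
    qed
   qed
  qed
 qed
qed

lemma wp_SEP:
 assumes B: "2 \<le> B" and s: "pinp B N P cls badj s" "point_sets N s"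
  and Q: "\<And>s' Z Y. \<lbrakk>eqx sepmods s s'; best Z Y;
    (\<And>p. p < N \<Longrightarrow> s' ''zz'' p \<noteq> 0 \<longleftrightarrow> p \<in> Z); (\<And>p. p \<in> P \<Longrightarrow> s' ''yb'' p \<noteq> 0 \<longleftrightarrow> Y (cls p))\<rbrakk> \<Longrightarrow> Q s'"
 shows "wp B SEP s Q"
 unfolding SEP_def
proof (rule wp_Seq[OF B], rule wp_SEPA[OF B s])
 fix s1 assume h: "pinp B N P cls badj s1" "bid_state N s s1"
  "\<And>p q. auc_free N (s1 ''ow'') p \<Longrightarrow> E p q \<Longrightarrow> s1 ''pr'' q > N"
 have m: "eqx {''L'', ''R'', ''pr'', ''ow'', ''P'', ''Q''} s s1" "LR N s1" "auc_inv N E (s1 ''pr'') (s1 ''ow'')"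
  using h(2) unfolding bid_state_def by simp_all
 have ps: "point_sets N s1" using s(2) eqxD[OF m(1)] unfolding point_sets_def by simp
 show "wp B SEPB s1 Q"
 proof (rule wp_SEPB[OF B h(1) ps m(2,3) h(3)])
  fix s' Z Y assume q: "eqx {''l'', ''xx'', ''xb'', ''zz'', ''yb''} s1 s'" "best Z Y"
   "\<And>p. p < N \<Longrightarrow> s' ''zz'' p \<noteq> 0 \<longleftrightarrow> p \<in> Z" "\<And>p. p \<in> P \<Longrightarrow> s' ''yb'' p \<noteq> 0 \<longleftrightarrow> Y (cls p)"
  show "Q s'"
   by (rule Q[OF eqx_trans[OF m(1) q(1)] q(2-4)]) simp_all
 qed simp_all
qed

end

section \<open>Point separations as cuts of the quotient\<close>

context prime_points
begin

lemma sepI: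
 assumes "S1 \<subseteq> P" "S2 \<subseteq> P" "S1 \<inter> S2 = {}"
  "\<And>p q. \<lbrakk>p \<in> S1; q \<in> P; cls p = cls q\<rbrakk> \<Longrightarrow> q \<in> S1"
  "\<And>p q. \<lbrakk>p \<in> S2; q \<in> P; cls p = cls q\<rbrakk> \<Longrightarrow> q \<in> S2"
 shows "separation P cls badj S1 S2"
proof
 show "finite P" by (rule finP)
 show "S1 \<subseteq> P" "S2 \<subseteq> P" "S1 \<inter> S2 = {}" by (rule assms)+
 show "q \<in> S1" if "p \<in> S1" "q \<in> P" "cls p = cls q" for p q by (rule assms(4)[OF that])
 show "q \<in> S2" if "p \<in> S2" "q \<in> P" "cls p = cls q" for p q by (rule assms(5)[OF that])
 show "badj c b" if "badj b c" for b c by (rule badj_sym[OF that])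
qed

lemma best_cov:
 assumes sep: "separation P cls badj S1 S2" and best: "separation.best P cls badj S1 S2 Z Y"
 shows "cov (cls ` Z) {b \<in> BL. Y b}" "wt (cls ` Z) = card Z"
  "\<lbrakk>cov Z' W; (\<And>p. p \<in> S1 \<Longrightarrow> cls p \<in> W); (\<And>p. p \<in> S2 \<Longrightarrow> cls p \<notin> W)\<rbrakk> \<Longrightarrow> card Z \<le> wt Z'"
  "p \<in> S1 \<Longrightarrow> Y (cls p)" "p \<in> S2 \<Longrightarrow> \<not> Y (cls p)" "Z \<subseteq> P"
  "\<lbrakk>p \<in> Z; q \<in> P; cls p = cls q\<rbrakk> \<Longrightarrow> q \<in> Z"
proof -
 interpret S: separation P cls badj S1 S2 by (rule sep)
 note bb = best[unfolded S.best_def]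
 note b1 = bb[THEN conjunct1] and b2 = bb[THEN conjunct2, THEN conjunct1]
  and b3 = bb[THEN conjunct2, THEN conjunct2, THEN conjunct1]
  and b4 = bb[THEN conjunct2, THEN conjunct2, THEN conjunct2, THEN conjunct1]
  and b5 = bb[THEN conjunct2, THEN conjunct2, THEN conjunct2, THEN conjunct2, THEN conjunct1]
  and b6 = bb[THEN conjunct2, THEN conjunct2, THEN conjunct2, THEN conjunct2, THEN conjunct2]
 have pc: "pcov Z {b \<in> BL. Y b}"
  unfolding pcov_def
 using cls_BL b3 S.pcover_def by simp_all
 have c: "clsd Z" unfolding clsd_def by (rule conjI[OF b4 b5])
 show "cov (cls ` Z) {b \<in> BL. Y b}" "wt (cls ` Z) = card Z" by (rule pcov_cov[OF pc c])+
 show "Y (cls p)" if "p \<in> S1" by (rule bspec[OF b1 that])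
 show "\<not> Y (cls p)" if "p \<in> S2" by (rule bspec[OF b2 that])
 show "Z \<subseteq> P" by (rule b4)
 show "q \<in> Z" if "p \<in> Z" "q \<in> P" "cls p = cls q" using b5 that by simp
 show "card Z \<le> wt Z'" if h: "cov Z' W" "\<And>p. p \<in> S1 \<Longrightarrow> cls p \<in> W" "\<And>p. p \<in> S2 \<Longrightarrow> cls p \<notin> W"
 proof -
  note z = cov_pcov[OF h(1)]
  have p: "S.pcover {p \<in> P. cls p \<in> Z'} (\<lambda>b. b \<in> W)"
   using z(1) unfolding pcov_def S.pcover_def .
  have "card Z \<le> card {p \<in> P. cls p \<in> Z'}"
   by (rule b6[rule_format, OF h(2,3) p z(3)])
  then show ?thesis unfolding z(2) .
 qed
qed

text \<open>With complementary \<open>S1\<close> and \<open>S2\<close> the separation is forced to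
  be the cut of \<open>X\<close>, so the same routine computes a minimum cover of a given
  cut.\<close>

lemma best_all:
 assumes X: "X \<subseteq> BL" and S1: "S1 = {p \<in> P. cls p \<in> X}" and S2: "S2 = P - S1"
  and best: "separation.best P cls badj S1 S2 Z Y"
 shows "cov (cls ` Z) X" "wt (cls ` Z) = card Z" "cov Z' X \<Longrightarrow> card Z \<le> wt Z'" "Z \<subseteq> P"
  "\<lbrakk>p \<in> Z; q \<in> P; cls p = cls q\<rbrakk> \<Longrightarrow> q \<in> Z"
proof -
 have sep: "separation P cls badj S1 S2"
 proof (rule sepI)
  show "S1 \<subseteq> P" "S2 \<subseteq> P" "S1 \<inter> S2 = {}" unfolding S2 S1 by blast+
  show "q \<in> S1" if "p \<in> S1" "q \<in> P" "cls p = cls q" for p q using that unfolding S1 by simp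
  show "q \<in> S2" if "p \<in> S2" "q \<in> P" "cls p = cls q" for p q using that unfolding S2 S1 by simp
 qed
 note b = best_cov[OF sep best]
 have "{b \<in> BL. Y b} = X"
 using point_of S1 S2 b(5) X b(4) by blast
 then show "cov (cls ` Z) X" using b(1) by simp
 show "wt (cls ` Z) = card Z" "Z \<subseteq> P" "\<lbrakk>p \<in> Z; q \<in> P; cls p = cls q\<rbrakk> \<Longrightarrow> q \<in> Z" by (rule b; assumption)+
 show "cov Z' X \<Longrightarrow> card Z \<le> wt Z'" by (rule b(3)) (use S1 S2 in auto)
qed

text \<open>\<open>W\<close> competes for the separation of \<open>S1\<close> from
  \<open>S2\<close>, so the one found has a cover of weight less than \<open>K\<close>, and it
  divides \<open>S\<close> as \<open>W\<close> does; hence \<open>cut_parts\<close> applies. The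
  classes \<open>b1\<close> and \<open>b2\<close> among the terminals keep both parts
  nonempty.\<close>

lemma best_parts:
 assumes X: "X \<subseteq> BL" and S: "S \<subseteq> P" "cov (cls ` S) X" and W: "cov Z0 W" "wt Z0 < K"
  and SW: "wt (cls ` S \<inter> W) \<le> 3 * K" "wt (cls ` S - W) \<le> 3 * K"
  and b: "b1 \<in> X \<inter> W" "b2 \<in> X - W"
  and S1: "S1 = {p \<in> P. cls p \<in> cls ` S \<inter> W \<or> cls p = b1}"
  and S2: "S2 = {p \<in> P. p \<notin> S1 \<and> (p \<in> S \<or> cls p = b2)}"
  and sep: "separation P cls badj S1 S2" and best: "separation.best P cls badj S1 S2 Z Y"
 shows "okc {b \<in> X. Y b}" "okc {b \<in> X. \<not> Y b}" "Y b1" "\<not> Y b2"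
proof -
 note c = best_cov[OF sep best]
 have "card Z \<le> wt Z0" by (rule c(3)[OF W(1)]) (use b S1 S2 in auto)
 then have z: "wt (cls ` Z) < K" using c(2) W(2) by simp
 have y1: "cls ` S \<inter> W \<subseteq> {b \<in> BL. Y b}"
 using S(1) S1 c(4) cls_BL by blast
 have y2: "(cls ` S - W) \<inter> {b \<in> BL. Y b} = {}"
 using b S1 S(1) S2 c(5) by fastforce
 note k = cut_parts[OF S(2) c(1) z SW y1 y2]
 have "X \<inter> {b \<in> BL. Y b} = {b \<in> X. Y b}" "X - {b \<in> BL. Y b} = {b \<in> X. \<not> Y b}" using X by auto
 then show "okc {b \<in> X. Y b}" "okc {b \<in> X. \<not> Y b}" using k by simp_all
 obtain p1 where p1: "p1 \<in> P" "cls p1 = b1" using point_of b X by blast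
 then have "p1 \<in> S1" using S1 by simp
 then show "Y b1" using c(4) p1 by blast
 obtain p2 where p2: "p2 \<in> P" "cls p2 = b2" using point_of b X by blast
 moreover have "p2 \<notin> S1" using p2 b S1 by auto
 ultimately have "p2 \<in> S2" using S2 by simp
 then show "\<not> Y b2" using c(5) p2 by blast
qed

end

text \<open>The rule of the binary counter that enumerates subsets. It is kept as an array of bits,
  since extracting bits from a number is not a machine instruction.\<close>

lemma bit_Suc_iff: "bit (Suc x) r \<longleftrightarrow> bit x r \<noteq> (\<forall>r'<r. bit x r')" for x :: nat
proof (induction r arbitrary: x)
 case 0
 then show ?case by (simp add: bit_0)
next
 case (Suc r)
 have a: "(\<forall>r'<Suc r. bit x r') \<longleftrightarrow> odd x \<and> (\<forall>r'<r. bit (x div 2) r')"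
 proof
  assume h: "\<forall>r'<Suc r. bit x r'"
  have "odd x" using h by (auto simp: bit_0)
  moreover have "bit (x div 2) r'" if "r' < r" for r' using h that by (simp add: bit_Suc[symmetric])
  ultimately show "odd x \<and> (\<forall>r'<r. bit (x div 2) r')" by blast
 next
  assume h: "odd x \<and> (\<forall>r'<r. bit (x div 2) r')"
  show "\<forall>r'<Suc r. bit x r'"
  proof (intro allI impI)
   fix r' assume "r' < Suc r"
   then show "bit x r'" using h by (cases r') (simp_all add: bit_0 bit_Suc)
  qed
 qed
 show ?case
 proof (cases "odd x")
  case True
  then have "Suc x div 2 = Suc (x div 2)" by presburger
  then have "bit (Suc x) (Suc r) = bit (Suc (x div 2)) r" by (simp add: bit_Suc)
  then show ?thesis unfolding a Suc.IH using True by (simp add: bit_Suc)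
 next
  case False
  then have "Suc x div 2 = x div 2" by presburger
  then show ?thesis unfolding a using False by (simp add: bit_Suc)
 qed
qed

lemma subset_code: "\<exists>x<2 ^ m. \<forall>r<m. bit (x :: nat) r \<longleftrightarrow> r \<in> T"
proof (intro exI conjI)
 let ?x = "horner_sum of_bool 2 (map (\<lambda>r. r \<in> T) [0..<m]) :: nat"
 show "?x < 2 ^ m" using horner_sum_of_bool_2_less[of "map (\<lambda>r. r \<in> T) [0..<m]", where 'a = nat] by simp
 show "\<forall>r<m. bit ?x r \<longleftrightarrow> r \<in> T" by (simp add: bit_horner_sum_bit_iff)
qed

section \<open>Splitting a node\<close>

definition PTS :: "xexp \<Rightarrow> xexp \<Rightarrow> com" where
 "PTS a b = Seq (ARR ''p1'' (XN 0) ''p'' ''N'' (xand (XG ''ac'' (V ''p'')) a))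
   (ARR ''p2'' (XN 0) ''p'' ''N'' (xand (XG ''ac'' (V ''p'')) (xand (xnot (XG ''p1'' (V ''p''))) b)))"

definition vsep :: "string \<Rightarrow> com" where
 "vsep w = Seq (PTS (XG w (XG ''pv'' (V ''p''))) (XN 1)) SEP"

definition smallx :: xexp where
 "smallx = xand (xex ''v'' ''n'' (XG ''W'' (V ''v'')))
   (xor (xall ''v'' ''n'' (xall ''u'' ''n'' (ximp (xand (XG ''W'' (V ''v'')) (XG ''W'' (V ''u'')))
      (xeq (XG ''bk'' (V ''v'')) (XG ''bk'' (V ''u''))))))
     (xlt (xcnt ''p'' ''N'' (XG ''zz'' (V ''p''))) (V ''th'')))"

definition TEST :: com where
 "TEST = Seq (vsep ''W'') (SET ''ok'' (XN 0) smallx)"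

lemma asetI: "(\<And>v. v < n \<Longrightarrow> s x v \<noteq> 0 \<longleftrightarrow> v \<in> X) \<Longrightarrow> X \<subseteq> {..<n} \<Longrightarrow> aset s x n = X"
 unfolding aset_def by auto

lemma asetD: "aset s x n = X \<Longrightarrow> v < n \<Longrightarrow> s x v \<noteq> 0 \<longleftrightarrow> v \<in> X"
 unfolding aset_def by auto

text \<open>Both parts are tested with minimum covers of their own. A wrong guess is therefore
  harmless, and only the existence of one successful guess has to be shown.\<close>

definition CHECK :: com where
 "CHECK = Seq (ARR ''W'' (XN 0) ''v'' ''n'' (XG ''D'' (V ''v'')))
   (Seq TEST
   (Seq (SET ''o1'' (XN 0) (V ''ok''))
   (Seq (ARR ''W'' (XN 0) ''v'' ''n'' (xand (XG ''A'' (V ''v'')) (xnot (XG ''D'' (V ''v'')))))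
   (Seq TEST
    (IFF (xand (V ''o1'') (V ''ok''))
     (Seq (ARR ''C'' (XN 0) ''v'' ''n'' (XG ''D'' (V ''v''))) (SET ''fd'' (XN 0) (XN 1)))
     Skip)))))"

text \<open>Equal blocks of \<open>b1\<close> and \<open>b2\<close> encode the attempt to split off
  a single block. Otherwise \<open>c\<close> selects the cover points on the side of
  \<open>b1\<close>, indexed by rank, and the rank is found by counting.\<close>

definition SPLIT :: com where
 "SPLIT = IFF (xeq (XG ''bk'' (V ''b1'')) (XG ''bk'' (V ''b2'')))
   (ARR ''D'' (XN 0) ''v'' ''n'' (xand (XG ''A'' (V ''v'')) (xeq (XG ''bk'' (V ''v'')) (XG ''bk'' (V ''b1'')))))
   (Seq (PTS (xor (xex ''q'' ''N'' (xand (XG ''ss'' (V ''q'')) (xand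
         (XG ''c'' (xcnt ''j'' ''N'' (xand (XG ''ss'' (V ''j'')) (xlt (V ''j'') (V ''q'')))))
         (xeq (XG ''cl'' (V ''q'')) (XG ''cl'' (V ''p''))))))
        (xeq (XG ''cl'' (V ''p'')) (XG ''bk'' (V ''b1''))))
       (xor (XG ''ss'' (V ''p'')) (xeq (XG ''cl'' (V ''p'')) (XG ''bk'' (V ''b2'')))))
   (Seq SEP
    (ARR ''D'' (XN 0) ''v'' ''n'' (xand (XG ''A'' (V ''v'')) (xex ''p'' ''N''
     (xand (XG ''ac'' (V ''p'')) (xand (xeq (XG ''cl'' (V ''p'')) (XG ''bk'' (V ''v''))) (XG ''yb'' (V ''p'')))))))))"

abbreviation testmods :: "string set" where
 "testmods \<equiv> {''p1'', ''p2'', ''ok''} \<union> sepmods"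

text \<open>The bound \<open>th\<close> on the cover ensures that the counter has a bit for each of
  its points.\<close>

definition candx :: xexp where
 "candx = xand (xnot (V ''fd'')) (xand (xand (XG ''A'' (V ''b1'')) (XG ''A'' (V ''b2'')))
   (xor (xlt (xcnt ''p'' ''N'' (XG ''ss'' (V ''p''))) (V ''th'')) (xeq (XG ''bk'' (V ''b1'')) (XG ''bk'' (V ''b2'')))))"

definition CAND :: com where
 "CAND = IFF candx
   (Seq SPLIT CHECK) Skip"

definition COUNTER :: com where
 "COUNTER = Seq (ARR ''cd'' (XN 0) ''r'' ''th'' (xnot (xeq (xbool (XG ''c'' (V ''r'')))
    (xbool (xall ''i'' ''th'' (ximp (xlt (V ''i'') (V ''r'')) (XG ''c'' (V ''i''))))))))
   (ARR ''c'' (XN 0) ''r'' ''th'' (XG ''cd'' (V ''r'')))"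

definition SEARCH :: com where
 "SEARCH = Seq (SET ''fd'' (XN 0) (XN 0)) (Seq (ARR ''c'' (XN 0) ''r'' ''th'' (XN 0))
   (FOR ''x'' ''pw'' (Seq (FOR ''b1'' ''n'' (FOR ''b2'' ''n'' CAND)) COUNTER)))"

abbreviation searchmods :: "string set" where
 "searchmods \<equiv> {''D'', ''W'', ''o1'', ''C'', ''fd'', ''b1'', ''b2'', ''c'', ''cd'', ''x''} \<union> testmods"

lemma wp_COUNTER:
 assumes B: "2 \<le> B" and s: "s ''th'' 0 = m" "m \<le> B" "\<And>r. r < m \<Longrightarrow> s ''c'' r \<noteq> 0 \<longleftrightarrow> bit (x :: nat) r"
  and Q: "\<And>s'. eqx {''c'', ''cd''} s s' \<Longrightarrow> (\<And>r. r < m \<Longrightarrow> s' ''c'' r \<noteq> 0 \<longleftrightarrow> bit (Suc x) r) \<Longrightarrow> Q s'"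
 shows "wp B COUNTER s Q"
 unfolding COUNTER_def
proof (rule wp_Seq_ARR[OF B B], goal_cases)
 case 1
 show ?case using s(1,2) by simp
 case (2 s1)
 note h1 = 2
 note x1 = eqx1[OF h1(1)]
 show ?case
 proof (rule wp_ARR1[OF B], goal_cases)
  case 1
  show ?case using s(1,2) x1 by simp
 next
  case (2 s2)
  show ?case
  proof (rule Q)
   show "eqx {''c'', ''cd''} s s2" by (rule eqx_trans[OF h1(1) 2(1)]) auto
   fix r assume r: "r < m"
   have "s2 ''c'' r \<noteq> 0 \<longleftrightarrow> s1 ''cd'' r \<noteq> 0" using 2(3)[of r] r s(1) x1 by simp
   also have "\<dots> \<longleftrightarrow> ((s ''c'' r \<noteq> 0) \<noteq> (\<forall>i<m. i < r \<longrightarrow> s ''c'' i \<noteq> 0))"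
    using h1(3)[of r] r s(1) by (simp add: of_bool_eq_iff)
   also have "\<dots> \<longleftrightarrow> (bit x r \<noteq> (\<forall>i<r. bit x i))" using s(3) r by (metis less_trans)
   finally show "s2 ''c'' r \<noteq> 0 \<longleftrightarrow> bit (Suc x) r" unfolding bit_Suc_iff .
  qed
 qed
qed

text \<open>Different cover points use different bits, so every subset of the cover has a
  code.\<close>

lemma rank_inj:
 fixes S :: "nat set"
 assumes "finite S" "q \<in> S" "q' \<in> S" "card {j \<in> S. j < q} = card {j \<in> S. j < q'}"
 shows "q = q'"
proof -
 have lt: "card {j \<in> S. j < a} < card {j \<in> S. j < b}" if "a \<in> S" "a < b" for a b
 proof (rule psubset_card_mono)
  show "{j \<in> S. j < a} \<subset> {j \<in> S. j < b}" using that by auto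
 qed (use assms(1) in simp)
 show ?thesis using lt[OF assms(2), of q'] lt[OF assms(3), of q] assms(4) by (cases q q' rule: linorder_cases) simp_all
qed

context nodes
begin

definition part_ok :: "nat \<Rightarrow> nat set \<Rightarrow> bool" where
 "part_ok t W \<longleftrightarrow> W \<noteq> {} \<and> ((\<forall>x\<in>W. \<forall>y\<in>W. blkt t x = blkt t y) \<or> covered t W)"

context
 fixes t B :: nat
 assumes ctx: "prime_points n adj (blkt t) K (wgt t) (4 * K)" and B: "2 \<le> B"
begin

interpretation C: prime_points n adj "blkt t" K "wgt t" "4 * K" by (rule ctx)

definition cin :: "state \<Rightarrow> bool" where
 "cin s \<longleftrightarrow> pinp B (n * (4 * K)) C.P C.cls C.badj s \<and> s ''n'' 0 = n \<and> n \<le> B \<and> s ''th'' 0 = 4 * K \<and> 4 * K \<le> B \<and>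
   (\<forall>v<n. s ''bk'' v = blkt t v) \<and> (\<forall>p<n * (4 * K). s ''pv'' p = p div (4 * K))"

lemma cin_eqx:
 assumes "cin s" "eqx M s s'"
  "{''N'', ''NN'', ''n'', ''ac'', ''cl'', ''G'', ''pv'', ''th'', ''bk''} \<inter> M = {}"
 shows "cin s'"
proof -
 have "pinp B (n * (4 * K)) C.P C.cls C.badj s'"
  by (rule pinp_eqx[OF _ assms(2)]) (use assms(1,3) in \<open>simp_all add: cin_def\<close>)
 then show ?thesis using assms(1,3) eqxD[OF assms(2)] unfolding cin_def by simp
qed

lemma cinD:
 assumes "cin s"
 shows "s ''n'' 0 = n" "n \<le> B" "s ''th'' 0 = 4 * K" "4 * K \<le> B" "v < n \<Longrightarrow> s ''bk'' v = blkt t v"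
  "p < n * (4 * K) \<Longrightarrow> s ''pv'' p = p div (4 * K)" "pinp B (n * (4 * K)) C.P C.cls C.badj s"
  "s ''N'' 0 = n * (4 * K)" "n * (4 * K) \<le> B" "p < n * (4 * K) \<Longrightarrow> s ''ac'' p \<noteq> 0 \<longleftrightarrow> p \<in> C.P"
  "p \<in> C.P \<Longrightarrow> s ''cl'' p = C.cls p" "p \<in> C.P \<Longrightarrow> p < n * (4 * K)"
 using assms unfolding cin_def pinp_def by auto

lemma wp_PTS:
 assumes s: "cin s" and ab: "ok B s a \<and> ok B s b \<and> ''p1'' \<notin> names a \<and> ''p1'' \<notin> names b \<and> ''p2'' \<notin> names b"
  and TA: "\<And>p. p \<in> C.P \<Longrightarrow> tr a (sc s ''p'' p) \<longleftrightarrow> p \<in> TA" and TB: "\<And>p. p \<in> C.P \<Longrightarrow> tr b (sc s ''p'' p) \<longleftrightarrow> p \<in> TB"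
  and Q: "\<And>s'. \<lbrakk>eqx {''p1'', ''p2''} s s'; cin s';
   (\<And>p. p < n * (4 * K) \<Longrightarrow> s' ''p1'' p \<noteq> 0 \<longleftrightarrow> p \<in> C.P \<inter> TA);
   (\<And>p. p < n * (4 * K) \<Longrightarrow> s' ''p2'' p \<noteq> 0 \<longleftrightarrow> p \<in> (C.P - TA) \<inter> TB)\<rbrakk> \<Longrightarrow> Q s'"
 shows "wp B (PTS a b) s Q"
 unfolding PTS_def
proof (rule wp_Seq_ARR[OF B B], goal_cases)
 note c = cinD[OF s]
 case 1
 show ?case using c(8,9) ab by simp
 case (2 s1)
 note x1 = eqx1[OF 2(1)]
 have p1: "s1 ''p1'' p \<noteq> 0 \<longleftrightarrow> p \<in> C.P \<inter> TA" if p: "p < n * (4 * K)" for p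
 proof -
  have "s1 ''p1'' p \<noteq> 0 \<longleftrightarrow> s ''ac'' p \<noteq> 0 \<and> tr a (sc s ''p'' p)" using 2(3)[of p] c(8) p by simp
  then show ?thesis unfolding c(10)[OF p] using TA by blast
 qed
 show ?case
 proof (rule wp_ARR1[OF B], goal_cases)
  case 1
  have "ok B s1 b = ok B s b" by (rule ok_cong) (use x1 ab in metis)
  then show ?case using c(8,9) ab x1 by simp
 next
  case (2 s2)
  note x2 = eqx1[OF 2(1)]
  have p2: "s2 ''p2'' p \<noteq> 0 \<longleftrightarrow> p \<in> (C.P - TA) \<inter> TB" if p: "p < n * (4 * K)" for p
  proof -
   have "xval b (sc s1 ''p'' p) = xval b (sc s ''p'' p)"
    by (rule xval_cong) (use x1 ab in \<open>metis fun_upd_apply\<close>)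
   then have e: "tr b (sc s1 ''p'' p) = tr b (sc s ''p'' p)" unfolding tr_def by simp
   have "s2 ''p2'' p \<noteq> 0 \<longleftrightarrow> s ''ac'' p \<noteq> 0 \<and> \<not> s1 ''p1'' p \<noteq> 0 \<and> tr b (sc s1 ''p'' p)"
    using 2(3)[of p] c(8) p x1 by simp
   then show ?thesis unfolding c(10)[OF p] p1[OF p] e using TB by blast
  qed
  have e: "eqx {''p1'', ''p2''} s s2" unfolding eqx_def using x1 x2 by simp
  show ?case
  proof (rule Q[OF e])
   show "cin s2" by (rule cin_eqx[OF s e]) simp
   show "(s2 ''p1'' p \<noteq> 0) = (p \<in> C.P \<inter> TA)" if "p < n * (4 * K)" for p using p1[OF that] x2 by simp
  qed (rule p2)
 qed
qed

lemma wp_vsep: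
 assumes s: "cin s" and w: "w \<notin> {tmp, ''p1'', ''p2'', ''p'', ''_''}" and W: "aset s w n = W" "bclosed t W"
  and Q: "\<And>s' Z. \<lbrakk>eqx ({''p1'', ''p2''} \<union> sepmods) s s'; cin s';
   (\<And>p. p < n * (4 * K) \<Longrightarrow> s' ''zz'' p \<noteq> 0 \<longleftrightarrow> p \<in> Z); Z \<subseteq> C.P; C.cov (C.cls ` Z) (blkt t ` W);
   C.wt (C.cls ` Z) = card Z; (\<And>Z'. C.cov Z' (blkt t ` W) \<Longrightarrow> card Z \<le> C.wt Z');
   (\<And>p q. p \<in> Z \<Longrightarrow> q \<in> C.P \<Longrightarrow> C.cls p = C.cls q \<Longrightarrow> q \<in> Z)\<rbrakk> \<Longrightarrow> Q s'"
 shows "wp B (vsep w) s Q"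
 unfolding vsep_def
proof (rule wp_Seq[OF B], rule wp_PTS[OF s, where TA = "{p. C.cls p \<in> blkt t ` W}" and TB = UNIV], goal_cases)
 note c = cinD[OF s]
 case 1
 show ?case using w by auto
 case (2 p)
 have pn: "p < n * (4 * K)" using c(12)[OF 2] .
 then have pd: "p div (4 * K) < n" using K0 by (simp add: less_mult_imp_div_less)
 have "tr (XG w (XG ''pv'' (V ''p''))) (sc s ''p'' p) \<longleftrightarrow> s w (p div (4 * K)) \<noteq> 0" using w c(6)[OF pn] by simp
 also have "\<dots> \<longleftrightarrow> p div (4 * K) \<in> W" by (rule asetD[OF W(1) pd])
 also have "\<dots> \<longleftrightarrow> C.cls p \<in> blkt t ` W"
 proof
  assume "C.cls p \<in> blkt t ` W"
  then obtain v where "v \<in> W" "blkt t v = blkt t (p div (4 * K))" unfolding C.cls_def by auto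
  then show "p div (4 * K) \<in> W" using W(2) pd unfolding bclosed_def by blast
 qed (simp add: C.cls_def)
 finally show ?case by simp
next
 case (3 p)
 show ?case by (simp add: tr_def)
next
 case (4 s1)
 let ?S1 = "{p \<in> C.P. C.cls p \<in> blkt t ` W}"
 have WB: "blkt t ` W \<subseteq> C.BL" unfolding C.BL_def W(1)[symmetric] aset_def by auto
 have sep: "separation C.P C.cls C.badj ?S1 (C.P - ?S1)"
 proof (rule C.sepI)
  show "q \<in> ?S1" if "p \<in> ?S1" "q \<in> C.P" "C.cls p = C.cls q" for p q using that by simp
  show "q \<in> C.P - ?S1" if "p \<in> C.P - ?S1" "q \<in> C.P" "C.cls p = C.cls q" for p q using that by simp
 qed auto
 have ps: "separation.point_sets ?S1 (C.P - ?S1) (n * (4 * K)) s1"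
  unfolding separation.point_sets_def[OF sep] using 4(3,4) by auto
 show ?case
 proof (rule separation.wp_SEP[OF sep B cinD(7)[OF 4(2)] ps])
  fix s2 Z Y assume h: "eqx sepmods s1 s2" "separation.best C.P C.cls C.badj ?S1 (C.P - ?S1) Z Y"
   "\<And>p. p < n * (4 * K) \<Longrightarrow> s2 ''zz'' p \<noteq> 0 \<longleftrightarrow> p \<in> Z"
  note b = C.best_all[OF WB refl refl h(2)]
  show "Q s2"
  proof (rule Q)
   show "eqx ({''p1'', ''p2''} \<union> sepmods) s s2" by (rule eqx_trans[OF 4(1) h(1)]) auto
   show "cin s2" by (rule cin_eqx[OF 4(2) h(1)]) simp
   show "(s2 ''zz'' p \<noteq> 0) = (p \<in> Z)" if "p < n * (4 * K)" for p by (rule h(3)[OF that])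
   show "q \<in> Z" if "p \<in> Z" "q \<in> C.P" "C.cls p = C.cls q" for p q by (rule b(5)[OF that])
  qed (rule b; assumption)+
 qed
qed

lemma wp_TEST:
 assumes s: "cin s" and W: "aset s ''W'' n = W" "bclosed t W"
  and Q: "\<And>s'. eqx ({''p1'', ''p2'', ''ok''} \<union> sepmods) s s' \<Longrightarrow> (s' ''ok'' 0 \<noteq> 0 \<longleftrightarrow> part_ok t W) \<Longrightarrow> Q s'"
 shows "wp B TEST s Q"
 unfolding TEST_def
proof (rule wp_Seq[OF B], rule wp_vsep[OF s _ W], goal_cases)
 case (2 s1 Z)
 note h = 2
 note c = cinD[OF 2(2)]
 have W1: "s1 ''W'' v \<noteq> 0 \<longleftrightarrow> v \<in> W" if "v < n" for v
  using asetD[OF W(1) that] eqxD[OF 2(1), of "''W''"] by simp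
 have Wn: "W \<subseteq> {..<n}" unfolding W(1)[symmetric] aset_def by auto
 show ?case
 proof (rule wp_SET0[OF B], goal_cases)
  case 1
  show ?case using c(1-4,8,9) unfolding smallx_def by simp
 next
  case 2
  show ?case
  proof (rule Q)
   show "eqx ({''p1'', ''p2'', ''ok''} \<union> sepmods) s (sc s1 ''ok'' (xval smallx s1))"
    by (rule eqx_upd[OF eqx_trans[OF h(1) eqx_refl[of "{}"]]]) auto
   have "sc s1 ''ok'' (xval smallx s1) ''ok'' 0 \<noteq> 0 \<longleftrightarrow> tr smallx s1" unfolding tr_def by simp
   also have "\<dots> \<longleftrightarrow> (\<exists>v<n. s1 ''W'' v \<noteq> 0) \<and>
     ((\<forall>v<n. \<forall>u<n. s1 ''W'' v \<noteq> 0 \<and> s1 ''W'' u \<noteq> 0 \<longrightarrow> s1 ''bk'' v = s1 ''bk'' u) \<or>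
     card {p. p < n * (4 * K) \<and> s1 ''zz'' p \<noteq> 0} < 4 * K)"
    using c(1,3,8) unfolding smallx_def by simp
   also have "(\<exists>v<n. s1 ''W'' v \<noteq> 0) \<longleftrightarrow> W \<noteq> {}" using W1 Wn by blast
   also have "(\<forall>v<n. \<forall>u<n. s1 ''W'' v \<noteq> 0 \<and> s1 ''W'' u \<noteq> 0 \<longrightarrow> s1 ''bk'' v = s1 ''bk'' u) \<longleftrightarrow>
     (\<forall>v\<in>W. \<forall>u\<in>W. blkt t v = blkt t u)" using W1 Wn c(5) by (auto simp: subset_iff)
   also have "{p. p < n * (4 * K) \<and> s1 ''zz'' p \<noteq> 0} = Z" using h(3,4) c(12) by blast
   also have "card Z < 4 * K \<longleftrightarrow> covered t W"
   proof
    assume "card Z < 4 * K"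
    then show "covered t W" unfolding covered_def using h(5,6) by metis
   next
    assume "covered t W"
    then obtain Z' where "C.cov Z' (blkt t ` W)" "C.wt Z' < 4 * K" unfolding covered_def by blast
    then show "card Z < 4 * K" using h(7)[of Z'] by simp
   qed
   finally show "(sc s1 ''ok'' (xval smallx s1) ''ok'' 0 \<noteq> 0) = part_ok t W" unfolding part_ok_def .
  qed
 qed
qed simp

lemma wp_CHECK:
 assumes s: "cin s" and A: "aset s ''A'' n = A" and D: "aset s ''D'' n = D" "D \<subseteq> A" "bclosed t D" "bclosed t (A - D)"
  and Q: "\<And>s'. eqx ({''W'', ''o1'', ''C'', ''fd''} \<union> testmods) s s' \<Longrightarrow>
   (if part_ok t D \<and> part_ok t (A - D) then s' ''fd'' 0 \<noteq> 0 \<and> aset s' ''C'' n = D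
    else s' ''fd'' = s ''fd'' \<and> s' ''C'' = s ''C'') \<Longrightarrow> Q s'"
 shows "wp B CHECK s Q"
 unfolding CHECK_def
proof (rule wp_Seq_ARR[OF B B], goal_cases)
 note c = cinD[OF s]
 let ?M = "{''W'', ''o1'', ''C'', ''fd''} \<union> testmods"
 case 1
 show ?case using c(1,2) by simp
 case (2 s1)
 have c1: "cin s1" by (rule cin_eqx[OF s 2(1)]) simp
 note x1 = eqx1[OF 2(1)]
 have Dn: "D \<subseteq> {..<n}" and An: "A \<subseteq> {..<n}" unfolding A[symmetric] D(1)[symmetric] aset_def by auto
 have W1: "aset s1 ''W'' n = D"
  by (rule asetI[OF _ Dn]) (use 2(3) c(1) asetD[OF D(1)] in simp)
 show ?case
 proof (rule wp_Seq[OF B], rule wp_TEST[OF c1 W1 D(3)], goal_cases)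
  case (1 s2)
  note h2 = 1
  have x2: "s2 x = s x" if "x \<notin> ?M" for x using eqxD[OF h2(1), of x] x1[of x] that by auto
  have y2: "s2 ''C'' = s ''C''" "s2 ''fd'' = s ''fd''" "s2 ''D'' = s ''D''" "s2 ''A'' = s ''A''" "s2 ''n'' = s ''n''"
   using eqxD[OF h2(1)] x1 by simp_all
  show ?case
  proof (rule wp_Seq_SET[OF B B], goal_cases)
   case 1
   show ?case by simp
  next
   case 2
   let ?s3 = "sc s2 ''o1'' (xval (V ''ok'') s2)"
   have o3: "?s3 ''o1'' 0 \<noteq> 0 \<longleftrightarrow> part_ok t D" using h2(2) by simp
   have y3: "?s3 x = s x" if "x \<notin> ?M" for x using x2[OF that] that by auto
   have z3: "?s3 ''C'' = s ''C''" "?s3 ''fd'' = s ''fd''" using y2 by simp_all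
   have e3: "eqx ?M s ?s3" unfolding eqx_def using y3 by blast
   have c3: "cin ?s3" by (rule cin_eqx[OF s e3]) simp
   show ?case
   proof (rule wp_Seq_ARR[OF B B], goal_cases)
    case 1
    show ?case using c(1,2) y2 by simp
   next
    case (2 s4)
    note h4 = 2
    note x4 = eqx1[OF h4(1)]
    have c4: "cin s4" by (rule cin_eqx[OF c3 h4(1)]) simp
    have W4: "aset s4 ''W'' n = A - D"
    proof (rule asetI)
     fix v assume v: "v < n"
     have "s4 ''W'' v \<noteq> 0 \<longleftrightarrow> s ''A'' v \<noteq> 0 \<and> \<not> s ''D'' v \<noteq> 0"
      using h4(3)[of v] v c(1) y2 by simp
     then show "s4 ''W'' v \<noteq> 0 \<longleftrightarrow> v \<in> A - D" unfolding asetD[OF A v] asetD[OF D(1) v] by simp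
    qed (use An in blast)
    show ?case
    proof (rule wp_Seq[OF B], rule wp_TEST[OF c4 W4 D(4)], goal_cases)
     case (1 s5)
     note h5 = 1
     have y5: "s5 x = s x" if "x \<notin> ?M" for x
      using eqxD[OF h5(1), of x] x4[of x] y3[OF that] that by auto
     have z5: "s5 ''C'' = s ''C''" "s5 ''fd'' = s ''fd''" "s5 ''o1'' = ?s3 ''o1''"
      using eqxD[OF h5(1)] x4 z3 by simp_all
     have e5: "eqx ?M s s5" unfolding eqx_def using y5 by blast
     have t5: "tr (xand (V ''o1'') (V ''ok'')) s5 \<longleftrightarrow> part_ok t D \<and> part_ok t (A - D)"
      using h5(2) o3 z5(3) by simp
     show ?case
     proof (rule wp_IFF'[OF B], goal_cases)
      case 1
      show ?case by simp
     next
      case 2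
      then have ok: "part_ok t D \<and> part_ok t (A - D)" unfolding t5 .
      have n5: "s5 ''n'' 0 = n" "s5 ''D'' = s ''D''" using y5[of "''n''"] y5[of "''D''"] c(1) by simp_all
      show ?case
      proof (rule wp_Seq_ARR[OF B B], goal_cases)
       case 1
       show ?case using n5 c(2) by simp
      next
       case (2 s6)
       note h6 = 2
       have C6: "aset s6 ''C'' n = D"
        by (rule asetI[OF _ Dn]) (use h6(3) n5 asetD[OF D(1)] in simp)
       show ?case
       proof (rule wp_SET0[OF B], goal_cases)
        case 1
        show ?case by simp
       next
        case 2
        have "eqx ?M s (sc s6 ''fd'' (xval (XN 1) s6))"
         by (rule eqx_upd[OF eqx_trans[OF e5 h6(1)]]) auto
        moreover have "aset (sc s6 ''fd'' (xval (XN 1) s6)) ''C'' n = D" using C6 unfolding aset_def by simp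
        ultimately show ?case using ok by (intro Q) simp_all
       qed
      qed
     next
      case 3
      then have nok: "\<not> (part_ok t D \<and> part_ok t (A - D))" unfolding t5 .
      show ?case
       by (rule wp_Skip[OF B], rule Q[OF e5], unfold if_not_P[OF nok], intro conjI z5)
     qed
    qed
   qed
  qed
 qed
qed

text \<open>Suffices for iteration \<open>(x, b1, b2)\<close> of the search to succeed: the bits of \<open>x\<close> select the part of the cover \<open>S\<close> on the side of \<open>b1\<close>.\<close>

definition win :: "nat set \<Rightarrow> nat set \<Rightarrow> nat \<Rightarrow> nat \<Rightarrow> nat \<Rightarrow> bool" where
 "win A S x b1 b2 \<longleftrightarrow> b1 \<in> A \<and> b2 \<in> A \<and>
   (if blkt t b1 = blkt t b2 then part_ok t {v \<in> A. blkt t v = blkt t b1} \<and> part_ok t {v \<in> A. blkt t v \<noteq> blkt t b1}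
   else card S < 4 * K \<and> (\<exists>W Z0. C.cov Z0 W \<and> C.wt Z0 < K \<and> C.wt (C.cls ` S \<inter> W) \<le> 3 * K \<and> C.wt (C.cls ` S - W) \<le> 3 * K \<and>
     blkt t b1 \<in> W \<and> blkt t b2 \<notin> W \<and>
     (\<forall>q\<in>S. bit x (card {j \<in> S. j < q}) \<longleftrightarrow> C.cls q \<in> W)))"

lemma part_okI:
 assumes A: "A \<subseteq> {..<n}" and D: "D = {v \<in> A. Y (blkt t v)}" "D \<noteq> {}" and okc: "C.okc {b \<in> blkt t ` A. Y b}"
 shows "part_ok t D"
proof -
 have im: "blkt t ` D = {b \<in> blkt t ` A. Y b}" unfolding D(1) by auto
 have "(\<exists>c. blkt t ` D = {c}) \<or> (\<exists>Z. C.cov Z (blkt t ` D) \<and> C.wt Z < 4 * K)"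
  using okc unfolding C.okc_def im .
 then show ?thesis
 proof
  assume "\<exists>c. blkt t ` D = {c}"
  then obtain c where "blkt t ` D = {c}" by blast
  then have "blkt t x = c" if "x \<in> D" for x using that by blast
  then show ?thesis unfolding part_ok_def using D(2) by simp
 next
  assume "\<exists>Z. C.cov Z (blkt t ` D) \<and> C.wt Z < 4 * K"
  then show ?thesis unfolding part_ok_def covered_def using D(2) by blast
 qed
qed

lemma bclosed_sel:
 assumes "bclosed t A"
 shows "bclosed t {v \<in> A. Y (blkt t v)}"
 unfolding bclosed_def
using assms bclosed_def by auto

text \<open>\<open>D\<close> is a union of blocks inside \<open>A\<close> for every guess; that both
  parts are acceptable is claimed for winning guesses only, by \<open>best_parts\<close>.\<close>

lemma wp_SPLIT:
 assumes s: "cin s" and A: "aset s ''A'' n = A" "bclosed t A"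
  and S: "aset s ''ss'' (n * (4 * K)) = S" "S \<subseteq> C.P" "C.cov (C.cls ` S) (blkt t ` A)"
   "\<And>p q. \<lbrakk>p \<in> S; q \<in> C.P; C.cls p = C.cls q\<rbrakk> \<Longrightarrow> q \<in> S"
  and c: "\<And>r. r < 4 * K \<Longrightarrow> s ''c'' r \<noteq> 0 \<longleftrightarrow> bit x r" "card S < 4 * K \<or> blkt t b1 = blkt t b2"
  and b: "s ''b1'' 0 = b1" "s ''b2'' 0 = b2" "b1 \<in> A" "b2 \<in> A"
  and Q: "\<And>s' D. \<lbrakk>eqx ({''p1'', ''p2'', ''D''} \<union> sepmods) s s'; aset s' ''D'' n = D; D \<subseteq> A;
    bclosed t D; bclosed t (A - D); (win A S x b1 b2 \<Longrightarrow> part_ok t D \<and> part_ok t (A - D))\<rbrakk> \<Longrightarrow> Q s'"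
 shows "wp B SPLIT s Q"
proof -
 note ci = cinD[OF s]
 have An: "A \<subseteq> {..<n}" unfolding A(1)[symmetric] aset_def by auto
 have bn: "b1 < n" "b2 < n" using b(3,4) An by auto
 have cond: "tr (xeq (XG ''bk'' (V ''b1'')) (XG ''bk'' (V ''b2''))) s \<longleftrightarrow> blkt t b1 = blkt t b2"
  using ci(5) bn b(1,2) by simp
 show ?thesis
  unfolding SPLIT_def
 proof (rule wp_IFF'[OF B], goal_cases)
  case 1
  show ?case by simp
 next
  case 2
  then have eq: "blkt t b1 = blkt t b2" unfolding cond .
  show ?case
  proof (rule wp_ARR1[OF B], goal_cases)
   case 1
   show ?case using ci(1,2) by simp
  next
   case (2 s1)
   note h = 2
   let ?D = "{v \<in> A. blkt t v = blkt t b1}"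
   have D: "aset s1 ''D'' n = ?D"
   proof (rule asetI)
    fix v assume v: "v < n"
    have "s1 ''D'' v \<noteq> 0 \<longleftrightarrow> s ''A'' v \<noteq> 0 \<and> blkt t v = blkt t b1"
     using h(3)[of v] v ci(1,5) bn b(1) by simp
    then show "s1 ''D'' v \<noteq> 0 \<longleftrightarrow> v \<in> ?D" unfolding asetD[OF A(1) v] by simp
   qed (use An in blast)
   have co: "A - ?D = {v \<in> A. blkt t v \<noteq> blkt t b1}" by auto
   show ?case
   proof (rule Q[OF _ D])
    show "eqx ({''p1'', ''p2'', ''D''} \<union> sepmods) s s1" by (rule eqx_trans[OF h(1) eqx_refl[of "{}"]]) auto
    show "bclosed t ?D" by (rule bclosed_sel[OF A(2)])
    show "bclosed t (A - ?D)" unfolding co by (rule bclosed_sel[OF A(2)])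
    show "part_ok t ?D \<and> part_ok t (A - ?D)" if "win A S x b1 b2"
     using that eq unfolding win_def co by simp
   qed blast
  qed
 next
  case 3
  then have ne: "blkt t b1 \<noteq> blkt t b2" unfolding cond .
  then have cS: "card S < 4 * K" using c(2) by blast
  let ?N = "n * (4 * K)"
  have SN: "S \<subseteq> {..<?N}" using S(2) ci(12) by blast
  have finS: "finite S" using SN finite_subset by blast
  have rk: "card {j \<in> S. j < q} < 4 * K" for q
  proof -
   have "card {j \<in> S. j < q} \<le> card S" using finS by (intro card_mono) auto
   then show ?thesis using cS by simp
  qed
  have ssS: "s ''ss'' q \<noteq> 0 \<longleftrightarrow> q \<in> S" if "q < ?N" for q by (rule asetD[OF S(1) that])
  let ?sel = "\<lambda>q. bit x (card {j \<in> S. j < q})"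
  let ?TA = "{p. (\<exists>q\<in>S. ?sel q \<and> C.cls q = C.cls p) \<or> C.cls p = blkt t b1}"
  let ?TB = "{p. p \<in> S \<or> C.cls p = blkt t b2}"
  let ?S1 = "C.P \<inter> ?TA" and ?S2 = "(C.P - ?TA) \<inter> ?TB"
  show ?case
  proof (rule wp_Seq[OF B], rule wp_PTS[OF s, where TA = ?TA and TB = ?TB], goal_cases)
   case 1
   show ?case using ci(8,9) by simp
  next
   case (2 p)
   have pN: "p < ?N" using ci(12)[OF 2] .
   have r: "{j. j < ?N \<and> s ''ss'' j \<noteq> 0 \<and> j < q} = {j \<in> S. j < q}" for q
    using ssS SN by blast
   have cq: "s ''c'' (card {j \<in> S. j < q}) \<noteq> 0 \<longleftrightarrow> ?sel q" for q by (rule c(1)[OF rk])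
   have "tr (xor (xex ''q'' ''N'' (xand (XG ''ss'' (V ''q'')) (xand
          (XG ''c'' (xcnt ''j'' ''N'' (xand (XG ''ss'' (V ''j'')) (xlt (V ''j'') (V ''q'')))))
          (xeq (XG ''cl'' (V ''q'')) (XG ''cl'' (V ''p''))))))
         (xeq (XG ''cl'' (V ''p'')) (XG ''bk'' (V ''b1'')))) (sc s ''p'' p) \<longleftrightarrow>
     (\<exists>q<?N. s ''ss'' q \<noteq> 0 \<and> s ''c'' (card {j. j < ?N \<and> s ''ss'' j \<noteq> 0 \<and> j < q}) \<noteq> 0 \<and> s ''cl'' q = s ''cl'' p) \<or>
     s ''cl'' p = s ''bk'' b1"
    using ci(8) b(1) by simp
   also have "\<dots> \<longleftrightarrow> p \<in> ?TA"
    unfolding r cq ci(11)[OF 2] ci(5)[OF bn(1)]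
   proof -
    have "(\<exists>q<?N. s ''ss'' q \<noteq> 0 \<and> ?sel q \<and> s ''cl'' q = C.cls p) \<longleftrightarrow> (\<exists>q\<in>S. ?sel q \<and> C.cls q = C.cls p)"
    proof
     assume "\<exists>q<?N. s ''ss'' q \<noteq> 0 \<and> ?sel q \<and> s ''cl'' q = C.cls p"
     then obtain q where q: "q < ?N" "s ''ss'' q \<noteq> 0" "?sel q" "s ''cl'' q = C.cls p" by blast
     have "q \<in> S" using q(1,2) ssS by blast
     moreover from this have "C.cls q = C.cls p" using ci(11)[of q] S(2) q(4) by auto
     ultimately show "\<exists>q\<in>S. ?sel q \<and> C.cls q = C.cls p" using q(3) by blast
    next
     assume "\<exists>q\<in>S. ?sel q \<and> C.cls q = C.cls p"
     then obtain q where q: "q \<in> S" "?sel q" "C.cls q = C.cls p" by blast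
     have "q < ?N" using q(1) SN by blast
     moreover have "s ''ss'' q \<noteq> 0" using ssS[OF calculation] q(1) by blast
     moreover have "s ''cl'' q = C.cls p" using ci(11)[of q] S(2) q(1,3) by auto
     ultimately show "\<exists>q<?N. s ''ss'' q \<noteq> 0 \<and> ?sel q \<and> s ''cl'' q = C.cls p" using q(2) by blast
    qed
    then show "((\<exists>q<?N. s ''ss'' q \<noteq> 0 \<and> ?sel q \<and> s ''cl'' q = C.cls p) \<or> C.cls p = blkt t b1) = (p \<in> ?TA)" by simp
   qed
   finally show ?case .
  next
   case (3 p)
   have pN: "p < ?N" using ci(12)[OF 3] .
   have "tr (xor (XG ''ss'' (V ''p'')) (xeq (XG ''cl'' (V ''p'')) (XG ''bk'' (V ''b2'')))) (sc s ''p'' p) \<longleftrightarrow>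
     s ''ss'' p \<noteq> 0 \<or> s ''cl'' p = s ''bk'' b2" using b(2) by simp
   also have "\<dots> \<longleftrightarrow> p \<in> ?TB" unfolding ssS[OF pN] ci(11)[OF 3] ci(5)[OF bn(2)] by simp
   finally show ?case .
  next
   case (4 s1)
   note h1 = 4
   have sep: "separation C.P C.cls C.badj ?S1 ?S2"
   proof (rule C.sepI)
    show "q \<in> ?S1" if "p \<in> ?S1" "q \<in> C.P" "C.cls p = C.cls q" for p q using that by simp
    show "q \<in> ?S2" if pq: "p \<in> ?S2" "q \<in> C.P" "C.cls p = C.cls q" for p q
    proof -
     have "q \<notin> ?TA" using pq by simp
     moreover have "q \<in> ?TB" using pq S(4)[of p q] by auto
     ultimately show ?thesis using pq(2) by blast
    qed
    show "?S1 \<subseteq> C.P" "?S2 \<subseteq> C.P" "?S1 \<inter> ?S2 = {}" by blast+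
   qed
   have ps: "separation.point_sets ?S1 ?S2 ?N s1"
    unfolding separation.point_sets_def[OF sep] by (intro allI impI conjI h1(3,4))
   show ?case
   proof (rule wp_Seq[OF B], rule separation.wp_SEP[OF sep B cinD(7)[OF h1(2)] ps])
    fix s2 Z Y assume h2: "eqx sepmods s1 s2" "separation.best C.P C.cls C.badj ?S1 ?S2 Z Y"
     "\<And>p. p \<in> C.P \<Longrightarrow> s2 ''yb'' p \<noteq> 0 \<longleftrightarrow> Y (C.cls p)"
    have c2: "cin s2" by (rule cin_eqx[OF h1(2) h2(1)]) simp
    note ci2 = cinD[OF c2]
    have e2: "eqx ({''p1'', ''p2'', ''D''} \<union> sepmods) s s2" by (rule eqx_trans[OF h1(1) h2(1)]) auto
    have A2: "s2 ''A'' = s ''A''" using eqxD[OF e2, of "''A''"] by simp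
    let ?D = "{v \<in> A. Y (blkt t v)}"
    show "wp B (ARR ''D'' (XN 0) ''v'' ''n'' (xand (XG ''A'' (V ''v'')) (xex ''p'' ''N''
      (xand (XG ''ac'' (V ''p'')) (xand (xeq (XG ''cl'' (V ''p'')) (XG ''bk'' (V ''v''))) (XG ''yb'' (V ''p''))))))) s2 Q"
    proof (rule wp_ARR1[OF B], goal_cases)
     case 1
     show ?case using ci2(1,2,8,9) by simp
    next
     case (2 s3)
     note h3 = 2
     have D: "aset s3 ''D'' n = ?D"
     proof (rule asetI)
      fix v assume v: "v < n"
      have bv: "blkt t v \<in> C.BL" using v unfolding C.BL_def by blast
      have "s3 ''D'' v \<noteq> 0 \<longleftrightarrow> s2 ''A'' v \<noteq> 0 \<and>
        (\<exists>p<?N. s2 ''ac'' p \<noteq> 0 \<and> s2 ''cl'' p = s2 ''bk'' v \<and> s2 ''yb'' p \<noteq> 0)"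
       using h3(3)[of v] v ci2(1,8) by simp
      also have "(\<exists>p<?N. s2 ''ac'' p \<noteq> 0 \<and> s2 ''cl'' p = s2 ''bk'' v \<and> s2 ''yb'' p \<noteq> 0) \<longleftrightarrow> Y (blkt t v)"
      using ci2(10) ci2(11) ci2(5) v h2(3) C.point_of bv ci2(12) by metis
      finally show "s3 ''D'' v \<noteq> 0 \<longleftrightarrow> v \<in> ?D" unfolding A2 asetD[OF A(1) v] by simp
     qed (use An in blast)
     have co: "A - ?D = {v \<in> A. \<not> Y (blkt t v)}" by blast
     show ?case
     proof (rule Q[OF _ D])
      show "eqx ({''p1'', ''p2'', ''D''} \<union> sepmods) s s3" by (rule eqx_trans[OF e2 h3(1)]) auto
      show "bclosed t ?D" by (rule bclosed_sel[OF A(2)])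
      show "bclosed t (A - ?D)" unfolding co by (rule bclosed_sel[OF A(2), of "\<lambda>b. \<not> Y b"])
      assume w: "win A S x b1 b2"
      from w obtain W Z0 where W: "C.cov Z0 W" "C.wt Z0 < K" "C.wt (C.cls ` S \<inter> W) \<le> 3 * K"
       "C.wt (C.cls ` S - W) \<le> 3 * K" "blkt t b1 \<in> W" "blkt t b2 \<notin> W" "\<forall>q\<in>S. ?sel q \<longleftrightarrow> C.cls q \<in> W"
       unfolding win_def if_not_P[OF ne] by blast
      have XB: "blkt t ` A \<subseteq> C.BL" using An unfolding C.BL_def by blast
      \<comment> \<open>Whether a point is in \<open>W\<close> depends on its class alone, so
        selecting points of \<open>S\<close> amounts to selecting classes.\<close>
      have s1e: "?S1 = {p \<in> C.P. C.cls p \<in> C.cls ` S \<inter> W \<or> C.cls p = blkt t b1}"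
      proof -
       have "(\<exists>q\<in>S. ?sel q \<and> C.cls q = C.cls p) \<longleftrightarrow> C.cls p \<in> C.cls ` S \<inter> W" for p
       proof
        assume "\<exists>q\<in>S. ?sel q \<and> C.cls q = C.cls p"
        then obtain q where q: "q \<in> S" "?sel q" "C.cls q = C.cls p" by blast
        have "C.cls q \<in> W" using W(7) q(1,2) by blast
        then show "C.cls p \<in> C.cls ` S \<inter> W" using q(1,3) by (metis IntI imageI)
       next
        assume a: "C.cls p \<in> C.cls ` S \<inter> W"
        then obtain q where q: "q \<in> S" "C.cls q = C.cls p" by (metis IntD1 imageE)
        then show "\<exists>q\<in>S. ?sel q \<and> C.cls q = C.cls p" using W(7) a by (metis IntD2)
       qed
       then show ?thesis by blast
      qed
      have s2e: "?S2 = {p \<in> C.P. p \<notin> ?S1 \<and> (p \<in> S \<or> C.cls p = blkt t b2)}" by blast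
      have bb: "blkt t b1 \<in> blkt t ` A \<inter> W" "blkt t b2 \<in> blkt t ` A - W" using b(3,4) W(5,6) by blast+
      note bp = C.best_parts[OF XB S(2,3) W(1-4) bb s1e s2e sep h2(2)]
      have "part_ok t ?D"
       by (rule part_okI[OF An refl _ bp(1)]) (use bp(3) b(3) in blast)
      moreover have "part_ok t (A - ?D)"
       by (rule part_okI[OF An co _ bp(2)]) (use bp(4) b(4) in blast)
      ultimately show "part_ok t ?D \<and> part_ok t (A - ?D)" by blast
     qed blast
    qed
   qed
  qed
 qed
qed

definition solution :: "nat set \<Rightarrow> nat set \<Rightarrow> bool" where
 "solution A D \<longleftrightarrow> D \<subseteq> A \<and> bclosed t D \<and> bclosed t (A - D) \<and> part_ok t D \<and> part_ok t (A - D)"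

lemma wp_SEARCH:
 assumes s: "cin s" "s ''pw'' 0 = pw" "pw \<le> B" and A: "aset s ''A'' n = A" "bclosed t A"
  and S: "aset s ''ss'' (n * (4 * K)) = S" "S \<subseteq> C.P" "C.cov (C.cls ` S) (blkt t ` A)"
   "\<And>p q. \<lbrakk>p \<in> S; q \<in> C.P; C.cls p = C.cls q\<rbrakk> \<Longrightarrow> q \<in> S"
  and w: "x0 < pw" "b0 < n" "b0' < n" "win A S x0 b0 b0'"
  and Q: "\<And>s' D. \<lbrakk>eqx searchmods s s'; aset s' ''C'' n = D; solution A D\<rbrakk> \<Longrightarrow> Q s'"
 shows "wp B SEARCH s Q"
proof -
 let ?N = "n * (4 * K)"
 \<comment> \<open>\<open>Vs\<close> collects the guesses examined so far; if a winning one is among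
   them, \<open>fd\<close> has been set.\<close>
 define J where "J x Vs s' \<longleftrightarrow> eqx searchmods s s' \<and> (s' ''fd'' 0 \<noteq> 0 \<longrightarrow> solution A (aset s' ''C'' n)) \<and>
   (\<forall>r<4 * K. s' ''c'' r \<noteq> 0 \<longleftrightarrow> bit x r) \<and> s' ''x'' 0 = x \<and>
   (\<forall>(x, b1, b2)\<in>Vs. win A S x b1 b2 \<longrightarrow> s' ''fd'' 0 \<noteq> 0)"
  for x :: nat and Vs s'
 have Jx: "s' v = s v" if "J x Vs s'" "v \<notin> searchmods" for x Vs s' v
  using that(1) eqxD[of searchmods s s' v] that(2) unfolding J_def by blast
 have Jcin: "cin s'" if "J x Vs s'" for x Vs s'
  by (rule cin_eqx[OF s(1), of searchmods]) (use that in \<open>simp_all add: J_def\<close>)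
 have Jupd: "J x Vs (sc s' i j)" if "J x Vs s'" "i \<in> {''b1'', ''b2''}" for x Vs s' i j
 proof -
  have i: "i \<noteq> ''C''" "i \<noteq> ''fd''" "i \<noteq> ''c''" "i \<noteq> ''x''" "i \<in> searchmods" using that(2) by auto
  then have "aset (sc s' i j) ''C'' n = aset s' ''C'' n" unfolding aset_def by simp
  moreover have "eqx searchmods s (sc s' i j)" by (rule eqx_upd[OF _ i(5)]) (use that(1) in \<open>simp add: J_def\<close>)
  ultimately show ?thesis using that(1) i unfolding J_def by simp
 qed
 have An: "A \<subseteq> {..<n}" unfolding A(1)[symmetric] aset_def by auto
 have cand: "wp B CAND s' (\<lambda>s''. s'' ''b2'' 0 = b2 \<and> s'' ''b1'' 0 = b1 \<and> J x (Vs \<union> {(x, b1, b2)}) s'')"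
  if h: "b1 < n" "b2 < n" "J x Vs s'" "s' ''b1'' 0 = b1" "s' ''b2'' 0 = b2" for x b1 b2 Vs s'
 proof -
  note ci = cinD[OF Jcin[OF h(3)]]
  have A': "aset s' ''A'' n = A" using A(1) Jx[OF h(3), of "''A''"] unfolding aset_def by simp
  have S': "aset s' ''ss'' ?N = S" using S(1) Jx[OF h(3), of "''ss''"] unfolding aset_def by simp
  have c': "s' ''c'' r \<noteq> 0 \<longleftrightarrow> bit x r" if "r < 4 * K" for r using h(3) that unfolding J_def by blast
  have J0: "eqx searchmods s s'" "s' ''fd'' 0 \<noteq> 0 \<longrightarrow> solution A (aset s' ''C'' n)" "s' ''x'' 0 = x"
   "\<forall>(x, b1, b2)\<in>Vs. win A S x b1 b2 \<longrightarrow> s' ''fd'' 0 \<noteq> 0" using h(3) unfolding J_def by blast+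
  have cond: "tr candx s'
   \<longleftrightarrow> s' ''fd'' 0 = 0 \<and> (b1 \<in> A \<and> b2 \<in> A) \<and> (card S < 4 * K \<or> blkt t b1 = blkt t b2)"
  proof -
   have "{j. j < ?N \<and> s' ''ss'' j \<noteq> 0} = S" using S' unfolding aset_def by simp
   moreover have "s' ''A'' b1 \<noteq> 0 \<longleftrightarrow> b1 \<in> A" "s' ''A'' b2 \<noteq> 0 \<longleftrightarrow> b2 \<in> A" by (rule asetD[OF A'], rule h)+
   ultimately show ?thesis using h(1,2,4,5) ci(3,5,8) unfolding candx_def by simp
  qed
  show ?thesis
   unfolding CAND_def
  proof (rule wp_IFF'[OF B], goal_cases)
   case 1
   show ?case using ci(8,9) unfolding candx_def by simp
  next
   case 2
   then have k: "s' ''fd'' 0 = 0" "b1 \<in> A" "b2 \<in> A" "card S < 4 * K \<or> blkt t b1 = blkt t b2"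
    unfolding cond by blast+
   show ?case
   proof (rule wp_Seq[OF B], rule wp_SPLIT[OF Jcin[OF h(3)] A' A(2) S' S(2,3) S(4) c' k(4) h(4,5) k(2,3)])
    fix s1 D assume d: "eqx ({''p1'', ''p2'', ''D''} \<union> sepmods) s' s1" "aset s1 ''D'' n = D" "D \<subseteq> A"
     "bclosed t D" "bclosed t (A - D)" "win A S x b1 b2 \<Longrightarrow> part_ok t D \<and> part_ok t (A - D)"
    have c1: "cin s1" by (rule cin_eqx[OF Jcin[OF h(3)] d(1)]) simp
    have A1: "aset s1 ''A'' n = A" using A' eqxD[OF d(1), of "''A''"] unfolding aset_def by simp
    show "wp B CHECK s1 (\<lambda>s''. s'' ''b2'' 0 = b2 \<and> s'' ''b1'' 0 = b1 \<and> J x (Vs \<union> {(x, b1, b2)}) s'')"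
    proof (rule wp_CHECK[OF c1 A1 d(2-5)])
     fix s2 assume e: "eqx ({''W'', ''o1'', ''C'', ''fd''} \<union> testmods) s1 s2"
      "if part_ok t D \<and> part_ok t (A - D) then s2 ''fd'' 0 \<noteq> 0 \<and> aset s2 ''C'' n = D
       else s2 ''fd'' = s1 ''fd'' \<and> s2 ''C'' = s1 ''C''"
     let ?M2 = "{''p1'', ''p2'', ''D'', ''W'', ''o1'', ''C'', ''fd''} \<union> testmods"
     have e2: "eqx ?M2 s' s2" by (rule eqx_trans[OF d(1) e(1)]) auto
     have "eqx searchmods s s2" by (rule eqx_trans[OF J0(1) e2]) auto
     moreover have fdC: "(s2 ''fd'' 0 \<noteq> 0 \<longrightarrow> solution A (aset s2 ''C'' n)) \<and>
       (win A S x b1 b2 \<longrightarrow> s2 ''fd'' 0 \<noteq> 0)"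
     proof (cases "part_ok t D \<and> part_ok t (A - D)")
      case True
      then have "s2 ''fd'' 0 \<noteq> 0 \<and> aset s2 ''C'' n = D" using e(2) by (simp only: if_True simp_thms)
      then show ?thesis unfolding solution_def using d(3-5) True by simp
     next
      case False
      then have "s2 ''fd'' = s1 ''fd''" using e(2)[unfolded if_not_P[OF False]] by blast
      moreover have "s1 ''fd'' = s' ''fd''" using eqxD[OF d(1), of "''fd''"] by simp
      moreover have "\<not> win A S x b1 b2" using d(6) False by blast
      ultimately show ?thesis using k(1) by simp
     qed
     moreover have "s2 ''c'' = s' ''c''" "s2 ''x'' = s' ''x''" "s2 ''b1'' = s' ''b1''" "s2 ''b2'' = s' ''b2''"
      using eqxD[OF e2, of "''c''"] eqxD[OF e2, of "''x''"] eqxD[OF e2, of "''b1''"] eqxD[OF e2, of "''b2''"] by simp_all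
     moreover have "\<forall>(x, b1, b2)\<in>Vs. win A S x b1 b2 \<longrightarrow> s2 ''fd'' 0 \<noteq> 0" using J0(4) k(1) by auto
     ultimately show "s2 ''b2'' 0 = b2 \<and> s2 ''b1'' 0 = b1 \<and> J x (Vs \<union> {(x, b1, b2)}) s2"
      unfolding J_def using h(4,5) J0(3) c' by simp
    qed
   qed
  next
   case 3
   then have k: "s' ''fd'' 0 \<noteq> 0 \<or> \<not> (b1 \<in> A \<and> b2 \<in> A) \<or> \<not> (card S < 4 * K \<or> blkt t b1 = blkt t b2)"
    unfolding cond by (simp only: de_Morgan_conj)
   have "win A S x b1 b2 \<longrightarrow> s' ''fd'' 0 \<noteq> 0"
    using k unfolding win_def by (auto split: if_splits)
   then have "J x (Vs \<union> {(x, b1, b2)}) s'" using h(3) unfolding J_def by simp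
   then show ?case using h(4,5) by (intro wp_Skip[OF B]) simp
  qed
 qed
 have Jn: "s' ''n'' 0 = n" if "J x Vs s'" for x Vs s' by (rule cinD(1)[OF Jcin[OF that]])
 have nB: "n \<le> B" by (rule cinD(2)[OF s(1)])
 have l2: "wp B (FOR ''b2'' ''n'' CAND) s' (\<lambda>s''. s'' ''b1'' 0 = b1 \<and> J x (Vs \<union> {x} \<times> {b1} \<times> {..<n}) s'')"
  if h: "b1 < n" "J x Vs s'" "s' ''b1'' 0 = b1" for x b1 Vs s'
 proof (rule wp_FOR_visit[where J = "\<lambda>Vs s. J x Vs s \<and> s ''b1'' 0 = b1" and m = n and D = Vs
    and S = "\<lambda>b2. {(x, b1, b2)}", OF B])
  fix b2 s'' D' assume a: "b2 < n" "J x D' s'' \<and> s'' ''b1'' 0 = b1" "s'' ''b2'' 0 = b2"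
  show "wp B CAND s'' (\<lambda>s'. s' ''b2'' 0 = b2 \<and> J x (D' \<union> {(x, b1, b2)}) s' \<and> s' ''b1'' 0 = b1)"
   by (rule wp_mono[OF cand[OF h(1) a(1) a(2)[THEN conjunct1] a(2)[THEN conjunct2] a(3)]]) blast
 next
  fix s'' assume a: "J x (Vs \<union> (\<Union>b2<n. {(x, b1, b2)})) s'' \<and> s'' ''b1'' 0 = b1"
  have "(\<Union>b2<n. {(x, b1, b2)}) = {x} \<times> {b1} \<times> {..<n}" by auto
  then show "s'' ''b1'' 0 = b1 \<and> J x (Vs \<union> {x} \<times> {b1} \<times> {..<n}) s''" using a by simp
 next
  show "s' ''n'' 0 = n" by (rule Jn[OF h(2)])
  show "J x Vs s' \<and> s' ''b1'' 0 = b1" using h by simp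
  fix D s j assume a: "J x D s \<and> s ''b1'' 0 = b1"
  then have "J x D (sc s ''b2'' j)" by (intro Jupd) simp_all
  then show "J x D (sc s ''b2'' j) \<and> sc s ''b2'' j ''b1'' 0 = b1" using a by simp
  show "s ''n'' 0 = n" by (rule Jn) (rule a[THEN conjunct1])
 qed (use nB in simp_all)
 have l1: "wp B (FOR ''b1'' ''n'' (FOR ''b2'' ''n'' CAND)) s' (J x (Vs \<union> {x} \<times> {..<n} \<times> {..<n}))"
  if h: "J x Vs s'" for x Vs s'
 proof (rule wp_FOR_visit[where J = "J x" and m = n and D = Vs and S = "\<lambda>b1. {x} \<times> {b1} \<times> {..<n}", OF B])
  fix b1 s'' D' assume a: "b1 < n" "J x D' s''" "s'' ''b1'' 0 = b1"
  show "wp B (FOR ''b2'' ''n'' CAND) s'' (\<lambda>s'. s' ''b1'' 0 = b1 \<and> J x (D' \<union> {x} \<times> {b1} \<times> {..<n}) s')"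
   by (rule l2[OF a])
 next
  fix s'' assume a: "J x (Vs \<union> (\<Union>b1<n. {x} \<times> {b1} \<times> {..<n})) s''"
  have "(\<Union>b1<n. {x} \<times> {b1} \<times> {..<n}) = {x} \<times> {..<n} \<times> {..<n}" by auto
  then show "J x (Vs \<union> {x} \<times> {..<n} \<times> {..<n}) s''" using a by simp
 next
  show "s' ''n'' 0 = n" by (rule Jn[OF h])
  show "J x Vs s'" by (rule h)
  fix D s j assume a: "J x D s"
  then show "J x D (sc s ''b1'' j)" by (intro Jupd) simp_all
  show "s ''n'' 0 = n" by (rule Jn) (rule a)
 qed (use nB in simp_all)
 have pwJ: "s' ''pw'' 0 = pw" if "J x Vs s'" for x Vs s' using Jx[OF that, of "''pw''"] s(2) by simp
 note ci = cinD[OF s(1)]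
 show ?thesis
  unfolding SEARCH_def
 proof (rule wp_Seq_SET[OF B B], goal_cases)
  case 1
  show ?case by simp
 next
  case 2
  let ?s0 = "sc s ''fd'' (xval (XN 0) s)"
  show ?case
  proof (rule wp_Seq_ARR[OF B B], goal_cases)
   case 1
   show ?case using ci(3,4) by simp
  next
   case (2 s1)
   note h1 = 2
   note x1 = eqx1[OF h1(1)]
   have c1: "s1 ''c'' r = 0" if "r < 4 * K" for r using h1(2)[of r] that ci(3) by simp
   have e1: "eqx searchmods s s1" unfolding eqx_def using x1 by simp
   have J1: "J 0 {} (sc s1 ''x'' 0)"
   proof -
    have "eqx searchmods s (sc s1 ''x'' 0)" by (rule eqx_upd[OF e1]) simp
    moreover have "s1 ''fd'' 0 = 0" using x1[of "''fd''"] by simp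
    ultimately show ?thesis unfolding J_def using c1 by simp
   qed
   show ?case
   proof (rule wp_FOR[where m = pw and I = "\<lambda>j. J j ({..<j} \<times> {..<n} \<times> {..<n})", OF B])
    show "s1 ''pw'' 0 = pw" using x1[of "''pw''"] s(2) by simp
    show "pw \<le> B" by (rule s(3))
    show "J 0 ({..<0} \<times> {..<n} \<times> {..<n}) (sc s1 ''x'' 0)" using J1 by simp
    fix j s' assume a: "j < pw" "J j ({..<j} \<times> {..<n} \<times> {..<n}) s'"
    have un: "{..<j} \<times> {..<n} \<times> {..<n} \<union> {j} \<times> {..<n} \<times> {..<n} = {..<Suc j} \<times> {..<n} \<times> {..<n}"
     by auto
    show "wp B (Seq (FOR ''b1'' ''n'' (FOR ''b2'' ''n'' CAND)) COUNTER) s'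
      (\<lambda>s'. s' ''x'' 0 = j \<and> s' ''pw'' 0 = pw \<and> J (Suc j) ({..<Suc j} \<times> {..<n} \<times> {..<n}) (sc s' ''x'' (Suc j)))"
    proof (rule wp_Seq_cut[OF B l1[OF a(2), unfolded un]])
     fix s2 assume j2: "J j ({..<Suc j} \<times> {..<n} \<times> {..<n}) s2"
     note ci2 = cinD[OF Jcin[OF j2]]
     show "wp B COUNTER s2
      (\<lambda>s'. s' ''x'' 0 = j \<and> s' ''pw'' 0 = pw \<and> J (Suc j) ({..<Suc j} \<times> {..<n} \<times> {..<n}) (sc s' ''x'' (Suc j)))"
     proof (rule wp_COUNTER[where s = s2 and m = "4 * K" and x = j, OF B ci2(3,4)])
      show "s2 ''c'' r \<noteq> 0 \<longleftrightarrow> bit j r" if "r < 4 * K" for r using j2 that unfolding J_def by blast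
      fix s3 assume h3: "eqx {''c'', ''cd''} s2 s3" "\<And>r. r < 4 * K \<Longrightarrow> s3 ''c'' r \<noteq> 0 \<longleftrightarrow> bit (Suc j) r"
      have y3: "s3 ''x'' = s2 ''x''" "s3 ''pw'' = s2 ''pw''" "s3 ''fd'' = s2 ''fd''" "s3 ''C'' = s2 ''C''"
       using eqxD[OF h3(1)] by simp_all
      have "eqx searchmods s s3" by (rule eqx_trans[OF _ h3(1), of searchmods]) (use j2 in \<open>simp_all add: J_def\<close>)
      then have e3: "eqx searchmods s (sc s3 ''x'' (Suc j))" by (rule eqx_upd) simp
      have C3: "aset (sc s3 ''x'' (Suc j)) ''C'' n = aset s2 ''C'' n" using y3 unfolding aset_def by simp
      have xj: "s2 ''x'' 0 = j" "s2 ''fd'' 0 \<noteq> 0 \<longrightarrow> solution A (aset s2 ''C'' n)"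
       "\<forall>(x, b1, b2)\<in>{..<Suc j} \<times> {..<n} \<times> {..<n}. win A S x b1 b2 \<longrightarrow> s2 ''fd'' 0 \<noteq> 0"
       using j2 unfolding J_def by blast+
      have "J (Suc j) ({..<Suc j} \<times> {..<n} \<times> {..<n}) (sc s3 ''x'' (Suc j))"
       unfolding J_def C3
      proof (intro conjI)
       show "eqx searchmods s (sc s3 ''x'' (Suc j))" by (rule e3)
       show "sc s3 ''x'' (Suc j) ''fd'' 0 \<noteq> 0 \<longrightarrow> solution A (aset s2 ''C'' n)" using xj(2) y3 by simp
       show "\<forall>r<4 * K. (sc s3 ''x'' (Suc j) ''c'' r \<noteq> 0) = bit (Suc j) r" using h3(2) by simp
       show "sc s3 ''x'' (Suc j) ''x'' 0 = Suc j" by simp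
       have f: "sc s3 ''x'' (Suc j) ''fd'' = s2 ''fd''" using y3 by simp
       show "\<forall>(x, b1, b2)\<in>{..<Suc j} \<times> {..<n} \<times> {..<n}. win A S x b1 b2 \<longrightarrow> sc s3 ''x'' (Suc j) ''fd'' 0 \<noteq> 0"
        unfolding f by (rule xj(3))
      qed
      then show "s3 ''x'' 0 = j \<and> s3 ''pw'' 0 = pw \<and> J (Suc j) ({..<Suc j} \<times> {..<n} \<times> {..<n}) (sc s3 ''x'' (Suc j))"
       using xj(1) y3 pwJ[OF j2] by simp
     qed
    qed
   next
    fix s' assume j: "J pw ({..<pw} \<times> {..<n} \<times> {..<n}) s'"
    have f: "eqx searchmods s s'" "s' ''fd'' 0 \<noteq> 0 \<longrightarrow> solution A (aset s' ''C'' n)"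
     "\<forall>(x, b1, b2)\<in>{..<pw} \<times> {..<n} \<times> {..<n}. win A S x b1 b2 \<longrightarrow> s' ''fd'' 0 \<noteq> 0"
     using j unfolding J_def by blast+
    have "s' ''fd'' 0 \<noteq> 0" using f(3) w by blast
    then show "Q s'" using Q[OF f(1) refl] f(2) by blast
   qed simp_all
  qed
 qed
qed

end

end

section \<open>Recomputing the quotient at a node\<close>

definition homex :: xexp where
 "homex = xall ''v'' ''n'' (ximp (XG ''A'' (V ''v'')) (row ''gs'' (V ''t'') (V ''v'')))"

definition repx :: xexp where
 "repx = xor
  (xand (row ''gs'' (V ''ti'') (V ''v'')) (xand (row ''gs'' (V ''ti'') (V ''y''))
  (xor (xeq (V ''v'') (V ''y'')) (xex ''t'' ''ti'' (xand (row ''gs'' (V ''t'') (V ''v'')) (row ''gs'' (V ''t'') (V ''y'')))))))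
  (xand (xnot (row ''gs'' (V ''ti'') (V ''v''))) (xeq (V ''y'') (XN 0)))"

text \<open>The arrays hold the index of the member, block names, frontier marks and heavy marks of
  vertices, and for each point its vertex, its presence and its block. The vertex
  \<open>p div th\<close> is found by counting the positive multiples of \<open>th\<close> up to
  \<open>p\<close>.\<close>

definition CTX :: com where
 "CTX = Seq (SET ''ti'' (XN 0) (xleast ''t'' ''g'' homex))
   (Seq (ARR ''bk'' (XN 0) ''v'' ''n'' (xleast ''y'' ''n'' repx))
   (Seq (ARR ''fr'' (XN 0) ''v'' ''n'' (xor
    (xex ''y'' ''n'' (xand (gadj (V ''v'') (V ''y'')) (xnot (xeq (XG ''bk'' (V ''y'')) (XG ''bk'' (V ''v''))))))
    (xall ''y'' ''n'' (ximp (xeq (XG ''bk'' (V ''y'')) (XG ''bk'' (V ''v''))) (xeq (V ''y'') (V ''v''))))))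
   (Seq (ARR ''hv'' (XN 0) ''v'' ''n'' (xle (V ''K'') (xcnt ''y'' ''n''
    (xand (XG ''fr'' (V ''y'')) (xeq (XG ''bk'' (V ''y'')) (XG ''bk'' (V ''v'')))))))
   (Seq (ARR ''pv'' (XN 0) ''p'' ''N'' (xcnt ''v'' ''n'' (xle (xmul ''th'' (XA (V ''v'') (XN 1))) (V ''p''))))
   (Seq (ARR ''ac'' (XN 0) ''p'' ''N'' (xand (XG ''fr'' (XG ''pv'' (V ''p'')))
    (xor (xeq (V ''p'') (xmul ''th'' (XG ''pv'' (V ''p'')))) (XG ''hv'' (XG ''pv'' (V ''p''))))))
     (ARR ''cl'' (XN 0) ''p'' ''N'' (XG ''bk'' (XG ''pv'' (V ''p'')))))))))"

definition STEP :: com where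
 "STEP = Seq CTX (Seq (vsep ''A'') (Seq (ARR ''ss'' (XN 0) ''p'' ''N'' (XG ''zz'' (V ''p''))) SEARCH))"

abbreviation ctxmods :: "string set" where
 "ctxmods \<equiv> {''ti'', ''bk'', ''fr'', ''hv'', ''pv'', ''ac'', ''cl''}"

text \<open>Programs decide a property below a bound, while \<open>ix\<close> and
  \<open>blkt\<close> minimise over all numbers; a solution below the bound reconciles the
  two.\<close>

lemma Least_cong:
 fixes m :: nat
 assumes "\<And>y. y < m \<Longrightarrow> P y \<longleftrightarrow> R y" "y0 < m" "R y0"
 shows "(LEAST y. P y) = (LEAST y. R y)"
proof (rule Least_equality)
 have l: "R (LEAST y. R y)" "(LEAST y. R y) \<le> y0" by (rule LeastI[of R, OF assms(3)], rule Least_le[of R, OF assms(3)])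
 then show "P (LEAST y. R y)" using assms(1,2) by simp
 fix y assume y: "P y"
 show "(LEAST y. R y) \<le> y"
 proof (cases "y < m")
  case True
  then show ?thesis using assms(1) y Least_le[of R y] by blast
 next
  case False
  then show ?thesis using l(2) assms(2) by simp
 qed
qed

lemma card_div:
 fixes c :: nat
 assumes "p < n * c"
 shows "card {v. v < n \<and> c * (v + 1) \<le> p} = p div c"
proof -
 have c: "c > 0" using assms by (cases c) simp_all
 have lt: "p div c < n" using assms c by (simp add: less_mult_imp_div_less)
 have e: "c * (v + 1) \<le> p \<longleftrightarrow> v < p div c" for v
  using less_eq_div_iff_mult_less_eq[OF c, of "v + 1" p] by (simp add: mult.commute Suc_le_eq)
 have "{v. v < n \<and> c * (v + 1) \<le> p} = {v. v < n \<and> v < p div c}" unfolding e ..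
 also have "\<dots> = {..<p div c}"
 proof (intro set_eqI iffI)
  fix v assume "v \<in> {..<p div c}"
  then have "v < p div c" by (simp only: lessThan_iff)
  then show "v \<in> {v. v < n \<and> v < p div c}" using less_trans[OF _ lt] by blast
 qed blast
 finally show ?thesis by (simp only: card_lessThan)
qed

context nodes
begin

definition base :: "nat \<Rightarrow> state \<Rightarrow> bool" where
 "base B s \<longleftrightarrow> inp B s \<and> s ''g'' 0 = g \<and> g \<le> B \<and> (\<forall>i<g. fm s i = fam i) \<and> s ''K'' 0 = K \<and> K \<le> B \<and>
   s ''th'' 0 = 4 * K \<and> 4 * K \<le> B \<and> s ''pw'' 0 = 2 ^ (4 * K) \<and> 2 ^ (4 * K) \<le> B \<and>
   s ''N'' 0 = n * (4 * K) \<and> s ''NN'' 0 = n * (4 * K) + 2 \<and> n * (4 * K) + 2 \<le> B \<and>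
   n * (4 * K) * Suc (n * (4 * K)) \<le> B"

lemma base_eqx:
 assumes "base B s" "eqx M s s'" "{''n'', ''nn'', ''rr'', ''G'', ''g'', ''gs'', ''K'', ''th'', ''pw'', ''N'', ''NN''} \<inter> M = {}"
 shows "base B s'"
proof -
 have "inp B s'" by (rule inp_eqx[OF _ assms(2)]) (use assms(1,3) in \<open>simp_all add: base_def\<close>)
 moreover have "fm s' = fm s" using eqxD[OF assms(2), of "''gs''"] assms(3) unfolding fm_def rows_def by simp
 ultimately show ?thesis using assms(1,3) eqxD[OF assms(2)] unfolding base_def by simp
qed

lemma baseD:
 assumes "base B s"
 shows "inp B s" "s ''g'' 0 = g" "g \<le> B" "i < g \<Longrightarrow> fm s i = fam i" "s ''K'' 0 = K" "K \<le> B"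
  "s ''th'' 0 = 4 * K" "4 * K \<le> B" "s ''pw'' 0 = 2 ^ (4 * K)" "2 ^ (4 * K) \<le> B" "s ''N'' 0 = n * (4 * K)"
  "s ''NN'' 0 = n * (4 * K) + 2" "n * (4 * K) + 2 \<le> B" "n * (4 * K) * Suc (n * (4 * K)) \<le> B"
  "s ''n'' 0 = n" "n \<le> B" "u < n \<Longrightarrow> v < n \<Longrightarrow> s ''G'' (n * u + v) \<noteq> 0 \<longleftrightarrow> adj u v"
  "n * (4 * K) \<le> B" "i < g \<Longrightarrow> v < n \<Longrightarrow> s ''gs'' (n * i + v) \<noteq> 0 \<longleftrightarrow> v \<in> fam i"
proof -
 show "i < g \<Longrightarrow> v < n \<Longrightarrow> s ''gs'' (n * i + v) \<noteq> 0 \<longleftrightarrow> v \<in> fam i"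
  using assms unfolding base_def fm_def rows_def by blast
 show "u < n \<Longrightarrow> v < n \<Longrightarrow> s ''G'' (n * u + v) \<noteq> 0 \<longleftrightarrow> adj u v"
  using assms unfolding base_def inp_def by blast
 show "n * (4 * K) \<le> B" using assms unfolding base_def by linarith
qed (use assms in \<open>simp_all add: base_def inp_def\<close>)

lemma wp_CTX:
 assumes B: "2 \<le> B" and s: "base B s" and A: "aset s ''A'' n = A" "A \<subseteq> {1..<n}" "A \<noteq> {}"
  and Q: "\<And>s'. eqx ctxmods s s' \<Longrightarrow> cin (ix A) B s' \<Longrightarrow> Q s'"
 shows "wp B CTX s Q"
proof -
 define t where "t = ix A"
 have ctx: "prime_points n adj (blkt t) K (wgt t) (4 * K)" unfolding t_def by (rule ix_ctx[OF A(2,3)])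
 interpret C: prime_points n adj "blkt t" K "wgt t" "4 * K" by (rule ctx)
 have tg: "t < g" unfolding t_def by (rule ix_props(1)[OF A(2)])
 note b = baseD[OF s]
 have An: "A \<subseteq> {..<n}" using A(2) by auto
 have e1: "tr homex (sc s ''t'' i) \<longleftrightarrow> i < g \<and> A \<subseteq> fam i" if "i < g" for i
 proof -
  have "tr homex (sc s ''t'' i) \<longleftrightarrow> (\<forall>v<n. s ''A'' v \<noteq> 0 \<longrightarrow> s ''gs'' (n * i + v) \<noteq> 0)" using b(15) unfolding homex_def by simp
  also have "\<dots> \<longleftrightarrow> (\<forall>v<n. v \<in> A \<longrightarrow> v \<in> fam i)" using b(19)[OF that] asetD[OF A(1)] by simp
  finally show ?thesis using that An by auto
 qed
 have w1: "t < g \<and> A \<subseteq> fam t" using tg ix_props(2)[OF A(2)] unfolding t_def by blast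
 have xv: "xval (xleast ''t'' ''g'' homex) s = t"
 proof -
  have "xval (xleast ''t'' ''g'' homex) s = (LEAST i. tr homex (sc s ''t'' i))"
   by (rule xval_xleast[where m = t]) (use e1[OF tg] w1 b(2) tg in \<open>simp_all add: homex_def[THEN arg_cong, of names]\<close>)
  also have "\<dots> = (LEAST i. i < g \<and> A \<subseteq> fam i)" by (rule Least_cong[where m = g and ?y0.0 = t]) (use e1 tg w1 in blast)+
  finally show ?thesis unfolding t_def ix_def .
 qed
 have tB: "t \<le> B" using tg b(3) by simp
 show ?thesis
  unfolding CTX_def
 proof (rule wp_Seq_SET[OF B B], goal_cases)
  case 1
  show ?case using b(2,3,15,16) unfolding homex_def by simp
 next
  case 2
  let ?s1 = "sc s ''ti'' t"
  have bk: "xval (xleast ''y'' ''n'' repx) (sc ?s1 ''v'' v) = blkt t v" if v: "v < n" for v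
  proof -
   let ?R = "\<lambda>y. if v \<in> fam t then y \<in> fam t \<and> same t fam v y else y = 0"
   have e2: "tr repx (sc (sc ?s1 ''v'' v) ''y'' y) \<longleftrightarrow> ?R y" if y: "y < n" for y
   proof -
    have q: "(s ''gs'' (n * i + v) \<noteq> 0 \<and> s ''gs'' (n * i + y) \<noteq> 0) \<longleftrightarrow> v \<in> fam i \<and> y \<in> fam i" if "i < t" for i
    proof -
     have "i < g" using that tg by simp
     show ?thesis unfolding b(19)[OF \<open>i < g\<close> v] b(19)[OF \<open>i < g\<close> y] ..
    qed
    have "tr repx (sc (sc ?s1 ''v'' v) ''y'' y) \<longleftrightarrow>
      (s ''gs'' (n * t + v) \<noteq> 0 \<and> s ''gs'' (n * t + y) \<noteq> 0 \<and>
       (v = y \<or> (\<exists>i<t. s ''gs'' (n * i + v) \<noteq> 0 \<and> s ''gs'' (n * i + y) \<noteq> 0))) \<or>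
      (\<not> s ''gs'' (n * t + v) \<noteq> 0 \<and> y = 0)" using b(15) unfolding repx_def by simp
    also have "(\<exists>i<t. s ''gs'' (n * i + v) \<noteq> 0 \<and> s ''gs'' (n * i + y) \<noteq> 0) \<longleftrightarrow> (\<exists>i<t. v \<in> fam i \<and> y \<in> fam i)"
     using q by blast
    finally show ?thesis unfolding b(19)[OF tg v] b(19)[OF tg y] same_def
     by (cases "v \<in> fam t") (simp_all only: if_True if_False simp_thms)
   qed
   have n0: "0 < n" using n by simp
   have ex: "?R (blkt t v)" "blkt t v < n"
   proof -
    show "?R (blkt t v)" using blkt_rep[OF tg, of v] blkt_0[OF tg, of v] by auto
    show "blkt t v < n"
    proof (cases "v \<in> fam t")
     case True
     then show ?thesis using blkt_rep(1)[OF tg True] fam_sub[OF tg] by auto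
    next
     case False
     then show ?thesis using blkt_0[OF tg, of v] n0 by simp
    qed
   qed
   have "xval (xleast ''y'' ''n'' repx) (sc ?s1 ''v'' v) = (LEAST y. tr repx (sc (sc ?s1 ''v'' v) ''y'' y))"
   proof (rule xval_xleast[where m = "blkt t v"])
    show "tr repx (sc (sc ?s1 ''v'' v) ''y'' (blkt t v))" unfolding e2[OF ex(2)] by (rule ex(1))
   qed (use ex(2) b(15) in \<open>simp_all add: repx_def[THEN arg_cong, of names]\<close>)
   also have "\<dots> = (LEAST y. ?R y)" by (rule Least_cong[where m = n and ?y0.0 = "blkt t v"], rule e2, assumption, rule ex(2), rule ex(1))
   also have "\<dots> = blkt t v" unfolding blkt_def by auto
   finally show ?thesis .
  qed
  show ?case
   unfolding xv
  proof (rule wp_Seq_ARR[OF B B], goal_cases)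
   case 1
   show ?case using b(15,16) tB unfolding repx_def by simp
  next
   case (2 s2)
   note h2 = 2
   have x2: "s2 x = s x" if "x \<noteq> ''ti''" "x \<noteq> ''bk''" for x using eqxD[OF h2(1), of x] that by simp
   have bk2: "s2 ''bk'' v = blkt t v" if "v < n" for v using h2(2)[of v] bk[OF that] that b(15) by simp
   show ?case
   proof (rule wp_Seq_ARR[OF B B], goal_cases)
    case 1
    show ?case using b(15,16) x2 by simp
   next
    case (2 s3)
    note h3 = 2
    note x3 = eqx1[OF h3(1)]
    have fr3: "s3 ''fr'' v \<noteq> 0 \<longleftrightarrow> C.Fr v" if v: "v < n" for v
    proof -
     have "s3 ''fr'' v \<noteq> 0 \<longleftrightarrow> (\<exists>y<n. s ''G'' (n * v + y) \<noteq> 0 \<and> s2 ''bk'' y \<noteq> s2 ''bk'' v) \<or>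
       (\<forall>y<n. s2 ''bk'' y = s2 ''bk'' v \<longrightarrow> y = v)"
      using h3(3)[of v] v b(15) x2 by simp
     also have "\<dots> \<longleftrightarrow> (\<exists>y<n. adj v y \<and> blkt t y \<noteq> blkt t v) \<or> (\<forall>y<n. blkt t y = blkt t v \<longrightarrow> y = v)"
      using b(17)[OF v] bk2 v by (metis (no_types, lifting))
     finally show ?thesis unfolding C.Fr_def using v by simp
    qed
    show ?case
    proof (rule wp_Seq_ARR[OF B B], goal_cases)
     case 1
     show ?case using b(15,16) x2 x3 by simp
    next
     case (2 s4)
     note h4 = 2
     note x4 = eqx1[OF h4(1)]
     have hv4: "s4 ''hv'' v \<noteq> 0 \<longleftrightarrow> K \<le> card (C.F (blkt t v))" if v: "v < n" for v
     proof -
      have "s4 ''hv'' v \<noteq> 0 \<longleftrightarrow> K \<le> card {y. y < n \<and> s3 ''fr'' y \<noteq> 0 \<and> s2 ''bk'' y = s2 ''bk'' v}"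
       using h4(3)[of v] v b(5,15) x2 x3 by simp
      also have "{y. y < n \<and> s3 ''fr'' y \<noteq> 0 \<and> s2 ''bk'' y = s2 ''bk'' v} = C.F (blkt t v)"
       unfolding C.F_def using fr3 bk2 v unfolding C.Fr_def by auto
      finally show ?thesis .
     qed
     show ?case
     proof (rule wp_Seq_ARR[OF B B], goal_cases)
      case 1
      show ?case using b(7,8,11,15,16,18) x2 x3 x4 by simp
     next
      case (2 s5)
      note h5 = 2
      note x5 = eqx1[OF h5(1)]
      have pv5: "s5 ''pv'' p = p div (4 * K)" if p: "p < n * (4 * K)" for p
      proof -
       have "s5 ''pv'' p = card {v. v < n \<and> 4 * K * (v + 1) \<le> p}"
        using h5(2)[of p] p b(7,11,15) x2 x3 x4 by (simp add: xval_xmul)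
       then show ?thesis unfolding card_div[OF p] .
      qed
      have pvn: "p div (4 * K) < n" if p: "p < n * (4 * K)" for p using p K0 by (simp add: less_mult_imp_div_less)
      show ?case
      proof (rule wp_Seq_ARR[OF B B], goal_cases)
       case 1
       show ?case using b(7,8,11,18) x2 x3 x4 x5 by simp
      next
       case (2 s6)
       note h6 = 2
       note x6 = eqx1[OF h6(1)]
       have ac6: "s6 ''ac'' p \<noteq> 0 \<longleftrightarrow> p \<in> C.P" if p: "p < n * (4 * K)" for p
       proof -
        let ?v = "p div (4 * K)"
        have "s6 ''ac'' p \<noteq> 0 \<longleftrightarrow> s3 ''fr'' ?v \<noteq> 0 \<and> (p = 4 * K * ?v \<or> s4 ''hv'' ?v \<noteq> 0)"
         using h6(3)[of p] p b(7,11) x2 x3 x4 x5 pv5[OF p] by (simp add: xval_xmul)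
        also have "p = 4 * K * ?v \<longleftrightarrow> p mod (4 * K) = 0"
         using mult_div_mod_eq[of "4 * K" p] by linarith
        finally show ?thesis unfolding C.P_def fr3[OF pvn[OF p]] hv4[OF pvn[OF p]] using p by simp
       qed
       show ?case
       proof (rule wp_ARR1[OF B], goal_cases)
        case 1
        show ?case using b(11,18) x2 x3 x4 x5 x6 by simp
       next
        case (2 s7)
        note h7 = 2
        note x7 = eqx1[OF h7(1)]
        have PN: "C.P \<subseteq> {..<n * (4 * K)}" unfolding C.P_def by auto
        have cl7: "s7 ''cl'' p = C.cls p" if p: "p \<in> C.P" for p
        proof -
         have pN: "p < n * (4 * K)" using p PN by blast
         show ?thesis unfolding C.cls_def
          using h7(2)[of p] pN b(11) x2 x3 x4 x5 x6 pv5[OF pN] bk2[OF pvn[OF pN]] by simp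
        qed
        have e7: "eqx ctxmods s s7" unfolding eqx_def using x2 x3 x4 x5 x6 x7 by simp
        have pv7: "s7 ''pv'' p = p div (4 * K)" if "p < n * (4 * K)" for p using pv5[OF that] x6 x7 by simp
        have crossx: "C.badj (C.cls p) (C.cls q) \<longleftrightarrow>
          C.cls p \<noteq> C.cls q \<and> s7 ''G'' (s7 ''n'' 0 * s7 ''pv'' p + s7 ''pv'' q) \<noteq> 0"
         if pq: "p \<in> C.P" "q \<in> C.P" for p q
        proof -
         have N: "p < n * (4 * K)" "q < n * (4 * K)" using pq PN by blast+
         have "s7 ''G'' = s ''G''" "s7 ''n'' 0 = n" using x2 x3 x4 x5 x6 x7 b(15) by simp_all
         then have "s7 ''G'' (s7 ''n'' 0 * s7 ''pv'' p + s7 ''pv'' q) \<noteq> 0 \<longleftrightarrow> adj (p div (4 * K)) (q div (4 * K))"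
          using b(17)[OF pvn[OF N(1)] pvn[OF N(2)]] pv7[OF N(1)] pv7[OF N(2)] by simp
         moreover have F: "p div (4 * K) \<in> C.F (C.cls p)" "q div (4 * K) \<in> C.F (C.cls q)"
          using pq unfolding C.P_def C.F_def C.cls_def by auto
         moreover have "C.badj (C.cls p) (C.cls q) \<longleftrightarrow> C.cls p \<noteq> C.cls q \<and> adj (p div (4 * K)) (q div (4 * K))"
         proof
          assume bb: "C.badj (C.cls p) (C.cls q)"
          then have "C.cls p \<noteq> C.cls q" unfolding C.badj_def by blast
          then show "C.cls p \<noteq> C.cls q \<and> adj (p div (4 * K)) (q div (4 * K))" using C.full[OF bb F] by blast
         next
          assume "C.cls p \<noteq> C.cls q \<and> adj (p div (4 * K)) (q div (4 * K))"
          then show "C.badj (C.cls p) (C.cls q)" unfolding C.badj_def using F by blast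
         qed
         ultimately show ?thesis by simp
        qed
        have k7: "s7 ''N'' 0 = n * (4 * K)" "s7 ''NN'' 0 = n * (4 * K) + 2" "s7 ''n'' 0 = n" "s7 ''th'' 0 = 4 * K"
         using b(7,11,12,15) x2 x3 x4 x5 x6 x7 by simp_all
        have "pinp B (n * (4 * K)) C.P C.cls C.badj s7"
         unfolding pinp_def
        proof (intro conjI allI ballI impI)
         show "s7 ''N'' 0 = n * (4 * K)" "s7 ''NN'' 0 = n * (4 * K) + 2" by (rule k7)+
         show "n * (4 * K) + 2 \<le> B" "n * (4 * K) * Suc (n * (4 * K)) \<le> B" by (rule b)+
         show "s7 ''n'' 0 \<le> B" using k7 b(16) by simp
         show "C.P \<subseteq> {..<n * (4 * K)}" by (rule PN)
         show "(s7 ''ac'' p \<noteq> 0) = (p \<in> C.P)" if "p < n * (4 * K)" for p using ac6[OF that] x7 by simp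
        qed (rule cl7 crossx, assumption+)+
        moreover have "s7 ''bk'' v = blkt t v" if "v < n" for v using bk2[OF that] x3 x4 x5 x6 x7 by simp
        ultimately have "cin t B s7"
         unfolding cin_def[OF ctx B] using k7(3,4) b(8,16) pv7 by simp
        then show ?case using Q[OF e7] unfolding t_def by simp
       qed
      qed
     qed
    qed
   qed
  qed
 qed
qed

end

abbreviation stepmods :: "string set" where
 "stepmods \<equiv> {''ss''} \<union> ctxmods \<union> searchmods"

context nodes
begin

context
 fixes A :: "nat set" and t B :: nat
 assumes ctx: "prime_points n adj (blkt t) K (wgt t) (4 * K)" and B: "2 \<le> B" and t: "t = ix A"
begin

interpretation C: prime_points n adj "blkt t" K "wgt t" "4 * K" by (rule ctx)

text \<open>Of the outcomes of \<open>node_cut\<close>, splitting off the block of \<open>v\<close>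
  is the guess \<open>v\<close>, \<open>v\<close> with code 0. For a balanced cut \<open>W\<close>
  the code lists the ranks of the cover points in \<open>W\<close>; as the cover has fewer than
  \<open>4 * K\<close> points, \<open>4 * K\<close> bits suffice.\<close>

lemma win_exists:
 assumes T: "small_tree T" and A: "ninv A" "A \<subseteq> {1..<n}" "card A \<ge> 2"
  and S: "S \<subseteq> C.P" "C.cov (C.cls ` S) (blkt t ` A)" "C.wt (C.cls ` S) = card S"
   "\<And>Z'. C.cov Z' (blkt t ` A) \<Longrightarrow> card S \<le> C.wt Z'" "\<And>p q. \<lbrakk>p \<in> S; q \<in> C.P; C.cls p = C.cls q\<rbrakk> \<Longrightarrow> q \<in> S"
 shows "\<exists>x b1 b2. x < 2 ^ (4 * K) \<and> b1 < n \<and> b2 < n \<and> win t A S x b1 b2"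
proof -
 have An: "A \<subseteq> {..<n}" using A(2) by auto
 have finS: "finite S" using S(1) C.finP finite_subset by blast
 have "C.wt (C.cls ` S) \<le> C.wt S'" if "C.cov S' (blkt t ` A)" for S' using S(3) S(4)[OF that] by simp
 then consider (1) "\<exists>b\<in>blkt t ` A. blkt t ` A - {b} \<noteq> {} \<and> C.okc (blkt t ` A - {b})"
  | (2) "\<exists>W Z. C.wt (C.cls ` S) < 4 * K \<and> W \<subseteq> C.BL \<and> C.cov Z W \<and> C.wt Z < K \<and>
   blkt t ` A \<inter> W \<noteq> {} \<and> blkt t ` A - W \<noteq> {} \<and>
   C.wt (C.cls ` S \<inter> W) \<le> 3 * K \<and> C.wt (C.cls ` S - W) \<le> 3 * K"
  using node_cut[OF T A refl, folded t, OF S(2)] by meson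
 then show ?thesis
 proof cases
  case 1
  then obtain v where v: "v \<in> A" "blkt t ` A - {blkt t v} \<noteq> {}" "C.okc (blkt t ` A - {blkt t v})" by blast
  have e: "{b \<in> blkt t ` A. b \<noteq> blkt t v} = blkt t ` A - {blkt t v}" by blast
  have "part_ok t {u \<in> A. blkt t u \<noteq> blkt t v}"
  proof (rule part_okI[OF ctx B An refl, of "\<lambda>b. b \<noteq> blkt t v"])
   show "{u \<in> A. blkt t u \<noteq> blkt t v} \<noteq> {}" using v(2) by blast
   show "C.okc {b \<in> blkt t ` A. b \<noteq> blkt t v}" unfolding e by (rule v(3))
  qed
  moreover have "part_ok t {u \<in> A. blkt t u = blkt t v}" unfolding part_ok_def using v(1) by auto
  ultimately have "win t A S 0 v v" unfolding win_def[OF ctx B] using v(1) by simp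
  moreover have "v < n" using v(1) An by blast
  moreover have "(0::nat) < 2 ^ (4 * K)" by simp
  ultimately show ?thesis by blast
 next
  case 2
  then obtain W Z where W: "C.wt (C.cls ` S) < 4 * K" "C.cov Z W" "C.wt Z < K"
   "blkt t ` A \<inter> W \<noteq> {}" "blkt t ` A - W \<noteq> {}" "C.wt (C.cls ` S \<inter> W) \<le> 3 * K" "C.wt (C.cls ` S - W) \<le> 3 * K"
   by blast
  obtain b1 where b1: "b1 \<in> A" "blkt t b1 \<in> W" using W(4) by blast
  obtain b2 where b2: "b2 \<in> A" "blkt t b2 \<notin> W" using W(5) by blast
  have ne: "blkt t b1 \<noteq> blkt t b2" using b1(2) b2(2) by metis
  have cS: "card S < 4 * K" using W(1) S(3) by simp
  let ?rk = "\<lambda>q. card {j \<in> S. j < q}"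
  obtain x :: nat where x: "x < 2 ^ (4 * K)" "\<forall>r<4 * K. bit x r \<longleftrightarrow> r \<in> ?rk ` {q \<in> S. C.cls q \<in> W}"
   using subset_code[of "4 * K" "?rk ` {q \<in> S. C.cls q \<in> W}"] by blast
  have "bit x (?rk q) \<longleftrightarrow> C.cls q \<in> W" if q: "q \<in> S" for q
  proof -
   have "?rk q \<le> card S" using finS by (intro card_mono) auto
   then have "?rk q < 4 * K" using cS by simp
   then have "bit x (?rk q) \<longleftrightarrow> ?rk q \<in> ?rk ` {q \<in> S. C.cls q \<in> W}" using x(2) by blast
   also have "\<dots> \<longleftrightarrow> C.cls q \<in> W"
   using rank_inj finS q by blast
   finally show ?thesis .
  qed
  then have "win t A S x b1 b2" unfolding win_def[OF ctx B] if_not_P[OF ne] using b1 b2 cS W(2,3,6,7) by blast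
  moreover have "b1 < n" "b2 < n" using b1(1) b2(1) An by blast+
  ultimately show ?thesis using x(1) by blast
 qed
qed

end

lemma wp_STEP:
 assumes B: "2 \<le> B" and s: "base B s" and T: "small_tree T"
  and A: "aset s ''A'' n = A" "ninv A" "A \<subseteq> {1..<n}" "card A \<ge> 2"
  and Q: "\<And>s' D. \<lbrakk>eqx stepmods s s'; aset s' ''C'' n = D; D \<subseteq> A; D \<noteq> {}; A - D \<noteq> {};
   ninv D; ninv (A - D)\<rbrakk> \<Longrightarrow> Q s'"
 shows "wp B STEP s Q"
proof -
 have ne: "A \<noteq> {}" using A(4) by auto
 let ?t = "ix A"
 have ctx: "prime_points n adj (blkt ?t) K (wgt ?t) (4 * K)" by (rule ix_ctx[OF A(3) ne])
 interpret C: prime_points n adj "blkt ?t" K "wgt ?t" "4 * K" by (rule ctx)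
 have bcl: "bclosed ?t A" by (rule two_blocks(2)[OF A(2-4)])
 show ?thesis
  unfolding STEP_def
 proof (rule wp_Seq[OF B], rule wp_CTX[OF B s A(1,3) ne])
  fix s1 assume h1: "eqx ctxmods s s1" "cin ?t B s1"
  have A1: "aset s1 ''A'' n = A" using A(1) eqxD[OF h1(1), of "''A''"] unfolding aset_def by simp
  show "wp B (Seq (vsep ''A'') (Seq (ARR ''ss'' (XN 0) ''p'' ''N'' (XG ''zz'' (V ''p''))) SEARCH)) s1 Q"
  proof (rule wp_Seq[OF B], rule wp_vsep[OF ctx B h1(2) _ A1 bcl], goal_cases)
   case (2 s2 Z)
   note h2 = 2
   note c2 = cinD[OF ctx B h2(2)]
   have A2: "aset s2 ''A'' n = A" using A1 eqxD[OF h2(1), of "''A''"] unfolding aset_def by simp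
   show ?case
   proof (rule wp_Seq_ARR[OF B B], goal_cases)
    case 1
    show ?case using c2(8,9) by simp
   next
    case (2 s3)
    note h3 = 2
    have c3: "cin ?t B s3" by (rule cin_eqx[OF ctx B h2(2) h3(1)]) simp
    have A3: "aset s3 ''A'' n = A" using A2 eqxD[OF h3(1), of "''A''"] unfolding aset_def by simp
    have ZN: "Z \<subseteq> {..<n * (4 * K)}" using h2(4) c2(12) by blast
    have S3: "aset s3 ''ss'' (n * (4 * K)) = Z"
    proof (rule asetI[OF _ ZN])
     fix p assume p: "p < n * (4 * K)"
     have "s3 ''ss'' p \<noteq> 0 \<longleftrightarrow> s2 ''zz'' p \<noteq> 0" using h3(3)[of p] p c2(8) by simp
     then show "s3 ''ss'' p \<noteq> 0 \<longleftrightarrow> p \<in> Z" unfolding h2(3)[OF p] .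
    qed
    let ?M = "{''ss''} \<union> ctxmods \<union> {''p1'', ''p2''} \<union> sepmods"
    have e12: "eqx ?M s s2" by (rule eqx_trans[OF h1(1) h2(1)]) auto
    have e3: "eqx ?M s s3" by (rule eqx_trans[OF e12 h3(1)]) auto
    have pw: "s3 ''pw'' 0 = 2 ^ (4 * K)" "2 ^ (4 * K) \<le> B" using eqxD[OF e3, of "''pw''"] baseD(9,10)[OF s] by simp_all
    have "\<exists>x b1 b2. x < 2 ^ (4 * K) \<and> b1 < n \<and> b2 < n \<and> win ?t A Z x b1 b2"
     by (rule win_exists[OF ctx B refl T A(2-4) h2(4,5,6)], rule h2(7), assumption, rule h2(8))
    then obtain x b1 b2 where w: "x < 2 ^ (4 * K)" "b1 < n" "b2 < n" "win ?t A Z x b1 b2" by blast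
    show ?case
    proof (rule wp_SEARCH[OF ctx B c3 pw A3 bcl S3 h2(4,5) h2(8) w])
     fix s4 D assume h4: "eqx searchmods s3 s4" "aset s4 ''C'' n = D" "solution ?t A D"
     note d = h4(3)[unfolded solution_def[OF ctx B]]
     have e4: "eqx stepmods s s4" by (rule eqx_trans[OF e3 h4(1)]) auto
     have nv: "ninv X" if "X \<subseteq> A" "bclosed ?t X" "part_ok ?t X" for X
      by (rule ninv_child[OF A(3) that(1)]) (use that in \<open>simp_all add: part_ok_def\<close>)
     show "Q s4"
     using Q e4 h4(2) d part_ok_def nv by fastforce
    qed
   qed
  qed simp
 qed
qed

end

section \<open>Building the decomposition\<close>

text \<open>All members of the family avoid vertex 0. Among nodes with at least two vertices only
  the root contains it, and there it is split off.\<close>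

definition CHOOSE :: com where
 "CHOOSE = IFF (XG ''A'' (XN 0)) (ARR ''C'' (XN 0) ''v'' ''n'' (xeq (V ''v'') (XN 0))) STEP"

definition ADD :: com where
 "ADD = Seq (ARR ''Lv'' (xmul ''n'' (V ''m'')) ''v'' ''n'' (XG ''C'' (V ''v'')))
   (Seq (ARR ''Lv'' (xmul ''n'' (XA (V ''m'') (XN 1))) ''v'' ''n'' (xand (XG ''A'' (V ''v'')) (xnot (XG ''C'' (V ''v'')))))
   (Seq (SET ''par'' (V ''m'') (V ''ai''))
   (Seq (SET ''par'' (XA (V ''m'') (XN 1)) (V ''ai''))
     (SET ''m'' (XN 0) (XA (V ''m'') (XN 2))))))"

definition GROW :: com where
 "GROW = Seq CHOOSE ADD"

definition NODE :: com where
 "NODE = Seq (ARR ''A'' (XN 0) ''v'' ''n'' (row ''Lv'' (V ''ai'') (V ''v'')))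
   (Seq (IFF (xle (XN 2) (xcnt ''v'' ''n'' (XG ''A'' (V ''v'')))) GROW
      (SET ''delta'' (V ''ai'') (xleast ''v'' ''n'' (XG ''A'' (V ''v'')))))
     (SET ''ai'' (XN 0) (XA (V ''ai'') (XN 1))))"

text \<open>Nodes are processed in the order of their creation, so the array \<open>Lv\<close> is
  also the queue: \<open>ai\<close> is the next unprocessed node, and parents have smaller
  numbers.\<close>

definition TREE :: com where
 "TREE = Seq (ARR ''Lv'' (XN 0) ''v'' ''n'' (XN 1))
   (Seq (SET ''m'' (XN 0) (XN 1))
   (Seq (SET ''ai'' (XN 0) (XN 0))
     (WHILE (xlt (V ''ai'') (V ''m'')) NODE)))"

abbreviation treemods :: "string set" where
 "treemods \<equiv> {''A'', ''Lv'', ''par'', ''m'', ''delta'', ''ai''} \<union> stepmods"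

context nodes
begin

definition nodeok :: "nat \<Rightarrow> (nat \<Rightarrow> nat set) \<Rightarrow> (nat \<Rightarrow> nat) \<Rightarrow> (nat \<Rightarrow> nat) \<Rightarrow> nat \<Rightarrow> bool" where
 "nodeok m L par \<delta> i \<longleftrightarrow> (L i = {\<delta> i} \<and> {c. 0 < c \<and> c < m \<and> par c = i} = {}) \<or>
   (\<exists>c d. c \<noteq> d \<and> {c. 0 < c \<and> c < m \<and> par c = i} = {c, d} \<and> L i = L c \<union> L d \<and> L c \<inter> L d = {})"

text \<open>The last conjunct accounts for the nodes to come: a set of size \<open>c\<close> is the root of a subtree with \<open>2 * c - 1\<close> nodes.\<close>

definition tinv :: "nat \<Rightarrow> nat \<Rightarrow> (nat \<Rightarrow> nat set) \<Rightarrow> (nat \<Rightarrow> nat) \<Rightarrow> (nat \<Rightarrow> nat) \<Rightarrow> bool" where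
 "tinv a m L par \<delta> \<longleftrightarrow> 1 \<le> m \<and> a \<le> m \<and> L 0 = {..<n} \<and>
   (\<forall>i<m. ninv (L i) \<and> L i \<noteq> {} \<and> L i \<subseteq> {..<n}) \<and>
   (\<forall>c. 0 < c \<longrightarrow> c < m \<longrightarrow> par c < c \<and> par c < a) \<and>
   (\<forall>i<a. nodeok m L par \<delta> i) \<and>
   a + (\<Sum>i\<in>{a..<m}. 2 * card (L i) - 1) = 2 * n - 1"

lemma tinv_init: "L 0 = {..<n} \<Longrightarrow> tinv 0 1 L par \<delta>"
 unfolding tinv_def ninv_def using n by (auto simp: lessThan_empty_iff)

lemma tinv_cong:
 assumes "tinv a m L par \<delta>" "\<And>i. i < m \<Longrightarrow> L' i = L i"
 shows "tinv a m L' par \<delta>"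
proof -
 note t = assms(1)[unfolded tinv_def]
 have am: "a \<le> m" "1 \<le> m" using t by blast+
 have "(\<Sum>i\<in>{a..<m}. 2 * card (L' i) - 1) = (\<Sum>i\<in>{a..<m}. 2 * card (L i) - 1)"
  by (rule sum.cong) (use assms(2) in simp_all)
 moreover have "nodeok m L' par \<delta> i" if "i < a" for i
 proof -
  have im: "i < m" using that am by simp
  have "nodeok m L par \<delta> i" using t that by blast
  then show ?thesis
   unfolding nodeok_def assms(2)[OF im]
  proof
   assume "\<exists>c d. c \<noteq> d \<and> {c. 0 < c \<and> c < m \<and> par c = i} = {c, d} \<and> L i = L c \<union> L d \<and> L c \<inter> L d = {}"
   then obtain c d where cd: "c \<noteq> d" "{c. 0 < c \<and> c < m \<and> par c = i} = {c, d}" "L i = L c \<union> L d" "L c \<inter> L d = {}"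
    by blast
   have "c < m" "d < m" using cd(2) by blast+
   then have "L' c = L c" "L' d = L d" using assms(2) by simp_all
   then show "L i = {\<delta> i} \<and> {c. 0 < c \<and> c < m \<and> par c = i} = {} \<or>
    (\<exists>c d. c \<noteq> d \<and> {c. 0 < c \<and> c < m \<and> par c = i} = {c, d} \<and> L i = L' c \<union> L' d \<and> L' c \<inter> L' d = {})"
    using cd by metis
  qed blast
 qed
 ultimately show ?thesis using t assms(2)[of 0] assms(2) am unfolding tinv_def by simp
qed

lemma tinv_leaf:
 assumes t: "tinv a m L par \<delta>" and a: "a < m" "L a = {v}"
 shows "tinv (Suc a) m L par (\<delta>(a := v))"
proof -
 note t = t[unfolded tinv_def]
 have p: "par c < c" "par c < a" if "0 < c" "c < m" for c using t that by blast+
 have "nodeok m L par (\<delta>(a := v)) i" if i: "i < Suc a" for i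
 proof (cases "i = a")
  case True
  have "{c. 0 < c \<and> c < m \<and> par c = a} = {}" using p(2) by blast
  then show ?thesis unfolding nodeok_def True using a(2) by simp
 next
  case False
  then have "nodeok m L par \<delta> i" using t i by simp
  then show ?thesis using False unfolding nodeok_def by simp
 qed
 moreover have "par c < Suc a" if "0 < c" "c < m" for c using p(2)[OF that] by simp
 moreover have "{a..<m} = insert a {Suc a..<m}" using a(1) by auto
 then have "(\<Sum>i\<in>{a..<m}. 2 * card (L i) - 1) = 1 + (\<Sum>i\<in>{Suc a..<m}. 2 * card (L i) - 1)" using a(2) by simp
 ultimately show ?thesis using t a(1) p(1) unfolding tinv_def by simp
qed

lemma tinv_split:
 assumes t: "tinv a m L par \<delta>" and a: "a < m" "D \<subseteq> L a" "D \<noteq> {}" "L a - D \<noteq> {}" "ninv D" "ninv (L a - D)"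
  and L': "\<And>i. i < m \<Longrightarrow> L' i = L i" "L' m = D" "L' (Suc m) = L a - D"
 shows "tinv (Suc a) (Suc (Suc m)) L' (par(m := a, Suc m := a)) \<delta>"
proof -
 note t = tinv_cong[OF t L'(1), unfolded tinv_def]
 let ?par = "par(m := a, Suc m := a)"
 have La: "L' a = L a" by (rule L'(1)[OF a(1)])
 have p: "par c < c" "par c < a" if "0 < c" "c < m" for c using t that by blast+
 have m1: "1 \<le> m" using t by blast
 have ch: "{c. 0 < c \<and> c < Suc (Suc m) \<and> ?par c = i} = {c. 0 < c \<and> c < m \<and> par c = i}" if "i < a" for i
  using that by (auto simp: less_Suc_eq)
 have cha: "{c. 0 < c \<and> c < Suc (Suc m) \<and> ?par c = a} = {m, Suc m}"
  using m1 p(2) by (auto simp: less_Suc_eq)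
 have nd: "nodeok (Suc (Suc m)) L' ?par \<delta> i" if i: "i < Suc a" for i
 proof (cases "i = a")
  case True
  have "L' a = L' m \<union> L' (Suc m)" "L' m \<inter> L' (Suc m) = {}" unfolding La L' using a(2) by blast+
  then have "m \<noteq> Suc m \<and> {m, Suc m} = {m, Suc m} \<and> L' a = L' m \<union> L' (Suc m) \<and> L' m \<inter> L' (Suc m) = {}" by simp
  then show ?thesis unfolding nodeok_def True cha by (intro disjI2 exI)
 next
  case False
  then have ia: "i < a" using i by simp
  then have "nodeok m L' par \<delta> i" using t by blast
  then show ?thesis unfolding nodeok_def ch[OF ia] .
 qed
 have pp: "?par c < c \<and> ?par c < Suc a" if "0 < c" "c < Suc (Suc m)" for c
  using that p[of c] a(1) by (auto simp: less_Suc_eq)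
 have nn: "ninv (L' i) \<and> L' i \<noteq> {} \<and> L' i \<subseteq> {..<n}" if "i < Suc (Suc m)" for i
 proof -
  have "L' a \<subseteq> {..<n}" using t a(1) by blast
  then have Ln: "L a \<subseteq> {..<n}" unfolding La .
  have "i < m \<or> i = m \<or> i = Suc m" using that by linarith
  then consider "i < m" | "i = m" | "i = Suc m" by blast
  then show ?thesis
  proof cases
   case 1
   then show ?thesis using t by blast
  next
   case 2
   then show ?thesis using L'(2) a Ln by auto
  next
   case 3
   then show ?thesis using L'(3) a Ln by auto
  qed
 qed
 have "finite (L a)" using nn[of a] a(1) La finite_subset by (metis finite_lessThan less_SucI)
 then have f: "finite D" "finite (L a - D)" using a(2) finite_subset by blast+
 have c: "card (L a) = card D + card (L a - D)"
  using card_Diff_subset[OF f(1) a(2)] card_mono[OF \<open>finite (L a)\<close> a(2)] by simp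
 have c2: "card D > 0" "card (L a - D) > 0" unfolding card_gt_0_iff using f a(3,4) by blast+
 have "{a..<m} = insert a {Suc a..<m}" using a(1) by auto
 then have s1: "(\<Sum>i\<in>{a..<m}. 2 * card (L' i) - 1) = (2 * card (L a) - 1) + (\<Sum>i\<in>{Suc a..<m}. 2 * card (L' i) - 1)"
  using La by simp
 have s2: "(\<Sum>i\<in>{Suc a..<Suc (Suc m)}. 2 * card (L' i) - 1) =
   (\<Sum>i\<in>{Suc a..<m}. 2 * card (L' i) - 1) + (2 * card D - 1) + (2 * card (L a - D) - 1)"
  using a(1) L'(2,3) by simp
 \<comment> \<open>The allowance of \<open>a\<close> pays for \<open>a\<close> itself and for the
   allowances of its two parts; both are nonempty, so the truncated subtractions are exact.\<close>
 have "Suc a + (\<Sum>i\<in>{Suc a..<Suc (Suc m)}. 2 * card (L' i) - 1) = a + (\<Sum>i\<in>{a..<m}. 2 * card (L' i) - 1)"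
  unfolding s1 s2 using c c2 by linarith
 also have "\<dots> = 2 * n - 1" using t by blast
 finally have "Suc a + (\<Sum>i\<in>{Suc a..<Suc (Suc m)}. 2 * card (L' i) - 1) = 2 * n - 1" .
 moreover have "L' 0 = {..<n}" using t by blast
 ultimately show ?thesis unfolding tinv_def using nd pp nn a(1) by simp
qed

text \<open>Every pending node contributes at least 1 to the count.\<close>

lemma tinv_le:
 assumes "tinv a m L par \<delta>"
 shows "m \<le> 2 * n - 1" "a \<le> m"
proof -
 note t = assms[unfolded tinv_def]
 show am: "a \<le> m" using t by blast
 have "(\<Sum>i\<in>{a..<m}. 1) \<le> (\<Sum>i\<in>{a..<m}. 2 * card (L i) - 1)"
 proof (rule sum_mono)
  fix i assume "i \<in> {a..<m}"
  then have im: "i < m" by simp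
  have "L i \<noteq> {}" "L i \<subseteq> {..<n}" using t im by blast+
  then have "L i \<noteq> {}" "finite (L i)" using finite_subset[OF _ finite_lessThan] by blast+
  then have "card (L i) > 0" by (simp add: card_gt_0_iff)
  then show "1 \<le> 2 * card (L i) - 1" by simp
 qed
 then have "m - a \<le> (\<Sum>i\<in>{a..<m}. 2 * card (L i) - 1)" by simp
 moreover have "a + (\<Sum>i\<in>{a..<m}. 2 * card (L i) - 1) = 2 * n - 1" using t by blast
 ultimately show "m \<le> 2 * n - 1" using am by simp
qed

lemma tinv_ptree:
 assumes "tinv m m L par \<delta>"
 shows "ptree n m par L \<delta>"
proof -
 note t = assms[unfolded tinv_def]
 show ?thesis
 proof
  show "1 \<le> m" "L 0 = {..<n}" using t by blast+
  show "par c < c" if "0 < c" "c < m" for c using t that by blast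
  fix a assume "a < m"
  then have "nodeok m L par \<delta> a" using t by blast
  then show "(L a = {\<delta> a} \<and> {c. 0 < c \<and> c < m \<and> par c = a} = {}) \<or>
   (\<exists>c d. c \<noteq> d \<and> {c. 0 < c \<and> c < m \<and> par c = a} = {c, d} \<and> L a = L c \<union> L d \<and> L c \<inter> L d = {})"
   unfolding nodeok_def .
 qed
qed

lemma wp_CHOOSE:
 assumes B: "2 \<le> B" and s: "base B s" and T: "small_tree T"
  and A: "aset s ''A'' n = A" "ninv A" "A \<subseteq> {..<n}" "card A \<ge> 2"
  and Q: "\<And>s' D. \<lbrakk>eqx stepmods s s'; aset s' ''C'' n = D; D \<subseteq> A; D \<noteq> {}; A - D \<noteq> {};
   ninv D; ninv (A - D)\<rbrakk> \<Longrightarrow> Q s'"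
 shows "wp B CHOOSE s Q"
 unfolding CHOOSE_def
proof (rule wp_IFF'[OF B], goal_cases)
 note b = baseD[OF s]
 have n0: "0 < n" using n by simp
 have cond: "tr (XG ''A'' (XN 0)) s \<longleftrightarrow> 0 \<in> A" using asetD[OF A(1) n0] by simp
 case 1
 show ?case by simp
 case 2
 then have A0: "0 \<in> A" unfolding cond .
 have ns: "A \<noteq> {v}" for v using A(4) by auto
 have "\<not> A \<subseteq> {1..<n}" using A0 by auto
 then have AV: "A = {..<n}" using A(2) ns unfolding ninv_def by blast
 have n2: "n \<ge> 2" using A(4) AV by simp
 show ?case
 proof (rule wp_ARR1[OF B], goal_cases)
  case 1
  show ?case using b(15,16) by simp
 next
  case (2 s1)
  note h = 2
  have C: "aset s1 ''C'' n = {0}"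
   by (rule asetI) (use h(3) b(15) n0 in simp_all)
  have r: "A - {0} = {1..<n}" unfolding AV by (rule compl0)
  show ?case
  proof (rule Q[OF _ C])
   show "eqx stepmods s s1" by (rule eqx_trans[OF h(1) eqx_refl[of "{}"]]) auto
   show "{0} \<subseteq> A" using A0 by simp
   show "A - {0} \<noteq> {}" unfolding r using n2 by simp
   show "ninv {0}" "ninv (A - {0})" unfolding r by (rule ninv_children_top[OF n2])+
  qed simp
 qed
next
 have n0: "0 < n" using n by simp
 have cond: "tr (XG ''A'' (XN 0)) s \<longleftrightarrow> 0 \<in> A" using asetD[OF A(1) n0] by simp
 case 3
 then have "0 \<notin> A" unfolding cond .
 then have "A \<subseteq> {..<n} - {0}" using A(3) by blast
 then have A1: "A \<subseteq> {1..<n}" unfolding compl0 .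
 show ?case by (rule wp_STEP[OF B s T A(1,2) A1 A(4) Q])
qed

definition tree_state :: "nat \<Rightarrow> state \<Rightarrow> bool" where
 "tree_state B s \<longleftrightarrow> base B s \<and> tinv (s ''ai'' 0) (s ''m'' 0) (rows s ''Lv'' n) (s ''par'') (s ''delta'')"

lemma rows_row:
 assumes "\<And>p. s' x p = (if n * m \<le> p \<and> p < n * m + n then f (p - n * m) else s x p)"
 shows "rows s' x n m = {v. v < n \<and> f v \<noteq> 0}" "i < m \<Longrightarrow> rows s' x n i = rows s x n i"
proof -
 show "rows s' x n m = {v. v < n \<and> f v \<noteq> 0}" unfolding rows_def using assms by auto
 assume i: "i < m"
 have "s' x (n * i + v) = s x (n * i + v)" if "v < n" for v
 proof -
  have "n * i + v < n * Suc i" using that by simp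
  also have "\<dots> \<le> n * m" using i by (intro mult_le_mono2) simp
  finally show ?thesis using assms by simp
 qed
 then show "rows s' x n i = rows s x n i" unfolding rows_def by auto
qed

lemma wp_GROW:
 assumes B: "2 \<le> B" and s: "tree_state B s" and T: "small_tree T"
  and a: "s ''ai'' 0 = a" "a < s ''m'' 0" and A: "aset s ''A'' n = rows s ''Lv'' n a" "card (rows s ''Lv'' n a) \<ge> 2"
  and Q: "\<And>s'. \<lbrakk>eqx treemods s s'; base B s'; s' ''ai'' = s ''ai'';
   tinv (Suc a) (s' ''m'' 0) (rows s' ''Lv'' n) (s' ''par'') (s' ''delta'')\<rbrakk> \<Longrightarrow> Q s'"
 shows "wp B GROW s Q"
proof -
 have bs: "base B s" and ti: "tinv a (s ''m'' 0) (rows s ''Lv'' n) (s ''par'') (s ''delta'')"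
  using s a(1) unfolding tree_state_def by simp_all
 note b = baseD[OF bs]
 let ?A = "rows s ''Lv'' n a"
 obtain m where m: "s ''m'' 0 = m" by simp
 have am: "a < m" using a(2) m by simp
 have Ai: "ninv ?A" "?A \<subseteq> {..<n}" using ti a(2) unfolding tinv_def by blast+
 show ?thesis
  unfolding GROW_def
 proof (rule wp_Seq[OF B], rule wp_CHOOSE[OF B bs T A(1) Ai A(2)])
  fix s1 D assume h1: "eqx stepmods s s1" "aset s1 ''C'' n = D" "D \<subseteq> ?A" "D \<noteq> {}" "?A - D \<noteq> {}" "ninv D" "ninv (?A - D)"
  have b1: "base B s1" by (rule base_eqx[OF bs h1(1)]) simp
  note c = baseD(15,16)[OF b1]
  have k1: "s1 ''m'' = s ''m''" "s1 ''ai'' = s ''ai''" "s1 ''Lv'' = s ''Lv''" "s1 ''A'' = s ''A''"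
    "s1 ''par'' = s ''par''" "s1 ''delta'' = s ''delta''"
   using eqxD[OF h1(1)] by simp_all
  define f2 where "f2 = (\<lambda>p. if n * m \<le> p \<and> p < n * m + n then s1 ''C'' (p - n * m) else s ''Lv'' p)"
  let ?s2 = "s1(''Lv'' := f2)"
  define w where "w = (\<lambda>v. xval (xand (XG ''A'' (V ''v'')) (xnot (XG ''C'' (V ''v'')))) (sc ?s2 ''v'' v))"
  define f3 where "f3 = (\<lambda>p. if n * Suc m \<le> p \<and> p < n * Suc m + n then w (p - n * Suc m) else f2 p)"
  let ?s3 = "s1(''Lv'' := f3)"
  let ?s6 = "sc (?s3(''par'' := (s ''par'')(m := a, Suc m := a))) ''m'' (Suc (Suc m))"
  have fin: "Q ?s6"
  proof (rule Q)
   have e: "eqx treemods s s1" by (rule eqx_trans[OF h1(1) eqx_refl[of "{}"]]) auto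
   show e6: "eqx treemods s ?s6" by (intro eqx_upd e) simp_all
   show "base B ?s6" by (rule base_eqx[OF bs e6]) simp
   show "?s6 ''ai'' = s ''ai''" using k1 by simp
   have r2: "rows ?s2 ''Lv'' n m = D" "\<And>i. i < m \<Longrightarrow> rows ?s2 ''Lv'' n i = rows s ''Lv'' n i"
   proof -
    have q: "?s2 ''Lv'' p = (if n * m \<le> p \<and> p < n * m + n then s1 ''C'' (p - n * m) else s ''Lv'' p)" for p
     unfolding f2_def by simp
    note rr = rows_row[where s' = ?s2 and x = "''Lv''" and m = m and f = "s1 ''C''" and s = s]
    show "rows ?s2 ''Lv'' n m = D" unfolding rr(1)[OF q] h1(2)[symmetric] aset_def by blast
    show "\<And>i. i < m \<Longrightarrow> rows ?s2 ''Lv'' n i = rows s ''Lv'' n i" by (rule rr(2)[OF q])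
   qed
   have r3: "rows ?s3 ''Lv'' n (Suc m) = {v. v < n \<and> w v \<noteq> 0}"
     "\<And>i. i < Suc m \<Longrightarrow> rows ?s3 ''Lv'' n i = rows ?s2 ''Lv'' n i"
   proof -
    have q: "?s3 ''Lv'' p = (if n * Suc m \<le> p \<and> p < n * Suc m + n then w (p - n * Suc m) else ?s2 ''Lv'' p)" for p
     unfolding f3_def by simp
    note rr = rows_row[where s' = ?s3 and x = "''Lv''" and m = "Suc m" and f = w and s = ?s2]
    show "rows ?s3 ''Lv'' n (Suc m) = {v. v < n \<and> w v \<noteq> 0}" by (rule rr(1)[OF q])
    show "\<And>i. i < Suc m \<Longrightarrow> rows ?s3 ''Lv'' n i = rows ?s2 ''Lv'' n i" by (rule rr(2)[OF q])
   qed
   have r6: "rows ?s6 ''Lv'' n = rows ?s3 ''Lv'' n" unfolding rows_def by (intro ext) simp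
   have wv: "w v \<noteq> 0 \<longleftrightarrow> v \<in> ?A - D" if v: "v < n" for v
   proof -
    have "w v \<noteq> 0 \<longleftrightarrow> tr (xand (XG ''A'' (V ''v'')) (xnot (XG ''C'' (V ''v'')))) (sc ?s2 ''v'' v)"
     unfolding w_def tr_def ..
    also have "\<dots> \<longleftrightarrow> s ''A'' v \<noteq> 0 \<and> \<not> s1 ''C'' v \<noteq> 0" using k1(4) by simp
    finally show ?thesis unfolding asetD[OF A(1) v] asetD[OF h1(2) v] by simp
   qed
   have "tinv (Suc a) (Suc (Suc m)) (rows ?s3 ''Lv'' n) ((s ''par'')(m := a, Suc m := a)) (s ''delta'')"
   proof (rule tinv_split[where L = "rows s ''Lv'' n" and D = D, OF _ am h1(3-7)])
    show "tinv a m (rows s ''Lv'' n) (s ''par'') (s ''delta'')" using ti m by simp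
    show "rows ?s3 ''Lv'' n i = rows s ''Lv'' n i" if "i < m" for i using r3(2)[of i] r2(2)[OF that] that by simp
    show "rows ?s3 ''Lv'' n m = D" using r3(2)[of m] r2(1) by simp
    show "rows ?s3 ''Lv'' n (Suc m) = ?A - D" unfolding r3(1) using wv Ai(2) by blast
   qed
   then show "tinv (Suc a) (?s6 ''m'' 0) (rows ?s6 ''Lv'' n) (?s6 ''par'') (?s6 ''delta'')"
    unfolding r6 using k1 by simp
  qed
  have l2: "(\<lambda>p. if xval (xmul ''n'' (V ''m'')) s1 \<le> p \<and> p < xval (xmul ''n'' (V ''m'')) s1 + s1 ''n'' 0
    then xval (XG ''C'' (V ''v'')) (sc s1 ''v'' (p - xval (xmul ''n'' (V ''m'')) s1)) else s1 ''Lv'' p) = f2"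
   unfolding f2_def using k1 m c by (simp add: xval_xmul cong: if_cong)
  have l3: "(\<lambda>p. if xval (xmul ''n'' (XA (V ''m'') (XN 1))) ?s2 \<le> p \<and> p < xval (xmul ''n'' (XA (V ''m'') (XN 1))) ?s2 + ?s2 ''n'' 0
    then xval (xand (XG ''A'' (V ''v'')) (xnot (XG ''C'' (V ''v'')))) (sc ?s2 ''v'' (p - xval (xmul ''n'' (XA (V ''m'') (XN 1))) ?s2)) else ?s2 ''Lv'' p) = f3"
  proof -
   have e: "xval (xmul ''n'' (XA (V ''m'') (XN 1))) ?s2 = n * Suc m" using k1 m c by (simp add: xval_xmul)
   show ?thesis unfolding e f3_def w_def using c by (simp cong: if_cong)
  qed
  show "wp B ADD s1 Q"
   unfolding ADD_def
  proof (rule wp_Seq[OF B], rule wp_ARR[OF B], goal_cases)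
   case 1
   show ?case using c by simp
  next
   case 2
   show ?case
    unfolding l2
   proof (rule wp_Seq[OF B], rule wp_ARR[OF B], goal_cases)
    case 1
    show ?case using c by simp
   next
    case 2
    have s3: "?s2(''Lv'' := f3) = ?s3" by simp
    show ?case
     unfolding l3 s3
    proof (rule wp_Seq[OF B], rule wp_SET1[OF B], goal_cases)
     case 1
     show ?case by simp
    next
     case 2
     have v: "xval (V ''m'') ?s3 = m" "xval (V ''ai'') ?s3 = a" using k1 m a by simp_all
     have p: "?s3 ''par'' = s ''par''" using k1 by simp
     show ?case
      unfolding v p
     proof (rule wp_Seq[OF B], rule wp_SET1[OF B], goal_cases)
      case 1
      show ?case by simp
     next
      case 2
      let ?s4 = "?s3(''par'' := (s ''par'')(m := a))"
      have v: "xval (XA (V ''m'') (XN 1)) ?s4 = Suc m" "xval (V ''ai'') ?s4 = a" using k1 m a by simp_all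
      have p: "?s4(''par'' := (?s4 ''par'')(Suc m := a)) = ?s3(''par'' := (s ''par'')(m := a, Suc m := a))" by simp
      show ?case
       unfolding v p
      proof (rule wp_SET0[OF B], goal_cases)
       case 1
       show ?case by simp
      next
       case 2
       have v: "xval (XA (V ''m'') (XN 2)) (?s3(''par'' := (s ''par'')(m := a, Suc m := a))) = Suc (Suc m)"
        using k1 m by simp
       show ?case unfolding v by (rule fin)
      qed
     qed
    qed
   qed
  qed
 qed
qed

end

section \<open>Writing the adjacency matrix of the tree\<close>

definition LINK :: com where
 "LINK = IFF (V ''i'')
   (Seq (SET ''T'' (XA (xmul ''m'' (V ''i'')) (XG ''par'' (V ''i''))) (XN 1))
     (SET ''T'' (XA (xmul ''m'' (XG ''par'' (V ''i''))) (V ''i'')) (XN 1)))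
   Skip"

definition OUT :: com where
 "OUT = FOR ''i'' ''m'' LINK"

context nodes
begin

lemma row_props:
 assumes "tinv a m L par \<delta>" "a < m"
 shows "ninv (L a)" "L a \<subseteq> {..<n}" "L a \<noteq> {}"
 using assms unfolding tinv_def by blast+

lemma wp_NODE:
 assumes B: "2 \<le> B" and s: "tree_state B s" and T: "n \<ge> 2 \<Longrightarrow> small_tree T" and a: "s ''ai'' 0 < s ''m'' 0"
  and Q: "\<And>s'. \<lbrakk>eqx treemods s s'; tree_state B s'; s' ''ai'' 0 = Suc (s ''ai'' 0)\<rbrakk> \<Longrightarrow> Q s'"
 shows "wp B NODE s Q"
 unfolding NODE_def
proof (rule wp_Seq_ARR[OF B B], goal_cases)
 have bs: "base B s" using s unfolding tree_state_def by blast
 note b = baseD[OF bs]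
 case 1
 show ?case using b(15,16) by simp
 case (2 s1)
 note h1 = 2
 note x1 = eqx1[OF h1(1)]
 let ?a = "s ''ai'' 0"
 let ?A = "rows s ''Lv'' n ?a"
 have r1: "rows s1 ''Lv'' n = rows s ''Lv'' n" unfolding rows_def using x1[of "''Lv''"] by (intro ext) simp
 have b1: "base B s1" by (rule base_eqx[OF bs h1(1)]) simp
 have t1: "tree_state B s1"
  unfolding tree_state_def r1 using b1 s x1[of "''ai''"] x1[of "''m''"] x1[of "''par''"] x1[of "''delta''"] unfolding tree_state_def by simp
 have ti: "tinv ?a (s ''m'' 0) (rows s ''Lv'' n) (s ''par'') (s ''delta'')" using s unfolding tree_state_def by blast
 note Ap = row_props[OF ti a]
 have A1: "aset s1 ''A'' n = ?A"
 proof (rule asetI[OF _ Ap(2)])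
  fix v assume v: "v < n"
  have "s1 ''A'' v \<noteq> 0 \<longleftrightarrow> s ''Lv'' (n * ?a + v) \<noteq> 0" using h1(3)[of v] v b(15) by simp
  then show "s1 ''A'' v \<noteq> 0 \<longleftrightarrow> v \<in> ?A" unfolding rows_def using v by simp
 qed
 have cA: "{v. v < n \<and> s1 ''A'' v \<noteq> 0} = ?A" using A1 unfolding aset_def .
 have finA: "finite ?A" unfolding rows_def by simp
 let ?R = "\<lambda>s'. eqx treemods s s' \<and> base B s' \<and> s' ''ai'' = s ''ai'' \<and>
   tinv (Suc ?a) (s' ''m'' 0) (rows s' ''Lv'' n) (s' ''par'') (s' ''delta'')"
 show ?case
 proof (rule wp_Seq_cut[OF B, where P = ?R], goal_cases)
  case 1
  show ?case
  proof (rule wp_IFF'[OF B], goal_cases)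
   case 1
   show ?case using baseD(15,16)[OF b1] by simp
  next
   case 2
   then have c2: "card ?A \<ge> 2" using baseD(15)[OF b1] cA by simp
   have "card ?A \<le> card {..<n}" by (rule card_mono[OF _ Ap(2)]) simp
   then have n2: "n \<ge> 2" using c2 by simp
   have ai: "s1 ''ai'' 0 = ?a" "?a < s1 ''m'' 0" using x1 a by simp_all
   show ?case
   proof (rule wp_GROW[OF B t1 T[OF n2] ai], unfold r1)
    show "aset s1 ''A'' n = ?A" by (rule A1)
    show "2 \<le> card ?A" by (rule c2)
    fix s' assume h: "eqx treemods s1 s'" "base B s'" "s' ''ai'' = s1 ''ai''"
     "tinv (Suc ?a) (s' ''m'' 0) (rows s' ''Lv'' n) (s' ''par'') (s' ''delta'')"
    have "eqx treemods s s'" by (rule eqx_trans[OF h1(1) h(1)]) auto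
    then show "?R s'" using h x1 by simp
   qed
  next
   case 3
   then have "\<not> 2 \<le> card ?A" using baseD(15)[OF b1] cA by simp
   moreover have "card ?A > 0" using Ap(3) finA by (simp add: card_gt_0_iff)
   ultimately have "card ?A = 1" by linarith
   then obtain v where v: "?A = {v}" by (rule card_1_singletonE)
   have vn: "v < n" using Ap(2) v by blast
   have av: "s1 ''A'' y \<noteq> 0 \<longleftrightarrow> y = v" if "y < n" for y using asetD[OF A1 that] v by simp
   have xv: "xval (xleast ''v'' ''n'' (XG ''A'' (V ''v''))) s1 = v"
   proof -
    have "xval (xleast ''v'' ''n'' (XG ''A'' (V ''v''))) s1 = (LEAST y. tr (XG ''A'' (V ''v'')) (sc s1 ''v'' y))"
     by (rule xval_xleast[where m = v]) (use av[OF vn] vn baseD(15)[OF b1] in simp_all)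
    also have "\<dots> = (LEAST y. y = v)"
     by (rule Least_cong[where m = n and ?y0.0 = v]) (use av vn in simp_all)
    also have "\<dots> = v" by (rule Least_equality) simp_all
    finally show ?thesis .
   qed
   show ?case
   proof (rule wp_SET1[OF B], goal_cases)
    case 1
    show ?case using baseD(15,16)[OF b1] by simp
   next
    case 2
    let ?s2 = "s1(''delta'' := (s1 ''delta'')(xval (V ''ai'') s1 := xval (xleast ''v'' ''n'' (XG ''A'' (V ''v''))) s1))"
    have sd: "?s2 ''delta'' = (s ''delta'')(?a := v)" unfolding xv using x1 by simp
    have r2: "rows ?s2 ''Lv'' n = rows s ''Lv'' n" unfolding r1[symmetric] unfolding rows_def by (intro ext) simp
    have e1: "eqx treemods s s1" by (rule eqx_trans[OF h1(1) eqx_refl[of "{}"]]) auto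
    have e2: "eqx treemods s ?s2" by (rule eqx_upd[OF e1]) simp
    have "base B ?s2" by (rule base_eqx[OF bs e2]) simp
    moreover have "tinv (Suc ?a) (?s2 ''m'' 0) (rows ?s2 ''Lv'' n) (?s2 ''par'') (?s2 ''delta'')"
     unfolding sd r2 using tinv_leaf[OF ti a v] x1 by simp
    ultimately show ?case using e2 x1 by simp
   qed
  qed
 next
  case (2 s')
  then have h: "eqx treemods s s'" "base B s'" "s' ''ai'' = s ''ai''"
   "tinv (Suc ?a) (s' ''m'' 0) (rows s' ''Lv'' n) (s' ''par'') (s' ''delta'')" by blast+
  show ?case
  proof (rule wp_SET0[OF B], goal_cases)
   case 1
   show ?case by simp
  next
   case 2
   let ?s3 = "sc s' ''ai'' (xval (XA (V ''ai'') (XN 1)) s')"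
   have ai: "?s3 ''ai'' 0 = Suc ?a" using h(3) by simp
   have e3: "eqx treemods s ?s3" by (rule eqx_upd[OF h(1)]) simp
   have "base B ?s3" by (rule base_eqx[OF bs e3]) simp
   moreover have "rows ?s3 ''Lv'' n = rows s' ''Lv'' n" unfolding rows_def by (intro ext) simp
   moreover have "?s3 ''m'' = s' ''m''" "?s3 ''par'' = s' ''par''" "?s3 ''delta'' = s' ''delta''" by simp_all
   ultimately have "tree_state B ?s3" unfolding tree_state_def ai using h(4) by (simp only: simp_thms)
   then show ?case by (rule Q[OF e3 _ ai])
  qed
 qed
qed

lemma wp_TREE:
 assumes B: "2 \<le> B" and s: "base B s" and T: "n \<ge> 2 \<Longrightarrow> small_tree T"
  and Q: "\<And>s'. \<lbrakk>eqx treemods s s'; base B s'; s' ''m'' 0 \<le> 2 * n - 1;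
   tinv (s' ''m'' 0) (s' ''m'' 0) (rows s' ''Lv'' n) (s' ''par'') (s' ''delta'')\<rbrakk> \<Longrightarrow> Q s'"
 shows "wp B TREE s Q"
 unfolding TREE_def
proof (rule wp_Seq_ARR[OF B B], goal_cases)
 note b = baseD[OF s]
 have n2B: "2 * n \<le> B"
 proof -
  have "2 * n \<le> n * (4 * K)" using K0 by simp
  then show ?thesis using b(18) by linarith
 qed
 case 1
 show ?case using b(15,16) by simp
 case (2 s1)
 note h1 = 2
 show ?case
 proof (rule wp_Seq_SET[OF B B], goal_cases)
  case 1
  show ?case by simp
 next
  case 2
  show ?case
  proof (rule wp_Seq_SET[OF B B], goal_cases)
   case 1
   show ?case by simp
  next
   case 2
   let ?s3 = "sc (sc s1 ''m'' (xval (XN 1) s1)) ''ai'' (xval (XN 0) (sc s1 ''m'' (xval (XN 1) s1)))"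
   have e1: "eqx treemods s s1" by (rule eqx_trans[OF h1(1) eqx_refl[of "{}"]]) auto
   have e3: "eqx treemods s ?s3" by (intro eqx_upd e1) simp_all
   have b3: "base B ?s3" by (rule base_eqx[OF s e3]) simp
   have "s1 ''Lv'' v \<noteq> 0" if "v < n" for v using h1(2)[of v] that b(15) by simp
   then have "rows ?s3 ''Lv'' n 0 = {..<n}" unfolding rows_def by auto
   from tinv_init[where L = "rows ?s3 ''Lv'' n", OF this] have t3: "tree_state B ?s3" unfolding tree_state_def using b3 by simp
   let ?I = "\<lambda>s'. eqx treemods s s' \<and> tree_state B s'"
   have le: "s' ''m'' 0 \<le> 2 * n - 1" "s' ''ai'' 0 \<le> s' ''m'' 0" if "tree_state B s'" for s'
    using that tinv_le unfolding tree_state_def by blast+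
   show ?case
   proof (rule wp_WHILE'[where I = ?I and \<mu> = "\<lambda>s. 2 * n - s ''ai'' 0", OF B])
    show "?I ?s3" using e3 t3 by blast
    show "2 * n - ?s3 ''ai'' 0 \<le> B" using n2B by simp
    fix s' assume I: "?I s'"
    show "ok B s' (xlt (V ''ai'') (V ''m''))" by simp
    show "wp B NODE s' (\<lambda>s''. ?I s'' \<and> 2 * n - s'' ''ai'' 0 < 2 * n - s' ''ai'' 0)"
     if c: "tr (xlt (V ''ai'') (V ''m'')) s'"
    proof (rule wp_NODE[OF B conjunct2[OF I] T])
     show lt: "s' ''ai'' 0 < s' ''m'' 0" using c by simp
     fix s'' assume h: "eqx treemods s' s''" "tree_state B s''" "s'' ''ai'' 0 = Suc (s' ''ai'' 0)"
     have "eqx treemods s s''" by (rule eqx_trans[OF conjunct1[OF I] h(1)]) auto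
     moreover have "2 * n - s'' ''ai'' 0 < 2 * n - s' ''ai'' 0"
      using h(3) lt le(1)[OF conjunct2[OF I]] n by linarith
     ultimately show "?I s'' \<and> 2 * n - s'' ''ai'' 0 < 2 * n - s' ''ai'' 0" using h(2) by blast
    qed
    assume "\<not> tr (xlt (V ''ai'') (V ''m'')) s'"
    then have "\<not> s' ''ai'' 0 < s' ''m'' 0" by simp
    then have eq: "s' ''ai'' 0 = s' ''m'' 0" using le(2)[OF conjunct2[OF I]] by linarith
    have "base B s'" "tinv (s' ''m'' 0) (s' ''m'' 0) (rows s' ''Lv'' n) (s' ''par'') (s' ''delta'')"
     using conjunct2[OF I] unfolding tree_state_def eq by blast+
    then show "Q s'" by (intro Q conjunct1[OF I] le(1)[OF conjunct2[OF I]])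
   qed
  qed
 qed
qed

end

lemma wp_OUT:
 assumes B: "2 \<le> B" and s: "s ''m'' 0 = m" "m \<le> B" "\<And>p. s ''T'' p = 0" "\<And>c. 0 < c \<Longrightarrow> c < m \<Longrightarrow> s ''par'' c < m"
  and Q: "\<And>s'. eqx {''T'', ''i''} s s' \<Longrightarrow>
   (\<And>u v. u < m \<Longrightarrow> v < m \<Longrightarrow> s' ''T'' (m * u + v) \<noteq> 0 \<longleftrightarrow>
     (0 < u \<and> v = s ''par'' u) \<or> (0 < v \<and> u = s ''par'' v)) \<Longrightarrow> Q s'"
 shows "wp B OUT s Q"
 unfolding OUT_def
proof -
 let ?E = "\<lambda>j u v. (0 < u \<and> u < j \<and> v = s ''par'' u) \<or> (0 < v \<and> v < j \<and> u = s ''par'' v)"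
 let ?I = "\<lambda>j s'. eqx {''T'', ''i''} s s' \<and> (\<forall>u<m. \<forall>v<m. s' ''T'' (m * u + v) \<noteq> 0 \<longleftrightarrow> ?E j u v)"
 have inj: "m * u + v = m * u' + v' \<longleftrightarrow> u = u' \<and> v = v'" if "v < m" "v' < m" for u v u' v'
 proof
  assume e: "m * u + v = m * u' + v'"
  have "(m * u + v) div m = u" "(m * u' + v') div m = u'" "(m * u + v) mod m = v" "(m * u' + v') mod m = v'"
   using that by simp_all
  then show "u = u' \<and> v = v'" using e by metis
 qed simp
 show "wp B (FOR ''i'' ''m'' LINK) s Q"
 proof (rule wp_FOR[where m = m and I = ?I, OF B])
  show "?I 0 (sc s ''i'' 0)" using s(3) by (simp add: eqx_def)
  fix j s' assume j: "j < m" "?I j s'" "s' ''i'' 0 = j" "s' ''m'' 0 = m"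
  have e: "eqx {''T'', ''i''} s s'" using j(2) by blast
  have TI: "s' ''T'' (m * u + v) \<noteq> 0 \<longleftrightarrow> ?E j u v" if "u < m" "v < m" for u v using j(2) that by blast
  have p': "s' ''par'' = s ''par''" using eqxD[OF e, of "''par''"] by simp
  show "wp B LINK s' (\<lambda>s'. s' ''i'' 0 = j \<and> s' ''m'' 0 = m \<and> ?I (Suc j) (sc s' ''i'' (Suc j)))"
   unfolding LINK_def
  proof (rule wp_IFF'[OF B], goal_cases)
   case 1
   show ?case by simp
  next
   case 2
   then have j0: "0 < j" using j(3) by simp
   let ?p = "s ''par'' j"
   have pm: "?p < m" by (rule s(4)[OF j0 j(1)])
   let ?T = "(s' ''T'')(m * j + ?p := 1, m * ?p + j := 1)"
   let ?s2 = "s'(''T'' := ?T)"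
   have fin: "?s2 ''i'' 0 = j \<and> ?s2 ''m'' 0 = m \<and> ?I (Suc j) (sc ?s2 ''i'' (Suc j))"
   proof (intro conjI allI impI)
    show "?s2 ''i'' 0 = j" "?s2 ''m'' 0 = m" using j by simp_all
    show "eqx {''T'', ''i''} s (sc ?s2 ''i'' (Suc j))" by (intro eqx_upd e) simp_all
    fix u v assume uv: "u < m" "v < m"
    have "sc ?s2 ''i'' (Suc j) ''T'' (m * u + v) \<noteq> 0 \<longleftrightarrow>
      (u = j \<and> v = ?p) \<or> (u = ?p \<and> v = j) \<or> s' ''T'' (m * u + v) \<noteq> 0"
     using inj[OF uv(2) pm, of u j] inj[OF uv(2) j(1), of u ?p] by (simp, blast)
    also have "\<dots> \<longleftrightarrow> ?E (Suc j) u v" unfolding TI[OF uv] using j0 by (auto simp: less_Suc_eq)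
    finally show "(sc ?s2 ''i'' (Suc j) ''T'' (m * u + v) \<noteq> 0) = ?E (Suc j) u v" .
   qed
   show ?case
   proof (rule wp_Seq[OF B], rule wp_SET1[OF B], goal_cases)
    case 1
    show ?case using j(4) s(2) by simp
   next
    case 2
    have v: "xval (XA (xmul ''m'' (V ''i'')) (XG ''par'' (V ''i''))) s' = m * j + ?p" "xval (XN 1) s' = 1"
     using j(3,4) p' by (simp_all add: xval_xmul)
    show ?case
     unfolding v
    proof (rule wp_SET1[OF B], goal_cases)
     case 1
     show ?case using j(4) s(2) by simp
    next
     case 2
     let ?s1 = "s'(''T'' := (s' ''T'')(m * j + ?p := 1))"
     have v: "xval (XA (xmul ''m'' (XG ''par'' (V ''i''))) (V ''i'')) ?s1 = m * ?p + j" "xval (XN 1) ?s1 = 1"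
      using j(3,4) p' by (simp_all add: xval_xmul)
     have q: "?s1(''T'' := (?s1 ''T'')(m * ?p + j := 1)) = ?s2" by simp
     show ?case unfolding v q by (rule fin)
    qed
   qed
  next
   case 3
   then have j0: "j = 0" using j(3) by simp
   have "?I (Suc j) (sc s' ''i'' (Suc j))"
   proof (intro conjI allI impI)
    show "eqx {''T'', ''i''} s (sc s' ''i'' (Suc j))" by (intro eqx_upd e) simp_all
    fix u v assume uv: "u < m" "v < m"
    have "sc s' ''i'' (Suc j) ''T'' = s' ''T''" by simp
    then show "(sc s' ''i'' (Suc j) ''T'' (m * u + v) \<noteq> 0) = ?E (Suc j) u v" using TI[OF uv] j0 by auto
   qed
   then show ?case using j by (intro wp_Skip[OF B]) blast
  qed
 next
  fix s' assume i: "?I m s'"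
  show "Q s'"
  proof (rule Q[OF conjunct1[OF i]])
   fix u v assume uv: "u < m" "v < m"
   have "s' ''T'' (m * u + v) \<noteq> 0 \<longleftrightarrow> ?E m u v" using i uv by blast
   then show "s' ''T'' (m * u + v) \<noteq> 0 \<longleftrightarrow> (0 < u \<and> v = s ''par'' u) \<or> (0 < v \<and> u = s ''par'' v)"
    using uv by blast
  qed
 qed (use s(1,2) in simp_all)
qed

section \<open>The algorithm\<close>

text \<open>\<open>pw\<close>, the number of subset codes to try, is the one exponential quantity;
  it is obtained by doubling \<open>th\<close> times.\<close>

definition INIT :: com where
 "INIT = Seq (SET ''K'' (XN 0) (XA (V ''k'') (XA (V ''k'') (V ''k''))))
   (Seq (SET ''th'' (XN 0) (XA (XA (V ''K'') (V ''K'')) (XA (V ''K'') (V ''K''))))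
   (Seq (SET ''nn'' (XN 0) (xmul ''n'' (V ''n'')))
   (Seq (SET ''rr'' (XN 0) (XA (V ''nn'') (XN 1)))
   (Seq (SET ''N'' (XN 0) (xmul ''n'' (V ''th'')))
   (Seq (SET ''NN'' (XN 0) (XA (V ''N'') (XN 2)))
   (Seq (SET ''pw'' (XN 0) (XN 1))
     (FOR ''r'' ''th'' (SET ''pw'' (XN 0) (XA (V ''pw'') (V ''pw''))))))))))"

definition CONN :: com where
 "CONN = Seq (ARR ''X'' (XN 0) ''b'' ''n'' (xeq (V ''b'') (XN 0)))
   (Seq (CLOSE (gadj (V ''a'') (V ''b'')))
     (SET ''cn'' (XN 0) (xall ''v'' ''n'' (XG ''X'' (V ''v'')))))"

definition ALG :: com where
 "ALG = Seq INIT (Seq CONN (Seq PH1 (Seq TREE OUT)))"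

text \<open>A single number above everything that a loop counts, including the potential of the
  auction on \<open>n * (12 * k)\<close> points.\<close>

definition bounds :: "nat \<Rightarrow> nat \<Rightarrow> nat \<Rightarrow> bool" where
 "bounds B n k \<longleftrightarrow> 2 \<le> B \<and> n \<le> B \<and> n * n + 1 \<le> B \<and> 12 * k \<le> B \<and> 2 ^ (12 * k) \<le> B \<and>
   n * (12 * k) + 2 \<le> B \<and> n * (12 * k) * Suc (n * (12 * k)) \<le> B"

abbreviation initmods :: "string set" where
 "initmods \<equiv> {''K'', ''th'', ''nn'', ''rr'', ''N'', ''NN'', ''pw'', ''r''}"

lemma wp_INIT:
 assumes b: "bounds B n k" and s: "s ''n'' 0 = n" "s ''k'' 0 = k"
  and Q: "\<And>s'. \<lbrakk>eqx initmods s s'; s' ''K'' 0 = 3 * k; s' ''th'' 0 = 12 * k; s' ''nn'' 0 = n * n;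
   s' ''rr'' 0 = n * n + 1; s' ''N'' 0 = n * (12 * k); s' ''NN'' 0 = n * (12 * k) + 2;
   s' ''pw'' 0 = 2 ^ (12 * k)\<rbrakk> \<Longrightarrow> Q s'"
 shows "wp B INIT s Q"
proof -
 note b = b[unfolded bounds_def]
 have B: "2 \<le> B" and nB: "n \<le> B" and tB: "12 * k \<le> B" using b by blast+
 define P where "P s' \<longleftrightarrow> eqx initmods s s' \<and> s' ''K'' 0 = 3 * k \<and> s' ''th'' 0 = 12 * k \<and> s' ''nn'' 0 = n * n \<and>
   s' ''rr'' 0 = n * n + 1 \<and> s' ''N'' 0 = n * (12 * k) \<and> s' ''NN'' 0 = n * (12 * k) + 2" for s'
 have loop: "wp B (FOR ''r'' ''th'' (SET ''pw'' (XN 0) (XA (V ''pw'') (V ''pw'')))) s1 Q" if P1: "P s1" "s1 ''pw'' 0 = 1" for s1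
 proof (rule wp_FOR[where m = "12 * k" and I = "\<lambda>j s'. P s' \<and> s' ''pw'' 0 = 2 ^ j", OF B])
  show "s1 ''th'' 0 = 12 * k" using P1 unfolding P_def by blast
  show "P (sc s1 ''r'' 0) \<and> sc s1 ''r'' 0 ''pw'' 0 = 2 ^ 0" using P1 unfolding P_def by (simp add: eqx_upd)
  fix j s' assume h: "P s' \<and> s' ''pw'' 0 = 2 ^ j" "s' ''r'' 0 = j" "s' ''th'' 0 = 12 * k"
  show "wp B (SET ''pw'' (XN 0) (XA (V ''pw'') (V ''pw''))) s'
   (\<lambda>s'. s' ''r'' 0 = j \<and> s' ''th'' 0 = 12 * k \<and> P (sc s' ''r'' (Suc j)) \<and> sc s' ''r'' (Suc j) ''pw'' 0 = 2 ^ Suc j)"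
   by (rule wp_SET0[OF B]) (use h in \<open>simp_all add: P_def eqx_upd\<close>)
 next
  fix s' assume h: "P s' \<and> s' ''pw'' 0 = 2 ^ (12 * k)"
  show "Q s'" by (rule Q) (use h in \<open>simp_all add: P_def\<close>)
 qed (use tB in simp_all)
 let ?s1 = "sc s ''K'' (3 * k)"
 let ?s2 = "sc ?s1 ''th'' (12 * k)"
 let ?s3 = "sc ?s2 ''nn'' (n * n)"
 let ?s4 = "sc ?s3 ''rr'' (n * n + 1)"
 let ?s5 = "sc ?s4 ''N'' (n * (12 * k))"
 let ?s6 = "sc ?s5 ''NN'' (n * (12 * k) + 2)"
 let ?s7 = "sc ?s6 ''pw'' 1"
 have e7: "eqx initmods s ?s7" by (intro eqx_upd eqx_refl) simp_all
 have P7: "P ?s7" unfolding P_def using e7 by simp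
 have v1: "xval (XA (V ''k'') (XA (V ''k'') (V ''k''))) s = 3 * k" using s by simp
 have v2: "xval (XA (XA (V ''K'') (V ''K'')) (XA (V ''K'') (V ''K''))) ?s1 = 12 * k" by simp
 have v3: "xval (xmul ''n'' (V ''n'')) ?s2 = n * n" using s by (simp add: xval_xmul)
 have v4: "xval (XA (V ''nn'') (XN 1)) ?s3 = n * n + 1" by simp
 have v5: "xval (xmul ''n'' (V ''th'')) ?s4 = n * (12 * k)" using s by (simp add: xval_xmul)
 have v6: "xval (XA (V ''N'') (XN 2)) ?s5 = n * (12 * k) + 2" by simp
 have v7: "xval (XN 1) ?s6 = 1" by simp
 show ?thesis
  unfolding INIT_def
  apply (rule wp_Seq_SET[OF B B], simp, unfold v1)
  apply (rule wp_Seq_SET[OF B B], simp, unfold v2)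
  apply (rule wp_Seq_SET[OF B B], simp add: s nB, unfold v3)
  apply (rule wp_Seq_SET[OF B B], simp, unfold v4)
  apply (rule wp_Seq_SET[OF B B], simp add: s nB, unfold v5)
  apply (rule wp_Seq_SET[OF B B], simp, unfold v6)
  apply (rule wp_Seq_SET[OF B B], simp, unfold v7)
  apply (rule loop[OF P7])
  apply simp
  done
qed

context ugraph
begin

text \<open>For the converse: a set without leaving edges and its complement are both closed under
  adjacency, and one of them contains 0.\<close>

lemma conn_reach: "conn \<longleftrightarrow> {(a, b). a < n \<and> b < n \<and> adj a b}\<^sup>* `` {0} = {..<n}" (is "_ \<longleftrightarrow> ?r\<^sup>* `` {0} = _")
proof
 assume c: conn
 have sub: "?r\<^sup>* `` {0} \<subseteq> {..<n}"
 proof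
  fix v assume "v \<in> ?r\<^sup>* `` {0}"
  then have "(0, v) \<in> ?r\<^sup>*" by simp
  then show "v \<in> {..<n}" by (cases rule: rtranclE) (use n in auto)
 qed
 show "?r\<^sup>* `` {0} = {..<n}"
 proof (rule ccontr)
  assume "?r\<^sup>* `` {0} \<noteq> {..<n}"
  then have ps: "?r\<^sup>* `` {0} \<subset> {..<n}" using sub by blast
  have "?r\<^sup>* `` {0} \<noteq> {}" by blast
  from connD[OF c this ps] obtain u v where uv: "u \<in> ?r\<^sup>* `` {0}" "v \<notin> ?r\<^sup>* `` {0}" "adj u v" .
  have "(u, v) \<in> ?r" using uv(3) adj_n by blast
  moreover have "(0, u) \<in> ?r\<^sup>*" using uv(1) by blast
  ultimately have "(0, v) \<in> ?r\<^sup>*" by (rule rtrancl_into_rtrancl[rotated])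
  then show False using uv(2) by blast
 qed
next
 assume r: "?r\<^sup>* `` {0} = {..<n}"
 have main: False if X: "0 \<in> X" "v < n" "v \<notin> X" "\<And>u w. u \<in> X \<Longrightarrow> adj u w \<Longrightarrow> w \<in> X" for X v
 proof -
  have "w \<in> X" if "(0, w) \<in> ?r\<^sup>*" for w
   using that
  proof (induction rule: rtrancl_induct)
   case (step y z)
   then show ?case using X(4) by blast
  qed (rule X(1))
  moreover have "v \<in> ?r\<^sup>* `` {0}" unfolding r using X(2) by simp
  ultimately show False using X(3) by blast
 qed
 show conn
  unfolding conn_def
 proof (intro allI impI, rule ccontr)
  fix X assume X: "X \<noteq> {}" "X \<subset> {..<n}" "\<not> (\<exists>u\<in>X. \<exists>v. v \<notin> X \<and> adj u v)"
  obtain x where x: "x \<in> X" using X(1) by blast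
  obtain v where v: "v < n" "v \<notin> X" using X(2) by blast
  show False
  proof (cases "0 \<in> X")
   case True
   show False by (rule main[OF True v]) (use X(3) in blast)
  next
   case False
   show False
   proof (rule main[of "- X" x])
    show "w \<in> - X" if "u \<in> - X" "adj u w" for u w using X(3) adj_sym[OF that(2)] that(1) by blast
   qed (use False x X(2) in auto)
  qed
 qed
qed

lemma wp_CONN:
 assumes B: "2 \<le> B" and s: "inp B s"
  and Q: "\<And>s'. eqx {''X'', ''Y'', ''z'', ''cn''} s s' \<Longrightarrow> (s' ''cn'' 0 \<noteq> 0 \<longleftrightarrow> conn) \<Longrightarrow> Q s'"
 shows "wp B CONN s Q"
 unfolding CONN_def
proof (rule wp_Seq_ARR[OF B B], goal_cases)
 have n': "s ''n'' 0 = n" "n \<le> B" "n * n \<le> B" "s ''nn'' 0 = n * n" using s unfolding inp_def by simp_all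
 have G: "s ''G'' (n * u + v) \<noteq> 0 \<longleftrightarrow> adj u v" if "u < n" "v < n" for u v using s that unfolding inp_def by blast
 case 1
 show ?case using n' by simp
 case (2 s1)
 note h1 = 2
 note x1 = eqx1[OF h1(1)]
 have X1: "aset s1 ''X'' n = {0}" by (rule asetI) (use h1(3) n' n in simp_all)
 have cr: "crl (gadj (V ''a'') (V ''b'')) n s1 = {(a, b). a < n \<and> b < n \<and> adj a b}"
 proof -
  have "tr (gadj (V ''a'') (V ''b'')) (sc (sc s1 ''b'' b) ''a'' a) \<longleftrightarrow> adj a b" if "a < n" "b < n" for a b
   using G[OF that] x1 n' by simp
  then show ?thesis unfolding crl_def by blast
 qed
 show ?case
 proof (rule wp_Seq[OF B], rule wp_CLOSE[where n = n, OF B], goal_cases)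
  case (9 s2)
  note h2 = 9
  have x2: "s2 x = s x" if "x \<notin> {''X'', ''Y'', ''z''}" for x using eqxD[OF h2(1) that] x1[of x] that by simp
  have n2: "s2 ''n'' 0 = n" using x2[of "''n''"] n' by simp
  show ?case
  proof (rule wp_SET0[OF B], goal_cases)
   case 1
   show ?case using n2 n' by simp
  next
   case 2
   let ?e = "xall ''v'' ''n'' (XG ''X'' (V ''v''))"
   show ?case
   proof (rule Q)
    show "eqx {''X'', ''Y'', ''z'', ''cn''} s (sc s2 ''cn'' (xval ?e s2))"
     unfolding eqx_def using x2 by simp
    have "sc s2 ''cn'' (xval ?e s2) ''cn'' 0 \<noteq> 0 \<longleftrightarrow> tr ?e s2" unfolding tr_def by simp
    also have "\<dots> \<longleftrightarrow> (\<forall>v<n. s2 ''X'' v \<noteq> 0)" using n2 by simp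
    also have "\<dots> \<longleftrightarrow> aset s2 ''X'' n = {..<n}" unfolding aset_def by auto
    also have "\<dots> \<longleftrightarrow> conn" unfolding h2(2) cr X1 conn_reach ..
    finally show "(sc s2 ''cn'' (xval ?e s2) ''cn'' 0 \<noteq> 0) = conn" .
   qed
  qed
 qed (use n' x1 in simp_all)
qed

end

context gr
begin

definition result :: "nat \<Rightarrow> state \<Rightarrow> bool" where
 "result k s \<longleftrightarrow> branch_decomposition G (output_tree s) (output_leaf_map s) \<and>
   decomposition_width (sm G) (output_tree s) (output_leaf_map s) < 16 * k"

lemma result_tree:
 assumes k: "k \<ge> 1" and nodes: "nodes n adjG g fam (3 * k)"
  and t: "nodes.tinv n adjG g fam (3 * k) m m L par \<delta>"
  and s: "s ''m'' 0 = m" "s ''delta'' = \<delta>"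
   "\<And>u v. u < m \<Longrightarrow> v < m \<Longrightarrow> s ''T'' (m * u + v) \<noteq> 0 \<longleftrightarrow> (0 < u \<and> v = par u) \<or> (0 < v \<and> u = par v)"
 shows "result k s"
proof -
 interpret N: nodes n adjG g fam "3 * k" by (rule nodes)
 interpret P: ptree n m par L \<delta> by (rule N.tinv_ptree[OF t])
 note t = t[unfolded N.tinv_def]
 have pl: "par c < m" if "0 < c" "c < m" for c using P.par[OF that] that by simp
 have T: "output_tree s = P.T"
 proof -
  have "{(i, j). i < m \<and> j < m \<and> s ''T'' (m * i + j) \<noteq> 0} = P.up \<union> P.up\<inverse>"
   unfolding P.up_def using s(3) pl by auto
  then show ?thesis unfolding output_tree_def P.T_def s(1) Let_def by simp
 qed
 have d: "output_leaf_map s = \<delta>" unfolding output_leaf_map_def by (rule s(2))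
 have "decomposition_width (sm G) P.T \<delta> < 16 * k"
 proof (rule P.width_T)
  show "0 < 16 * k" using k by simp
  fix c assume c: "0 < c" "c < m"
  have Lc: "N.ninv (L c)" "L c \<subseteq> {..<n}" using t c(2) by blast+
  \<comment> \<open>A node other than the root has a nonempty sibling disjoint from it.\<close>
  have "L c \<noteq> {..<n}"
  proof
   assume e: "L c = {..<n}"
   have "N.nodeok m L par \<delta> (par c)" using t pl[OF c] by blast
   moreover have "c \<in> {e. 0 < e \<and> e < m \<and> par e = par c}" using c by blast
   ultimately obtain x y where xy: "x \<noteq> y" "{e. 0 < e \<and> e < m \<and> par e = par c} = {x, y}" "L x \<inter> L y = {}"
    unfolding N.nodeok_def by blast
   have m: "x < m" "y < m" "c = x \<or> c = y" using xy(2) c by blast+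
   have "L x \<noteq> {}" "L x \<subseteq> {..<n}" "L y \<noteq> {}" "L y \<subseteq> {..<n}" using t m(1,2) by blast+
   then show False using m(3) xy(3) e by blast
  qed
  from N.ninv_cut[OF Lc(1) this] have "(\<exists>Z. U.vcov Z (L c) \<and> card Z < 16 * k) \<or> (U.conn \<and> U.good (L c))"
  proof
   assume "\<exists>Z. U.vcov Z (L c) \<and> card Z < 4 * (3 * k)"
   then obtain Z where "U.vcov Z (L c)" "card Z < 4 * (3 * k)" by blast
   then have "U.vcov Z (L c) \<and> card Z < 16 * k" by simp
   then show ?thesis by blast
  qed blast
  from sm_bound_both[OF this Lc(2)] show "sm G (L c) < 16 * k \<and> sm G ({..<n} - L c) < 16 * k" using k by simp
 qed
 moreover have "branch_decomposition G P.T \<delta>" by (rule P.branch_T[OF verts])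
 ultimately show ?thesis unfolding result_def T d by blast
qed

lemma wp_ALG:
 assumes w: "split_matching_width G < k" and b: "bounds B n k"
  and s: "s ''n'' 0 = n" "s ''k'' 0 = k" "\<And>u v. u < n \<Longrightarrow> v < n \<Longrightarrow> s ''G'' (n * u + v) \<noteq> 0 \<longleftrightarrow> adjG u v"
   "\<And>p. s ''T'' p = 0"
 shows "wp B ALG s (result k)"
 unfolding ALG_def
proof -
 have k: "k \<ge> 1" using w by simp
 note bb = b[unfolded bounds_def]
 have B: "2 \<le> B" and nB: "n \<le> B" using bb by blast+
 show "wp B (Seq INIT (Seq CONN (Seq PH1 (Seq TREE OUT)))) s (result k)"
 proof (rule wp_Seq[OF B], rule wp_INIT[where s = s, OF b s(1,2)])
  fix s1 assume h1: "eqx initmods s s1" "s1 ''K'' 0 = 3 * k" "s1 ''th'' 0 = 12 * k" "s1 ''nn'' 0 = n * n"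
   "s1 ''rr'' 0 = n * n + 1" "s1 ''N'' 0 = n * (12 * k)" "s1 ''NN'' 0 = n * (12 * k) + 2" "s1 ''pw'' 0 = 2 ^ (12 * k)"
  have G1: "s1 ''G'' = s ''G''" "s1 ''n'' = s ''n''" using eqxD[OF h1(1)] by simp_all
  have i1: "U.inp B s1" unfolding U.inp_def G1 using s(1,3) h1(4,5) bb by simp
  show "wp B (Seq CONN (Seq PH1 (Seq TREE OUT))) s1 (result k)"
  proof (rule wp_Seq[OF B], rule U.wp_CONN[OF B i1])
   fix s2 assume h2: "eqx {''X'', ''Y'', ''z'', ''cn''} s1 s2" "s2 ''cn'' 0 \<noteq> 0 \<longleftrightarrow> U.conn"
   have i2: "U.inp B s2" by (rule U.inp_eqx[OF i1 h2(1)]) simp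
   show "wp B (Seq PH1 (Seq TREE OUT)) s2 (result k)"
   proof (rule wp_Seq[OF B], rule U.wp_PH1[OF B i2 h2(2)])
    fix s3 assume h3: "eqx {''X'', ''Y'', ''z'', ''B'', ''u'', ''y'', ''w'', ''gs'', ''g'', ''r''} s2 s3"
     "s3 ''g'' 0 = n * n + 1" "U.famok (n * n + 1) (U.fm s3)" "\<exists>t<n * n + 1. U.fm s3 t = {1..<n}"
    let ?g = "n * n + 1" and ?fam = "U.fm s3" and ?K = "3 * k"
    have nd: "nodes n adjG ?g ?fam ?K"
     by unfold_locales (use h3(3,4) k in simp_all)
    interpret N: nodes n adjG ?g ?fam ?K by (rule nd)
    let ?M3 = "initmods \<union> {''X'', ''Y'', ''z'', ''cn'', ''B'', ''u'', ''y'', ''w'', ''gs'', ''g''}"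
    have e12: "eqx ?M3 s s2" by (rule eqx_trans[OF h1(1) h2(1)]) auto
    have e3: "eqx ?M3 s s3" by (rule eqx_trans[OF e12 h3(1)]) auto
    have i3: "U.inp B s3" by (rule U.inp_eqx[OF i2 h3(1)]) simp
    have x3: "s3 x = s1 x" if "x \<in> {''K'', ''th'', ''N'', ''NN'', ''pw''}" for x
    proof -
     have "x \<notin> {''X'', ''Y'', ''z'', ''cn''}" "x \<notin> {''X'', ''Y'', ''z'', ''B'', ''u'', ''y'', ''w'', ''gs'', ''g'', ''r''}"
      using that by auto
     then show ?thesis using eqxD[OF h2(1)] eqxD[OF h3(1)] by metis
    qed
    have e4K: "4 * (3 * k) = 12 * k" by simp
    have "3 * k \<le> B" using bb by linarith
    then have b3: "N.base B s3"
     unfolding N.base_def e4K using i3 h3(2) bb h1(2,3,6-8) by (simp add: x3)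
    have T: "\<exists>T. N.small_tree T" if n2: "n \<ge> 2"
    proof -
     obtain T where T: "dis T" "lv T = {..<n}"
      "\<forall>Y\<in>subs T. Y = {..<n} \<or> (\<exists>Z. U.vcov Z Y \<and> card Z < k) \<or> (U.conn \<and> U.good Y)"
      using width_tree[OF w n2] by blast
     have "3 * card Z < ?K \<longleftrightarrow> card Z < k" for Z :: "nat set" by simp
     then have "N.small_tree T" unfolding N.small_tree_def using T by simp
     then show ?thesis by blast
    qed
    \<comment> \<open>The tree of small width is fixed for the analysis alone. For
      \<open>n = 1\<close> it is an arbitrary value.\<close>
    define T where "T = (SOME T. N.small_tree T)"
    have T: "N.small_tree T" if "n \<ge> 2" unfolding T_def by (rule someI_ex[OF T[OF that]])
    show "wp B (Seq TREE OUT) s3 (result k)"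
    proof (rule wp_Seq[OF B], rule N.wp_TREE[OF B b3 T])
     fix s4 assume h4: "eqx treemods s3 s4" "N.base B s4" "s4 ''m'' 0 \<le> 2 * n - 1"
      "N.tinv (s4 ''m'' 0) (s4 ''m'' 0) (rows s4 ''Lv'' n) (s4 ''par'') (s4 ''delta'')"
     interpret P: ptree n "s4 ''m'' 0" "s4 ''par''" "rows s4 ''Lv'' n" "s4 ''delta''"
      by (rule N.tinv_ptree[OF h4(4)])
     have T4: "s4 ''T'' p = 0" for p using eqxD[OF e3, of "''T''"] eqxD[OF h4(1), of "''T''"] s(4) by simp
     have "2 * n \<le> n * (12 * k)" using k by simp
     then have mB: "s4 ''m'' 0 \<le> B" using h4(3) bb by linarith
     show "wp B OUT s4 (result k)"
     proof (rule wp_OUT[where s = s4 and m = "s4 ''m'' 0", OF B refl mB T4])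
      show "s4 ''par'' c < s4 ''m'' 0" if "0 < c" "c < s4 ''m'' 0" for c using P.par[OF that] that by simp
      fix s5 assume h5: "eqx {''T'', ''i''} s4 s5"
       "\<And>u v. u < s4 ''m'' 0 \<Longrightarrow> v < s4 ''m'' 0 \<Longrightarrow> s5 ''T'' (s4 ''m'' 0 * u + v) \<noteq> 0 \<longleftrightarrow>
        (0 < u \<and> v = s4 ''par'' u) \<or> (0 < v \<and> u = s4 ''par'' v)"
      show "result k s5"
      proof (rule result_tree[OF k nd h4(4)])
       show "s5 ''m'' 0 = s4 ''m'' 0" "s5 ''delta'' = s4 ''delta''" using eqxD[OF h5(1)] by simp_all
      qed (rule h5(2))
     qed
    qed
   qed
  qed
 qed
qed

end

text \<open>Squaring makes room for products such as \<open>n * n\<close> and the potential of the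
  auction. The second claim absorbs \<open>n + 2\<close> into \<open>n * 2 ^ (2 * k)\<close>, so
  that no additive constant remains; this turns the exponent 12 into 14.\<close>

lemma bounds_sq:
 assumes n: "n \<ge> 1" and k: "k \<ge> 1"
 defines "b \<equiv> (n + 2) * 2 ^ (12 * k)"
 shows "bounds (b ^ 2) n k" "b \<le> n * 2 ^ (14 * k)"
proof -
 define P where "P = (2 :: nat) ^ (12 * k)"
 have P: "12 * k < P" unfolding P_def by (rule less_exp)
 then have P1: "13 \<le> P" using k by linarith
 have b: "b = n * P + 2 * P" unfolding b_def P_def by (simp add: algebra_simps)
 have nP: "n * (12 * k) \<le> n * P" using P by simp
 have n1: "n \<le> n * P" using P1 by simp
 have b26: "26 \<le> b" using b P1 by linarith
 have sq: "b \<le> b ^ 2" using b26 by (simp add: power2_eq_square)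
 have "n * n + 1 \<le> (n + 1) * (n + 1)" by simp
 also have "\<dots> \<le> b * b" using b n1 P1 by (intro mult_mono) linarith+
 finally have q1: "n * n + 1 \<le> b ^ 2" by (simp add: power2_eq_square)
 have "n * (12 * k) * Suc (n * (12 * k)) \<le> b * b" using b nP P1 by (intro mult_mono) linarith+
 then have q2: "n * (12 * k) * Suc (n * (12 * k)) \<le> b ^ 2" by (simp only: power2_eq_square)
 have "2 \<le> b" "n \<le> b" "12 * k \<le> b" "P \<le> b" "n * (12 * k) + 2 \<le> b" using b26 b n1 P nP by linarith+
 then show "bounds (b ^ 2) n k"
  unfolding bounds_def P_def[symmetric] using sq q1 q2 by (meson order_trans)
 have "(2::nat) ^ 2 \<le> 2 ^ (2 * k)" using k by (intro power_increasing) simp_all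
 then have "n * 4 \<le> n * 2 ^ (2 * k)" by (intro mult_le_mono2) simp
 then have "n + 2 \<le> n * 2 ^ (2 * k)" using n by linarith
 then have "b \<le> n * 2 ^ (2 * k) * 2 ^ (12 * k)" unfolding b_def by (rule mult_le_mono1)
 also have "\<dots> = n * 2 ^ (14 * k)" by (simp flip: power_add add: mult.assoc)
 finally show "b \<le> n * 2 ^ (14 * k)" .
qed

theorem theorem1:
  shows "\<exists>(alg :: com) (c :: nat) (d :: nat).
    \<forall>(G :: nat pair_pre_digraph) (n :: nat) (k :: nat).
      pair_graph G \<and> pverts G = {..<n} \<and> n \<ge> 1 \<and> split_matching_width G < k \<longrightarrow>
      (\<exists>t s. exec alg (input_state G k) t s \<and>
             t \<le> n ^ c * 2 ^ (d * k) \<and>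
             branch_decomposition G (output_tree s) (output_leaf_map s) \<and>
             decomposition_width (sm G) (output_tree s) (output_leaf_map s) < 16 * k)"
proof (rule exI[of _ ALG], rule exI[of _ "2 * ce ALG"], rule exI[of _ "14 * (2 * ce ALG)"], intro allI impI)
 fix G :: "nat pair_pre_digraph" and n k :: nat
 \<comment> \<open>The time bound is \<open>B ^ ce ALG\<close> with \<open>B\<close> a square, hence
   the factor 2.\<close>
 let ?e = "2 * ce ALG"
 assume h: "pair_graph G \<and> pverts G = {..<n} \<and> n \<ge> 1 \<and> split_matching_width G < k"
 then interpret gr G n by (simp add: gr_def gr_axioms_def)
 have w: "split_matching_width G < k" using h by blast
 then have k: "k \<ge> 1" by simp
 let ?b = "(n + 2) * 2 ^ (12 * k)"
 let ?s = "input_state G k"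
 have "wp (?b ^ 2) ALG ?s (result k)"
 proof (rule wp_ALG[OF w bounds_sq(1)[OF n1 k]])
  show "?s ''n'' 0 = n" "?s ''k'' 0 = k" "?s ''T'' p = 0" for p
   unfolding input_state_def by (simp_all add: verts)
  fix u v assume uv: "u < n" "v < n"
  have "n * u + v < n * Suc u" using uv by simp
  also have "\<dots> \<le> n * n" using uv by (intro mult_le_mono2) simp
  finally have "n * u + v < n * n" .
  moreover have "(n * u + v) div n = u" "(n * u + v) mod n = v" using uv by simp_all
  ultimately show "(?s ''G'' (n * u + v) \<noteq> 0) = ((u, v) \<in> parcs G)"
   unfolding input_state_def by (simp add: verts)
 qed
 \<comment> \<open>\<open>wp\<close> allows any scratch contents at the start; here they are those
   of the input state.\<close>
 from wpD[OF this, of "?s tmp"] obtain s' h' t where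
  t: "exec ALG ?s t (s'(tmp := h'))" "t \<le> (?b ^ 2) ^ ce ALG" "result k s'"
  unfolding tex_def by auto
 have "(?b ^ 2) ^ ce ALG = ?b ^ ?e" by (simp add: power_mult)
 also have "\<dots> \<le> (n * 2 ^ (14 * k)) ^ ?e" by (rule power_mono[OF bounds_sq(2)[OF n1 k]]) simp
 also have "\<dots> = n ^ ?e * 2 ^ (14 * ?e * k)"
  by (simp add: power_mult_distrib mult_ac flip: power_mult)
 finally have "t \<le> n ^ ?e * 2 ^ (14 * ?e * k)" using t(2) by simp
 moreover have "output_tree (s'(tmp := h')) = output_tree s'" "output_leaf_map (s'(tmp := h')) = output_leaf_map s'"
  unfolding output_tree_def output_leaf_map_def by simp_all
 ultimately show "\<exists>t s. exec ALG (input_state G k) t s \<and>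
       t \<le> n ^ ?e * 2 ^ (14 * ?e * k) \<and>
       branch_decomposition G (output_tree s) (output_leaf_map s) \<and>
       decomposition_width (sm G) (output_tree s) (output_leaf_map s) < 16 * k"
  using t(1,3) unfolding result_def by metis
qed

end
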